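(* Let $f\in C_c^\infty(\mathbb{R})$ be a real-valued, even, smooth, compactly supported function. For each $N$ let $\{\theta_j\}_{j=1}^N$ be a CUE configuration with $N$ particles, and let $\{\tau_i\}_{i=1}^N$ come from one of the following three ensembles: (i) an independent copy of the CUE with $N$ particles; (ii) a sequence of $N$ i.i.d. uniformly distributed points on the unit circle (i.e. $\tau_i$ uniform on $[0,2\pi)$), independent of $\{\theta_j\}_{j=1}^N$; (iii) the evenly spaced deterministic sequence $\tau_i=\frac{2\pi i}{N}$, $i=1,\dots,N$. Let $$B_N(f)=\sum_{1\le i,j\le N} f_N(\tau_i-\theta_j).$$ Then, for all sufficiently large $N$, $\mathbb{E}B_N(f)=\frac{N}{2\pi}\int_{\mathbb{R}}f(x)\,dx$, and, as $N\to\infty$, $(B_N(f)-\mathbb{E}B_N(f))N^{-1/2}$ converges in distribution to a centered real Gaussian random variable with variance $\sigma^2(f)$, where $$\sigma^2(f)=\begin{cases}\dfrac{1}{2\pi}\displaystyle\int_{\mathbb{R}}|\hat f(t)|^2\min(|t|,1)^2\,dt & \text{in case (i)},\\[2mm] \dfrac{1}{2\pi}\displaystyle\int_{\mathbb{R}}|\hat f(t)|^2\min(|t|,1)\,dt & \text{in case (ii)},\\[2mm] \dfrac{1}{2\pi}\displaystyle\sum_{l\in\mathbb{Z},\,l\neq 0}|\hat f(l)|^2 & \text{in case (iii)}.\end{cases}$$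
   Context: The CUE with $N\ge 2$ particles is the probability distribution of $(\theta_1,\dots,\theta_N)\in[0,2\pi)^N$ with density, with respect to Lebesgue measure, $\frac{1}{(2\pi)^N N!}\prod_{1\le j<k\le N}|e^{i\theta_j}-e^{i\theta_k}|^{2}$ (the Circular Beta Ensemble with $\beta=2$, i.e. the distribution of the eigenangles of a Haar-distributed $N\times N$ unitary matrix). For a function $f$ on $\mathbb{R}$, $f_N$ denotes the function on $\mathbb{R}$ given by $f_N(\theta)=f(N\theta)$ for $\theta\in[-\pi,\pi)$ and extended $2\pi$-periodically, $f_N(\theta+2\pi)=f_N(\theta)$. The Fourier transform is $\hat f(t)=\frac{1}{\sqrt{2\pi}}\int_{\mathbb{R}}f(x)e^{-itx}\,dx$. *)

theory Defs
  imports "HOL-Probability.Probability"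
begin

definition Cc_infty :: "(real \<Rightarrow> real) set" where
  "Cc_infty = {f. (\<forall>n x. (deriv ^^ n) f differentiable (at x)) \<and> compact (closure {x. f x \<noteq> 0})}"

(* The argument of f is N times the representative of x modulo 2 pi in [-pi, pi). *)
definition rescaled_periodic :: "(real \<Rightarrow> real) \<Rightarrow> nat \<Rightarrow> real \<Rightarrow> real" where
  "rescaled_periodic f N x = f (real N * (x - 2 * pi * real_of_int \<lfloor>(x + pi) / (2 * pi)\<rfloor>))"

definition fourier_transform :: "(real \<Rightarrow> real) \<Rightarrow> real \<Rightarrow> complex" where
  "fourier_transform f t =
     complex_of_real (1 / sqrt (2 * pi)) *
     (\<integral>x. complex_of_real (f x) * exp (- \<i> * complex_of_real (t * x)) \<partial>lborel)"

definition cue_density :: "nat \<Rightarrow> (nat \<Rightarrow> real) \<Rightarrow> real" where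
  "cue_density N x =
     1 / ((2 * pi) ^ N * fact N) *
     (\<Prod>j\<in>{1..N}. \<Prod>k\<in>{j<..N}. (cmod (exp (\<i> * complex_of_real (x j)) - exp (\<i> * complex_of_real (x k))))\<^sup>2) *
     (\<Prod>j\<in>{1..N}. indicator {0..<2 * pi} (x j))"

(* The tuple (X 1, ..., X N) as a single random element of R^N. Outside {1..N} the
   family X is irrelevant; restricting it puts the tuple in the space of the product measure. *)
definition tuple :: "nat \<Rightarrow> (nat \<Rightarrow> 'a \<Rightarrow> real) \<Rightarrow> 'a \<Rightarrow> nat \<Rightarrow> real" where
  "tuple N X \<omega> = (\<lambda>i\<in>{1..N}. X i \<omega>)"

definition cue_configuration :: "'a measure \<Rightarrow> nat \<Rightarrow> (nat \<Rightarrow> 'a \<Rightarrow> real) \<Rightarrow> bool" where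
  "cue_configuration M N \<theta> \<longleftrightarrow>
     distributed M (PiM {1..N} (\<lambda>_. lborel)) (tuple N \<theta>) (\<lambda>x. ennreal (cue_density N x))"

definition independent_tuples ::
    "'a measure \<Rightarrow> nat \<Rightarrow> (nat \<Rightarrow> 'a \<Rightarrow> real) \<Rightarrow> (nat \<Rightarrow> 'a \<Rightarrow> real) \<Rightarrow> bool" where
  "independent_tuples M N X Y \<longleftrightarrow>
     prob_space.indep_var M (PiM {1..N} (\<lambda>_. borel)) (tuple N X) (PiM {1..N} (\<lambda>_. borel)) (tuple N Y)"

datatype ensemble = Independent_CUE | IID_Uniform | Evenly_Spaced

fun comes_from ::
    "ensemble \<Rightarrow> 'a measure \<Rightarrow> nat \<Rightarrow> (nat \<Rightarrow> 'a \<Rightarrow> real) \<Rightarrow> (nat \<Rightarrow> 'a \<Rightarrow> real) \<Rightarrow> bool" where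
  "comes_from Independent_CUE M N \<theta> \<tau> \<longleftrightarrow>
     cue_configuration M N \<tau> \<and> independent_tuples M N \<tau> \<theta>"
| "comes_from IID_Uniform M N \<theta> \<tau> \<longleftrightarrow>
     prob_space.indep_vars M (\<lambda>_. borel) \<tau> {1..N} \<and>
     (\<forall>i\<in>{1..N}. distr M lborel (\<tau> i) = uniform_measure lborel {0..<2 * pi}) \<and>
     independent_tuples M N \<tau> \<theta>"
| "comes_from Evenly_Spaced M N \<theta> \<tau> \<longleftrightarrow>
     (\<forall>i\<in>{1..N}. \<forall>\<omega>\<in>space M. \<tau> i \<omega> = 2 * pi * real i / real N)"

definition B_stat ::
    "(real \<Rightarrow> real) \<Rightarrow> nat \<Rightarrow> (nat \<Rightarrow> 'a \<Rightarrow> real) \<Rightarrow> (nat \<Rightarrow> 'a \<Rightarrow> real) \<Rightarrow> 'a \<Rightarrow> real" where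
  "B_stat f N \<tau> \<theta> \<omega> = (\<Sum>i\<in>{1..N}. \<Sum>j\<in>{1..N}. rescaled_periodic f N (\<tau> i \<omega> - \<theta> j \<omega>))"

fun limit_variance :: "ensemble \<Rightarrow> (real \<Rightarrow> real) \<Rightarrow> real" where
  "limit_variance Independent_CUE f =
     1 / (2 * pi) * (\<integral>t. (cmod (fourier_transform f t))\<^sup>2 * (min \<bar>t\<bar> 1)\<^sup>2 \<partial>lborel)"
| "limit_variance IID_Uniform f =
     1 / (2 * pi) * (\<integral>t. (cmod (fourier_transform f t))\<^sup>2 * min \<bar>t\<bar> 1 \<partial>lborel)"
| "limit_variance Evenly_Spaced f =
     1 / (2 * pi) * (\<Sum>\<^sub>\<infinity>l\<in>{l::int. l \<noteq> 0}. (cmod (fourier_transform f (real_of_int l)))\<^sup>2)"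

(* Law of a centered Gaussian of variance v >= 0. The variance in the theorem may vanish
   (e.g. for f = 0), and the law is then the point mass at 0. *)
definition centered_gaussian :: "real \<Rightarrow> real measure" where
  "centered_gaussian v =
     (if v = 0 then return borel 0
      else density lborel (\<lambda>x. ennreal (normal_density 0 (sqrt v) x)))"

end

theory Submission
  imports Defs "Jordan_Normal_Form.Schur_Decomposition" "HOL-Real_Asymp.Real_Asymp"
begin

text \<open>Write \<open>h\<^sub>\<tau>(x) = N\<^sup>-\<^sup>1\<^sup>/\<^sup>2 \<Sum>\<^sub>i g(x - \<tau>\<^sub>i)\<close> with \<open>g\<close> the mean zero part of \<open>f\<^sub>N\<close>; the normalised statistic is
\<open>\<Sum>\<^sub>j h\<^sub>\<tau>(\<theta>\<^sub>j)\<close>, a linear statistic of the CUE once \<open>\<tau>\<close> is frozen. For a real function \<open>h\<close> with mean zero, Heine's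
identity writes the average of \<open>\<Prod>\<^sub>j exp(i h(\<theta>\<^sub>j))\<close> as \<open>det(1 + T)\<close>, where \<open>T\<close> is the Toeplitz matrix of
\<open>exp(i h) - 1\<close>. Its eigenvalues \<open>l\<close> lie in the closed convex hull of the values of \<open>exp(i h) - 1\<close>, so that
\<open>|l|\<^sup>2 \<le> -2 Re l\<close>, and a second order expansion of the logarithm gives \<open>exp(-Q(h)/2)\<close>, where \<open>Q(h)\<close> is the
variance of \<open>\<Sum>\<^sub>j h(\<theta>\<^sub>j)\<close>, with an error of order \<open>(sup |h|) N \<integral>h\<^sup>2\<close>. Here \<open>h\<^sub>\<tau>\<close> is small off an event
where many \<open>\<tau>\<^sub>i\<close> cluster.

Evenly spaced \<open>\<tau>\<close> make \<open>Q(h\<^sub>\<tau>)\<close> equal to the limit variance. For random \<open>\<tau>\<close> it remains to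
show that \<open>Y = exp(-u\<^sup>2 Q(h\<^sub>\<tau>)/2)\<close> concentrates, and this follows from a replica argument: the second moment over
\<open>\<tau>\<close> of the conditional characteristic function is an average over two independent copies \<open>\<theta>, \<theta>'\<close> of the
characteristic function of \<open>\<Sum>\<^sub>i (h\<^sub>\<theta> + h\<^sub>\<theta>')(\<tau>\<^sub>i)\<close>, and the cross term of the quadratic form \<open>Q(h\<^sub>\<theta> + h\<^sub>\<theta>')\<close> is
negligible. So the variance of \<open>Y\<close> vanishes asymptotically, and the mean of \<open>Q(h\<^sub>\<tau>)\<close> is a Riemann sum converging
to the limit variance.\<close>

no_notation vec_index (infixl "$" 100)

section \<open>Determinants and eigenvalues\<close>

text \<open>The obstacle is that \<open>Q(h_\<tau>)\<close> is quadratic in the power sums of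
  \<tau>, so that a direct variance estimate would call for fourth moments of CUE power sums. Only
  second moments are computed. Since g is even, the double sum is symmetric in \<tau> and \<theta>,
  and either configuration may be frozen. The Gaussian approximation, applied on both sides, gives
  \<open>E Y^2 ~ E Phi^2 = E Psi ~ E exp(-u^2 Q'(h_\<theta> + h_\<theta>') / 2) ~ (E Y')^2 ~ (E
  Y)^2\<close>, where Q' is the variance for the ensemble of \<tau> and
  \<open>Y' = exp(-u^2 Q'(h_\<theta>) / 2)\<close>. The cross term has second moment of order 1/N
  because every Fourier coefficient of g is of order 1/N while their squares sum to order 1/N. The
  Toeplitz matrix of \<open>exp(i h) - 1\<close> need not be normal; the inequality for
  \<open>|l|^2\<close> still controls the cubic remainder, since its right side sums to a trace. If
  no arc of length of order 1/N holds more than A points, then \<open>|h_\<tau>|\<close> is of order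
  \<open>A / sqrt N\<close>; this fails with probability of order \<open>N 2^(-A)\<close>.\<close>

definition perm_det :: "nat \<Rightarrow> (nat \<Rightarrow> nat \<Rightarrow> complex) \<Rightarrow> complex" where
  "perm_det n a = (\<Sum>p | p permutes {0..<n}. signof p * (\<Prod>i = 0..<n. a i (p i)))"

text \<open>Symbols are kept as functions of two indices with the size as a separate argument; this
  bridge is crossed only where matrix theory is borrowed, such as Laplace expansion, similarity or
  the determinant of a scalar matrix.\<close>

lemma perm_det_mat: "perm_det n a = Determinant.det (Matrix.mat n n (\<lambda>(i, j). a i j))"
proof -
  have "(\<Prod>i = 0..<n. Matrix.mat n n (\<lambda>(i, j). a i j) $$ (i, p i)) = (\<Prod>i = 0..<n. a i (p i))"
    if "p permutes {0..<n}" for p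
    using that by (intro prod.cong) (auto dest: permutes_in_image[of p _])
  then show ?thesis
    by (simp add: perm_det_def det_def' [of _ n])
qed

lemma sum_diag_mult_comm:
  fixes X Y :: "complex mat"
  assumes "X \<in> carrier_mat n n" "Y \<in> carrier_mat n n"
  shows "(\<Sum>i<n. (X * Y) $$ (i, i)) = (\<Sum>i<n. (Y * X) $$ (i, i))"
proof -
  have "(\<Sum>i<n. (X * Y) $$ (i, i)) = (\<Sum>i<n. \<Sum>j<n. X $$ (i, j) * Y $$ (j, i))"
    using assms by (auto intro!: sum.cong simp: scalar_prod_def lessThan_atLeast0)
  also have "\<dots> = (\<Sum>j<n. \<Sum>i<n. Y $$ (j, i) * X $$ (i, j))"
    by (subst sum.swap) (simp add: mult.commute)
  also have "\<dots> = (\<Sum>i<n. (Y * X) $$ (i, i))"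
    using assms by (auto intro!: sum.cong simp: scalar_prod_def lessThan_atLeast0)
  finally show ?thesis .
qed

text \<open>Schur triangularisation \<open>A = P B Q\<close>: the diagonal of B carries the
  eigenvalues, and determinant, trace and trace of the square are invariant under similarity. All
  are stated for one family l because the logarithm of \<open>det(1 + A)\<close> is expanded as the
  sum of the \<open>l - l^2/2\<close>, and both sums become computable as traces.\<close>

lemma perm_det_eigenvalues:
  fixes a :: "nat \<Rightarrow> nat \<Rightarrow> complex"
  obtains l where
    "perm_det n (\<lambda>i j. (if i = j then 1 else 0) + a i j) = (\<Prod>i<n. 1 + l i)"
    "(\<Sum>i<n. a i i) = (\<Sum>i<n. l i)"
    "(\<Sum>i<n. \<Sum>j<n. a i j * a j i) = (\<Sum>i<n. (l i)\<^sup>2)"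
    "\<And>i. i < n \<Longrightarrow> \<exists>v. (\<exists>j<n. v j \<noteq> 0) \<and> (\<forall>r<n. (\<Sum>j<n. a r j * v j) = l i * v r)"
proof -
  define A where "A = Matrix.mat n n (\<lambda>(i, j). a i j)"
  have A: "A \<in> carrier_mat n n" by (simp add: A_def)
  obtain es where es: "char_poly A = (\<Prod>e\<leftarrow>es. [:- e, 1:])" "length es = n"
    using char_poly_factorized[OF A] by auto
  obtain B P Q where BPQ: "schur_decomposition A es = (B, P, Q)"
    by (cases "schur_decomposition A es") auto
  from schur_decomposition[OF A es(1) this]
  have sim: "similar_mat_wit A B P Q" and ut: "upper_triangular B" and diag: "diag_mat B = es"
    by auto
  note PQ = similar_mat_witD2[OF A sim]
  note c = PQ(4-7)
  have dB: "dim_row B = n" "dim_col B = n" using c by auto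
  have Bii: "B $$ (i, i) = es ! i" if "i < n" for i
    using that c unfolding diag[symmetric] by (simp add: diag_mat_def)
  have Bij: "B $$ (i, j) = 0" if "j < i" "i < n" for i j
    using ut that c by auto
  have tr: "(\<Sum>i<n. A $$ (i, i)) = (\<Sum>i<n. es ! i)"
  proof -
    have "(\<Sum>i<n. A $$ (i, i)) = (\<Sum>i<n. (Q * (P * B)) $$ (i, i))"
      unfolding PQ(3) using c by (intro sum_diag_mult_comm) auto
    also have "Q * (P * B) = B"
      using c PQ(2) by (metis assoc_mult_mat left_mult_one_mat)
    finally show ?thesis by (simp add: Bii)
  qed
  have tr2: "(\<Sum>i<n. (A * A) $$ (i, i)) = (\<Sum>i<n. (es ! i)\<^sup>2)"
  proof -
    have AA: "A * A = P * (B * B) * Q"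
    proof -
      have "A * A = P * B * Q * (P * B * Q)" by (simp add: PQ(3)[symmetric])
      also have "\<dots> = P * B * (Q * P) * B * Q"
        using c by (auto simp: assoc_mult_mat[of _ n n _ n _ n])
      also have "\<dots> = P * B * B * Q" using c PQ(2) by auto
      also have "\<dots> = P * (B * B) * Q" using c by (auto simp: assoc_mult_mat[of _ n n _ n _ n])
      finally show ?thesis .
    qed
    have "(\<Sum>i<n. (A * A) $$ (i, i)) = (\<Sum>i<n. (Q * (P * (B * B))) $$ (i, i))"
      unfolding AA using c by (intro sum_diag_mult_comm) auto
    also have "Q * (P * (B * B)) = (Q * P) * (B * B)"
      using c by (simp add: assoc_mult_mat[of _ n n _ n _ n])
    also have "\<dots> = B * B" using c PQ(2) by simp
    also have "(\<Sum>i<n. (B * B) $$ (i, i)) = (\<Sum>i<n. (es ! i)\<^sup>2)"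
    proof (intro sum.cong refl)
      fix i assume "i \<in> {..<n}"
      then have i: "i < n" by simp
      have "(B * B) $$ (i, i) = (\<Sum>j<n. B $$ (i, j) * B $$ (j, i))"
        using i dB by (auto simp: scalar_prod_def lessThan_atLeast0)
      also have "\<dots> = (\<Sum>j<n. if j = i then (es ! i)\<^sup>2 else 0)"
      proof (intro sum.cong refl)
        fix j assume "j \<in> {..<n}"
        then show "B $$ (i, j) * B $$ (j, i) = (if j = i then (es ! i)\<^sup>2 else 0)"
          using Bij[of i j] Bij[of j i] Bii i by (cases i j rule: linorder_cases) (auto simp: power2_eq_square)
      qed
      also have "\<dots> = (es ! i)\<^sup>2" using i by simp
      finally show "(B * B) $$ (i, i) = (es ! i)\<^sup>2" .
    qed
    finally show ?thesis .
  qed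
  have dt: "Determinant.det (1\<^sub>m n + A) = (\<Prod>i<n. 1 + es ! i)"
  proof -
    have "similar_mat_wit (1\<^sub>m n + A) (1\<^sub>m n + B) P Q"
    proof (rule similar_mat_witI[OF PQ(1,2) _ _ _ c(3,4)])
      show "1\<^sub>m n + A = P * (1\<^sub>m n + B) * Q"
      proof -
        have "P * (1\<^sub>m n + B) = P * 1\<^sub>m n + P * B"
          by (rule mult_add_distrib_mat[of _ n n _ n]) (use c in auto)
        then have "P * (1\<^sub>m n + B) * Q = P * 1\<^sub>m n * Q + P * B * Q"
          using c by (simp only:) (rule add_mult_distrib_mat[of _ n n _ _ n], auto)
        then show ?thesis using c PQ(1,3) by simp
      qed
    qed (use c A in auto)
    then have "similar_mat (1\<^sub>m n + A) (1\<^sub>m n + B)" unfolding similar_mat_def by blast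
    then have "Determinant.det (1\<^sub>m n + A) = Determinant.det (1\<^sub>m n + B)" by (rule det_similar)
    also have "\<dots> = prod_list (diag_mat (1\<^sub>m n + B))"
      using c Bij by (intro det_upper_triangular[of _ n]) (auto simp: upper_triangular_def)
    also have "diag_mat (1\<^sub>m n + B) = map (\<lambda>i. 1 + es ! i) [0..<n]"
      using dB Bii by (simp add: diag_mat_def)
    also have "prod_list \<dots> = (\<Prod>i<n. 1 + es ! i)"
      by (simp add: prod.list_conv_set_nth lessThan_atLeast0)
    finally show ?thesis .
  qed
  have ev: "\<exists>v. (\<exists>j<n. v j \<noteq> 0) \<and> (\<forall>r<n. (\<Sum>j<n. a r j * v j) = es ! i * v r)" if i: "i < n" for i
  proof -
    have "poly (char_poly A) (es ! i) = 0"
      unfolding es(1) using i es(2) by (intro linear_poly_root) auto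
    then have "eigenvalue A (es ! i)" using eigenvalue_root_char_poly[OF A] by simp
    then obtain v where v: "v \<in> carrier_vec n" "v \<noteq> 0\<^sub>v n" "A *\<^sub>v v = es ! i \<cdot>\<^sub>v v"
      using A unfolding eigenvalue_def eigenvector_def by auto
    show ?thesis
    proof (intro exI[of _ "vec_index v"] conjI allI impI)
      show "\<exists>j<n. vec_index v j \<noteq> 0"
        using v(1,2) by (metis carrier_vecD eq_vecI index_zero_vec)
      fix r assume r: "r < n"
      have "(\<Sum>j<n. a r j * vec_index v j) = vec_index (A *\<^sub>v v) r"
        using r v(1) by (auto simp: A_def scalar_prod_def lessThan_atLeast0 intro!: sum.cong)
      also have "\<dots> = es ! i * vec_index v r" using v r by simp
      finally show "(\<Sum>j<n. a r j * vec_index v j) = es ! i * vec_index v r" .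
    qed
  qed
  show ?thesis
  proof (rule that[of "(!) es"])
    have "1\<^sub>m n + A = Matrix.mat n n (\<lambda>(i, j). (if i = j then 1 else 0) + a i j)"
      by (auto simp: A_def)
    then show "perm_det n (\<lambda>i j. (if i = j then 1 else 0) + a i j) = (\<Prod>i<n. 1 + es ! i)"
      using dt by (simp add: perm_det_mat)
    show "(\<Sum>i<n. a i i) = (\<Sum>i<n. es ! i)" using tr by (simp add: A_def)
    have "(A * A) $$ (i, i) = (\<Sum>j<n. a i j * a j i)" if "i < n" for i
      using that by (auto simp: A_def scalar_prod_def lessThan_atLeast0 intro!: sum.cong)
    then show "(\<Sum>i<n. \<Sum>j<n. a i j * a j i) = (\<Sum>i<n. (es ! i)\<^sup>2)"
      using tr2 by simp
  qed (rule ev)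
qed

text \<open>Induction on the size with the last node replaced by a variable x: the determinant is a
  polynomial in x of degree at most n, it vanishes at the earlier nodes, and its top coefficient is
  the smaller Vandermonde determinant.\<close>

lemma perm_det_vandermonde:
  "perm_det n (\<lambda>i j. z i ^ j) = (\<Prod>j<n. \<Prod>i<j. z j - z i)"
proof (induction n)
  case 0
  then show ?case by (simp add: perm_det_def)
next
  case (Suc n)
  define M where "M = (\<lambda>x. Matrix.mat (Suc n) (Suc n) (\<lambda>(i, j). (if i = n then x else z i) ^ j))"
  define c where "c = (\<lambda>j. cofactor (M 0) n j)"
  define p where "p = (\<Sum>j\<le>n. monom (c j) j)"
  have Mc: "M x \<in> carrier_mat (Suc n) (Suc n)" for x by (simp add: M_def)
  \<comment> \<open>Deleting the last row removes x, so the cofactors along it are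
    constants.\<close>
  have md: "mat_delete (M x) n j = mat_delete (M 0) n j" for x j
    by (rule eq_matI) (auto simp: M_def mat_delete_def)
  have pM: "poly p x = Determinant.det (M x)" for x
  proof -
    have "Determinant.det (M x) = (\<Sum>j<Suc n. M x $$ (n, j) * cofactor (M x) n j)"
      by (rule laplace_expansion_row[OF Mc]) simp
    also have "\<dots> = (\<Sum>j<Suc n. c j * x ^ j)"
    proof (intro sum.cong refl)
      fix j assume "j \<in> {..<Suc n}"
      then have "M x $$ (n, j) = x ^ j" by (simp add: M_def)
      then show "M x $$ (n, j) * cofactor (M x) n j = c j * x ^ j"
        by (simp add: c_def cofactor_def md[of x])
    qed
    finally show ?thesis by (simp add: p_def poly_sum poly_monom lessThan_Suc_atMost)
  qed
  have lead: "c n = (\<Prod>j<n. \<Prod>i<j. z j - z i)"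
  proof -
    have "mat_delete (M 0) n n = Matrix.mat n n (\<lambda>(i, j). z i ^ j)"
      by (rule eq_matI) (auto simp: M_def mat_delete_def)
    then show ?thesis using Suc.IH by (simp add: c_def cofactor_def perm_det_mat)
  qed
  have roots: "poly p (z i) = 0" if "i < n" for i
    unfolding pM using that
    by (intro det_identical_rows[OF Mc, of i n]) (auto simp: M_def intro!: eq_vecI)
  \<comment> \<open>For distinct nodes, p minus \<open>c n\<close> times the product of the linear
    factors has degree below n and n roots, hence is zero. If two nodes coincide, both sides
    vanish.\<close>
  have "poly p (z n) = c n * (\<Prod>i<n. z n - z i)"
  proof (cases "inj_on z {..<n}")
    case True
    define q where "q = p - Polynomial.smult (c n) (\<Prod>i<n. [:- z i, 1:])"
    have degprod: "degree (\<Prod>i<n. [:- z i, 1:]) = n"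
      by (subst degree_prod_eq_sum_degree) auto
    have "lead_coeff (\<Prod>i<n. [:- z i, 1:]) = 1" by (simp add: lead_coeff_prod)
    then have cp: "coeff (\<Prod>i<n. [:- z i, 1:]) n = 1" using degprod by simp
    have dp: "degree p \<le> n" unfolding p_def
      by (intro degree_sum_le) (auto intro: order.trans[OF degree_monom_le])
    have "degree q \<le> n" unfolding q_def
      by (intro degree_diff_le dp order.trans[OF degree_smult_le]) (simp add: degprod)
    moreover have "coeff q n = 0"
      by (simp add: q_def cp p_def coeff_sum sum.delta' if_distrib cong: if_cong)
    ultimately have dq: "q = 0 \<or> degree q < n"
      by (metis leading_coeff_0_iff le_neq_implies_less)
    have rq: "poly q (z i) = 0" if "i < n" for i
      using roots[OF that] that by (auto simp: q_def poly_prod intro!: prod_zero)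
    have "q = 0"
    proof (rule ccontr)
      assume q: "q \<noteq> 0"
      have "card (z ` {..<n}) \<le> card {x. poly q x = 0}"
        using rq by (intro card_mono poly_roots_finite q) auto
      also have "\<dots> \<le> degree q" by (rule card_poly_roots_bound[OF q])
      finally show False using dq q True by (simp add: card_image)
    qed
    then have "p = Polynomial.smult (c n) (\<Prod>i<n. [:- z i, 1:])" by (simp add: q_def)
    then show ?thesis by (simp add: poly_prod)
  next
    case False
    then obtain i j where ij: "i < n" "j < n" "i \<noteq> j" "z i = z j" by (auto simp: inj_on_def)
    have 1: "poly p (z n) = 0"
      unfolding pM using ij
      by (intro det_identical_rows[OF Mc, of i j]) (auto simp: M_def intro!: eq_vecI)
    have "c n = 0" if "i < j" "j < n" "z i = z j" for i j
    proof -
      have "(\<Prod>i<j. z j - z i) = 0"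
        using that by (intro prod_zero) (auto intro!: bexI[of _ i])
      then have "\<exists>j\<in>{..<n}. (\<Prod>i<j. z j - z i) = 0" using \<open>j < n\<close> by blast
      then show ?thesis unfolding lead by (intro prod_zero) simp_all
    qed
    then have "c n = 0"
      using ij by (cases i j rule: linorder_cases) auto
    with 1 show ?thesis by simp
  qed
  moreover have "M (z n) = Matrix.mat (Suc n) (Suc n) (\<lambda>(i, j). z i ^ j)"
    by (rule eq_matI) (auto simp: M_def)
  ultimately show ?case by (simp add: perm_det_mat pM lead)
qed

declare One_nat_def [simp del]

section \<open>Heine's identity\<close>

definition circ :: "real measure" where
  "circ = uniform_measure lborel {0..<2 * pi}"

definition fcoef :: "(real \<Rightarrow> complex) \<Rightarrow> int \<Rightarrow> complex" where
  "fcoef g k = (\<integral>x. g x * cis (- (real_of_int k * x)) \<partial>circ)"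

definition bdd_meas :: "(real \<Rightarrow> 'a::{second_countable_topology, real_normed_vector}) \<Rightarrow> bool" where
  "bdd_meas g \<longleftrightarrow> g \<in> borel_measurable borel \<and> (\<exists>C. \<forall>x. norm (g x) \<le> C)"

text \<open>The flag selects the ensemble: CUE for \<open>True\<close>, independent uniform points for \<open>False\<close>. The latter fits
the same determinantal formalism with the Toeplitz matrix cut down to its diagonal.\<close>

definition toep :: "bool \<Rightarrow> (real \<Rightarrow> complex) \<Rightarrow> nat \<Rightarrow> nat \<Rightarrow> complex" where
  "toep b g i j = (if b \<or> i = j then fcoef g (int i - int j) else 0)"

definition law :: "bool \<Rightarrow> nat \<Rightarrow> (nat \<Rightarrow> real) measure" where
  "law b N = (if b then density (PiM {1..N} (\<lambda>_. lborel)) (\<lambda>x. ennreal (cue_density N x))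
              else PiM {1..N} (\<lambda>_. circ))"

section \<open>Integration against normalised Lebesgue measure on the circle\<close>

lemma circ_density: "circ = density lborel (\<lambda>x. ennreal (indicator {0..<2 * pi} x / (2 * pi)))"
proof -
  have "ennreal (indicator {0..<2 * pi} x / (2 * pi)) = indicator {0..<2 * pi} x / emeasure lborel {0..<2 * pi}"
    for x :: real
    by (auto simp: divide_ennreal indicator_def simp flip: ennreal_1)
  then show ?thesis by (simp add: circ_def uniform_measure_def)
qed

lemma sets_circ [measurable_cong, simp]: "sets circ = sets borel"
  and space_circ [simp]: "space circ = UNIV"
  by (simp_all add: circ_def)

interpretation circ: prob_space circ
  unfolding circ_def by (rule prob_space_uniform_measure) auto

lemma bdd_meas_measurable [measurable_dest]: "bdd_meas g \<Longrightarrow> g \<in> borel_measurable borel"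
  by (simp add: bdd_meas_def)

lemma bdd_meas_integrable:
  fixes g :: "real \<Rightarrow> 'a::{second_countable_topology, banach}"
  assumes "bdd_meas g" shows "integrable circ g"
proof -
  from assms obtain C where C: "g \<in> borel_measurable borel" "\<And>x. norm (g x) \<le> C"
    by (auto simp: bdd_meas_def)
  show ?thesis
    by (rule circ.integrable_const_bound[of _ C]) (use C in \<open>auto simp: measurable_def\<close>)
qed

lemma integral_circ:
  fixes g :: "real \<Rightarrow> 'a::{second_countable_topology, banach}"
  assumes [measurable]: "g \<in> borel_measurable borel"
  shows "(\<integral>x. g x \<partial>circ) = (\<integral>x. (indicator {0..<2 * pi} x / (2 * pi)) *\<^sub>R g x \<partial>lborel)"
  unfolding circ_density by (subst integral_density) auto

lemma integrable_circ:
  fixes g :: "real \<Rightarrow> 'a::{second_countable_topology, banach}"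
  assumes [measurable]: "g \<in> borel_measurable borel"
  shows "integrable circ g \<longleftrightarrow> integrable lborel (\<lambda>x. (indicator {0..<2 * pi} x / (2 * pi)) *\<^sub>R g x)"
  unfolding circ_density by (subst integrable_density) auto

lemma bdd_meas_mult:
  fixes f g :: "real \<Rightarrow> 'a::{second_countable_topology, real_normed_algebra}"
  assumes "bdd_meas f" "bdd_meas g" shows "bdd_meas (\<lambda>x. f x * g x)"
proof -
  from assms obtain C D where C: "\<And>x. norm (f x) \<le> C" "\<And>x. norm (g x) \<le> D"
    by (auto simp: bdd_meas_def)
  have "norm (f x * g x) \<le> C * D" for x
    by (rule order.trans[OF norm_mult_ineq])
      (intro mult_mono C norm_ge_zero order.trans[OF norm_ge_zero C(1)])
  moreover have "(\<lambda>x. f x * g x) \<in> borel_measurable borel"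
    using assms by (intro borel_measurable_times) (auto simp: bdd_meas_def)
  ultimately show ?thesis by (auto simp: bdd_meas_def)
qed

lemma bdd_meas_add:
  assumes "bdd_meas f" "bdd_meas g" shows "bdd_meas (\<lambda>x. f x + g x)"
proof -
  from assms obtain C D where C: "\<And>x. norm (f x) \<le> C" "\<And>x. norm (g x) \<le> D"
    by (auto simp: bdd_meas_def)
  have "norm (f x + g x) \<le> C + D" for x
    by (rule order.trans[OF norm_triangle_ineq add_mono[OF C]])
  then show ?thesis using assms by (auto simp: bdd_meas_def)
qed

lemma bdd_meas_const [simp]: "bdd_meas (\<lambda>_. c)"
  by (auto simp: bdd_meas_def)

lemma bdd_meas_sum:
  "(\<And>i. i \<in> I \<Longrightarrow> bdd_meas (f i)) \<Longrightarrow> bdd_meas (\<lambda>x. \<Sum>i\<in>I. f i x)"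
  by (induction I rule: infinite_finite_induct) (auto intro!: bdd_meas_add)

lemma bdd_meas_cmult:
  fixes g :: "real \<Rightarrow> 'a::{second_countable_topology, real_normed_algebra}"
  shows "bdd_meas g \<Longrightarrow> bdd_meas (\<lambda>x. c * g x)"
  by (rule bdd_meas_mult) auto

lemma bdd_meas_cis [simp]: "bdd_meas (\<lambda>x. cis (a * x))" "bdd_meas (\<lambda>x. cis (- (a * x)))"
  by (auto simp: bdd_meas_def intro!: borel_measurable_continuous_onI continuous_intros exI[of _ 1])

lemma bdd_meas_of_real [simp]: "bdd_meas (\<lambda>x. complex_of_real (h x)) \<longleftrightarrow> bdd_meas h"
proof
  assume "bdd_meas (\<lambda>x. complex_of_real (h x))"
  then obtain C where "(\<lambda>x. complex_of_real (h x)) \<in> borel_measurable borel" "\<And>x. \<bar>h x\<bar> \<le> C"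
    unfolding bdd_meas_def by auto
  then show "bdd_meas h"
    using measurable_compose[OF _ borel_measurable_Re, of "\<lambda>x. complex_of_real (h x)" borel]
    unfolding bdd_meas_def by auto
next
  assume "bdd_meas h"
  then obtain C where "h \<in> borel_measurable borel" "\<And>x. \<bar>h x\<bar> \<le> C"
    unfolding bdd_meas_def by auto
  then show "bdd_meas (\<lambda>x. complex_of_real (h x))"
    unfolding bdd_meas_def by (intro conjI exI[of _ C]) simp_all
qed

section \<open>The joint laws and the average of a product over the points\<close>

lemma sets_law [measurable_cong, simp]: "sets (law b N) = sets (PiM {1..N} (\<lambda>_. borel))"
proof (cases b)
  case True
  then show ?thesis by (simp add: law_def) (rule sets_PiM_cong, simp_all)
next
  case False
  then show ?thesis by (simp add: law_def) (rule sets_PiM_cong, simp_all)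
qed

lemma measurable_cue_density [measurable]:
  "cue_density N \<in> borel_measurable (PiM {1..N} (\<lambda>_. borel))"
  unfolding cue_density_def by measurable

lemma cue_density_nonneg: "0 \<le> cue_density N x"
  unfolding cue_density_def by (intro mult_nonneg_nonneg prod_nonneg ballI) simp_all

text \<open>The square makes the order within a pair irrelevant. Points are numbered from 1 and rows
  of the determinant from 0, whence the shift by one in the reindexing.\<close>

lemma vandermonde_cue:
  "(\<Prod>j\<in>{1..N}. \<Prod>k\<in>{j<..N}. (cmod (cis (x j) - cis (x k)))\<^sup>2)
     = (cmod (perm_det N (\<lambda>i j. cis (x (Suc i)) ^ j)))\<^sup>2"
proof -
  have "(cmod (perm_det N (\<lambda>i j. cis (x (Suc i)) ^ j)))\<^sup>2
      = (\<Prod>(j, i)\<in>Sigma {..<N} (\<lambda>j. {..<j}). (cmod (cis (x (Suc j)) - cis (x (Suc i))))\<^sup>2)"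
    unfolding perm_det_vandermonde
    by (simp add: prod.Sigma prod_power_distrib case_prod_unfold flip: prod_norm)
  also have "\<dots> = (\<Prod>(j, k)\<in>Sigma {1..N} (\<lambda>j. {j<..N}). (cmod (cis (x j) - cis (x k)))\<^sup>2)"
    by (rule prod.reindex_bij_witness[of _ "\<lambda>(j, k). (k - 1, j - 1)" "\<lambda>(j, i). (Suc i, Suc j)"])
       (auto simp: norm_minus_commute)
  finally show ?thesis by (simp add: prod.Sigma)
qed

text \<open>Substituting the composition of p with q for p turns the product of signs into the sign
  of p and makes the inner sum independent of q, so each of the N! permutations q contributes one
  determinant. Double sums of this shape come from squaring a Vandermonde determinant.\<close>

lemma perm_det_correlation:
  fixes t :: "nat \<Rightarrow> nat \<Rightarrow> complex"
  shows "(\<Sum>p | p permutes {0..<N}. \<Sum>q | q permutes {0..<N}. signof p * signof q * (\<Prod>i = 0..<N. t (q i) (p i)))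
       = fact N * perm_det N t"
proof -
  have "(\<Sum>p | p permutes {0..<N}. signof p * signof q * (\<Prod>i = 0..<N. t (q i) (p i))) = perm_det N t"
    if q: "q permutes {0..<N}" for q
  proof -
    have "(\<Sum>p | p permutes {0..<N}. signof p * signof q * (\<Prod>i = 0..<N. t (q i) (p i)))
        = (\<Sum>p | p permutes {0..<N}. signof (p \<circ> q) * signof q * (\<Prod>i = 0..<N. t (q i) ((p \<circ> q) i)))"
      by (rule sum_permutations_compose_right[OF q])
    also have "\<dots> = perm_det N t" unfolding perm_det_def
    proof (intro sum.cong refl)
      fix p assume "p \<in> {p. p permutes {0..<N}}"
      then have p: "p permutes {0..<N}" by simp
      have "signof (p \<circ> q) * signof q = (signof p :: complex)"
      proof -
        have "sign (p \<circ> q) * sign q = sign p"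
          using sign_compose[of p q] p q by (simp add: permutes_imp_permutation[of "{0..<N}"] mult.assoc)
        then show ?thesis by (simp flip: of_int_mult)
      qed
      moreover have "(\<Prod>i = 0..<N. t (q i) ((p \<circ> q) i)) = (\<Prod>i = 0..<N. t i (p i))"
        using prod.permute[OF q, of "\<lambda>i. t i (p i)"] by (simp add: o_def)
      ultimately show "signof (p \<circ> q) * signof q * (\<Prod>i = 0..<N. t (q i) ((p \<circ> q) i))
          = signof p * (\<Prod>i = 0..<N. t i (p i))" by simp
    qed
    finally show ?thesis .
  qed
  then have "(\<Sum>q | q permutes {0..<N}. \<Sum>p | p permutes {0..<N}. signof p * signof q * (\<Prod>i = 0..<N. t (q i) (p i)))
      = of_nat (card {q. q permutes {0..<N}}) * perm_det N t"
    by simp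
  then show ?thesis
    by (subst sum.swap) (simp add: card_permutations[of _ N])
qed

text \<open>For the CUE the squared Vandermonde determinant expands into a double sum over
  permutations p and q, every term factorises over the points, and the integral over one point is
  the Fourier coefficient of g at a difference of values of q and p. For independent points the
  average is a power of the mean of g, that is, the determinant of a scalar matrix.\<close>

lemma law_prod:
  assumes g: "bdd_meas g"
  shows "(\<integral>x. (\<Prod>j\<in>{1..N}. g (x j)) \<partial>law b N) = perm_det N (toep b g)"
proof (cases b)
  case False
  interpret P: product_sigma_finite "\<lambda>_::nat. circ" ..
  have "(\<integral>x. (\<Prod>j\<in>{1..N}. g (x j)) \<partial>law b N) = (\<Prod>j\<in>{1..N}. \<integral>x. g x \<partial>circ)"
    using False P.product_integral_prod[of "{1..N}" "\<lambda>_. g"] bdd_meas_integrable[OF g] by (simp add: law_def)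
  also have "\<dots> = (fcoef g 0) ^ N" by (simp add: fcoef_def)
  also have "\<dots> = Determinant.det (fcoef g 0 \<cdot>\<^sub>m 1\<^sub>m N)" by simp
  also have "fcoef g 0 \<cdot>\<^sub>m 1\<^sub>m N = Matrix.mat N N (\<lambda>(i, j). toep b g i j)"
    using False by (auto simp: toep_def)
  finally show ?thesis by (simp add: perm_det_mat)
next
  case True
  interpret P: product_sigma_finite "\<lambda>_::nat. lborel :: real measure" ..
  \<comment> \<open>The weight of the uniform law on [0, 2 pi) is absorbed into the one-point
    functions, so that each of them has a Fourier coefficient of g as its Lebesgue integral.\<close>
  define G where "G = (\<lambda>m::int. \<lambda>x. (indicator {0..<2 * pi} x / (2 * pi)) *\<^sub>R (g x * cis (- (real_of_int m * x))))"
  have bG: "bdd_meas (\<lambda>x. g x * cis (- (real_of_int m * x)))" for m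
    by (intro bdd_meas_mult g bdd_meas_cis)
  have G: "integrable lborel (G m)" "integral\<^sup>L lborel (G m) = fcoef g m" for m
    using bdd_meas_integrable[OF bG[of m]] integrable_circ[OF bdd_meas_measurable[OF bG[of m]]]
      integral_circ[OF bdd_meas_measurable[OF bG[of m]]]
    by (simp_all add: G_def fcoef_def)
  have pt: "cue_density N x *\<^sub>R (\<Prod>j\<in>{1..N}. g (x j)) = (1 / fact N) *
      (\<Sum>p | p permutes {0..<N}. \<Sum>q | q permutes {0..<N}. signof p * signof q *
        (\<Prod>j\<in>{1..N}. G (int (q (j - 1)) - int (p (j - 1))) (x j)))" for x
  proof -
    define I where "I = (\<Prod>j\<in>{1..N}. indicator {0..<2 * pi} (x j) :: real)"
    define D where "D = perm_det N (\<lambda>i j. cis (x (Suc i)) ^ j)"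
    have GI: "(\<Prod>j\<in>{1..N}. G (m j) (x j)) = of_real (I / (2 * pi) ^ N) *
        ((\<Prod>j\<in>{1..N}. g (x j)) * (\<Prod>j\<in>{1..N}. cis (- (real_of_int (m j) * x j))))" for m
      unfolding G_def I_def
      by (simp add: scaleR_conv_of_real prod.distrib prod_dividef)
    have perm: "(\<Prod>j\<in>{1..N}. cis (- (real_of_int (int (q (j - 1)) - int (p (j - 1))) * x j)))
        = (\<Prod>i=0..<N. cis (x (Suc i)) ^ p i) * (\<Prod>i=0..<N. cnj (cis (x (Suc i)) ^ q i))" for p q :: "nat \<Rightarrow> nat"
    proof -
      have "(\<Prod>j\<in>{1..N}. cis (- (real_of_int (int (q (j - 1)) - int (p (j - 1))) * x j)))
         = (\<Prod>i\<in>{0..<N}. cis (- (real_of_int (int (q i) - int (p i)) * x (Suc i))))"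
        by (rule prod.reindex_bij_witness[of _ Suc "\<lambda>j. j - 1"]) auto
      also have "\<dots> = (\<Prod>i=0..<N. cis (x (Suc i)) ^ p i * cnj (cis (x (Suc i)) ^ q i))"
      proof (intro prod.cong refl)
        have "cis t ^ a * cnj (cis t ^ b) = cis (- (real_of_int (int b - int a) * t))" for t a b
        proof -
          have "cis t ^ a * cnj (cis t ^ b) = cis (real a * t) * cis (- (real b * t))"
            by (simp only: Complex.DeMoivre cis_cnj)
          then show ?thesis by (simp add: cis_mult left_diff_distrib)
        qed
        then show "cis (- (real_of_int (int (q i) - int (p i)) * x (Suc i)))
            = cis (x (Suc i)) ^ p i * cnj (cis (x (Suc i)) ^ q i)" for i by metis
      qed
      finally show ?thesis by (simp add: prod.distrib)
    qed
    have DD: "of_real ((cmod D)\<^sup>2) = (\<Sum>p | p permutes {0..<N}. \<Sum>q | q permutes {0..<N}. signof p * signof q *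
        ((\<Prod>i=0..<N. cis (x (Suc i)) ^ p i) * (\<Prod>i=0..<N. cnj (cis (x (Suc i)) ^ q i))))"
    proof -
      have cs: "cnj (signof q) = signof q" for q :: "nat \<Rightarrow> nat" by (simp add: sign_def)
      have "of_real ((cmod D)\<^sup>2) = D * cnj D" by (rule complex_norm_square)
      also have "\<dots> = (\<Sum>p | p permutes {0..<N}. \<Sum>q | q permutes {0..<N}.
         (signof p * (\<Prod>i=0..<N. cis (x (Suc i)) ^ p i)) * (signof q * (\<Prod>i=0..<N. cnj (cis (x (Suc i)) ^ q i))))"
        unfolding D_def perm_det_def by (simp add: sum_product cs del: complex_cnj_power)
      finally show ?thesis by (simp add: mult_ac)
    qed
    have "cue_density N x = 1 / ((2 * pi) ^ N * fact N) * (cmod D)\<^sup>2 * I"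
      unfolding cue_density_def I_def D_def vandermonde_cue[symmetric]
      unfolding cis_conv_exp by simp
    then have "cue_density N x *\<^sub>R (\<Prod>j\<in>{1..N}. g (x j)) = (1 / fact N) * (of_real ((cmod D)\<^sup>2) *
        (of_real (I / (2 * pi) ^ N) * (\<Prod>j\<in>{1..N}. g (x j))))"
      by (simp add: scaleR_conv_of_real mult_ac)
    also have "of_real ((cmod D)\<^sup>2) * (of_real (I / (2 * pi) ^ N) * (\<Prod>j\<in>{1..N}. g (x j)))
       = (\<Sum>p | p permutes {0..<N}. \<Sum>q | q permutes {0..<N}. signof p * signof q *
        (\<Prod>j\<in>{1..N}. G (int (q (j - 1)) - int (p (j - 1))) (x j)))"
      unfolding DD GI perm sum_distrib_right by (intro sum.cong refl) (simp only: mult_ac)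
    finally show ?thesis .
  qed
  have int: "integrable (PiM {1..N} (\<lambda>_. lborel)) (\<lambda>x. \<Prod>j\<in>{1..N}. G (m j) (x j))"
    and val: "(\<integral>x. (\<Prod>j\<in>{1..N}. G (m j) (x j)) \<partial>PiM {1..N} (\<lambda>_. lborel)) = (\<Prod>j\<in>{1..N}. fcoef g (m j))" for m
    using P.product_integrable_prod[of "{1..N}" "\<lambda>j. G (m j)"] P.product_integral_prod[of "{1..N}" "\<lambda>j. G (m j)"] G
    by auto
  have [measurable]: "cue_density N \<in> borel_measurable (PiM {1..N} (\<lambda>_. lborel))"
    by measurable
  have [measurable]: "(\<lambda>x. \<Prod>j\<in>{1..N}. g (x j)) \<in> borel_measurable (PiM {1..N} (\<lambda>_. lborel))"
    using bdd_meas_measurable[OF g] by measurable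
  have re: "(\<Prod>j\<in>{1..N}. fcoef g (int (q (j - 1)) - int (p (j - 1)))) = (\<Prod>i=0..<N. toep b g (q i) (p i))"
    for p q :: "nat \<Rightarrow> nat"
    using True by (intro prod.reindex_bij_witness[of _ Suc "\<lambda>j. j - 1"]) (auto simp: toep_def)
  have "(\<integral>x. (\<Prod>j\<in>{1..N}. g (x j)) \<partial>law b N)
      = (\<integral>x. cue_density N x *\<^sub>R (\<Prod>j\<in>{1..N}. g (x j)) \<partial>PiM {1..N} (\<lambda>_. lborel))"
    using True unfolding law_def by (simp only: if_True) (rule integral_density, auto simp: cue_density_nonneg)
  also have "\<dots> = (1 / fact N) *
      (\<Sum>p | p permutes {0..<N}. \<Sum>q | q permutes {0..<N}. signof p * signof q *
        (\<Prod>j\<in>{1..N}. fcoef g (int (q (j - 1)) - int (p (j - 1)))))"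
    unfolding pt by (simp add: int val Bochner_Integration.integral_sum)
  also have "\<dots> = (1 / fact N) * (fact N * perm_det N (toep b g))"
    unfolding re perm_det_correlation ..
  finally show ?thesis by simp
qed

section \<open>Fourier coefficients on the circle\<close>

lemma integral_circ_cis:
  "(\<integral>x. cis (real_of_int k * x) \<partial>circ) = (if k = 0 then 1 else 0)"
proof (cases "k = 0")
  case True
  have "(\<integral>x. (1::complex) \<partial>circ) = 1" using circ.prob_space by simp
  with True show ?thesis by simp
next
  case False
  define F where "F = (\<lambda>x. cis (real_of_int k * x) / (\<i> * of_int k))"
  have F: "(F has_vector_derivative cis (real_of_int k * x)) (at x within A)" for x A
  proof -
    have "((\<lambda>z. exp (\<i> * of_int k * z) / (\<i> * of_int k)) has_field_derivative exp (\<i> * of_int k * of_real x)) (at (of_real x))"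
      using False by (auto intro!: derivative_eq_intros)
    from has_vector_derivative_real_field[OF this, of A] show ?thesis
      by (simp add: F_def[abs_def] cis_conv_exp mult.assoc)
  qed
  have "(\<integral>x. indicator {0..2 * pi} x *\<^sub>R cis (real_of_int k * x) \<partial>lborel) = F (2 * pi) - F 0"
    by (rule integral_FTC_Icc) (auto intro!: F continuous_intros)
  also have "F (2 * pi) = F 0"
  proof -
    have "cis (real_of_int k * (2 * pi)) = 1"
      using cis_multiple_2pi[of "real_of_int k"] by (simp add: mult_ac)
    then show ?thesis by (simp add: F_def)
  qed
  finally have *: "(\<integral>x. indicator {0..2 * pi} x *\<^sub>R cis (real_of_int k * x) \<partial>lborel) = 0" by simp
  have "(\<integral>x. cis (real_of_int k * x) \<partial>circ)
      = (\<integral>x. (indicator {0..<2 * pi} x / (2 * pi)) *\<^sub>R cis (real_of_int k * x) \<partial>lborel)"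
    by (rule integral_circ[OF bdd_meas_measurable]) simp
  also have "\<dots> = (\<integral>x. (1 / (2 * pi)) *\<^sub>R (indicator {0..2 * pi} x *\<^sub>R cis (real_of_int k * x)) \<partial>lborel)"
    using AE_lborel_singleton[of "2 * pi"]
    by (intro integral_cong_AE borel_measurable_scaleR)
       (auto intro!: bdd_meas_measurable[OF bdd_meas_cis(1)] split: split_indicator elim!: eventually_mono)
  also have "\<dots> = 0" by (simp only: integral_scaleR_right *) simp
  finally show ?thesis using False by simp
qed

lemma fcoef_cis: "fcoef (\<lambda>x. c * cis (real_of_int m * x)) k = (if k = m then c else 0)"
proof -
  have *: "c * cis (real_of_int m * x) * cis (- (real_of_int k * x)) = c * cis (real_of_int (m - k) * x)" for x
    by (simp add: mult.assoc cis_mult algebra_simps)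
  show ?thesis unfolding fcoef_def * by (simp add: integral_circ_cis del: of_int_diff)
qed

lemma fcoef_const: "fcoef (\<lambda>_. c) k = (if k = 0 then c else 0)"
  using fcoef_cis[of c 0 k] by simp

lemma fcoef_integrable: "bdd_meas g \<Longrightarrow> integrable circ (\<lambda>x. g x * cis (- (real_of_int k * x)))"
  by (intro bdd_meas_integrable bdd_meas_mult bdd_meas_cis)

lemma fcoef_add: "bdd_meas f \<Longrightarrow> bdd_meas g \<Longrightarrow> fcoef (\<lambda>x. f x + g x) k = fcoef f k + fcoef g k"
  unfolding fcoef_def distrib_right by (intro Bochner_Integration.integral_add fcoef_integrable)

lemma fcoef_sum: "(\<And>i. i \<in> I \<Longrightarrow> bdd_meas (f i)) \<Longrightarrow> fcoef (\<lambda>x. \<Sum>i\<in>I. f i x) k = (\<Sum>i\<in>I. fcoef (f i) k)"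
  unfolding fcoef_def sum_distrib_right by (intro Bochner_Integration.integral_sum fcoef_integrable)

lemma fcoef_cmult: "fcoef (\<lambda>x. c * g x) k = c * fcoef g k"
  unfolding fcoef_def by (simp add: mult.assoc)

lemma fcoef_real_uminus: "fcoef (\<lambda>x. complex_of_real (h x)) (- k) = cnj (fcoef (\<lambda>x. of_real (h x)) k)"
proof -
  have "fcoef (\<lambda>x. complex_of_real (h x)) (- k) = (\<integral>x. cnj (complex_of_real (h x) * cis (- (real_of_int k * x))) \<partial>circ)"
    by (simp add: fcoef_def cis_cnj)
  also have "\<dots> = cnj (fcoef (\<lambda>x. of_real (h x)) k)"
    unfolding fcoef_def by (rule Bochner_Integration.integral_cnj)
  finally show ?thesis .
qed

section \<open>Toeplitz matrices: spectrum and Frobenius norm\<close>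

lemma toep_add: "bdd_meas f \<Longrightarrow> bdd_meas g \<Longrightarrow> toep b (\<lambda>x. f x + g x) i j = toep b f i j + toep b g i j"
  by (simp add: toep_def fcoef_add)

lemma toep_cmult: "toep b (\<lambda>x. c * g x) i j = c * toep b g i j"
  by (simp add: toep_def fcoef_cmult)

lemma bdd_meas_cnj [simp]: "bdd_meas g \<Longrightarrow> bdd_meas (\<lambda>x. cnj (g x))"
  unfolding bdd_meas_def
  using measurable_compose[OF _ borel_measurable_continuous_onI[OF continuous_on_cnj[OF continuous_on_id]], of g borel]
  by auto

lemma cmod_diff_squared: "(cmod (a - b))\<^sup>2 = (cmod a)\<^sup>2 - 2 * Re (a * cnj b) + (cmod b)\<^sup>2"
  unfolding cmod_power2 by (simp add: power2_eq_square algebra_simps)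

lemma bdd_meas_cmod: "bdd_meas g \<Longrightarrow> bdd_meas (\<lambda>x. cmod (g x))"
  unfolding bdd_meas_def by auto

lemma bdd_meas_power:
  fixes h :: "real \<Rightarrow> real"
  shows "bdd_meas h \<Longrightarrow> bdd_meas (\<lambda>x. h x ^ n)"
  by (induction n) (auto intro: bdd_meas_mult)

text \<open>The total mass is the average of a product of ones; by Heine's identity it is the
  determinant of the Toeplitz matrix of the constant 1, an identity matrix. This confirms the
  normalising constant of \<open>cue_density\<close>.\<close>

lemma prob_space_law: "prob_space (law b N)"
proof
  have "(\<integral>x. (1::complex) \<partial>law b N) = perm_det N (toep b (\<lambda>_. 1))"
    using law_prod[where g = "\<lambda>_. 1" and N = N and b = b] by simp
  also have "\<dots> = 1"
  proof -
    have "Matrix.mat N N (\<lambda>(i, j). toep b (\<lambda>_. 1) i j) = 1\<^sub>m N"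
      by (auto simp: toep_def fcoef_const)
    then show ?thesis by (simp add: perm_det_mat)
  qed
  finally have "measure (law b N) (space (law b N)) = 1"
    by (simp add: complex_eq_iff)
  \<comment> \<open>An infinite total mass would give \<open>measure\<close> the default value 0, so
    the value 1 rules it out.\<close>
  then show "emeasure (law b N) (space (law b N)) = 1"
    by (metis emeasure_eq_ennreal_measure ennreal_1 measure_zero_top zero_neq_one)
qed

text \<open>The quadratic form of a Toeplitz matrix integrates its symbol against the squared
  modulus of a trigonometric polynomial. The symbol 1 yields the norm of v, and an eigenvalue
  equation turns into an average of the symbol.\<close>

lemma trig_square_integral:
  fixes v :: "nat \<Rightarrow> complex"
  assumes f: "bdd_meas f"
  shows "(\<integral>x. f x * of_real ((cmod (\<Sum>j<N. v j * cis (real j * x)))\<^sup>2) \<partial>circ)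
       = (\<Sum>r<N. \<Sum>j<N. cnj (v r) * v j * fcoef f (int r - int j))"
proof -
  have "f x * of_real ((cmod (\<Sum>j<N. v j * cis (real j * x)))\<^sup>2)
      = (\<Sum>r<N. \<Sum>j<N. cnj (v r) * v j * (f x * cis (- (real_of_int (int r - int j) * x))))" for x
  proof -
    have *: "cis (- (real_of_int (int r - int j) * x)) = cis (real j * x) * cis (- (real r * x))" for r j
      by (simp add: cis_mult algebra_simps)
    have "of_real ((cmod (\<Sum>j<N. v j * cis (real j * x)))\<^sup>2)
       = (\<Sum>r<N. cnj (v r) * cis (- (real r * x))) * (\<Sum>j<N. v j * cis (real j * x))"
      unfolding complex_norm_square by (simp add: cis_cnj mult.commute)
    then show ?thesis
      unfolding * by (simp add: sum_product sum_distrib_left sum_distrib_right mult_ac)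
  qed
  then show ?thesis
    by (simp add: Bochner_Integration.integral_sum fcoef_integrable[OF f] fcoef_def
        del: of_int_diff of_int_of_nat_eq)
qed

text \<open>For a normalised eigenvector \<open>v\<close>, the weight is \<open>|\<Sum>\<^sub>j v\<^sub>j exp(i j x)|\<^sup>2\<close>. Since every eigenvalue is thus an
average of the symbol, no triangularisation by unitary matrices is needed to bound the sum of the \<open>|l|\<^sup>2\<close>.\<close>

lemma toep_eigen_weight:
  assumes nz: "\<exists>j<N. v j \<noteq> 0" and ev: "\<And>r. r < N \<Longrightarrow> (\<Sum>j<N. toep b g r j * v j) = l * v r"
    and g: "bdd_meas g"
  obtains w :: "real \<Rightarrow> real" where "bdd_meas w" "\<And>x. 0 \<le> w x" "(\<integral>x. w x \<partial>circ) = 1"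
    "l = (\<integral>x. g x * of_real (w x) \<partial>circ)"
proof (cases b)
  \<comment> \<open>The diagonal matrix is the mean of g times the identity, so the weight is the
    constant 1.\<close>
  case False
  from nz obtain r where r: "r < N" "v r \<noteq> 0" by auto
  have "(\<Sum>j<N. toep b g r j * v j) = fcoef g 0 * v r"
    using r False by (simp add: toep_def if_distrib[of "\<lambda>z. z * _"] cong: if_cong)
  then have "l = fcoef g 0" using ev[OF r(1)] r(2) by simp
  then show ?thesis using circ.prob_space by (intro that[of "\<lambda>_. 1"]) (auto simp: fcoef_def)
next
  case True
  define S where "S = (\<Sum>j<N. (cmod (v j))\<^sup>2)"
  define p where "p = (\<lambda>x. (\<Sum>j<N. v j * cis (real j * x)))"
  have S: "S > 0" unfolding S_def using nz by (auto intro!: sum_pos2)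
  have bp: "bdd_meas p" unfolding p_def by (intro bdd_meas_sum bdd_meas_mult) auto
  have bw: "bdd_meas (\<lambda>x. (cmod (p x))\<^sup>2)" by (intro bdd_meas_power bdd_meas_cmod bp)
  have "(\<integral>x. 1 * complex_of_real ((cmod (p x))\<^sup>2) \<partial>circ) = of_real S"
  proof -
    have "(\<integral>x. 1 * complex_of_real ((cmod (p x))\<^sup>2) \<partial>circ) = (\<Sum>r<N. v r * cnj (v r))"
      unfolding p_def using trig_square_integral[of "\<lambda>_. 1" v N]
      by (auto simp: fcoef_const mult.commute if_distrib[of "\<lambda>z. c * z" for c] cong: if_cong)
    also have "\<dots> = of_real S" unfolding S_def of_real_sum complex_norm_square ..
    finally show ?thesis .
  qed
  then have 1: "(\<integral>x. (cmod (p x))\<^sup>2 \<partial>circ) = S"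
    by (simp only: mult_1 integral_complex_of_real of_real_eq_iff)
  have 2: "(\<integral>x. g x * of_real ((cmod (p x))\<^sup>2) \<partial>circ) = l * of_real S"
  proof -
    have "(\<integral>x. g x * of_real ((cmod (p x))\<^sup>2) \<partial>circ) = (\<Sum>r<N. cnj (v r) * (\<Sum>j<N. toep b g r j * v j))"
      unfolding p_def using True by (subst trig_square_integral[OF g]) (simp add: toep_def sum_distrib_left mult_ac)
    also have "\<dots> = (\<Sum>r<N. cnj (v r) * (l * v r))" using ev by simp
    also have "\<dots> = l * of_real S"
      unfolding S_def of_real_sum complex_norm_square by (simp add: sum_distrib_left mult_ac)
    finally show ?thesis .
  qed
  show ?thesis
  proof (rule that[of "\<lambda>x. (1 / S) * (cmod (p x))\<^sup>2"])
    show "bdd_meas (\<lambda>x. (1 / S) * (cmod (p x))\<^sup>2)" by (intro bdd_meas_cmult bw)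
    show "0 \<le> (1 / S) * (cmod (p x))\<^sup>2" for x using S by simp
    show "(\<integral>x. (1 / S) * (cmod (p x))\<^sup>2 \<partial>circ) = 1" using S 1 by simp
    have "(\<integral>x. g x * of_real ((1 / S) * (cmod (p x))\<^sup>2) \<partial>circ)
        = (\<integral>x. of_real (1 / S) * (g x * of_real ((cmod (p x))\<^sup>2)) \<partial>circ)"
      by (intro Bochner_Integration.integral_cong) auto
    also have "\<dots> = of_real (1 / S) * (l * of_real S)"
      by (simp only: integral_mult_right_zero 2)
    finally show "l = (\<integral>x. g x * of_real ((1 / S) * (cmod (p x))\<^sup>2) \<partial>circ)" using S by simp
  qed
qed

lemma integral_diff_add_Re:
  fixes a :: "'a \<Rightarrow> real" and b c :: "'a \<Rightarrow> complex"
  assumes "integrable M a" "integrable M b" "integrable M c"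
  shows "(\<integral>x. a x - 2 * Re (b x) + Re (c x) \<partial>M) = integral\<^sup>L M a - 2 * Re (integral\<^sup>L M b) + Re (integral\<^sup>L M c)"
  using assms by simp

text \<open>Pythagoras: the partial Fourier sum is an orthogonal projection. Nonnegativity of the
  left side is Bessel's inequality, and its vanishing in the limit is Parseval's identity.\<close>

lemma trig_approx_error:
  assumes g: "bdd_meas g" and K: "finite K"
  shows "(\<integral>x. (cmod (g x - (\<Sum>k\<in>K. fcoef g k * cis (real_of_int k * x))))\<^sup>2 \<partial>circ)
       = (\<integral>x. (cmod (g x))\<^sup>2 \<partial>circ) - (\<Sum>k\<in>K. (cmod (fcoef g k))\<^sup>2)"
proof -
  define s where "s = (\<lambda>x. \<Sum>k\<in>K. fcoef g k * cis (real_of_int k * x))"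
  have bs: "bdd_meas s" unfolding s_def by (intro bdd_meas_sum bdd_meas_cmult) auto
  have gs: "(\<integral>x. f x * cnj (s x) \<partial>circ) = (\<Sum>k\<in>K. cnj (fcoef g k) * fcoef f k)" if "bdd_meas f" for f
  proof -
    have "f x * cnj (s x) = (\<Sum>k\<in>K. cnj (fcoef g k) * (f x * cis (- (real_of_int k * x))))" for x
      unfolding s_def by (simp add: cis_cnj sum_distrib_left mult_ac)
    then show ?thesis
      by (simp add: Bochner_Integration.integral_sum fcoef_integrable[OF that] fcoef_def)
  qed
  define S where "S = (\<Sum>k\<in>K. (cmod (fcoef g k))\<^sup>2)"
  have S: "of_real S = (\<Sum>k\<in>K. cnj (fcoef g k) * fcoef g k)"
    unfolding S_def of_real_sum complex_norm_square by (simp add: mult.commute)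
  have fs: "fcoef s k = fcoef g k" if "k \<in> K" for k
    unfolding s_def using that K
    by (subst fcoef_sum) (auto intro!: bdd_meas_cmult simp: fcoef_cis)
  have ss: "(\<integral>x. s x * cnj (s x) \<partial>circ) = of_real S"
    unfolding gs[OF bs] S by (intro sum.cong) (auto simp: fs)
  have "(\<integral>x. (cmod (g x - s x))\<^sup>2 \<partial>circ) = (\<integral>x. (cmod (g x))\<^sup>2 - 2 * Re (g x * cnj (s x)) + Re (s x * cnj (s x)) \<partial>circ)"
  proof (intro Bochner_Integration.integral_cong refl)
    fix x
    have "Re (s x * cnj (s x)) = (cmod (s x))\<^sup>2" by (metis Re_complex_of_real complex_norm_square)
    then show "(cmod (g x - s x))\<^sup>2 = (cmod (g x))\<^sup>2 - 2 * Re (g x * cnj (s x)) + Re (s x * cnj (s x))"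
      by (simp only: cmod_diff_squared)
  qed
  also have "\<dots> = (\<integral>x. (cmod (g x))\<^sup>2 \<partial>circ) - 2 * Re (\<integral>x. g x * cnj (s x) \<partial>circ) + Re (\<integral>x. s x * cnj (s x) \<partial>circ)"
  proof -
    have i: "integrable circ (\<lambda>x. (cmod (g x))\<^sup>2)" "integrable circ (\<lambda>x. g x * cnj (s x))" "integrable circ (\<lambda>x. s x * cnj (s x))"
      by (intro bdd_meas_integrable bdd_meas_power bdd_meas_cmod bdd_meas_mult bdd_meas_cnj g bs)+
    then show ?thesis by (rule integral_diff_add_Re)
  qed
  also have "\<dots> = (\<integral>x. (cmod (g x))\<^sup>2 \<partial>circ) - S"
    unfolding gs[OF g] ss S[symmetric] by simp
  finally show ?thesis by (simp add: S_def s_def)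
qed

lemma bessel:
  assumes g: "bdd_meas g" and K: "finite K"
  shows "(\<Sum>k\<in>K. (cmod (fcoef g k))\<^sup>2) \<le> (\<integral>x. (cmod (g x))\<^sup>2 \<partial>circ)"
proof -
  have "0 \<le> (\<integral>x. (cmod (g x - (\<Sum>k\<in>K. fcoef g k * cis (real_of_int k * x))))\<^sup>2 \<partial>circ)" by simp
  then show ?thesis unfolding trig_approx_error[OF g K] by simp
qed

text \<open>A row contains Fourier coefficients at N distinct frequencies, so Bessel's inequality
  applies row by row.\<close>

lemma toep_frobenius:
  assumes g: "bdd_meas g"
  shows "(\<Sum>i<N. \<Sum>j<N. (cmod (toep b g i j))\<^sup>2) \<le> real N * (\<integral>x. (cmod (g x))\<^sup>2 \<partial>circ)"
proof -
  have "(\<Sum>j<N. (cmod (toep b g i j))\<^sup>2) \<le> (\<integral>x. (cmod (g x))\<^sup>2 \<partial>circ)" for i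
  proof -
    have "(\<Sum>j<N. (cmod (toep b g i j))\<^sup>2) \<le> (\<Sum>j<N. (cmod (fcoef g (int i - int j)))\<^sup>2)"
      by (intro sum_mono) (auto simp: toep_def)
    also have "\<dots> = (\<Sum>k\<in>(\<lambda>j. int i - int j) ` {..<N}. (cmod (fcoef g k))\<^sup>2)"
      by (subst sum.reindex) (auto simp: inj_on_def)
    also have "\<dots> \<le> (\<integral>x. (cmod (g x))\<^sup>2 \<partial>circ)" by (rule bessel[OF g]) simp
    finally show ?thesis .
  qed
  from sum_mono[of "{..<N}", OF this] show ?thesis by simp
qed

text \<open>The second bound is Jensen's inequality combined with \<open>|exp(i h) - 1|\<^sup>2 = -2 Re (exp(i h) - 1)\<close>.\<close>

lemma eigen_bounds:
  fixes w h :: "real \<Rightarrow> real"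
  assumes w: "bdd_meas w" "\<And>x. 0 \<le> w x" "(\<integral>x. w x \<partial>circ) = 1"
    and h: "bdd_meas h" and bd: "\<And>x. \<bar>h x\<bar> \<le> \<epsilon>"
    and l: "l = (\<integral>x. (cis (h x) - 1) * of_real (w x) \<partial>circ)"
  shows "cmod l \<le> \<epsilon>" "(cmod l)\<^sup>2 \<le> - 2 * Re l"
proof -
  define g where "g = (\<lambda>x. cis (h x) - 1)"
  have ng: "cmod (g x) \<le> \<bar>h x\<bar>" for x
    using iexp_approx1[of "h x" 0] by (simp add: g_def cis_conv_exp)
  have "continuous_on UNIV cis" by (intro continuous_intros)
  then have "cis \<in> borel_measurable borel" by (rule borel_measurable_continuous_onI)
  then have mg: "g \<in> borel_measurable borel"
    unfolding g_def using bdd_meas_measurable[OF h] by measurable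
  have bg: "bdd_meas g"
    unfolding bdd_meas_def using mg order.trans[OF ng bd] by auto
  have lg: "l = (\<integral>x. g x * of_real (w x) \<partial>circ)" by (simp add: l g_def)
  have iw: "integrable circ w" by (rule bdd_meas_integrable[OF w(1)])
  have igw: "integrable circ (\<lambda>x. g x * of_real (w x))"
    by (intro bdd_meas_integrable bdd_meas_mult bg) (simp add: w)
  have "cmod l \<le> (\<integral>x. cmod (g x * of_real (w x)) \<partial>circ)"
    unfolding lg by (rule integral_norm_bound)
  also have "\<dots> \<le> (\<integral>x. \<epsilon> * w x \<partial>circ)"
    using w(2) order.trans[OF ng bd]
    by (intro integral_mono integrable_norm igw integrable_mult_right iw)
       (auto simp: norm_mult intro!: mult_right_mono)
  finally show "cmod l \<le> \<epsilon>" using w(3) by simp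
  have gg: "(cmod (g x))\<^sup>2 = - 2 * Re (g x)" for x
    unfolding g_def cmod_power2 using sin_cos_squared_add[of "h x"]
    by (simp add: power2_eq_square algebra_simps)
  have "0 \<le> (\<integral>x. (cmod (g x - l))\<^sup>2 * w x \<partial>circ)" by (intro Bochner_Integration.integral_nonneg) (simp add: w(2))
  also have "\<dots> = (\<integral>x. - 2 * Re (g x * of_real (w x)) - 2 * Re ((g x * of_real (w x)) * cnj l) + (cmod l)\<^sup>2 * w x \<partial>circ)"
    by (intro Bochner_Integration.integral_cong refl)
       (simp add: cmod_diff_squared gg algebra_simps)
  also have "\<dots> = - 2 * Re l - 2 * Re (l * cnj l) + (cmod l)\<^sup>2"
  proof -
    define G where "G = (\<lambda>x. g x * of_real (w x))"
    define H where "H = (\<lambda>x. G x * cnj l)"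
    have iG: "integrable circ G" unfolding G_def by (rule igw)
    have iH: "integrable circ H" unfolding H_def using iG by simp
    have H: "integral\<^sup>L circ H = integral\<^sup>L circ G * cnj l"
      unfolding H_def by (rule integral_mult_left_zero)
    have "(\<integral>x. - 2 * Re (G x) - 2 * Re (H x) + (cmod l)\<^sup>2 * w x \<partial>circ)
      = - 2 * Re (integral\<^sup>L circ G) - 2 * Re (integral\<^sup>L circ H) + (cmod l)\<^sup>2 * (\<integral>x. w x \<partial>circ)"
      using iG iH iw by simp
    then show ?thesis unfolding H unfolding H_def G_def lg[symmetric] w(3) by simp
  qed
  also have "Re (l * cnj l) = (cmod l)\<^sup>2" by (simp flip: complex_norm_square)
  finally show "(cmod l)\<^sup>2 \<le> - 2 * Re l" by simp
qed

text \<open>The remainder has derivative \<open>u^2 / (1 + u)\<close>, which is at most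
  \<open>2 |z|^2\<close> on the disc of radius |z| because \<open>|1 + u|\<close> is at least 1/2
  there; the mean value bound supplies the third power.\<close>

lemma Ln_approx_quadratic:
  fixes z :: complex
  assumes "cmod z \<le> 1 / 2"
  shows "cmod (Ln (1 + z) - z + z\<^sup>2 / 2) \<le> 2 * cmod z ^ 3"
proof -
  define f :: "complex \<Rightarrow> complex" where "f = (\<lambda>u. Ln (1 + u) - u + u\<^sup>2 / 2)"
  have "cmod (f z - f 0) \<le> 2 * (cmod z)\<^sup>2 * cmod (z - 0)"
  proof (rule field_differentiable_bound[where S = "cball 0 (cmod z)" and f' = "\<lambda>u. u\<^sup>2 / (1 + u)"])
    fix u :: complex assume u: "u \<in> cball 0 (cmod z)"
    then have un: "cmod u \<le> 1 / 2" using assms by simp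
    have "1 = cmod ((1 + u) - u)" by simp
    also have "\<dots> \<le> cmod (1 + u) + cmod u" by (rule norm_triangle_ineq4)
    finally have lower: "cmod (1 + u) \<ge> 1 / 2" using un by simp
    then have nz: "1 + u \<noteq> 0" by auto
    have nz4: "4 + u * 4 \<noteq> 0" using nz by (metis mult.commute mult.right_neutral distrib_left mult_eq_0_iff zero_neq_numeral)
    have "\<bar>Re u\<bar> \<le> 1 / 2" using abs_Re_le_cmod[of u] un by linarith
    then have "Re (1 + u) > 0" by simp
    then have "1 + u \<notin> \<real>\<^sub>\<le>\<^sub>0" by (auto simp: complex_nonpos_Reals_iff)
    then show "(f has_field_derivative u\<^sup>2 / (1 + u)) (at u within cball 0 (cmod z))"
      unfolding f_def using nz nz4
      by (auto intro!: derivative_eq_intros simp: field_simps power2_eq_square)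
    have "cmod (u\<^sup>2 / (1 + u)) = (cmod u)\<^sup>2 / cmod (1 + u)" by (simp add: norm_divide norm_power)
    also have "\<dots> \<le> (cmod u)\<^sup>2 / (1 / 2)" using lower by (intro divide_left_mono) auto
    also have "\<dots> \<le> 2 * (cmod z)\<^sup>2" using u by (simp add: power_mono)
    finally show "cmod (u\<^sup>2 / (1 + u)) \<le> 2 * (cmod z)\<^sup>2" .
  qed auto
  then show ?thesis by (simp add: f_def power3_eq_cube power2_eq_square)
qed

lemma norm_exp_diff_one: "cmod w \<le> 1 \<Longrightarrow> cmod (exp w - 1) \<le> 3 * cmod w"
proof -
  assume w: "cmod w \<le> 1"
  have "cmod (exp w - exp 0) \<le> 3 * cmod (w - 0)"
  proof (rule field_differentiable_bound[where S = "cball 0 1" and f' = exp])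
    fix u :: complex assume "u \<in> cball 0 1"
    then have "cmod (exp u) \<le> exp 1" using norm_exp[of u] by (auto intro: order.trans)
    also have "\<dots> \<le> 3" by (rule exp_le)
    finally show "cmod (exp u) \<le> 3" .
  qed (use w in \<open>auto intro!: DERIV_subset[OF DERIV_exp]\<close>)
  then show ?thesis by simp
qed

section \<open>Gaussian approximation of linear statistics\<close>

text \<open>The variance of \<open>\<Sum>\<^sub>j h(x\<^sub>j)\<close> for mean zero \<open>h\<close>, see \<open>law_moments\<close>.\<close>

definition qform :: "bool \<Rightarrow> nat \<Rightarrow> (real \<Rightarrow> real) \<Rightarrow> real" where
  "qform b N h = real N * (\<integral>x. (h x)\<^sup>2 \<partial>circ)
     - (\<Sum>i<N. \<Sum>j<N. (cmod (toep b (\<lambda>x. complex_of_real (h x)) i j))\<^sup>2)"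

text \<open>This is Bessel's inequality summed over the rows. It keeps the Gaussian factor
  \<open>exp(-Q/2)\<close> at most 1, on which the later crude bounds rest.\<close>

lemma qform_nonneg: "bdd_meas h \<Longrightarrow> 0 \<le> qform b N h"
  using toep_frobenius[where g = "\<lambda>x. complex_of_real (h x)" and N = N and b = b] by (simp add: qform_def)

lemma qform_le: "qform b N h \<le> real N * (\<integral>x. (h x)\<^sup>2 \<partial>circ)"
  by (simp add: qform_def sum_nonneg)

lemma measurable_cis [measurable]: "cis \<in> borel_measurable borel"
  by (intro borel_measurable_continuous_onI continuous_intros)

lemma bdd_meas_cis_comp: "bdd_meas h \<Longrightarrow> bdd_meas (\<lambda>x. cis (h x))"
proof -
  assume "bdd_meas h"
  then have "h \<in> borel_measurable borel" by (rule bdd_meas_measurable)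
  from measurable_compose[OF this measurable_cis] show ?thesis
    unfolding bdd_meas_def by (intro conjI exI[of _ 1]) simp_all
qed

text \<open>The logarithm is taken factor by factor inside the disc of radius 1/2 around 1, so no
  branch for the whole product has to be chosen.\<close>

lemma prod_exp_log:
  fixes l :: "nat \<Rightarrow> complex"
  assumes "\<And>i. i < N \<Longrightarrow> cmod (l i) \<le> 1 / 2"
  obtains w where "(\<Prod>i<N. 1 + l i) = exp ((\<Sum>i<N. l i) - (\<Sum>i<N. (l i)\<^sup>2) / 2 + w)"
    "cmod w \<le> 2 * (\<Sum>i<N. cmod (l i) ^ 3)"
proof
  define w where "w = (\<Sum>i<N. Ln (1 + l i) - l i + (l i)\<^sup>2 / 2)"
  have "1 + l i \<noteq> 0" if "i < N" for i
  proof
    assume "1 + l i = 0"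
    then have "l i = - 1" by (simp add: add_eq_0_iff)
    then show False using assms[OF that] by simp
  qed
  then have "(\<Prod>i<N. 1 + l i) = exp (\<Sum>i<N. Ln (1 + l i))"
    by (simp add: exp_sum)
  also have "(\<Sum>i<N. Ln (1 + l i)) = (\<Sum>i<N. l i) - (\<Sum>i<N. (l i)\<^sup>2) / 2 + w"
    by (simp add: w_def sum.distrib sum_subtractf sum_divide_distrib)
  finally show "(\<Prod>i<N. 1 + l i) = exp ((\<Sum>i<N. l i) - (\<Sum>i<N. (l i)\<^sup>2) / 2 + w)" .
  have "cmod w \<le> (\<Sum>i<N. 2 * cmod (l i) ^ 3)"
    unfolding w_def by (intro sum_norm_le Ln_approx_quadratic assms) simp
  then show "cmod w \<le> 2 * (\<Sum>i<N. cmod (l i) ^ 3)" by (simp add: sum_distrib_left)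
qed

text \<open>Heine's identity for the symbol \<open>1 + (cis h - 1)\<close>, whose Toeplitz matrix is
  the identity plus that of \<open>cis h - 1\<close>. The trace of the latter is N times the mean of
  its symbol, and its eigenvalues inherit both inequalities valid for averages of the
  symbol.\<close>

lemma law_cis_eigenvalues:
  assumes h: "bdd_meas h" and bd: "\<And>x. \<bar>h x\<bar> \<le> \<epsilon>"
  obtains l where
    "(\<integral>x. cis (\<Sum>j\<in>{1..N}. h (x j)) \<partial>law b N) = (\<Prod>i<N. 1 + l i)"
    "(\<Sum>i<N. l i) = of_nat N * (\<integral>x. cis (h x) - 1 \<partial>circ)"
    "(\<Sum>i<N. (l i)\<^sup>2) = (\<Sum>i<N. \<Sum>j<N. toep b (\<lambda>x. cis (h x) - 1) i j * toep b (\<lambda>x. cis (h x) - 1) j i)"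
    "\<And>i. i < N \<Longrightarrow> cmod (l i) \<le> \<epsilon>" "\<And>i. i < N \<Longrightarrow> (cmod (l i))\<^sup>2 \<le> - 2 * Re (l i)"
proof -
  define A where "A = toep b (\<lambda>x. cis (h x) - 1)"
  define g where "g = (\<lambda>x. cis (h x) - 1)"
  have bg: "bdd_meas g"
    unfolding g_def using bdd_meas_add[OF bdd_meas_cis_comp[OF h] bdd_meas_const[of "- 1"]] by simp
  obtain l where l:
    "perm_det N (\<lambda>i j. (if i = j then 1 else 0) + A i j) = (\<Prod>i<N. 1 + l i)"
    "(\<Sum>i<N. A i i) = (\<Sum>i<N. l i)"
    "(\<Sum>i<N. \<Sum>j<N. A i j * A j i) = (\<Sum>i<N. (l i)\<^sup>2)"
    "\<And>i. i < N \<Longrightarrow> \<exists>v. (\<exists>j<N. v j \<noteq> 0) \<and> (\<forall>r<N. (\<Sum>j<N. A r j * v j) = l i * v r)"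
    using perm_det_eigenvalues[of N A] by blast
  have ev: "cmod (l i) \<le> \<epsilon> \<and> (cmod (l i))\<^sup>2 \<le> - 2 * Re (l i)" if i: "i < N" for i
  proof -
    from l(4)[OF i] obtain v where v: "\<exists>j<N. v j \<noteq> 0" "\<And>r. r < N \<Longrightarrow> (\<Sum>j<N. A r j * v j) = l i * v r"
      by blast
    show ?thesis
      by (rule toep_eigen_weight[OF v(1) v(2)[unfolded A_def g_def[symmetric]] bg])
         (use eigen_bounds[OF _ _ _ h bd] in \<open>auto simp: g_def\<close>)
  qed
  show ?thesis
  proof (rule that[of l])
    have "(\<integral>x. cis (\<Sum>j\<in>{1..N}. h (x j)) \<partial>law b N) = (\<integral>x. (\<Prod>j\<in>{1..N}. cis (h (x j))) \<partial>law b N)"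
      by (simp add: cis_conv_exp exp_sum sum_distrib_left)
    also have "\<dots> = perm_det N (toep b (\<lambda>x. cis (h x)))"
      by (rule law_prod[OF bdd_meas_cis_comp[OF h]])
    also have "toep b (\<lambda>x. cis (h x)) = (\<lambda>i j. (if i = j then 1 else 0) + A i j)"
    proof (intro ext)
      fix i j
      have "toep b (\<lambda>x. 1 + g x) i j = toep b (\<lambda>_. 1) i j + toep b g i j"
        by (rule toep_add) (auto intro: bg)
      then show "toep b (\<lambda>x. cis (h x)) i j = (if i = j then 1 else 0) + A i j"
        by (simp add: g_def A_def toep_def fcoef_const)
    qed
    also note l(1)
    finally show "(\<integral>x. cis (\<Sum>j\<in>{1..N}. h (x j)) \<partial>law b N) = (\<Prod>i<N. 1 + l i)" .
    show "(\<Sum>i<N. l i) = of_nat N * (\<integral>x. cis (h x) - 1 \<partial>circ)"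
      unfolding l(2)[symmetric] by (simp add: A_def toep_def fcoef_def)
  qed (use l(3) ev in \<open>auto simp: A_def\<close>)
qed

lemma law_cis_le_1: "cmod (\<integral>x. cis (F x) \<partial>law b N) \<le> 1"
proof -
  interpret prob_space "law b N" by (rule prob_space_law)
  show ?thesis
    by (rule order.trans[OF integral_norm_bound]) (simp add: prob_space)
qed

text \<open>The weighted arithmetic-geometric mean inequality, and the Frobenius bound for either
  factor. The weight c is free because the factors differ in size: in the main use g is smaller than
  f by a factor of order \<epsilon>, and c = \<epsilon> balances the two terms.\<close>

lemma sum_toep_trace_bound:
  assumes f: "bdd_meas f" and g: "bdd_meas g" and c: "c > 0"
  shows "(\<Sum>i<N. \<Sum>j<N. cmod (toep b f i j) * cmod (toep b g j i))
     \<le> real N * (c * (\<integral>x. (cmod (f x))\<^sup>2 \<partial>circ) + (\<integral>x. (cmod (g x))\<^sup>2 \<partial>circ) / c) / 2"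
proof -
  have "(\<Sum>i<N. \<Sum>j<N. cmod (toep b f i j) * cmod (toep b g j i))
     \<le> (\<Sum>i<N. \<Sum>j<N. (c * (cmod (toep b f i j))\<^sup>2 + (cmod (toep b g j i))\<^sup>2 / c) / 2)"
  proof (intro sum_mono)
    fix i j
    let ?a = "cmod (toep b f i j)" and ?b = "cmod (toep b g j i)"
    have "0 \<le> (c * ?a - ?b)\<^sup>2 / c" using c by simp
    also have "\<dots> = c * ?a\<^sup>2 + ?b\<^sup>2 / c - 2 * (?a * ?b)"
      using c by (simp add: power2_eq_square field_simps)
    finally show "?a * ?b \<le> (c * ?a\<^sup>2 + ?b\<^sup>2 / c) / 2" by simp
  qed
  also have "\<dots> = (c * (\<Sum>i<N. \<Sum>j<N. (cmod (toep b f i j))\<^sup>2) + (\<Sum>i<N. \<Sum>j<N. (cmod (toep b g j i))\<^sup>2) / c) / 2"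
    by (simp add: sum.distrib sum_divide_distrib sum_distrib_left add_divide_distrib)
  also have "(\<Sum>i<N. \<Sum>j<N. (cmod (toep b g j i))\<^sup>2) = (\<Sum>i<N. \<Sum>j<N. (cmod (toep b g i j))\<^sup>2)"
    by (rule sum.swap)
  also have "(c * (\<Sum>i<N. \<Sum>j<N. (cmod (toep b f i j))\<^sup>2) + (\<Sum>i<N. \<Sum>j<N. (cmod (toep b g i j))\<^sup>2) / c) / 2
     \<le> (c * (real N * (\<integral>x. (cmod (f x))\<^sup>2 \<partial>circ)) + (real N * (\<integral>x. (cmod (g x))\<^sup>2 \<partial>circ)) / c) / 2"
    using c by (intro divide_right_mono add_mono mult_left_mono toep_frobenius f g) auto
  finally show ?thesis by (simp add: algebra_simps)
qed

lemma toep_real_herm: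
  "toep b (\<lambda>x. complex_of_real (h x)) j i = cnj (toep b (\<lambda>x. complex_of_real (h x)) i j)"
  using fcoef_real_uminus[of h "int i - int j"] by (auto simp: toep_def)

text \<open>The exponent of the product of the \<open>1 + l\<close> is compared with
  \<open>-Q/2\<close> in three pieces: the trace, half the trace of the square, and the cubic
  remainder. With E = N times the integral of \<open>h^2\<close> the total is at most 3 \<epsilon>
  E, and passing to exponentials costs another factor 3.\<close>

lemma law_gaussian_approx:
  assumes h: "bdd_meas h" and bd: "\<And>x. \<bar>h x\<bar> \<le> \<epsilon>" and e: "0 < \<epsilon>" "\<epsilon> \<le> 1 / 2"
    and mean: "(\<integral>x. h x \<partial>circ) = 0"
  shows "cmod ((\<integral>x. cis (\<Sum>j\<in>{1..N}. h (x j)) \<partial>law b N) - of_real (exp (- qform b N h / 2)))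
     \<le> 9 * \<epsilon> * real N * (\<integral>x. (h x)\<^sup>2 \<partial>circ)"
proof -
  define V where "V = (\<integral>x. (h x)\<^sup>2 \<partial>circ)"
  define T where "T = toep b (\<lambda>x. complex_of_real (h x))"
  \<comment> \<open>The Taylor remainder of second order. It splits A into \<open>i T + R\<close>
    with T Hermitian, so that the trace of \<open>A^2\<close> is minus the squared Frobenius norm of
    T up to terms containing R.\<close>
  define r where "r = (\<lambda>x. cis (h x) - 1 - \<i> * of_real (h x))"
  define R where "R = toep b r"
  define A where "A = toep b (\<lambda>x. cis (h x) - 1)"
  define E where "E = real N * V"
  have V0: "0 \<le> V" unfolding V_def by simp
  have E0: "0 \<le> E" unfolding E_def using V0 by simp
  note ih = bdd_meas_integrable[OF h]
  have bh: "bdd_meas (\<lambda>x. complex_of_real (h x))" using h by simp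
  have ih2: "integrable circ (\<lambda>x. (h x)\<^sup>2)" by (intro bdd_meas_integrable bdd_meas_power h)
  have ih2c: "integrable circ (\<lambda>x. complex_of_real ((h x)\<^sup>2 / 2))"
    by (intro integrable_of_real integrable_divide ih2)
  have bc: "bdd_meas (\<lambda>x. cis (h x) - 1)"
    using bdd_meas_add[OF bdd_meas_cis_comp[OF h] bdd_meas_const[of "- 1"]] by simp
  have br: "bdd_meas r"
    unfolding r_def using bdd_meas_add[OF bc bdd_meas_cmult[OF bh, of "- \<i>"]] by simp
  have nr: "cmod (r x) \<le> (h x)\<^sup>2 / 2" for x
    using iexp_approx1[of "h x" 1] by (simp add: r_def cis_conv_exp algebra_simps numeral_2_eq_2 One_nat_def)
  have nr2: "(cmod (r x))\<^sup>2 \<le> \<epsilon>\<^sup>2 / 4 * (h x)\<^sup>2" for x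
  proof -
    have "cmod (r x) \<le> \<bar>h x\<bar> * \<epsilon> / 2"
    proof -
      have "(h x)\<^sup>2 = \<bar>h x\<bar> * \<bar>h x\<bar>" by (simp add: power2_eq_square)
      also have "\<dots> \<le> \<bar>h x\<bar> * \<epsilon>" by (intro mult_left_mono bd) simp
      finally show ?thesis using nr[of x] by simp
    qed
    then have "(cmod (r x))\<^sup>2 \<le> (\<bar>h x\<bar> * \<epsilon> / 2)\<^sup>2" by (intro power_mono) auto
    then show ?thesis by (simp add: power_mult_distrib power_divide mult_ac)
  qed
  have Ir2: "(\<integral>x. (cmod (r x))\<^sup>2 \<partial>circ) \<le> \<epsilon>\<^sup>2 / 4 * V"
  proof -
    have "(\<integral>x. (cmod (r x))\<^sup>2 \<partial>circ) \<le> (\<integral>x. \<epsilon>\<^sup>2 / 4 * (h x)\<^sup>2 \<partial>circ)"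
      by (intro integral_mono bdd_meas_integrable bdd_meas_power bdd_meas_cmod br bdd_meas_cmult h nr2)
    then show ?thesis by (simp add: V_def)
  qed
  obtain l where l:
    "(\<integral>x. cis (\<Sum>j\<in>{1..N}. h (x j)) \<partial>law b N) = (\<Prod>i<N. 1 + l i)"
    "(\<Sum>i<N. l i) = of_nat N * (\<integral>x. cis (h x) - 1 \<partial>circ)"
    "(\<Sum>i<N. (l i)\<^sup>2) = (\<Sum>i<N. \<Sum>j<N. A i j * A j i)"
    "\<And>i. i < N \<Longrightarrow> cmod (l i) \<le> \<epsilon>" "\<And>i. i < N \<Longrightarrow> (cmod (l i))\<^sup>2 \<le> - 2 * Re (l i)"
    unfolding A_def by (rule law_cis_eigenvalues[OF h bd]) blast
  obtain w where w: "(\<Prod>i<N. 1 + l i) = exp ((\<Sum>i<N. l i) - (\<Sum>i<N. (l i)\<^sup>2) / 2 + w)"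
    "cmod w \<le> 2 * (\<Sum>i<N. cmod (l i) ^ 3)"
    by (rule prod_exp_log[of N l, OF order.trans[OF l(4) e(2)]])
  have ci: "(\<integral>x. cis (h x) - 1 \<partial>circ) = (\<integral>x. r x \<partial>circ)"
  proof -
    have "(\<integral>x. cis (h x) - 1 \<partial>circ) = (\<integral>x. r x + \<i> * of_real (h x) \<partial>circ)"
      by (simp add: r_def)
    also have "\<dots> = (\<integral>x. r x \<partial>circ) + \<i> * of_real (\<integral>x. h x \<partial>circ)"
      using bdd_meas_integrable[OF br] bdd_meas_integrable[OF bh] by simp
    finally show ?thesis using mean by simp
  qed
  \<comment> \<open>The linear term of the symbol integrates to 0, the quadratic one gives -E/2, and
    what remains is cubic in h.\<close>
  have tr: "cmod ((\<Sum>i<N. l i) + of_real (E / 2)) \<le> \<epsilon> * E / 6"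
  proof -
    have n3: "cmod (r x + of_real ((h x)\<^sup>2 / 2)) \<le> \<epsilon> / 6 * (h x)\<^sup>2" for x
    proof -
      have "cmod (r x + of_real ((h x)\<^sup>2 / 2)) \<le> \<bar>h x\<bar> ^ 3 / 6"
        using iexp_approx1[of "h x" 2]
        by (simp add: r_def cis_conv_exp algebra_simps numeral_2_eq_2 numeral_3_eq_3 One_nat_def power2_eq_square fact_numeral)
      also have "\<bar>h x\<bar> ^ 3 = \<bar>h x\<bar> * (h x)\<^sup>2" by (simp add: power3_eq_cube power2_eq_square)
      also have "\<dots> \<le> \<epsilon> * (h x)\<^sup>2" by (intro mult_right_mono bd) simp
      finally show ?thesis by simp
    qed
    have "cmod (\<integral>x. r x + of_real ((h x)\<^sup>2 / 2) \<partial>circ) \<le> (\<integral>x. cmod (r x + of_real ((h x)\<^sup>2 / 2)) \<partial>circ)"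
      by (rule integral_norm_bound)
    also have "\<dots> \<le> (\<integral>x. \<epsilon> / 6 * (h x)\<^sup>2 \<partial>circ)"
      by (intro integral_mono n3 integrable_norm Bochner_Integration.integrable_add bdd_meas_integrable[OF br] ih2c)
         (use ih2 in auto)
    also have "(\<integral>x. r x + of_real ((h x)\<^sup>2 / 2) \<partial>circ) = (\<integral>x. r x \<partial>circ) + of_real (V / 2)"
    proof -
      have "(\<integral>x. complex_of_real ((h x)\<^sup>2 / 2) \<partial>circ) = of_real (V / 2)"
        unfolding integral_complex_of_real V_def by simp
      then show ?thesis
        using Bochner_Integration.integral_add[OF bdd_meas_integrable[OF br] ih2c] by simp
    qed
    finally have "real N * cmod ((\<integral>x. r x \<partial>circ) + of_real (V / 2)) \<le> real N * (\<epsilon> / 6 * V)"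
      by (intro mult_left_mono) (auto simp: V_def)
    moreover have "(\<Sum>i<N. l i) + of_real (E / 2) = of_nat N * ((\<integral>x. r x \<partial>circ) + of_real (V / 2))"
      unfolding l(2) ci by (simp add: E_def algebra_simps)
    ultimately have "cmod ((\<Sum>i<N. l i) + of_real (E / 2)) \<le> real N * (\<epsilon> / 6 * V)"
      by (simp only: norm_mult norm_of_nat)
    then show ?thesis by (simp add: E_def mult_ac)
  qed
  have cosV: "(\<integral>x. 2 * (1 - cos (h x)) \<partial>circ) \<le> V"
      unfolding V_def
    proof (rule integral_mono[OF _ ih2])
      have [measurable]: "h \<in> borel_measurable borel" by (rule bdd_meas_measurable[OF h])
      have "bdd_meas (\<lambda>x. cos (h x))"
        unfolding bdd_meas_def by (intro conjI exI[of _ 1]) simp_all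
      then show "integrable circ (\<lambda>x. 2 * (1 - cos (h x)))"
        by (intro integrable_mult_right Bochner_Integration.integrable_diff bdd_meas_integrable) simp_all
      show "2 * (1 - cos (h x)) \<le> (h x)\<^sup>2" for x
      proof -
        have "1 - cos (h x) = 2 * (sin (h x / 2))\<^sup>2"
          using cos_double_sin[of "h x / 2"] by simp
        also have "\<dots> \<le> 2 * \<bar>h x / 2\<bar>\<^sup>2"
          using abs_sin_x_le_abs_x[of "h x / 2"] by (metis abs_ge_zero mult_left_mono power2_abs power_mono zero_le_numeral)
        finally show ?thesis by (simp add: power_divide)
      qed
    qed
  \<comment> \<open>Here \<open>|l|^2 \<le> -2 Re l\<close> enters: it reduces the sum of the
    \<open>|l|^2\<close> to the trace, which is a plain integral. The trace of the square alone
    would not control the moduli.\<close>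
  have cube: "(\<Sum>i<N. cmod (l i) ^ 3) \<le> \<epsilon> * E"
  proof -
    have "(\<Sum>i<N. cmod (l i) ^ 3) \<le> (\<Sum>i<N. \<epsilon> * (- 2 * Re (l i)))"
    proof (intro sum_mono)
      fix i assume "i \<in> {..<N}"
      then have "cmod (l i) ^ 3 \<le> \<epsilon> * (cmod (l i))\<^sup>2" "(cmod (l i))\<^sup>2 \<le> - 2 * Re (l i)"
        using l(4,5)[of i] by (auto simp: power3_eq_cube power2_eq_square mult.assoc intro!: mult_right_mono)
      then show "cmod (l i) ^ 3 \<le> \<epsilon> * (- 2 * Re (l i))"
        using e(1) by (meson mult_left_mono less_imp_le order.trans)
    qed
    also have "\<dots> = \<epsilon> * (- 2 * Re (\<Sum>i<N. l i))" by (simp add: sum_distrib_left sum_negf)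
    also have "- 2 * Re (\<Sum>i<N. l i) = real N * (\<integral>x. 2 * (1 - cos (h x)) \<partial>circ)"
    proof -
      have "Re (\<integral>x. cis (h x) - 1 \<partial>circ) = (\<integral>x. Re (cis (h x) - 1) \<partial>circ)"
        by (rule Bochner_Integration.integral_Re[OF bdd_meas_integrable[OF bc], symmetric])
      also have "\<dots> = (\<integral>x. (- 1 / 2) * (2 * (1 - cos (h x))) \<partial>circ)"
        by (intro Bochner_Integration.integral_cong) (auto simp: algebra_simps)
      also have "\<dots> = (- 1 / 2) * (\<integral>x. 2 * (1 - cos (h x)) \<partial>circ)"
        by (rule integral_mult_right_zero)
      finally show ?thesis unfolding l(2) by simp
    qed
    also have "\<epsilon> * (real N * (\<integral>x. 2 * (1 - cos (h x)) \<partial>circ)) \<le> \<epsilon> * (real N * V)"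
      using cosV e(1) by (intro mult_left_mono) auto
    finally show ?thesis by (simp add: E_def)
  qed
  have TT: "(\<Sum>i<N. \<Sum>j<N. T i j * T j i) = of_real (\<Sum>i<N. \<Sum>j<N. (cmod (T i j))\<^sup>2)"
    unfolding of_real_sum complex_norm_square T_def toep_real_herm[of b h _ _, symmetric] ..
  have AR: "A i j = \<i> * T i j + R i j" for i j
  proof -
    have "A i j = toep b (\<lambda>x. \<i> * of_real (h x) + r x) i j" by (simp add: A_def r_def)
    also have "\<dots> = \<i> * T i j + R i j"
      unfolding T_def R_def by (subst toep_add) (auto simp: toep_cmult intro: bdd_meas_cmult bh br)
    finally show ?thesis .
  qed
  have sq: "cmod ((\<Sum>i<N. (l i)\<^sup>2) + of_real (\<Sum>i<N. \<Sum>j<N. (cmod (T i j))\<^sup>2)) \<le> 11 / 8 * \<epsilon> * E"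
  proof -
    have eq: "(\<Sum>i<N. (l i)\<^sup>2) + of_real (\<Sum>i<N. \<Sum>j<N. (cmod (T i j))\<^sup>2)
       = (\<Sum>i<N. \<Sum>j<N. \<i> * (T i j * R j i) + \<i> * (R i j * T j i) + R i j * R j i)"
      unfolding l(3) TT[symmetric] AR sum.distrib[symmetric]
      by (intro sum.cong refl) (simp add: algebra_simps)
    have "cmod ((\<Sum>i<N. (l i)\<^sup>2) + of_real (\<Sum>i<N. \<Sum>j<N. (cmod (T i j))\<^sup>2))
       \<le> (\<Sum>i<N. \<Sum>j<N. cmod (T i j) * cmod (R j i) + cmod (R i j) * cmod (T j i) + cmod (R i j) * cmod (R j i))"
      unfolding eq
    proof (intro sum_norm_le)
      fix i j
      show "cmod (\<i> * (T i j * R j i) + \<i> * (R i j * T j i) + R i j * R j i)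
        \<le> cmod (T i j) * cmod (R j i) + cmod (R i j) * cmod (T j i) + cmod (R i j) * cmod (R j i)"
        by (intro order.trans[OF norm_triangle_ineq] add_mono) (auto simp: norm_mult)
    qed
    also have "\<dots> = (\<Sum>i<N. \<Sum>j<N. cmod (T i j) * cmod (R j i)) + (\<Sum>i<N. \<Sum>j<N. cmod (R i j) * cmod (T j i))
        + (\<Sum>i<N. \<Sum>j<N. cmod (R i j) * cmod (R j i))" by (simp add: sum.distrib)
    also have "\<dots> \<le> 5 / 8 * \<epsilon> * E + 5 / 8 * \<epsilon> * E + 1 / 8 * \<epsilon> * E"
    proof (intro add_mono)
      have VV: "(\<integral>x. (cmod (complex_of_real (h x)))\<^sup>2 \<partial>circ) = V" by (simp add: V_def)
      have r2e: "(\<integral>x. (cmod (r x))\<^sup>2 \<partial>circ) / \<epsilon> \<le> \<epsilon> / 4 * V"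
      proof -
        have "(\<integral>x. (cmod (r x))\<^sup>2 \<partial>circ) / \<epsilon> \<le> \<epsilon>\<^sup>2 / 4 * V / \<epsilon>"
          using e(1) by (intro divide_right_mono Ir2) simp
        also have "\<dots> = \<epsilon> / 4 * V" using e(1) by (simp add: power2_eq_square)
        finally show ?thesis .
      qed
      \<comment> \<open>With weight \<epsilon>, half of
        \<open>\<epsilon> V + (\<epsilon> / 4) V\<close> is 5/8 \<epsilon> V.\<close>
      have 1: "(\<Sum>i<N. \<Sum>j<N. cmod (T i j) * cmod (R j i)) \<le> 5 / 8 * \<epsilon> * E"
      proof -
        have "(\<Sum>i<N. \<Sum>j<N. cmod (T i j) * cmod (R j i)) \<le> real N * (\<epsilon> * V + (\<integral>x. (cmod (r x))\<^sup>2 \<partial>circ) / \<epsilon>) / 2"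
          unfolding T_def R_def using sum_toep_trace_bound[OF bh br e(1), where N = N and b = b] VV by simp
        also have "\<dots> \<le> real N * (\<epsilon> * V + \<epsilon> / 4 * V) / 2"
          by (intro divide_right_mono mult_left_mono add_left_mono r2e) simp_all
        finally show ?thesis by (simp add: E_def algebra_simps)
      qed
      then show "(\<Sum>i<N. \<Sum>j<N. cmod (T i j) * cmod (R j i)) \<le> 5 / 8 * \<epsilon> * E" .
      have "(\<Sum>i<N. \<Sum>j<N. cmod (R i j) * cmod (T j i)) = (\<Sum>i<N. \<Sum>j<N. cmod (T i j) * cmod (R j i))"
        by (subst sum.swap) (simp add: mult.commute)
      with 1 show "(\<Sum>i<N. \<Sum>j<N. cmod (R i j) * cmod (T j i)) \<le> 5 / 8 * \<epsilon> * E" by simp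
      have "(\<Sum>i<N. \<Sum>j<N. cmod (R i j) * cmod (R j i)) \<le> real N * (\<integral>x. (cmod (r x))\<^sup>2 \<partial>circ)"
        unfolding R_def using sum_toep_trace_bound[OF br br, where c = 1 and N = N and b = b] by simp
      also have "\<dots> \<le> real N * (\<epsilon>\<^sup>2 / 4 * V)" by (intro mult_left_mono Ir2) simp
      also have "\<dots> = \<epsilon> * (\<epsilon> / 4 * E)" by (simp add: E_def power2_eq_square)
      also have "\<dots> \<le> \<epsilon> * (1 / 8 * E)"
        using e E0 by (intro mult_left_mono mult_right_mono) auto
      finally show "(\<Sum>i<N. \<Sum>j<N. cmod (R i j) * cmod (R j i)) \<le> 1 / 8 * \<epsilon> * E" by simp
    qed
    also have "5 / 8 * \<epsilon> * E + 5 / 8 * \<epsilon> * E + 1 / 8 * \<epsilon> * E = 11 / 8 * \<epsilon> * E"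
      by (simp add: algebra_simps)
    finally show ?thesis .
  qed
  define q where "q = qform b N h"
  have q: "q = E - (\<Sum>i<N. \<Sum>j<N. (cmod (T i j))\<^sup>2)"
    by (simp add: q_def qform_def E_def V_def T_def)
  have q0: "0 \<le> q" unfolding q_def by (rule qform_nonneg[OF h])
  define u where "u = (\<Sum>i<N. l i) - (\<Sum>i<N. (l i)\<^sup>2) / 2 + w + of_real (q / 2)"
  have ueq: "u = ((\<Sum>i<N. l i) + of_real (E / 2)) - ((\<Sum>i<N. (l i)\<^sup>2) + of_real (\<Sum>i<N. \<Sum>j<N. (cmod (T i j))\<^sup>2)) / 2 + w"
    unfolding u_def q by (simp add: field_simps)
  have "cmod u \<le> cmod ((\<Sum>i<N. l i) + of_real (E / 2))
     + cmod (((\<Sum>i<N. (l i)\<^sup>2) + of_real (\<Sum>i<N. \<Sum>j<N. (cmod (T i j))\<^sup>2)) / 2) + cmod w"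
    unfolding ueq by (intro order.trans[OF norm_triangle_ineq] add_right_mono norm_triangle_ineq4)
  also have "\<dots> \<le> \<epsilon> * E / 6 + 11 / 16 * \<epsilon> * E + 2 * (\<epsilon> * E)"
    using tr sq w(2) cube by (intro add_mono) (auto simp: norm_divide)
  \<comment> \<open>1/6 + 11/16 + 2 is just below 3.\<close>
  also have "\<dots> \<le> 3 * \<epsilon> * E"
    using e(1) E0 by (simp add: field_simps)
  finally have u: "cmod u \<le> 3 * \<epsilon> * E" .
  define Z where "Z = (\<integral>x. cis (\<Sum>j\<in>{1..N}. h (x j)) \<partial>law b N)"
  have Z: "Z = exp (of_real (- q / 2)) * exp u"
    unfolding Z_def l(1) w(1) exp_add[symmetric] u_def by simp
  have ex1: "exp (- q / 2) \<le> 1" using q0 by simp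
  have "cmod (Z - of_real (exp (- q / 2))) \<le> 9 * \<epsilon> * E"
  \<comment> \<open>For |u| > 1 the claim is trivial: both terms have modulus at most 1, and 2 \<le>
    3 |u|.\<close>
  proof (cases "cmod u \<le> 1")
    case True
    have "Z - of_real (exp (- q / 2)) = of_real (exp (- q / 2)) * (exp u - 1)"
      unfolding Z exp_of_real by (simp add: algebra_simps)
    then have "cmod (Z - of_real (exp (- q / 2))) = exp (- q / 2) * cmod (exp u - 1)"
      by (simp add: norm_mult)
    also have "\<dots> \<le> 1 * (3 * cmod u)"
      using ex1 norm_exp_diff_one[OF True] by (intro mult_mono) auto
    finally show ?thesis using u by simp
  next
    case False
    have "cmod (Z - of_real (exp (- q / 2))) \<le> cmod Z + exp (- q / 2)"
      using norm_triangle_ineq4[of Z "of_real (exp (- q / 2))"] by simp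
    also have "\<dots> \<le> 1 + 1" unfolding Z_def by (intro add_mono law_cis_le_1 ex1)
    also have "\<dots> \<le> 3 * cmod u" using False by simp
    finally show ?thesis using u by simp
  qed
  then show ?thesis by (simp add: Z_def q_def E_def V_def mult.assoc)
qed

section \<open>Exponential moments of point counts\<close>

lemma bdd_meas_indicator: "A \<in> sets borel \<Longrightarrow> bdd_meas (indicator A :: real \<Rightarrow> real)"
  unfolding bdd_meas_def by (auto intro!: exI[of _ 1] simp: indicator_def)

definition num_in :: "nat \<Rightarrow> real set \<Rightarrow> (nat \<Rightarrow> real) \<Rightarrow> real" where
  "num_in N A x = (\<Sum>j\<in>{1..N}. indicator A (x j))"

lemma measurable_num_in [measurable]:
  "A \<in> sets borel \<Longrightarrow> num_in N A \<in> borel_measurable (PiM {1..N} (\<lambda>_. borel))"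
  unfolding num_in_def
  by (intro borel_measurable_sum measurable_compose[OF measurable_component_singleton borel_measurable_indicator])

lemma num_in_nonneg: "0 \<le> num_in N A x"
  unfolding num_in_def by (simp add: sum_nonneg)

lemma num_in_le: "num_in N A x \<le> real N"
  unfolding num_in_def using sum_mono[of "{1..N}" "\<lambda>j. indicator A (x j)" "\<lambda>_. 1::real"] by simp

lemma num_in_mono: "A \<subseteq> B \<Longrightarrow> num_in N A x \<le> num_in N B x"
  unfolding num_in_def by (intro sum_mono) (auto simp: indicator_def)

lemma law_integrable:
  fixes F :: "(nat \<Rightarrow> real) \<Rightarrow> 'a::{second_countable_topology, banach}"
  assumes "F \<in> borel_measurable (PiM {1..N} (\<lambda>_. borel))" "\<And>x. norm (F x) \<le> C"
  shows "integrable (law b N) F"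
proof -
  interpret prob_space "law b N" by (rule prob_space_law)
  have "F \<in> borel_measurable (law b N)" using assms(1) by simp
  then show ?thesis using assms(2) by (intro integrable_const_bound[of _ C]) auto
qed

text \<open>2 to the power of the count is the product of the \<open>1 + indicator A\<close>, so
  Heine's identity gives a product of \<open>1 + l\<close> over eigenvalues that are averages of an
  indicator, hence real and nonnegative. Each factor is at most \<open>exp l\<close>, and the trace
  is N times the measure of A. The bound is the corresponding moment of a Poisson variable with the
  same mean.\<close>

lemma law_num_in_exp:
  assumes A [measurable]: "A \<in> sets borel"
  shows "(\<integral>x. 2 powr num_in N A x \<partial>law b N) \<le> exp (real N * measure circ A)"
proof -
  define g where "g = (\<lambda>x. complex_of_real (indicator A x))"
  have bg: "bdd_meas g" unfolding g_def using bdd_meas_indicator[OF A] by simp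
  have bg1: "bdd_meas (\<lambda>x. 1 + g x)" by (intro bdd_meas_add bg) simp
  obtain l where l:
    "perm_det N (\<lambda>i j. (if i = j then 1 else 0) + toep b g i j) = (\<Prod>i<N. 1 + l i)"
    "(\<Sum>i<N. toep b g i i) = (\<Sum>i<N. l i)"
    "(\<Sum>i<N. \<Sum>j<N. toep b g i j * toep b g j i) = (\<Sum>i<N. (l i)\<^sup>2)"
    "\<And>i. i < N \<Longrightarrow> \<exists>v. (\<exists>j<N. v j \<noteq> 0) \<and> (\<forall>r<N. (\<Sum>j<N. toep b g r j * v j) = l i * v r)"
    using perm_det_eigenvalues[of N "toep b g"] by blast
  have ev: "cmod (l i) = Re (l i)" if i: "i < N" for i
  proof -
    from l(4)[OF i] obtain v where v: "\<exists>j<N. v j \<noteq> 0" "\<And>r. r < N \<Longrightarrow> (\<Sum>j<N. toep b g r j * v j) = l i * v r"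
      by blast
    obtain w :: "real \<Rightarrow> real" where w: "bdd_meas w" "\<And>x. 0 \<le> w x" "(\<integral>x. w x \<partial>circ) = 1"
      "l i = (\<integral>x. g x * of_real (w x) \<partial>circ)"
      using toep_eigen_weight[OF v bg] by blast
    have "l i = (\<integral>x. of_real (indicator A x * w x) \<partial>circ)"
      unfolding w(4) g_def by simp
    also have "\<dots> = of_real (\<integral>x. indicator A x * w x \<partial>circ)"
      by (rule integral_complex_of_real)
    finally have li: "l i = of_real (\<integral>x. indicator A x * w x \<partial>circ)" .
    have "0 \<le> (\<integral>x. indicator A x * w x \<partial>circ)"
      by (intro Bochner_Integration.integral_nonneg) (simp add: w(2))
    then show ?thesis unfolding li by simp
  qed
  have fg: "fcoef g 0 = of_real (measure circ A)"
    unfolding fcoef_def g_def by simp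
  have "complex_of_real (\<integral>x. 2 powr num_in N A x \<partial>law b N) = (\<integral>x. complex_of_real (2 powr num_in N A x) \<partial>law b N)"
    by (rule integral_complex_of_real[symmetric])
  also have "\<dots> = (\<integral>x. (\<Prod>j\<in>{1..N}. 1 + g (x j)) \<partial>law b N)"
  proof (intro Bochner_Integration.integral_cong refl)
    fix x
    have "2 powr num_in N A x = (\<Prod>j\<in>{1..N}. 2 powr indicator A (x j))"
      unfolding num_in_def by (simp add: powr_sum)
    also have "\<dots> = (\<Prod>j\<in>{1..N}. 1 + indicator A (x j))"
      by (intro prod.cong) (auto simp: indicator_def)
    finally show "complex_of_real (2 powr num_in N A x) = (\<Prod>j\<in>{1..N}. 1 + g (x j))"
      by (simp add: g_def)
  qed
  also have "\<dots> = perm_det N (toep b (\<lambda>x. 1 + g x))" by (rule law_prod[OF bg1])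
  also have "toep b (\<lambda>x. 1 + g x) = (\<lambda>i j. (if i = j then 1 else 0) + toep b g i j)"
    using bg by (intro ext) (simp add: toep_add toep_def fcoef_const fcoef_add)
  also note l(1)
  finally have eq: "complex_of_real (\<integral>x. 2 powr num_in N A x \<partial>law b N) = (\<Prod>i<N. 1 + l i)" .
  have "(\<integral>x. 2 powr num_in N A x \<partial>law b N) \<le> cmod (\<Prod>i<N. 1 + l i)"
    unfolding eq[symmetric] by simp
  also have "\<dots> = (\<Prod>i<N. cmod (1 + l i))" by (simp add: prod_norm)
  also have "\<dots> \<le> (\<Prod>i<N. exp (Re (l i)))"
  proof (intro prod_mono conjI)
    fix i assume "i \<in> {..<N}"
    then have "cmod (1 + l i) \<le> 1 + Re (l i)"
      using norm_triangle_ineq[of 1 "l i"] ev[of i] by simp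
    also have "\<dots> \<le> exp (Re (l i))" by (rule exp_ge_add_one_self)
    finally show "cmod (1 + l i) \<le> exp (Re (l i))" .
  qed simp
  also have "\<dots> = exp (Re (\<Sum>i<N. l i))" by (simp add: exp_sum)
  also have "(\<Sum>i<N. l i) = of_nat N * of_real (measure circ A)"
    unfolding l(2)[symmetric] by (simp add: toep_def fg)
  finally show ?thesis by simp
qed

section \<open>First and second moments of linear statistics\<close>

lemma le_zero_of_small:
  fixes a K s0 :: real
  assumes "0 < s0" "\<And>s. 0 < s \<Longrightarrow> s \<le> s0 \<Longrightarrow> a \<le> K * s"
  shows "a \<le> 0"
proof (rule tendsto_lowerbound[where F = "at_right (0::real)" and f = "\<lambda>s. K * s"])
  show "((\<lambda>s. K * s) \<longlongrightarrow> 0) (at_right 0)" by (auto intro!: tendsto_eq_intros)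
  show "\<forall>\<^sub>F s in at_right (0::real). a \<le> K * s"
    unfolding eventually_at_right_field using assms by (intro exI[of _ s0]) auto
qed simp

text \<open>Both moments are read off from \<open>law_gaussian_approx\<close> for \<open>s h\<close> as \<open>s\<close> tends to 0.\<close>

lemma law_moments:
  assumes h: "bdd_meas h" and mean: "(\<integral>x. h x \<partial>circ) = 0"
  shows "(\<integral>x. (\<Sum>j\<in>{1..N}. h (x j)) \<partial>law b N) = 0"
    and "(\<integral>x. (\<Sum>j\<in>{1..N}. h (x j))\<^sup>2 \<partial>law b N) = qform b N h"
proof -
  interpret L: prob_space "law b N" by (rule prob_space_law)
  obtain C' where C': "\<And>x. \<bar>h x\<bar> \<le> C'" using h by (auto simp: bdd_meas_def)
  define C where "C = max C' 1"
  have C: "\<And>x. \<bar>h x\<bar> \<le> C" "C > 0" "C \<ge> 1" using C' by (auto simp: C_def le_max_iff_disj)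
  have [measurable]: "h \<in> borel_measurable borel" by (rule bdd_meas_measurable[OF h])
  define X where "X = (\<lambda>x::nat \<Rightarrow> real. \<Sum>j\<in>{1..N}. h (x j))"
  have Xm [measurable]: "X \<in> borel_measurable (PiM {1..N} (\<lambda>_. borel))" unfolding X_def by measurable
  have XB: "\<bar>X x\<bar> \<le> real N * C" for x
    unfolding X_def using sum_abs[of "\<lambda>j. h (x j)" "{1..N}"] sum_bounded_above[of "{1..N}" "\<lambda>j. \<bar>h (x j)\<bar>" C] C(1)
    by (auto intro: order.trans)
  have iX: "integrable (law b N) X" using XB by (intro law_integrable) auto
  have XB2: "\<bar>(X x)\<^sup>2\<bar> \<le> (real N * C)\<^sup>2" for x
    using power_mono[OF XB[of x], of 2] by simp
  have iX2: "integrable (law b N) (\<lambda>x. (X x)\<^sup>2)"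
    using XB2 by (intro law_integrable[where C = "(real N * C)\<^sup>2"]) auto
  define m1 where "m1 = (\<integral>x. X x \<partial>law b N)"
  define m2 where "m2 = (\<integral>x. (X x)\<^sup>2 \<partial>law b N)"
  define V where "V = (\<integral>x. (h x)\<^sup>2 \<partial>circ)"
  define Q where "Q = qform b N h"
  have Q0: "0 \<le> Q" unfolding Q_def by (rule qform_nonneg[OF h])
  \<comment> \<open>The three cubic errors: Gaussian approximation, Taylor expansion of the
    characteristic function, and Taylor expansion of \<open>exp(-s^2 Q/2)\<close>.\<close>
  define K where "K = 9 * C * real N * V + (real N * C) ^ 3 / 6 + Q\<^sup>2"
  have main: "cmod (\<i> * of_real (s * m1) - of_real (s\<^sup>2 * (m2 - Q) / 2)) \<le> K * s ^ 3"
    if s: "0 < s" "s \<le> 1 / (2 * C)" for s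
  proof -
    have s1: "s \<le> 1" using s(2) C(3) by (smt (verit) divide_le_eq_1_pos)
    have sh: "bdd_meas (\<lambda>x. s * h x)" by (intro bdd_meas_cmult h)
    have qs: "qform b N (\<lambda>x. s * h x) = s\<^sup>2 * Q"
      unfolding qform_def Q_def using toep_cmult[of b "of_real s" "\<lambda>x. of_real (h x)"]
      by (simp add: norm_mult power_mult_distrib sum_distrib_left right_diff_distrib)
    have vs: "(\<integral>x. (s * h x)\<^sup>2 \<partial>circ) = s\<^sup>2 * V"
      by (simp add: power_mult_distrib V_def)
    define Z where "Z = (\<integral>x. cis (s * X x) \<partial>law b N)"
    have a: "cmod (Z - of_real (exp (- (s\<^sup>2 * Q) / 2))) \<le> 9 * (s * C) * real N * (s\<^sup>2 * V)"
    proof -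
      have "cmod ((\<integral>x. cis (\<Sum>j\<in>{1..N}. s * h (x j)) \<partial>law b N) - of_real (exp (- qform b N (\<lambda>x. s * h x) / 2)))
         \<le> 9 * (s * C) * real N * (\<integral>x. (s * h x)\<^sup>2 \<partial>circ)"
      proof (rule law_gaussian_approx[OF sh])
        show "\<bar>s * h x\<bar> \<le> s * C" for x using s(1) C(1) by (simp add: abs_mult)
        show "0 < s * C" "s * C \<le> 1 / 2" using s C by (simp_all add: field_simps)
        show "(\<integral>x. s * h x \<partial>circ) = 0" using mean by simp
      qed
      then show ?thesis unfolding qs vs by (simp add: Z_def X_def sum_distrib_left)
    qed
    define P where "P = (\<lambda>x. 1 + \<i> * of_real (s * X x) - of_real ((s * X x)\<^sup>2 / 2))"
    have iP: "integrable (law b N) P" unfolding P_def power_mult_distrib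
      using iX iX2 by (intro Bochner_Integration.integrable_diff Bochner_Integration.integrable_add
          integrable_mult_right integrable_of_real integrable_divide) auto
    have IP: "integral\<^sup>L (law b N) P = 1 + \<i> * of_real (s * m1) - of_real (s\<^sup>2 * m2 / 2)"
    proof -
      have 1: "integrable (law b N) (\<lambda>x. \<i> * of_real (s * X x))" using iX by simp
      have 2: "integrable (law b N) (\<lambda>x. complex_of_real (s\<^sup>2 / 2 * (X x)\<^sup>2))"
        by (intro integrable_of_real integrable_mult_right iX2)
      have 3: "(\<integral>x. complex_of_real (s\<^sup>2 / 2 * (X x)\<^sup>2) \<partial>law b N) = of_real (s\<^sup>2 / 2 * m2)"
        unfolding integral_complex_of_real m2_def by simp
      have 4: "(\<integral>x. \<i> * of_real (s * X x) \<partial>law b N) = \<i> * of_real (s * m1)"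
        using integral_complex_of_real[of "law b N" "\<lambda>x. s * X x"] by (simp add: m1_def)
      have 5: "(\<integral>x. (1::complex) \<partial>law b N) = 1" by (simp add: L.prob_space)
      have "P = (\<lambda>x. (1 + \<i> * of_real (s * X x)) - of_real (s\<^sup>2 / 2 * (X x)\<^sup>2))"
        unfolding P_def by (simp add: power_mult_distrib)
      then have "integral\<^sup>L (law b N) P = (\<integral>x. 1 + \<i> * of_real (s * X x) \<partial>law b N) - (\<integral>x. complex_of_real (s\<^sup>2 / 2 * (X x)\<^sup>2) \<partial>law b N)"
        using 1 2 by (simp only:) (rule Bochner_Integration.integral_diff, auto)
      also have "(\<integral>x. 1 + \<i> * of_real (s * X x) \<partial>law b N) = 1 + \<i> * of_real (s * m1)"
      proof -
        have "(\<integral>x. 1 + \<i> * of_real (s * X x) \<partial>law b N)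
            = (\<integral>x. 1 \<partial>law b N) + (\<integral>x. \<i> * of_real (s * X x) \<partial>law b N)"
          by (rule Bochner_Integration.integral_add[OF _ 1]) simp
        then show ?thesis by (simp only: 4 5)
      qed
      finally show ?thesis unfolding 3 by simp
    qed
    have iZ: "integrable (law b N) (\<lambda>x. cis (s * X x))"
      by (intro law_integrable[where C = 1]) auto
    have b: "cmod (Z - integral\<^sup>L (law b N) P) \<le> s ^ 3 * (real N * C) ^ 3 / 6"
    proof -
      have pt: "cmod (cis (s * X x) - P x) \<le> s ^ 3 * (real N * C) ^ 3 / 6" for x
      proof -
        have "cmod (cis (s * X x) - P x) \<le> \<bar>s * X x\<bar> ^ 3 / 6"
          using iexp_approx1[of "s * X x" 2]
          by (simp add: P_def cis_conv_exp algebra_simps numeral_2_eq_2 numeral_3_eq_3 One_nat_def power2_eq_square fact_numeral)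
        also have "\<dots> \<le> (s * (real N * C)) ^ 3 / 6"
          using XB[of x] s(1) by (intro divide_right_mono power_mono) (auto simp: abs_mult)
        finally show ?thesis by (simp add: power_mult_distrib)
      qed
      have "Z - integral\<^sup>L (law b N) P = (\<integral>x. cis (s * X x) - P x \<partial>law b N)"
        unfolding Z_def using iZ iP by simp
      also have "cmod \<dots> \<le> (\<integral>x. cmod (cis (s * X x) - P x) \<partial>law b N)" by (rule integral_norm_bound)
      also have "\<dots> \<le> (\<integral>x. s ^ 3 * (real N * C) ^ 3 / 6 \<partial>law b N)"
        by (intro integral_mono integrable_norm Bochner_Integration.integrable_diff iZ iP pt) simp
      finally show ?thesis by (simp add: L.prob_space)
    qed
    have c: "\<bar>exp (- (s\<^sup>2 * Q) / 2) - (1 - s\<^sup>2 * Q / 2)\<bar> \<le> s ^ 3 * Q\<^sup>2"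
    proof -
      define y where "y = s\<^sup>2 * Q / 2"
      have y0: "0 \<le> y" unfolding y_def using Q0 by simp
      have "1 - y \<le> exp (- y)" using exp_ge_add_one_self[of "- y"] by simp
      moreover have "exp (- y) \<le> 1 - y + y\<^sup>2"
      proof -
        have "exp (- y) \<le> inverse (1 + y)"
          unfolding exp_minus using exp_ge_add_one_self[of y] y0 by (intro le_imp_inverse_le) auto
        also have "\<dots> \<le> 1 - y + y\<^sup>2"
        proof -
          have "(1 - y + y\<^sup>2) * (1 + y) = 1 + y ^ 3" by (simp add: algebra_simps power2_eq_square power3_eq_cube)
          also have "\<dots> \<ge> 1" using y0 by simp
          finally show ?thesis using y0 by (simp add: inverse_eq_divide divide_le_eq)
        qed
        finally show ?thesis .
      qed
      ultimately have "\<bar>exp (- y) - (1 - y)\<bar> \<le> y\<^sup>2" by simp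
      also have "y\<^sup>2 = s ^ 3 * (s * Q\<^sup>2 / 4)" by (simp add: y_def power2_eq_square power3_eq_cube)
      also have "\<dots> \<le> s ^ 3 * Q\<^sup>2"
      proof (intro mult_left_mono)
        have "s * Q\<^sup>2 \<le> 1 * Q\<^sup>2" using s1 by (intro mult_right_mono) auto
        then show "s * Q\<^sup>2 / 4 \<le> Q\<^sup>2" using zero_le_power2[of Q] by linarith
      qed (use s in simp)
      finally show ?thesis by (simp add: y_def)
    qed
    have eq: "\<i> * of_real (s * m1) - of_real (s\<^sup>2 * (m2 - Q) / 2)
       = (Z - of_real (exp (- (s\<^sup>2 * Q) / 2))) - (Z - integral\<^sup>L (law b N) P)
        + of_real (exp (- (s\<^sup>2 * Q) / 2) - (1 - s\<^sup>2 * Q / 2))"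
      unfolding IP by (simp add: field_simps)
    have "cmod (\<i> * of_real (s * m1) - of_real (s\<^sup>2 * (m2 - Q) / 2))
       \<le> cmod (Z - of_real (exp (- (s\<^sup>2 * Q) / 2))) + cmod (Z - integral\<^sup>L (law b N) P)
        + cmod (of_real (exp (- (s\<^sup>2 * Q) / 2) - (1 - s\<^sup>2 * Q / 2)))"
      unfolding eq by (intro order.trans[OF norm_triangle_ineq] add_right_mono norm_triangle_ineq4)
    also have "\<dots> \<le> 9 * (s * C) * real N * (s\<^sup>2 * V) + s ^ 3 * (real N * C) ^ 3 / 6 + s ^ 3 * Q\<^sup>2"
      using a b c by (intro add_mono) (simp_all only: norm_of_real)
    also have "\<dots> = K * s ^ 3" by (simp add: K_def algebra_simps power2_eq_square power3_eq_cube)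
    finally show ?thesis .
  qed
  have s0: "0 < 1 / (2 * C)" using C by simp
  \<comment> \<open>The imaginary part of \<open>main\<close> isolates the first moment and the real
    part the second; both are of lower order in s than the error.\<close>
  have "\<bar>m1\<bar> \<le> 0"
  proof (rule le_zero_of_small[OF s0])
    fix s assume s: "0 < s" "s \<le> 1 / (2 * C)"
    have s1: "s \<le> 1" using s(2) C(3) by (smt (verit) divide_le_eq_1_pos)
    have "\<bar>s * m1\<bar> \<le> K * s ^ 3"
      using order.trans[OF abs_Im_le_cmod main[OF s]] by simp
    then have "s * \<bar>m1\<bar> \<le> s * (K * s\<^sup>2)"
      using s by (simp add: abs_mult power2_eq_square power3_eq_cube mult_ac)
    then have m: "\<bar>m1\<bar> \<le> K * s\<^sup>2" using s by simp
    have "K * s\<^sup>2 \<le> \<bar>K\<bar> * (s * 1)"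
      unfolding power2_eq_square using s s1 by (intro mult_mono) auto
    with m show "\<bar>m1\<bar> \<le> \<bar>K\<bar> * s" by simp
  qed
  then show "(\<integral>x. (\<Sum>j\<in>{1..N}. h (x j)) \<partial>law b N) = 0" by (simp add: m1_def X_def)
  have "\<bar>m2 - Q\<bar> \<le> 0"
  proof (rule le_zero_of_small[OF s0])
    fix s assume s: "0 < s" "s \<le> 1 / (2 * C)"
    have "\<bar>s\<^sup>2 * (m2 - Q) / 2\<bar> \<le> K * s ^ 3"
      using order.trans[OF abs_Re_le_cmod main[OF s]] by (simp add: abs_mult)
    then have "s\<^sup>2 * \<bar>m2 - Q\<bar> \<le> s\<^sup>2 * (2 * K * s)"
      using s by (simp add: abs_mult power2_eq_square power3_eq_cube mult_ac)
    then show "\<bar>m2 - Q\<bar> \<le> 2 * K * s" using s by simp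
  qed
  then show "(\<integral>x. (\<Sum>j\<in>{1..N}. h (x j))\<^sup>2 \<partial>law b N) = qform b N h"
    by (simp add: m2_def X_def Q_def)
qed

section \<open>Fourier series of Lipschitz functions\<close>

definition circ_periodic :: "(real \<Rightarrow> 'a) \<Rightarrow> bool" where
  "circ_periodic g \<longleftrightarrow> (\<forall>x. g (x + 2 * pi) = g x)"

lemma circ_periodic_int:
  assumes "circ_periodic g" shows "g (x + 2 * pi * real_of_int m) = g x"
proof -
  have n: "g (x + 2 * pi * real n) = g x" for x n
  proof (induction n)
    case (Suc n)
    have "g (x + 2 * pi * real (Suc n)) = g ((x + 2 * pi * real n) + 2 * pi)"
      by (simp add: algebra_simps)
    also have "\<dots> = g x" using assms Suc by (simp add: circ_periodic_def)
    finally show ?case .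
  qed simp
  show ?thesis
  proof (cases "m \<ge> 0")
    case True
    then show ?thesis using n[of x "nat m"] by simp
  next
    case False
    then show ?thesis using n[of "x + 2 * pi * real_of_int m" "nat (- m)"] by (simp add: algebra_simps)
  qed
qed

lemma bdd_meas_integrable_interval:
  fixes g :: "real \<Rightarrow> 'a::{second_countable_topology, banach}"
  assumes "bdd_meas g" shows "integrable lborel (\<lambda>x. indicator {a..<b::real} x *\<^sub>R g x)"
proof -
  obtain C where C: "g \<in> borel_measurable borel" "\<And>x. norm (g x) \<le> C"
    using assms by (auto simp: bdd_meas_def)
  show ?thesis
  proof (rule Bochner_Integration.integrable_bound[of _ "\<lambda>x. C * indicator {a..<b} x"])
    show "integrable lborel (\<lambda>x. C * indicator {a..<b} x)"
    proof -
      have "emeasure lborel {a..<b} < \<infinity>" by (cases "a \<le> b") auto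
      then show ?thesis by (intro integrable_mult_right integrable_real_indicator) auto
    qed
    show "AE x in lborel. norm (indicator {a..<b} x *\<^sub>R g x) \<le> norm (C * indicator {a..<b} x)"
      using C(2) order.trans[OF norm_ge_zero C(2)] by (auto simp: indicator_def)
  qed (use C in measurable)
qed

lemma lborel_integral_shift:
  fixes F :: "real \<Rightarrow> 'a::{second_countable_topology, banach}"
  shows "(\<integral>x. F x \<partial>lborel) = (\<integral>x. F (t + x) \<partial>lborel)"
  using lborel_integral_real_affine[of 1 F t] by simp

text \<open>\<open>circ\<close> lives on [0, 2 pi) rather than on a quotient: whole periods are
  removed with the floor, and the overhang of the shifted interval is moved back by one
  period.\<close>

lemma integral_circ_translate:
  fixes g :: "real \<Rightarrow> 'a::{second_countable_topology, banach}"
  assumes g: "bdd_meas g" and p: "circ_periodic g"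
  shows "(\<integral>x. g (x - a) \<partial>circ) = (\<integral>x. g x \<partial>circ)"
proof -
  have [measurable]: "g \<in> borel_measurable borel" by (rule bdd_meas_measurable[OF g])
  define J where "J = (\<lambda>u v. \<integral>x. indicator {u..<v} x *\<^sub>R g x \<partial>lborel)"
  have Jshift: "J (u + t) (v + t) = (\<integral>x. indicator {u..<v} x *\<^sub>R g (x + t) \<partial>lborel)" for u v t
    unfolding J_def by (subst lborel_integral_shift[of _ t]) (simp add: indicator_def algebra_simps)
  have Jper: "J (u + 2 * pi * real_of_int m) (v + 2 * pi * real_of_int m) = J u v" for u v m
    unfolding Jshift unfolding circ_periodic_int[OF p] J_def ..
  have Jadd: "J u w = J u v + J v w" if "u \<le> v" "v \<le> w" for u v w
  proof -
    have "indicator {u..<w} x *\<^sub>R g x = indicator {u..<v} x *\<^sub>R g x + indicator {v..<w} x *\<^sub>R g x" for x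
      using that by (auto simp: indicator_def)
    then show ?thesis
      unfolding J_def by (simp add: bdd_meas_integrable_interval[OF g])
  qed
  have base: "J r (r + 2 * pi) = J 0 (2 * pi)" if "0 \<le> r" "r < 2 * pi" for r
  proof -
    have "J r (r + 2 * pi) = J r (2 * pi) + J (2 * pi) (r + 2 * pi)" using that by (intro Jadd) auto
    also have "J (2 * pi) (r + 2 * pi) = J 0 r" using Jper[of 0 1 r] by simp
    also have "J r (2 * pi) + J 0 r = J 0 (2 * pi)" using Jadd[of 0 r "2 * pi"] that by simp
    finally show ?thesis .
  qed
  define m where "m = \<lfloor>- a / (2 * pi)\<rfloor>"
  define r where "r = - a - 2 * pi * real_of_int m"
  have "real_of_int m \<le> - a / (2 * pi)" "- a / (2 * pi) < real_of_int m + 1"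
    unfolding m_def by linarith+
  then have r: "0 \<le> r" "r < 2 * pi"
    unfolding r_def by (auto simp: field_simps)
  have "(\<integral>x. g (x - a) \<partial>circ) = (\<integral>x. (indicator {0..<2 * pi} x / (2 * pi)) *\<^sub>R g (x - a) \<partial>lborel)"
    by (rule integral_circ) measurable
  also have "\<dots> = (\<integral>x. (1 / (2 * pi)) *\<^sub>R (indicator {0..<2 * pi} x *\<^sub>R g (x + - a)) \<partial>lborel)"
    by (intro Bochner_Integration.integral_cong) auto
  also have "\<dots> = (1 / (2 * pi)) *\<^sub>R J (- a) (2 * pi - a)"
    unfolding integral_scaleR_right Jshift[of 0 "- a" "2 * pi", symmetric] by simp
  also have "J (- a) (2 * pi - a) = J (r + 2 * pi * real_of_int m) ((r + 2 * pi) + 2 * pi * real_of_int m)"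
    by (simp add: r_def algebra_simps)
  also have "\<dots> = J 0 (2 * pi)" unfolding Jper by (rule base[OF r])
  also have "(1 / (2 * pi)) *\<^sub>R J 0 (2 * pi) = (\<integral>x. g x \<partial>circ)"
    unfolding J_def by (subst integral_circ) (auto simp flip: integral_scaleR_right)
  finally show ?thesis .
qed

lemma cis_periodic: "circ_periodic (\<lambda>x. cis (- (real_of_int k * x)))"
proof -
  have "cis (- (real_of_int k * (x + 2 * pi))) = cis (- (real_of_int k * x)) * cis (2 * pi * real_of_int (- k))" for x
    by (simp add: cis_mult algebra_simps)
  moreover have "cis (2 * pi * real_of_int (- k)) = 1"
    by (rule cis_multiple_2pi) simp
  ultimately show ?thesis by (simp add: circ_periodic_def)
qed

lemma fcoef_translate:
  assumes g: "bdd_meas g" and p: "circ_periodic g"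
  shows "fcoef (\<lambda>x. g (x - a)) k = cis (- (real_of_int k * a)) * fcoef g k"
proof -
  define G where "G = (\<lambda>x. g x * cis (- (real_of_int k * x)))"
  have bG: "bdd_meas G" unfolding G_def by (intro bdd_meas_mult g bdd_meas_cis)
  have pG: "circ_periodic G"
    using p cis_periodic[of k] unfolding circ_periodic_def G_def by metis
  have "g (x - a) * cis (- (real_of_int k * x)) = cis (- (real_of_int k * a)) * G (x - a)" for x
    unfolding G_def by (simp add: cis_mult algebra_simps)
  then have "fcoef (\<lambda>x. g (x - a)) k = cis (- (real_of_int k * a)) * (\<integral>x. G (x - a) \<partial>circ)"
    by (simp add: fcoef_def)
  also have "\<dots> = cis (- (real_of_int k * a)) * fcoef g k"
    unfolding integral_circ_translate[OF bG pG] by (simp add: G_def fcoef_def)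
  finally show ?thesis .
qed

text \<open>The condition refers to the chordal distance on the circle, so it contains periodicity
  and continuity as well.\<close>

definition circ_lipschitz :: "real \<Rightarrow> (real \<Rightarrow> 'a::real_normed_vector) \<Rightarrow> bool" where
  "circ_lipschitz L g \<longleftrightarrow> (\<forall>x y. norm (g x - g y) \<le> L * cmod (cis x - cis y))"

lemma circ_lipschitz_nonneg: "circ_lipschitz L g \<Longrightarrow> 0 \<le> L"
proof -
  assume "circ_lipschitz L g"
  then have "norm (g 0 - g pi) \<le> L * cmod (cis 0 - cis pi)" unfolding circ_lipschitz_def by blast
  then have "0 \<le> L * cmod (cis 0 - cis pi)" using norm_ge_zero order.trans by blast
  then show ?thesis by (simp add: zero_le_mult_iff)
qed

lemma circ_lipschitz_bdd_meas:
  fixes g :: "real \<Rightarrow> 'a::{second_countable_topology, real_normed_vector}"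
  assumes "circ_lipschitz L g" shows "bdd_meas g"
proof -
  note L = circ_lipschitz_nonneg[OF assms]
  have "continuous_on UNIV g"
    unfolding continuous_on_iff
  proof (intro ballI allI impI)
    fix x e :: real assume e: "0 < e"
    have "continuous_on UNIV cis" by (intro continuous_intros)
    then have "isCont cis x" by (simp add: continuous_on_eq_continuous_at)
    moreover have "0 < e / (L + 1)" using e L by simp
    ultimately obtain d where d: "d > 0" "\<And>y. dist y x < d \<Longrightarrow> dist (cis y) (cis x) < e / (L + 1)"
      unfolding continuous_at_eps_delta by blast
    show "\<exists>d>0. \<forall>x'\<in>UNIV. dist x' x < d \<longrightarrow> dist (g x') (g x) < e"
    proof (intro exI[of _ d] conjI d ballI impI)
      fix y assume "dist y x < d"
      then have c: "cmod (cis y - cis x) < e / (L + 1)" using d(2) by (simp add: dist_norm)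
      have "norm (g y - g x) \<le> L * cmod (cis y - cis x)" using assms by (simp add: circ_lipschitz_def)
      also have "\<dots> \<le> (L + 1) * cmod (cis y - cis x)" by (intro mult_right_mono) auto
      also have "\<dots> < e" using c L by (simp add: field_simps)
      finally show "dist (g y) (g x) < e" by (simp add: dist_norm)
    qed
  qed
  then have m: "g \<in> borel_measurable borel" by (rule borel_measurable_continuous_onI)
  have "norm (g x) \<le> norm (g 0) + L * 2" for x
  proof -
    have "norm (g x - g 0) \<le> L * cmod (cis x - cis 0)" using assms unfolding circ_lipschitz_def by blast
    also have "\<dots> \<le> L * 2"
      using norm_triangle_ineq4[of "cis x" "cis 0"] by (intro mult_left_mono L) simp
    finally show ?thesis using norm_triangle_sub[of "g x" "g 0"] by linarith
  qed
  with m show ?thesis unfolding bdd_meas_def by blast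
qed

lemma circ_lipschitz_periodic: "circ_lipschitz L g \<Longrightarrow> circ_periodic g"
proof -
  assume l: "circ_lipschitz L g"
  have "norm (g (x + 2 * pi) - g x) \<le> L * cmod (cis (x + 2 * pi) - cis x)" for x
    using l unfolding circ_lipschitz_def by blast
  then show ?thesis by (simp add: circ_periodic_def cis_mult[symmetric])
qed

text \<open>Riemann-Lebesgue: by Bessel's inequality the coefficients are square summable in either
  direction.\<close>

lemma fcoef_tendsto_0:
  assumes g: "bdd_meas g"
  shows "(\<lambda>n. fcoef g (int n)) \<longlonglongrightarrow> 0" "(\<lambda>n. fcoef g (- int n)) \<longlonglongrightarrow> 0"
proof -
  have *: "(\<lambda>n. fcoef g (s * int n)) \<longlonglongrightarrow> 0" if "s = 1 \<or> s = - 1" for s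
  proof -
    have "summable (\<lambda>n. (cmod (fcoef g (s * int n)))\<^sup>2)"
    proof (rule summableI_nonneg_bounded)
      fix n
      have "(\<Sum>i<n. (cmod (fcoef g (s * int i)))\<^sup>2) = (\<Sum>k\<in>(\<lambda>i. s * int i) ` {..<n}. (cmod (fcoef g k))\<^sup>2)"
        using that by (subst sum.reindex) (auto simp: inj_on_def)
      also have "\<dots> \<le> (\<integral>x. (cmod (g x))\<^sup>2 \<partial>circ)" by (rule bessel[OF g]) simp
      finally show "(\<Sum>i<n. (cmod (fcoef g (s * int i)))\<^sup>2) \<le> (\<integral>x. (cmod (g x))\<^sup>2 \<partial>circ)" .
    qed simp
    then have "(\<lambda>n. (cmod (fcoef g (s * int n)))\<^sup>2) \<longlonglongrightarrow> 0" by (rule summable_LIMSEQ_zero)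
    then have "(\<lambda>n. sqrt ((cmod (fcoef g (s * int n)))\<^sup>2)) \<longlonglongrightarrow> sqrt 0" by (rule tendsto_real_sqrt)
    then show ?thesis by (simp add: tendsto_norm_zero_iff)
  qed
  from *[of 1] *[of "- 1"] show "(\<lambda>n. fcoef g (int n)) \<longlonglongrightarrow> 0" "(\<lambda>n. fcoef g (- int n)) \<longlonglongrightarrow> 0"
    by simp_all
qed

lemma fcoef_bound:
  assumes "bdd_meas g" "\<And>x. cmod (g x) \<le> L" shows "cmod (fcoef g k) \<le> L"
proof -
  have "cmod (fcoef g k) \<le> (\<integral>x. cmod (g x * cis (- (real_of_int k * x))) \<partial>circ)"
    unfolding fcoef_def by (rule integral_norm_bound)
  also have "\<dots> \<le> (\<integral>x. L \<partial>circ)"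
    by (intro integral_mono integrable_norm fcoef_integrable assms(1)) (auto simp: norm_mult assms(2))
  finally show ?thesis using circ.prob_space by simp
qed

lemma sum_int_symmetric_Suc:
  fixes f :: "int \<Rightarrow> 'a::comm_monoid_add"
  shows "(\<Sum>k=- int (Suc n)..int (Suc n). f k) = (\<Sum>k=- int n..int n. f k) + (f (int (Suc n)) + f (- int (Suc n)))"
proof -
  have "{- int (Suc n)..int (Suc n)} = insert (int (Suc n)) (insert (- int (Suc n)) {- int n..int n})" by auto
  then show ?thesis by (simp add: add_ac)
qed

text \<open>Chernoff's argument: the partial sums telescope after dividing \<open>g - g(x)\<close> by \<open>exp(i t) - exp(i x)\<close>, so pointwise
convergence reduces to the Riemann--Lebesgue lemma.\<close>

lemma fourier_partial_sum_error:
  assumes l: "circ_lipschitz L g"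
  obtains q where "bdd_meas q" "\<And>t. cmod (q t) \<le> L"
    "\<And>n. (\<Sum>k=- int n..int n. fcoef g k * cis (real_of_int k * x)) - g x
        = cis (- (real n * x)) * fcoef q (- int n - 1) - cis (real (Suc n) * x) * fcoef q (int n)"
proof -
  note bg = circ_lipschitz_bdd_meas[OF l]
  have [measurable]: "g \<in> borel_measurable borel" by (rule bdd_meas_measurable[OF bg])
  have lip: "cmod (g t - g x) \<le> L * cmod (cis t - cis x)" for t
    using l by (simp add: circ_lipschitz_def)
  \<comment> \<open>Where \<open>cis t = cis x\<close> the quotient is 0 by division by zero. This
    is harmless: the chordal Lipschitz bound forces \<open>g t = g x\<close> there.\<close>
  define q where "q = (\<lambda>t. (g t - g x) / (cis t - cis x))"
  have qb: "cmod (q t) \<le> L" for t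
  proof (cases "cis t = cis x")
    case True
    then show ?thesis using circ_lipschitz_nonneg[OF l] by (simp add: q_def)
  next
    case False
    then show ?thesis using lip[of t] by (simp add: q_def norm_divide divide_le_eq)
  qed
  have bq: "bdd_meas q"
    unfolding bdd_meas_def using qb by (auto simp: q_def)
  have gq: "g t = g x + (q t * cis t - cis x * q t)" for t
  proof (cases "cis t = cis x")
    case True
    then show ?thesis using lip[of t] by simp
  next
    case False
    then have "q t * (cis t - cis x) = g t - g x" by (simp add: q_def)
    then show ?thesis by (simp add: algebra_simps)
  qed
  have bqc: "bdd_meas (\<lambda>t. q t * cis t)" using bdd_meas_mult[OF bq bdd_meas_cis(1)[of 1]] by simp
  have fshift: "fcoef (\<lambda>t. q t * cis t) m = fcoef q (m - 1)" for m
  proof -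
    have *: "q t * cis t * cis (- (real_of_int m * t)) = q t * cis (- (real_of_int (m - 1) * t))" for t
      by (simp add: mult.assoc cis_mult algebra_simps)
    show ?thesis unfolding fcoef_def * ..
  qed
  have fm: "fcoef g m = (if m = 0 then g x else 0) + (fcoef q (m - 1) - cis x * fcoef q m)" for m
  proof -
    have "fcoef g m = fcoef (\<lambda>t. g x + (q t * cis t + (- cis x) * q t)) m"
      by (subst gq[abs_def]) simp
    also have "\<dots> = fcoef (\<lambda>t. g x) m + (fcoef (\<lambda>t. q t * cis t) m + (- cis x) * fcoef q m)"
      by (subst fcoef_add, simp, intro bdd_meas_add bqc bdd_meas_cmult bq,
          subst fcoef_add, rule bqc, intro bdd_meas_cmult bq, simp only: fcoef_cmult)
    finally show ?thesis by (simp add: fcoef_const fshift)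
  qed
  \<comment> \<open>The factor \<open>cis t - cis x\<close> acts on Fourier coefficients as a
    difference of neighbours, so the partial sum telescopes to boundary terms at -n and n +
    1.\<close>
  define a where "a = (\<lambda>m. cis (real_of_int m * x) * fcoef q (m - 1))"
  have summand: "fcoef g m * cis (real_of_int m * x) = (if m = 0 then g x else 0) + (a m - a (m + 1))" for m
  proof -
    have "cis (real_of_int (m + 1) * x) = cis x * cis (real_of_int m * x)"
      by (simp add: cis_mult algebra_simps)
    then show ?thesis by (simp add: fm a_def algebra_simps)
  qed
  have tele: "(\<Sum>k=- int n..int n. fcoef g k * cis (real_of_int k * x)) = g x + (a (- int n) - a (int n + 1))" for n
  proof (induction n)
    case 0
    then show ?case by (simp add: summand[of 0, simplified])
  next
    case (Suc n)
    show ?case unfolding sum_int_symmetric_Suc Suc summand[of "int (Suc n)"] summand[of "- int (Suc n)"]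
      by (simp add: algebra_simps)
  qed
  show ?thesis
  proof (rule that[OF bq qb])
    fix n
    show "(\<Sum>k=- int n..int n. fcoef g k * cis (real_of_int k * x)) - g x
        = cis (- (real n * x)) * fcoef q (- int n - 1) - cis (real (Suc n) * x) * fcoef q (int n)"
      unfolding tele by (simp add: a_def add.commute)
  qed
qed

text \<open>The partial sums converge pointwise with error at most 2 L, so dominated convergence
  gives convergence in mean square; that error is the norm minus the partial sum of squares.\<close>

lemma parseval_partial:
  assumes l: "circ_lipschitz L g"
  shows "(\<lambda>n. \<Sum>k=- int n..int n. (cmod (fcoef g k))\<^sup>2) \<longlonglongrightarrow> (\<integral>x. (cmod (g x))\<^sup>2 \<partial>circ)"
proof -
  note bg = circ_lipschitz_bdd_meas[OF l]
  define s where "s = (\<lambda>n x. \<Sum>k=- int n..int n. fcoef g k * cis (real_of_int k * x))"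
  have bs: "bdd_meas (s n)" for n unfolding s_def by (intro bdd_meas_sum bdd_meas_cmult) auto
  have [measurable]: "g \<in> borel_measurable borel" "s n \<in> borel_measurable borel" for n
    by (intro bdd_meas_measurable bg bs)+
  have err: "(\<lambda>n. s n x) \<longlonglongrightarrow> g x" "cmod (g x - s n x) \<le> 2 * L" for x n
  proof -
    obtain q where q: "bdd_meas q" "\<And>t. cmod (q t) \<le> L"
      "\<And>n. s n x - g x = cis (- (real n * x)) * fcoef q (- int n - 1) - cis (real (Suc n) * x) * fcoef q (int n)"
      unfolding s_def by (rule fourier_partial_sum_error[OF l, of x]) blast
    have e: "cmod (s n x - g x) \<le> cmod (fcoef q (- int (Suc n))) + cmod (fcoef q (int n))" for n
    proof -
      have eq: "- int n - 1 = - int (Suc n)" by simp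
      show ?thesis unfolding q(3) eq by (rule order.trans[OF norm_triangle_ineq4]) (simp add: norm_mult)
    qed
    show "cmod (g x - s n x) \<le> 2 * L"
      using e[of n] fcoef_bound[OF q(1,2), of "- int (Suc n)"] fcoef_bound[OF q(1,2), of "int n"]
      by (simp add: norm_minus_commute)
    have "(\<lambda>n. cmod (fcoef q (- int (Suc n))) + cmod (fcoef q (int n))) \<longlonglongrightarrow> 0 + 0"
      by (intro tendsto_add tendsto_norm_zero fcoef_tendsto_0 LIMSEQ_Suc[OF fcoef_tendsto_0(2)] q(1))
    then have "(\<lambda>n. cmod (s n x - g x)) \<longlonglongrightarrow> 0"
      by (intro Lim_null_comparison[of "\<lambda>n. cmod (s n x - g x)"] always_eventually) (use e in auto)
    then show "(\<lambda>n. s n x) \<longlonglongrightarrow> g x" by (simp add: tendsto_norm_zero_iff LIM_zero_iff)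
  qed
  have "(\<lambda>n. \<integral>x. (cmod (g x - s n x))\<^sup>2 \<partial>circ) \<longlonglongrightarrow> (\<integral>x. 0 \<partial>circ)"
  proof (rule integral_dominated_convergence[where w = "\<lambda>_. (2 * L)\<^sup>2"])
    show "AE x in circ. (\<lambda>n. (cmod (g x - s n x))\<^sup>2) \<longlonglongrightarrow> 0"
    proof (intro AE_I2)
      fix x
      have "(\<lambda>n. (cmod (g x - s n x))\<^sup>2) \<longlonglongrightarrow> (cmod (g x - g x))\<^sup>2" by (intro tendsto_intros err)
      then show "(\<lambda>n. (cmod (g x - s n x))\<^sup>2) \<longlonglongrightarrow> 0" by simp
    qed
    show "AE x in circ. norm ((cmod (g x - s n x))\<^sup>2) \<le> (2 * L)\<^sup>2" for n
    proof (intro AE_I2)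
      fix x
      show "norm ((cmod (g x - s n x))\<^sup>2) \<le> (2 * L)\<^sup>2"
        using power_mono[OF err(2)[of x n] norm_ge_zero, of 2] by simp
    qed
  qed auto
  then have "(\<lambda>n. (\<integral>x. (cmod (g x))\<^sup>2 \<partial>circ) - (\<Sum>k=- int n..int n. (cmod (fcoef g k))\<^sup>2)) \<longlonglongrightarrow> 0"
    unfolding s_def by (subst (asm) trig_approx_error[OF bg]) auto
  from tendsto_diff[OF tendsto_const[of "\<integral>x. (cmod (g x))\<^sup>2 \<partial>circ"] this] show ?thesis by simp
qed

section \<open>The variance as a sum over Fourier modes\<close>

lemma sum_int_symmetric_even:
  fixes f :: "int \<Rightarrow> real"
  assumes "\<And>k. f (- k) = f k"
  shows "(\<Sum>k=- int n..int n. f k) = f 0 + 2 * (\<Sum>k<n. f (int (Suc k)))"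
proof (induction n)
  case (Suc n)
  show ?case unfolding sum_int_symmetric_Suc Suc using assms[of "int (Suc n)"] by simp
qed simp

lemma cmod_fcoef_real_even:
  "cmod (fcoef (\<lambda>x. complex_of_real (h x)) (- k)) = cmod (fcoef (\<lambda>x. of_real (h x)) k)"
  by (simp add: fcoef_real_uminus)

lemma circ_lipschitz_of_real:
  "circ_lipschitz L (\<lambda>x. complex_of_real (h x)) \<longleftrightarrow> circ_lipschitz L h"
  unfolding circ_lipschitz_def by (metis norm_of_real of_real_diff real_norm_def)

lemma parseval_real:
  assumes l: "circ_lipschitz L h" and mean: "(\<integral>x. h x \<partial>circ) = 0"
  shows "(\<lambda>k. 2 * (cmod (fcoef (\<lambda>x. complex_of_real (h x)) (int (Suc k))))\<^sup>2) sums (\<integral>x. (h x)\<^sup>2 \<partial>circ)"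
proof -
  have l': "circ_lipschitz L (\<lambda>x. complex_of_real (h x))" using l circ_lipschitz_of_real by blast
  have "fcoef (\<lambda>x. complex_of_real (h x)) 0 = 0"
    using mean by (simp add: fcoef_def)
  then show ?thesis
    using parseval_partial[OF l'] sum_int_symmetric_even[of "\<lambda>k. (cmod (fcoef (\<lambda>x. complex_of_real (h x)) k))\<^sup>2"]
    by (simp add: cmod_fcoef_real_even sums_def sum_distrib_left)
qed

text \<open>The mean squared modulus of the power sum of order k \<ge> 1 under either ensemble, as
  \<open>pow_sum_second_moment\<close> shows.\<close>

definition mode_var :: "bool \<Rightarrow> nat \<Rightarrow> nat \<Rightarrow> real" where
  "mode_var b N k = (if b then min (real k) (real N) else real N)"

lemma mode_var_bounds: "0 \<le> mode_var b N k" "mode_var b N k \<le> real N"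
  by (auto simp: mode_var_def)

text \<open>The difference k + 1 occurs N - 1 - k times below the diagonal and as often above it; k
  starts at 0, so frequency and index differ by one.\<close>

lemma sum_differences:
  fixes f :: "int \<Rightarrow> real"
  assumes "\<And>k. f (- k) = f k"
  shows "(\<Sum>i<N. \<Sum>j<N. f (int i - int j)) = real N * f 0 + 2 * (\<Sum>k<N. (real N - 1 - real k) * f (int (Suc k)))"
proof (induction N)
  case (Suc N)
  have a: "(\<Sum>j<N. f (int N - int j)) = (\<Sum>k<N. f (int (Suc k)))"
    by (subst sum.nat_diff_reindex[symmetric]) (auto intro!: sum.cong simp: of_nat_diff)
  have b: "(\<Sum>i<N. f (int i - int N)) = (\<Sum>k<N. f (int (Suc k)))"
    unfolding a[symmetric] using assms by (intro sum.cong refl) (metis minus_diff_eq)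
  define A F where "A = (\<Sum>k<N. (real N - 1 - real k) * f (int (Suc k)))" and "F = (\<Sum>k<N. f (int (Suc k)))"
  have c: "(\<Sum>k<Suc N. (real (Suc N) - 1 - real k) * f (int (Suc k))) = A + F"
    unfolding A_def F_def sum.distrib[symmetric] by (simp add: algebra_simps)
  have "(\<Sum>i<Suc N. \<Sum>j<Suc N. f (int i - int j))
      = (\<Sum>i<N. \<Sum>j<N. f (int i - int j)) + (\<Sum>i<N. f (int i - int N)) + (\<Sum>j<N. f (int N - int j)) + f 0"
    by (simp add: sum.distrib)
  also have "\<dots> = real N * f 0 + 2 * A + F + F + f 0"
    unfolding a b Suc A_def F_def ..
  also have "\<dots> = real (Suc N) * f 0 + 2 * (A + F)" by (simp add: algebra_simps)
  also note c[symmetric]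
  finally show ?case .
qed simp

text \<open>Parseval gives weight 2 N to the frequency k, and the Frobenius norm of the Toeplitz
  matrix removes 2 (N - k) of it for k < N, which leaves 2 min(k, N). The diagonal matrix removes
  nothing because the mean vanishes.\<close>

lemma qform_sums:
  assumes l: "circ_lipschitz L h" and mean: "(\<integral>x. h x \<partial>circ) = 0"
  shows "(\<lambda>k. 2 * mode_var b N (Suc k) * (cmod (fcoef (\<lambda>x. complex_of_real (h x)) (int (Suc k))))\<^sup>2) sums qform b N h"
proof -
  define f where "f = (\<lambda>k. (cmod (fcoef (\<lambda>x. complex_of_real (h x)) k))\<^sup>2)"
  have f0: "f 0 = 0" using mean by (simp add: f_def fcoef_def)
  have fe: "f (- k) = f k" for k by (simp add: f_def cmod_fcoef_real_even)
  have 1: "(\<lambda>k. real N * (2 * f (int (Suc k)))) sums (real N * (\<integral>x. (h x)\<^sup>2 \<partial>circ))"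
    unfolding f_def by (intro sums_mult parseval_real[OF l mean])
  show ?thesis
  proof (cases b)
    case False
    have "(\<Sum>i<N. \<Sum>j<N. (cmod (toep b (\<lambda>x. complex_of_real (h x)) i j))\<^sup>2) = 0"
      using False f0 by (auto simp: toep_def f_def)
    with 1 show ?thesis unfolding qform_def using False
      by (simp add: mode_var_def f_def mult_ac)
  next
    case True
    have "(\<Sum>i<N. \<Sum>j<N. (cmod (toep b (\<lambda>x. complex_of_real (h x)) i j))\<^sup>2) = (\<Sum>i<N. \<Sum>j<N. f (int i - int j))"
      using True by (simp add: toep_def f_def)
    also have "\<dots> = (\<Sum>k<N. 2 * (real N - 1 - real k) * f (int (Suc k)))"
      using sum_differences[of f, OF fe] by (simp only: f0 sum_distrib_left mult.assoc mult_zero_right add_0)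
    finally have 2: "(\<Sum>i<N. \<Sum>j<N. (cmod (toep b (\<lambda>x. complex_of_real (h x)) i j))\<^sup>2)
        = (\<Sum>k<N. 2 * (real N - 1 - real k) * f (int (Suc k)))" .
    have "(\<lambda>k. if k \<in> {..<N} then 2 * (real N - 1 - real k) * f (int (Suc k)) else 0) sums
        (\<Sum>k<N. 2 * (real N - 1 - real k) * f (int (Suc k)))"
      by (rule sums_If_finite_set) simp
    from sums_diff[OF 1 this] have "(\<lambda>k. real N * (2 * f (int (Suc k)))
        - (if k \<in> {..<N} then 2 * (real N - 1 - real k) * f (int (Suc k)) else 0)) sums qform b N h"
      unfolding qform_def 2 .
    moreover have "real N * (2 * f (int (Suc k)))
        - (if k \<in> {..<N} then 2 * (real N - 1 - real k) * f (int (Suc k)) else 0)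
        = 2 * mode_var b N (Suc k) * f (int (Suc k))" for k
      using True by (auto simp: mode_var_def algebra_simps min_def)
    ultimately show ?thesis by (simp add: f_def)
  qed
qed

section \<open>Arcs and power sums\<close>

text \<open>An arc of half-width r around y, as a subset of the line invariant under translation by
  2 pi; points can be tested without being reduced modulo 2 pi.\<close>

definition win :: "real \<Rightarrow> real \<Rightarrow> real set" where
  "win y r = (\<Union>m::int. {y + 2 * pi * real_of_int m - r..y + 2 * pi * real_of_int m + r})"

lemma win_iff: "t \<in> win y r \<longleftrightarrow> (\<exists>m::int. \<bar>t - y - 2 * pi * real_of_int m\<bar> \<le> r)"
  unfolding win_def by (auto simp: abs_le_iff algebra_simps)

lemma sets_win [measurable]: "win y r \<in> sets borel"
  unfolding win_def by (intro sets.countable_UN) auto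

lemma win_translate: "x - a \<in> win y r \<longleftrightarrow> x \<in> win (y + a) r"
  unfolding win_iff by (simp add: algebra_simps)

lemma win_periodic: "circ_periodic (indicator (win y r) :: real \<Rightarrow> real)"
proof -
  have "x + 2 * pi \<in> win y r \<longleftrightarrow> x \<in> win y r" for x
  proof
    assume "x + 2 * pi \<in> win y r"
    then obtain m :: int where "\<bar>x + 2 * pi - y - 2 * pi * real_of_int m\<bar> \<le> r" unfolding win_iff by blast
    then have "\<bar>x - y - 2 * pi * real_of_int (m - 1)\<bar> \<le> r" by (simp add: algebra_simps)
    then show "x \<in> win y r" unfolding win_iff by blast
  next
    assume "x \<in> win y r"
    then obtain m :: int where "\<bar>x - y - 2 * pi * real_of_int m\<bar> \<le> r" unfolding win_iff by blast
    then have "\<bar>x + 2 * pi - y - 2 * pi * real_of_int (m + 1)\<bar> \<le> r" by (simp add: algebra_simps)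
    then show "x + 2 * pi \<in> win y r" unfolding win_iff by blast
  qed
  then show ?thesis by (simp add: circ_periodic_def indicator_def)
qed

text \<open>\<open>circ\<close> is normalised, so an arc of length 2 r has measure at most r / pi.
  Moving the centre to pi puts the arc inside [0, 2 pi), where only one of its translates is
  met.\<close>

lemma measure_win:
  assumes r: "0 \<le> r" "r < pi" shows "measure circ (win y r) \<le> r / pi"
proof -
  have "measure circ (win y r) = (\<integral>x. indicator (win pi r) (x - (y - pi)) \<partial>circ)"
  proof -
    have "indicator (win pi r) (x - (y - pi)) = (indicator (win y r) x :: real)" for x
      using win_translate[of x "y - pi" pi r] by (simp add: indicator_def)
    then show ?thesis by simp
  qed
  also have "\<dots> = (\<integral>x. indicator (win pi r) x \<partial>circ)"
    by (rule integral_circ_translate[OF bdd_meas_indicator[OF sets_win] win_periodic])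
  also have "\<dots> = (\<integral>x. (indicator {0..<2 * pi} x / (2 * pi)) *\<^sub>R indicator (win pi r) x \<partial>lborel)"
    by (rule integral_circ) measurable
  also have "\<dots> \<le> (\<integral>x. indicator {pi - r..pi + r} x / (2 * pi) \<partial>lborel)"
  proof (intro integral_mono)
    have i: "integrable lborel (indicator {pi - r..pi + r} :: real \<Rightarrow> real)"
      using r by (intro integrable_real_indicator) auto
    show i2: "integrable lborel (\<lambda>x. indicator {pi - r..pi + r} x / (2 * pi) :: real)"
      by (intro integrable_divide i)
    show le: "(indicator {0..<2 * pi} x / (2 * pi)) *\<^sub>R indicator (win pi r) x \<le> indicator {pi - r..pi + r} x / (2 * pi)" for x :: real
    proof -
      have "x \<in> {pi - r..pi + r}" if x: "x \<in> {0..<2 * pi}" "x \<in> win pi r"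
      proof -
        obtain m :: int where m: "\<bar>x - pi - 2 * pi * real_of_int m\<bar> \<le> r" using x(2) unfolding win_iff by blast
        have "\<bar>x - pi\<bar> \<le> pi" using x(1) by auto
        then have "\<bar>2 * pi * real_of_int m\<bar> < 2 * pi" using m r by linarith
        then have "m = 0" by (simp add: abs_mult)
        with m show ?thesis by (auto simp: abs_le_iff)
      qed
      then show ?thesis by (auto simp: indicator_def)
    qed
    show "integrable lborel (\<lambda>x. (indicator {0..<2 * pi} x / (2 * pi)) *\<^sub>R indicator (win pi r) x :: real)"
      using le by (intro Bochner_Integration.integrable_bound[OF i2]) auto
  qed
  also have "\<dots> = r / pi" using r by (simp add: field_simps)
  finally show ?thesis .
qed

text \<open>Rounding the centre down to a grid of N points moves it by at most
  \<open>2 pi / N\<close>, which the enlarged radius absorbs. A supremum over all centres thus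
  becomes a maximum over N arcs, fit for a union bound.\<close>

lemma win_cover:
  assumes N: "N > 0" and r: "0 \<le> r"
  shows "\<exists>m<N. win x (r / real N) \<subseteq> win (2 * pi * real m / real N) ((r + 2 * pi) / real N)"
proof -
  define j where "j = \<lfloor>x / (2 * pi)\<rfloor>"
  define x' where "x' = x - 2 * pi * real_of_int j"
  have "real_of_int j \<le> x / (2 * pi)" "x / (2 * pi) < real_of_int j + 1" unfolding j_def by linarith+
  then have x': "0 \<le> x'" "x' < 2 * pi" unfolding x'_def by (auto simp: field_simps)
  define m where "m = nat \<lfloor>real N * x' / (2 * pi)\<rfloor>"
  have m: "real m \<le> real N * x' / (2 * pi)" "real N * x' / (2 * pi) < real m + 1"
    unfolding m_def using x' by (auto simp: of_nat_floor)
  have "real N * x' / (2 * pi) < real N" using x' N by (simp add: field_simps)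
  then have mN: "m < N" using m(1) by linarith
  have d: "0 \<le> x' - 2 * pi * real m / real N" "x' - 2 * pi * real m / real N \<le> 2 * pi / real N"
  proof -
    have a: "0 \<le> real N * x' - 2 * pi * real m" "real N * x' - 2 * pi * real m \<le> 2 * pi"
      using m by (auto simp: field_simps)
    have "x' - 2 * pi * real m / real N = (real N * x' - 2 * pi * real m) / real N"
      using N by (simp add: field_simps)
    then show "0 \<le> x' - 2 * pi * real m / real N" "x' - 2 * pi * real m / real N \<le> 2 * pi / real N"
      using a by (auto intro!: divide_right_mono)
  qed
  show ?thesis
  proof (intro exI[of _ m] conjI mN subsetI)
    fix t assume "t \<in> win x (r / real N)"
    then obtain k :: int where k: "\<bar>t - x - 2 * pi * real_of_int k\<bar> \<le> r / real N" unfolding win_iff by blast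
    have "t - 2 * pi * real m / real N - 2 * pi * real_of_int (k + j)
        = (t - x - 2 * pi * real_of_int k) + (x' - 2 * pi * real m / real N)"
      by (simp add: x'_def algebra_simps)
    then have "\<bar>t - 2 * pi * real m / real N - 2 * pi * real_of_int (k + j)\<bar> \<le> r / real N + 2 * pi / real N"
      using k d by linarith
    then show "t \<in> win (2 * pi * real m / real N) ((r + 2 * pi) / real N)"
      unfolding win_iff add_divide_distrib by blast
  qed
qed

section \<open>Second moments of power sums\<close>

definition pow_sum :: "nat \<Rightarrow> nat \<Rightarrow> (nat \<Rightarrow> real) \<Rightarrow> complex" where
  "pow_sum N k x = (\<Sum>j\<in>{1..N}. cis (real k * x j))"

lemma measurable_pow_sum [measurable]: "pow_sum N k \<in> borel_measurable (PiM {1..N} (\<lambda>_. borel))"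
  unfolding pow_sum_def by measurable

lemma pow_sum_bound: "cmod (pow_sum N k x) \<le> real N"
  unfolding pow_sum_def using sum_norm_le[of "{1..N}" "\<lambda>j. cis (real k * x j)" "\<lambda>_. 1"] by simp

lemma cis_power_lipschitz: "cmod (cis (real k * x) - cis (real k * y)) \<le> real k * cmod (cis x - cis y)"
  using norm_power_diff[of "cis x" "cis y" k] by (simp add: Complex.DeMoivre)

text \<open>A combination of power sums is the linear statistic of a trigonometric polynomial
  without constant term, whose variance is known mode by mode. In effect, power sums of different
  positive orders are uncorrelated.\<close>

lemma trig_poly_moment:
  fixes a :: "nat \<Rightarrow> complex"
  shows "(\<integral>x. (\<Sum>k\<in>{1..M}. 2 * Re (a k * pow_sum N k x))\<^sup>2 \<partial>law b N)
      = (\<Sum>k\<in>{1..M}. 2 * mode_var b N k * (cmod (a k))\<^sup>2)"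
proof -
  define q where "q = (\<lambda>x. \<Sum>k\<in>{1..M}. 2 * Re (a k * cis (real k * x)))"
  have qc: "complex_of_real (q x) = (\<Sum>k\<in>{1..M}. a k * cis (real_of_int (int k) * x) + cnj (a k) * cis (real_of_int (- int k) * x))" for x
  proof -
    have "complex_of_real (2 * Re (a k * cis (real k * x))) = a k * cis (real_of_int (int k) * x) + cnj (a k) * cis (real_of_int (- int k) * x)" for k
      using complex_add_cnj[of "a k * cis (real k * x)"] by (simp add: cis_cnj)
    then show ?thesis unfolding q_def of_real_sum by simp
  qed
  have lip: "circ_lipschitz (\<Sum>k\<in>{1..M}. 2 * cmod (a k) * real k) q"
    unfolding circ_lipschitz_def
  proof (intro allI)
    fix x y
    have "\<bar>q x - q y\<bar> \<le> (\<Sum>k\<in>{1..M}. \<bar>2 * Re (a k * cis (real k * x)) - 2 * Re (a k * cis (real k * y))\<bar>)"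
      unfolding q_def sum_subtractf[symmetric] by (rule sum_abs)
    also have "\<dots> \<le> (\<Sum>k\<in>{1..M}. 2 * cmod (a k) * real k * cmod (cis x - cis y))"
    proof (intro sum_mono)
      fix k
      have "2 * Re (a k * cis (real k * x)) - 2 * Re (a k * cis (real k * y)) = 2 * Re (a k * (cis (real k * x) - cis (real k * y)))"
        by (simp add: algebra_simps)
      then have "\<bar>2 * Re (a k * cis (real k * x)) - 2 * Re (a k * cis (real k * y))\<bar> \<le> 2 * cmod (a k * (cis (real k * x) - cis (real k * y)))"
        using abs_Re_le_cmod[of "a k * (cis (real k * x) - cis (real k * y))"] by linarith
      also have "\<dots> \<le> 2 * (cmod (a k) * (real k * cmod (cis x - cis y)))"
        unfolding norm_mult by (intro mult_left_mono cis_power_lipschitz) auto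
      finally show "\<bar>2 * Re (a k * cis (real k * x)) - 2 * Re (a k * cis (real k * y))\<bar> \<le> 2 * cmod (a k) * real k * cmod (cis x - cis y)"
        by (simp add: mult_ac)
    qed
    finally show "norm (q x - q y) \<le> (\<Sum>k\<in>{1..M}. 2 * cmod (a k) * real k) * cmod (cis x - cis y)"
      by (simp add: sum_distrib_right)
  qed
  note bq = circ_lipschitz_bdd_meas[OF lip]
  have bk: "bdd_meas (\<lambda>x. c * cis (real_of_int k * x))" for c k by (intro bdd_meas_cmult) simp
  have fq: "fcoef (\<lambda>x. complex_of_real (q x)) m
      = (\<Sum>k\<in>{1..M}. (if m = int k then a k else 0) + (if m = - int k then cnj (a k) else 0))" for m
    unfolding qc by (subst fcoef_sum, intro bdd_meas_add bk, subst fcoef_add, rule bk, rule bk, simp only: fcoef_cis)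
  have f0: "fcoef (\<lambda>x. complex_of_real (q x)) 0 = 0"
    unfolding fq by (intro sum.neutral) auto
  then have mean: "(\<integral>x. q x \<partial>circ) = 0" by (simp add: fcoef_def)
  have fS: "fcoef (\<lambda>x. complex_of_real (q x)) (int (Suc k)) = (if Suc k \<le> M then a (Suc k) else 0)" for k
  proof -
    have "fcoef (\<lambda>x. complex_of_real (q x)) (int (Suc k)) = (\<Sum>j\<in>{1..M}. if j = Suc k then a j else 0)"
      unfolding fq by (intro sum.cong refl) auto
    then show ?thesis by simp
  qed
  have 1: "(\<lambda>k. 2 * mode_var b N (Suc k) * (cmod (if Suc k \<le> M then a (Suc k) else 0))\<^sup>2) sums qform b N q"
    using qform_sums[OF lip mean, where b = b and N = N] unfolding fS .
  have "(\<lambda>k. 2 * mode_var b N (Suc k) * (cmod (if Suc k \<le> M then a (Suc k) else 0))\<^sup>2) sums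
     (\<Sum>k<M. 2 * mode_var b N (Suc k) * (cmod (if Suc k \<le> M then a (Suc k) else 0))\<^sup>2)"
    by (rule sums_finite) auto
  from sums_unique2[OF 1 this]
  have "qform b N q = (\<Sum>k<M. 2 * mode_var b N (Suc k) * (cmod (a (Suc k)))\<^sup>2)"
    by simp
  also have "\<dots> = (\<Sum>k\<in>{1..M}. 2 * mode_var b N k * (cmod (a k))\<^sup>2)"
    by (rule sum.reindex_bij_witness[of _ "\<lambda>k. k - 1" Suc]) auto
  finally have Q: "qform b N q = (\<Sum>k\<in>{1..M}. 2 * mode_var b N k * (cmod (a k))\<^sup>2)" .
  have "(\<Sum>k\<in>{1..M}. 2 * Re (a k * pow_sum N k x)) = (\<Sum>j\<in>{1..N}. q (x j))" for x
    unfolding q_def pow_sum_def by (subst sum.swap) (simp add: sum_distrib_left)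
  then show ?thesis using law_moments(2)[OF bq mean, where N = N and b = b] Q by simp
qed

lemma pow_sum_second_moment:
  assumes k: "k \<ge> 1"
  shows "(\<integral>x. (cmod (pow_sum N k x))\<^sup>2 \<partial>law b N) = mode_var b N k"
proof -
  have one: "(\<integral>x. (2 * Re (c * pow_sum N k x))\<^sup>2 \<partial>law b N) = 2 * mode_var b N k * (cmod c)\<^sup>2" for c
  proof -
    have s: "(\<Sum>j\<in>{1..k}. 2 * Re ((if j = k then c else 0) * pow_sum N j x)) = 2 * Re (c * pow_sum N k x)" for x
    proof -
      have "(\<Sum>j\<in>{1..k}. 2 * Re ((if j = k then c else 0) * pow_sum N j x)) = (\<Sum>j\<in>{1..k}. if j = k then 2 * Re (c * pow_sum N j x) else 0)"
        by (intro sum.cong) auto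
      then show ?thesis using k by simp
    qed
    have t: "(\<Sum>j\<in>{1..k}. 2 * mode_var b N j * (cmod (if j = k then c else 0))\<^sup>2) = 2 * mode_var b N k * (cmod c)\<^sup>2"
    proof -
      have "(\<Sum>j\<in>{1..k}. 2 * mode_var b N j * (cmod (if j = k then c else 0))\<^sup>2) = (\<Sum>j\<in>{1..k}. if j = k then 2 * mode_var b N j * (cmod c)\<^sup>2 else 0)"
        by (intro sum.cong) auto
      then show ?thesis using k by simp
    qed
    show ?thesis
      using trig_poly_moment[where a = "\<lambda>j. if j = k then c else 0" and M = k and N = N and b = b] unfolding s t .
  qed
  have i: "integrable (law b N) (\<lambda>x. (2 * Re (c * pow_sum N k x))\<^sup>2)" for c
  proof (rule law_integrable[where C = "(2 * (cmod c * real N))\<^sup>2"])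
    fix x
    have "\<bar>2 * Re (c * pow_sum N k x)\<bar> \<le> 2 * (cmod c * cmod (pow_sum N k x))"
      using abs_Re_le_cmod[of "c * pow_sum N k x"] by (simp add: norm_mult)
    also have "\<dots> \<le> 2 * (cmod c * real N)" by (intro mult_left_mono pow_sum_bound) auto
    finally have "\<bar>2 * Re (c * pow_sum N k x)\<bar>\<^sup>2 \<le> (2 * (cmod c * real N))\<^sup>2" by (intro power_mono) auto
    then show "norm ((2 * Re (c * pow_sum N k x))\<^sup>2) \<le> (2 * (cmod c * real N))\<^sup>2" by simp
  qed measurable
  \<comment> \<open>The coefficients 1/2 and -i/2 pick the real and the imaginary part of the power
    sum.\<close>
  have "(cmod (pow_sum N k x))\<^sup>2 = (2 * Re ((1 / 2) * pow_sum N k x))\<^sup>2 + (2 * Re ((- \<i> / 2) * pow_sum N k x))\<^sup>2" for x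
    by (simp add: cmod_power2)
  then have "(\<integral>x. (cmod (pow_sum N k x))\<^sup>2 \<partial>law b N)
      = (\<integral>x. (2 * Re ((1 / 2) * pow_sum N k x))\<^sup>2 \<partial>law b N) + (\<integral>x. (2 * Re ((- \<i> / 2) * pow_sum N k x))\<^sup>2 \<partial>law b N)"
    by (simp only:) (rule Bochner_Integration.integral_add[OF i i])
  also have "\<dots> = mode_var b N k"
    unfolding one by (simp add: norm_divide power2_eq_square)
  finally show ?thesis .
qed

section \<open>Measurability of the variance and concentration of its exponential\<close>

lemma measurable_qform:
  fixes H :: "'a \<Rightarrow> real \<Rightarrow> real"
  assumes [measurable]: "(\<lambda>(p, x). H p x) \<in> borel_measurable (M \<Otimes>\<^sub>M borel)"
  shows "(\<lambda>p. qform b N (H p)) \<in> borel_measurable M"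
proof -
  have [measurable]: "(\<lambda>(p, x). H p x) \<in> borel_measurable (M \<Otimes>\<^sub>M circ)"
  proof -
    have "sets (M \<Otimes>\<^sub>M circ) = sets (M \<Otimes>\<^sub>M borel)" by (intro sets_pair_measure_cong) simp_all
    from measurable_cong_sets[OF this refl] assms show ?thesis by blast
  qed
  have 1: "(\<lambda>p. \<integral>x. (H p x)\<^sup>2 \<partial>circ) \<in> borel_measurable M"
    by (rule circ.borel_measurable_lebesgue_integral) measurable
  have 2: "(\<lambda>p. fcoef (\<lambda>x. complex_of_real (H p x)) k) \<in> borel_measurable M" for k
    unfolding fcoef_def by (rule circ.borel_measurable_lebesgue_integral) measurable
  have 3: "(\<lambda>p. toep b (\<lambda>x. complex_of_real (H p x)) i j) \<in> borel_measurable M" for i j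
    unfolding toep_def using 2 by (cases "b \<or> i = j") auto
  show ?thesis unfolding qform_def using 1 3 by measurable
qed

text \<open>With \<open>m\<close> the mean of \<open>exp(-Q)\<close>, the pointwise bound \<open>Q + ln m \<le> (2/m) |exp(-Q) - m| (1 + Q)\<close> is averaged
by the arithmetic-geometric mean inequality.\<close>

lemma exp_concentration:
  fixes Q :: "'a \<Rightarrow> real"
  assumes P: "prob_space P" and Qm [measurable]: "Q \<in> borel_measurable P" and Q0: "\<And>x. 0 \<le> Q x"
    and iQ2: "integrable P (\<lambda>x. (Q x)\<^sup>2)" and S: "(\<integral>x. Q x \<partial>P) \<le> S" and K: "(\<integral>x. (Q x)\<^sup>2 \<partial>P) \<le> K"
    and w: "0 < w" and var: "(\<integral>x. (exp (- Q x))\<^sup>2 \<partial>P) - (\<integral>x. exp (- Q x) \<partial>P)\<^sup>2 \<le> w\<^sup>2"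
  shows "\<bar>(\<integral>x. exp (- Q x) \<partial>P) - exp (- (\<integral>x. Q x \<partial>P))\<bar> \<le> exp S * (w * (3 + 2 * K))"
proof -
  interpret prob_space P by (rule P)
  have iQ: "integrable P Q"
  proof (rule Bochner_Integration.integrable_bound[of _ "\<lambda>x. 1 + (Q x)\<^sup>2"])
    show "integrable P (\<lambda>x. 1 + (Q x)\<^sup>2)" using iQ2 by simp
    have "\<bar>q\<bar> \<le> 1 + q\<^sup>2" for q :: real
      using zero_le_power2[of "\<bar>q\<bar> - 1 / 2"] by (simp add: power2_eq_square algebra_simps)
    then show "AE x in P. norm (Q x) \<le> norm (1 + (Q x)\<^sup>2)" by (auto intro: order.trans[OF _ abs_ge_self])
  qed simp
  define Y where "Y = (\<lambda>x. exp (- Q x))"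
  have Ym [measurable]: "Y \<in> borel_measurable P" unfolding Y_def by measurable
  have Y1: "0 < Y x" "Y x \<le> 1" for x using Q0[of x] by (auto simp: Y_def)
  have iY: "integrable P Y" by (rule integrable_const_bound[of _ 1]) (use Y1 in \<open>auto simp: less_imp_le\<close>)
  have iY2: "integrable P (\<lambda>x. (Y x)\<^sup>2)"
    by (rule integrable_const_bound[of _ 1]) (use Y1 in \<open>auto simp: less_imp_le power_le_one\<close>)
  define m where "m = (\<integral>x. Y x \<partial>P)"
  define s where "s = (\<integral>x. Q x \<partial>P)"
  \<comment> \<open>Jensen's inequality, by the tangent of the exponential at -s.\<close>
  have lower: "exp (- s) \<le> m"
  proof -
    have "(\<integral>x. exp (- s) * (1 - (Q x - s)) \<partial>P) \<le> m"
      unfolding m_def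
    proof (intro integral_mono iY)
      show "integrable P (\<lambda>x. exp (- s) * (1 - (Q x - s)))" using iQ by simp
      fix x
      have "exp (- s) * (1 - (Q x - s)) \<le> exp (- s) * exp (- (Q x - s))"
      proof (rule mult_left_mono)
        show "1 - (Q x - s) \<le> exp (- (Q x - s))" using exp_ge_add_one_self[of "- (Q x - s)"] by linarith
      qed simp
      also have "\<dots> = Y x" by (simp add: Y_def flip: exp_add)
      finally show "exp (- s) * (1 - (Q x - s)) \<le> Y x" .
    qed
    moreover have "(\<integral>x. exp (- s) * (1 - (Q x - s)) \<partial>P) = exp (- s)"
      using iQ by (simp add: prob_space s_def)
    ultimately show ?thesis by simp
  qed
  then have m0: "0 < m" using exp_gt_zero[of "- s"] by linarith
  have m1: "m \<le> 1"
    using integral_mono[OF iY, of "\<lambda>_. 1"] Y1(2) by (simp add: m_def prob_space)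
  have mS: "1 / m \<le> exp S"
  proof -
    have "exp (- S) \<le> m" using lower S by (auto simp: s_def intro: order.trans[rotated])
    then have "1 / m \<le> 1 / exp (- S)" using m0 by (intro divide_left_mono) auto
    then show ?thesis by (simp add: exp_minus inverse_eq_divide)
  qed
  define q where "q = - ln m"
  have q0: "0 \<le> q" unfolding q_def using m0 m1 by simp
  have pt: "Q x - q \<le> (1 / m) * ((Y x - m)\<^sup>2 / w + w * (2 + 2 * (Q x)\<^sup>2))" for x
  proof -
    define d where "d = \<bar>Y x - m\<bar>"
    \<comment> \<open>If Y is at least m/2, then \<open>Q - q = ln(m / Y)\<close> is bounded through
      ln x \<le> x - 1. Otherwise |Y - m| exceeds m/2 and the right side is at least 1 + Q.\<close>
    have "Q x - q \<le> (2 / m) * d * (1 + Q x)"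
    proof (cases "Y x \<ge> m / 2")
      case True
      have "Q x - q = ln (m / Y x)" using m0 Y1[of x] by (simp add: q_def Y_def ln_div)
      also have "\<dots> \<le> m / Y x - 1" using m0 Y1[of x] by (intro ln_le_minus_one) auto
      also have "\<dots> = (m - Y x) / Y x" using Y1[of x] by (simp add: diff_divide_distrib)
      also have "\<dots> \<le> d / Y x" unfolding d_def using Y1[of x] by (intro divide_right_mono) auto
      also have "\<dots> \<le> d / (m / 2)" unfolding d_def using True m0 by (intro divide_left_mono) auto
      also have "\<dots> = (2 / m) * d * 1" by simp
      also have "\<dots> \<le> (2 / m) * d * (1 + Q x)"
        using Q0[of x] m0 unfolding d_def by (intro mult_left_mono) auto
      finally show ?thesis .
    next
      case False
      then have "1 \<le> (2 / m) * d" unfolding d_def using m0 by (simp add: field_simps)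
      then have "1 * (1 + Q x) \<le> (2 / m) * d * (1 + Q x)" using Q0[of x] by (intro mult_right_mono) auto
      then show ?thesis using q0 by simp
    qed
    also have "\<dots> = (1 / m) * (2 * d * (1 + Q x))" by simp
    also have "\<dots> \<le> (1 / m) * (d\<^sup>2 / w + w * (1 + Q x)\<^sup>2)"
    proof (intro mult_left_mono)
      have "0 \<le> (d - w * (1 + Q x))\<^sup>2 / w" using w by simp
      also have "\<dots> = d\<^sup>2 / w + w * (1 + Q x)\<^sup>2 - 2 * d * (1 + Q x)"
        using w by (simp add: power2_eq_square field_simps)
      finally show "2 * d * (1 + Q x) \<le> d\<^sup>2 / w + w * (1 + Q x)\<^sup>2" by simp
    qed (use m0 in simp)
    also have "\<dots> \<le> (1 / m) * (d\<^sup>2 / w + w * (2 + 2 * (Q x)\<^sup>2))"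
    proof (intro mult_left_mono add_left_mono)
      show "(1 + Q x)\<^sup>2 \<le> 2 + 2 * (Q x)\<^sup>2"
        using zero_le_power2[of "1 - Q x"] by (simp add: power2_eq_square algebra_simps)
    qed (use m0 w in auto)
    finally show ?thesis by (simp add: d_def)
  qed
  have i: "integrable P (\<lambda>x. (Y x - m)\<^sup>2)"
    using iY iY2 by (simp add: power2_diff)
  have Iv: "(\<integral>x. (Y x - m)\<^sup>2 \<partial>P) \<le> w\<^sup>2"
  proof -
    have "(\<integral>x. (Y x - m)\<^sup>2 \<partial>P) = (\<integral>x. (Y x)\<^sup>2 \<partial>P) - m\<^sup>2"
      using iY iY2 by (simp add: power2_diff prob_space m_def[symmetric] power2_eq_square[of m])
    then show ?thesis using var by (simp add: m_def Y_def)
  qed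
  have "s - q = (\<integral>x. Q x - q \<partial>P)" using iQ by (simp add: s_def prob_space)
  also have "\<dots> \<le> (\<integral>x. (1 / m) * ((Y x - m)\<^sup>2 / w + w * (2 + 2 * (Q x)\<^sup>2)) \<partial>P)"
    using iQ i iQ2 by (intro integral_mono pt) auto
  also have "\<dots> = (1 / m) * ((\<integral>x. (Y x - m)\<^sup>2 \<partial>P) / w + w * (2 + 2 * (\<integral>x. (Q x)\<^sup>2 \<partial>P)))"
  proof -
    define A B where "A = (\<lambda>x. (Y x - m)\<^sup>2)" and "B = (\<lambda>x. (Q x)\<^sup>2)"
    have "integrable P A" "integrable P B" using i iQ2 by (simp_all add: A_def B_def)
    then have "(\<integral>x. (1 / m) * (A x / w + w * (2 + 2 * B x)) \<partial>P)
      = (1 / m) * ((\<integral>x. A x \<partial>P) / w + w * (2 + 2 * (\<integral>x. B x \<partial>P)))"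
      by (simp add: prob_space)
    then show ?thesis by (simp add: A_def B_def)
  qed
  also have "\<dots> \<le> (1 / m) * (w\<^sup>2 / w + w * (2 + 2 * K))"
    using Iv K w m0 by (intro mult_left_mono add_mono divide_right_mono) auto
  also have "\<dots> = (1 / m) * (w * (3 + 2 * K))" using w by (simp add: power2_eq_square algebra_simps)
  also have "\<dots> \<le> exp S * (w * (3 + 2 * K))"
  proof (intro mult_right_mono mS)
    have "0 \<le> (\<integral>x. (Q x)\<^sup>2 \<partial>P)" by simp
    then have "0 \<le> K" using K by linarith
    then show "0 \<le> w * (3 + 2 * K)" using w by simp
  qed
  finally have sq: "s - q \<le> exp S * (w * (3 + 2 * K))" .
  \<comment> \<open>Since \<open>m = exp(-q)\<close> with 0 \<le> q \<le> s, the difference of the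
    exponentials is at most that of the exponents.\<close>
  have "m - exp (- s) \<le> s - q"
  proof -
    have mq: "m = exp (- q)" using m0 by (simp add: q_def)
    have sq0: "0 \<le> s - q" using lower unfolding mq by simp
    have "exp (- q) - exp (- s) = exp (- q) * (1 - exp (- (s - q)))"
      by (simp add: right_diff_distrib flip: exp_add)
    also have "\<dots> \<le> 1 * (s - q)"
    proof (intro mult_mono)
      show "1 - exp (- (s - q)) \<le> s - q" using exp_ge_add_one_self[of "- (s - q)"] by linarith
    qed (use q0 sq0 in auto)
    finally show ?thesis using mq by simp
  qed
  with sq lower show ?thesis unfolding m_def[symmetric, unfolded Y_def] s_def[symmetric] by simp
qed

definition potential :: "nat \<Rightarrow> (real \<Rightarrow> real) \<Rightarrow> (nat \<Rightarrow> real) \<Rightarrow> real \<Rightarrow> real" where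
  "potential N g \<tau> x = (\<Sum>i\<in>{1..N}. g (x - \<tau> i)) / sqrt (real N)"

text \<open>The inequality y \<le> exp y at \<open>y = (n + 1) ln 2 / 4\<close>, raised to the
  fourth power. It lets exponential moments of counts bound their fourth moments.\<close>

lemma succ_fourth_power_le:
  fixes n :: real
  assumes "0 \<le> n" shows "(n + 1) ^ 4 \<le> 2 * (4 / ln 2) ^ 4 * 2 powr n"
proof -
  have l2: "0 < ln (2::real)" by simp
  have "(n + 1) * ln 2 / 4 \<le> exp ((n + 1) * ln 2 / 4)"
    using exp_ge_add_one_self[of "(n + 1) * ln 2 / 4"] by linarith
  then have "n + 1 \<le> (4 / ln 2) * exp ((n + 1) * ln 2 / 4)"
    using l2 by (simp add: field_simps)
  then have "(n + 1) ^ 4 \<le> ((4 / ln 2) * exp ((n + 1) * ln 2 / 4)) ^ 4"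
    using assms by (intro power_mono) auto
  also have "\<dots> = (4 / ln 2) ^ 4 * exp ((n + 1) * ln 2)"
    unfolding power_mult_distrib using exp_of_nat_mult[of 4 "(n + 1) * ln 2 / 4"] by simp
  also have "exp ((n + 1) * ln 2) = 2 * 2 powr n"
    by (simp add: powr_def distrib_right exp_add)
  finally show ?thesis by simp
qed

section \<open>Statistics with a localised kernel\<close>

text \<open>The function \<open>g\<close> lives on the scale \<open>1/N\<close>; in the application all constants except \<open>Lip\<close> are independent of \<open>N\<close>.\<close>

locale kernel =
  fixes N :: nat and g :: "real \<Rightarrow> real" and Lip F R K0 K1 K2 :: real
  assumes N: "0 < N" and lip: "circ_lipschitz Lip g" and even: "\<And>x. g (- x) = g x"
    and mean: "(\<integral>x. g x \<partial>circ) = 0"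
    and F: "0 \<le> F" and K0: "0 \<le> K0" and R: "0 \<le> R" "(R + 2 * pi) / real N < pi"
    and loc: "\<And>t. \<bar>g t\<bar> \<le> F * indicator (win 0 (R / real N)) t + K0 / real N"
    and K1: "\<And>k. cmod (fcoef (\<lambda>x. complex_of_real (g x)) (int k)) \<le> K1 / real N"
    and K2: "real N * (\<integral>x. (g x)\<^sup>2 \<partial>circ) \<le> K2"
begin

abbreviation "h \<equiv> potential N g"
abbreviation "c k \<equiv> fcoef (\<lambda>x. complex_of_real (g x)) (int k)"

lemma g_bdd: "bdd_meas g" by (rule circ_lipschitz_bdd_meas[OF lip])
lemma g_periodic: "circ_periodic g" by (rule circ_lipschitz_periodic[OF lip])
lemma g_meas [measurable]: "g \<in> borel_measurable borel" by (rule bdd_meas_measurable[OF g_bdd])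
lemma h_meas [measurable]: "(\<lambda>(\<tau>, x). h \<tau> x) \<in> borel_measurable (PiM {1..N} (\<lambda>_. borel) \<Otimes>\<^sub>M borel)"
  unfolding potential_def by measurable

lemma shift_lip: "circ_lipschitz Lip (\<lambda>x. g (x - a))"
  unfolding circ_lipschitz_def
proof (intro allI)
  fix x y
  have "norm (g (x - a) - g (y - a)) \<le> Lip * cmod (cis (x - a) - cis (y - a))"
    using lip by (simp add: circ_lipschitz_def)
  also have "cis (x - a) - cis (y - a) = (cis x - cis y) * cis (- a)"
    by (simp add: cis_mult left_diff_distrib)
  finally show "norm (g (x - a) - g (y - a)) \<le> Lip * cmod (cis x - cis y)" by (simp add: norm_mult)
qed

lemma h_lip: "circ_lipschitz (real N * Lip / sqrt (real N)) (h \<tau>)"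
  unfolding circ_lipschitz_def
proof (intro allI)
  fix x y
  have "\<bar>(\<Sum>i\<in>{1..N}. g (x - \<tau> i)) - (\<Sum>i\<in>{1..N}. g (y - \<tau> i))\<bar> \<le> (\<Sum>i\<in>{1..N}. \<bar>g (x - \<tau> i) - g (y - \<tau> i)\<bar>)"
    unfolding sum_subtractf[symmetric] by (rule sum_abs)
  also have "\<dots> \<le> (\<Sum>i\<in>{1..N}. Lip * cmod (cis x - cis y))"
    using shift_lip by (intro sum_mono) (simp add: circ_lipschitz_def)
  finally have "\<bar>(\<Sum>i\<in>{1..N}. g (x - \<tau> i)) - (\<Sum>i\<in>{1..N}. g (y - \<tau> i))\<bar> / sqrt (real N) \<le> (real N * (Lip * cmod (cis x - cis y))) / sqrt (real N)"
    by (intro divide_right_mono) auto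
  then show "norm (h \<tau> x - h \<tau> y) \<le> real N * Lip / sqrt (real N) * cmod (cis x - cis y)"
    by (simp add: potential_def diff_divide_distrib[symmetric] mult_ac)
qed

lemma h_bdd: "bdd_meas (h \<tau>)" by (rule circ_lipschitz_bdd_meas[OF h_lip])

lemma h_mean: "(\<integral>x. h \<tau> x \<partial>circ) = 0"
proof -
  have "(\<integral>x. (\<Sum>i\<in>{1..N}. g (x - \<tau> i)) \<partial>circ) = (\<Sum>i\<in>{1..N}. \<integral>x. g (x - \<tau> i) \<partial>circ)"
    by (intro Bochner_Integration.integral_sum bdd_meas_integrable circ_lipschitz_bdd_meas[OF shift_lip])
  also have "\<dots> = 0" unfolding integral_circ_translate[OF g_bdd g_periodic] mean by simp
  finally show ?thesis by (simp add: potential_def)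
qed

text \<open>\<open>h \<tau>\<close> is a convolution of g with the points, so coefficients multiply.
  The variance of the potential thereby becomes a weighted sum of squared moduli of power sums of
  \<tau>.\<close>

lemma h_fcoef: "fcoef (\<lambda>x. complex_of_real (h \<tau> x)) (int k) = c k * cnj (pow_sum N k \<tau>) / of_real (sqrt (real N))"
proof -
  have b: "bdd_meas (\<lambda>x. complex_of_real (g x))" using g_bdd by simp
  have p: "circ_periodic (\<lambda>x. complex_of_real (g x))" using g_periodic by (simp add: circ_periodic_def)
  have "fcoef (\<lambda>x. complex_of_real (h \<tau> x)) (int k)
      = fcoef (\<lambda>x. of_real (1 / sqrt (real N)) * (\<Sum>i\<in>{1..N}. complex_of_real (g (x - \<tau> i)))) (int k)"
    by (simp add: potential_def)
  also have "\<dots> = of_real (1 / sqrt (real N)) * (\<Sum>i\<in>{1..N}. fcoef (\<lambda>x. complex_of_real (g (x - \<tau> i))) (int k))"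
    unfolding fcoef_cmult
    by (subst fcoef_sum) (simp_all add: circ_lipschitz_bdd_meas[OF shift_lip])
  also have "\<dots> = of_real (1 / sqrt (real N)) * (\<Sum>i\<in>{1..N}. cis (- (real k * \<tau> i)) * c k)"
    using fcoef_translate[OF b p, of _ "int k"] by simp
  also have "\<dots> = c k * cnj (pow_sum N k \<tau>) / of_real (sqrt (real N))"
    by (simp add: pow_sum_def cis_cnj sum_distrib_left sum_divide_distrib mult_ac)
  finally show ?thesis .
qed

lemma h_fcoef_sq: "(cmod (fcoef (\<lambda>x. complex_of_real (h \<tau> x)) (int k)))\<^sup>2 = (cmod (c k))\<^sup>2 * (cmod (pow_sum N k \<tau>))\<^sup>2 / real N"
  using N unfolding h_fcoef by (simp add: norm_divide norm_mult power_divide power_mult_distrib)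

lemma g_parseval: "(\<lambda>k. 2 * (cmod (c (Suc k)))\<^sup>2) sums (\<integral>x. (g x)\<^sup>2 \<partial>circ)"
  by (rule parseval_real[OF lip mean])

lemma qform_h_sums:
  "(\<lambda>k. 2 * mode_var b N (Suc k) * ((cmod (c (Suc k)))\<^sup>2 * (cmod (pow_sum N (Suc k) \<tau>))\<^sup>2 / real N)) sums qform b N (h \<tau>)"
  using qform_sums[OF h_lip h_mean, where b = b and N = N and \<tau>1 = \<tau>] unfolding h_fcoef_sq .

lemma qform_h_meas [measurable]: "(\<lambda>\<tau>. qform b N (h \<tau>)) \<in> borel_measurable (PiM {1..N} (\<lambda>_. borel))"
  by (rule measurable_qform) measurable

abbreviation "energy \<tau> \<equiv> real N * (\<integral>x. (h \<tau> x)\<^sup>2 \<partial>circ)"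

text \<open>The potential has mean zero, so its energy is its variance under independent points, and
  facts on \<open>qform\<close> apply with the flag False.\<close>

lemma energy_eq: "energy \<tau> = qform False N (h \<tau>)"
proof -
  have "fcoef (\<lambda>x. complex_of_real (h \<tau> x)) 0 = 0" using h_mean[of \<tau>] by (simp add: fcoef_def)
  then have "(\<Sum>i<N. \<Sum>j<N. (cmod (toep False (\<lambda>x. complex_of_real (h \<tau> x)) i j))\<^sup>2) = 0"
    by (auto simp: toep_def)
  then show ?thesis by (simp add: qform_def)
qed

text \<open>A series of nonnegative terms is integrated term by term, each squared power sum
  contributing its \<open>mode_var\<close>. The result is symmetric in the two ensembles.\<close>

lemma qform_h_mean:
  "integrable (law b' N) (\<lambda>\<tau>. qform b N (h \<tau>))"
  "(\<lambda>k. 2 * mode_var b N (Suc k) * mode_var b' N (Suc k) * (cmod (c (Suc k)))\<^sup>2 / real N) sums (\<integral>\<tau>. qform b N (h \<tau>) \<partial>law b' N)"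
proof -
  define f where "f = (\<lambda>k \<tau>. 2 * mode_var b N (Suc k) * ((cmod (c (Suc k)))\<^sup>2 * (cmod (pow_sum N (Suc k) \<tau>))\<^sup>2 / real N))"
  have f0: "0 \<le> f k \<tau>" for k \<tau> unfolding f_def using mode_var_bounds by (intro mult_nonneg_nonneg) auto
  have fm: "f k \<in> borel_measurable (PiM {1..N} (\<lambda>_. borel))" for k unfolding f_def by measurable
  have iT: "integrable (law b' N) (\<lambda>\<tau>. (cmod (pow_sum N k \<tau>))\<^sup>2)" for k
    using power_mono[OF pow_sum_bound norm_ge_zero, of N k _ 2]
    by (intro law_integrable[where C = "(real N)\<^sup>2"]) auto
  have fi: "integrable (law b' N) (f k)" for k
    unfolding f_def by (intro integrable_mult_right integrable_divide iT)
  have fI: "(\<integral>\<tau>. f k \<tau> \<partial>law b' N) = 2 * mode_var b N (Suc k) * mode_var b' N (Suc k) * (cmod (c (Suc k)))\<^sup>2 / real N" for k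
    unfolding f_def using pow_sum_second_moment[where k = "Suc k" and N = N and b = b'] by simp
  have s1: "summable (\<lambda>k. \<integral>\<tau>. norm (f k \<tau>) \<partial>law b' N)"
  proof (rule summable_comparison_test_ev)
    show "summable (\<lambda>k. real N * (2 * (cmod (c (Suc k)))\<^sup>2))"
      by (rule summable_mult[OF sums_summable[OF g_parseval]])
    show "\<forall>\<^sub>F k in sequentially. norm (\<integral>\<tau>. norm (f k \<tau>) \<partial>law b' N) \<le> real N * (2 * (cmod (c (Suc k)))\<^sup>2)"
    proof (intro always_eventually allI)
      fix k
      have "mode_var b N (Suc k) * mode_var b' N (Suc k) \<le> real N * real N"
        by (intro mult_mono mode_var_bounds) auto
      then have "mode_var b N (Suc k) * mode_var b' N (Suc k) * (2 * (cmod (c (Suc k)))\<^sup>2 / real N)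
          \<le> real N * real N * (2 * (cmod (c (Suc k)))\<^sup>2 / real N)"
        by (intro mult_right_mono) auto
      then show "norm (\<integral>\<tau>. norm (f k \<tau>) \<partial>law b' N) \<le> real N * (2 * (cmod (c (Suc k)))\<^sup>2)"
        using f0 N mode_var_bounds by (simp add: fI mult_ac)
    qed
  qed
  have sm: "AE \<tau> in law b' N. summable (\<lambda>k. norm (f k \<tau>))"
    unfolding real_norm_def abs_of_nonneg[OF f0] unfolding f_def
    by (intro AE_I2 sums_summable[OF qform_h_sums])
  have eq: "(\<Sum>k. f k \<tau>) = qform b N (h \<tau>)" for \<tau>
    unfolding f_def by (rule sums_unique[OF qform_h_sums, symmetric])
  from integrable_suminf[OF fi sm s1] show "integrable (law b' N) (\<lambda>\<tau>. qform b N (h \<tau>))"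
    by (simp add: eq)
  from sums_integral[OF fi sm s1]
  show "(\<lambda>k. 2 * mode_var b N (Suc k) * mode_var b' N (Suc k) * (cmod (c (Suc k)))\<^sup>2 / real N) sums (\<integral>\<tau>. qform b N (h \<tau>) \<partial>law b' N)"
    by (simp add: eq fI)
qed

lemma qform_h_mean_le: "(\<integral>\<tau>. qform b N (h \<tau>) \<partial>law b' N) \<le> K2"
proof -
  have "(\<integral>\<tau>. qform b N (h \<tau>) \<partial>law b' N) \<le> real N * (\<integral>x. (g x)\<^sup>2 \<partial>circ)"
  proof (rule sums_le[OF _ qform_h_mean(2) sums_mult[OF g_parseval]])
    fix k
    have "mode_var b N (Suc k) * mode_var b' N (Suc k) \<le> real N * real N"
      by (intro mult_mono mode_var_bounds) auto
    then have "mode_var b N (Suc k) * mode_var b' N (Suc k) * (2 * (cmod (c (Suc k)))\<^sup>2 / real N)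
        \<le> real N * real N * (2 * (cmod (c (Suc k)))\<^sup>2 / real N)"
      by (intro mult_right_mono) auto
    then show "2 * mode_var b N (Suc k) * mode_var b' N (Suc k) * (cmod (c (Suc k)))\<^sup>2 / real N \<le> real N * (2 * (cmod (c (Suc k)))\<^sup>2)"
      using N by (simp add: mult_ac)
  qed
  then show ?thesis using K2 by linarith
qed

section \<open>Size of the potential and crowded configurations\<close>

lemma h_bound: "\<bar>h \<tau> x\<bar> \<le> (F * num_in N (win x (R / real N)) \<tau> + K0) / sqrt (real N)"
proof -
  have sym: "indicator (win 0 (R / real N)) (x - t) = (indicator (win x (R / real N)) t :: real)" for t
  proof -
    have "x - t \<in> win 0 (R / real N) \<longleftrightarrow> t \<in> win x (R / real N)"
    proof
      assume "x - t \<in> win 0 (R / real N)"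
      then obtain m :: int where "\<bar>x - t - 2 * pi * real_of_int m\<bar> \<le> R / real N" unfolding win_iff by auto
      then have "\<bar>t - x - 2 * pi * real_of_int (- m)\<bar> \<le> R / real N" by (simp add: abs_le_iff)
      then show "t \<in> win x (R / real N)" unfolding win_iff by blast
    next
      assume "t \<in> win x (R / real N)"
      then obtain m :: int where "\<bar>t - x - 2 * pi * real_of_int m\<bar> \<le> R / real N" unfolding win_iff by auto
      then have "\<bar>x - t - 0 - 2 * pi * real_of_int (- m)\<bar> \<le> R / real N" by (simp add: abs_le_iff)
      then show "x - t \<in> win 0 (R / real N)" unfolding win_iff by blast
    qed
    then show ?thesis by (simp add: indicator_def)
  qed
  \<comment> \<open>Points in the arc around x contribute at most F each; the N remainders
    \<open>K0 / N\<close>, which in the application stem from the subtracted mean, add up to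
    K0.\<close>
  have "\<bar>\<Sum>i\<in>{1..N}. g (x - \<tau> i)\<bar> \<le> (\<Sum>i\<in>{1..N}. F * indicator (win x (R / real N)) (\<tau> i) + K0 / real N)"
    by (rule order.trans[OF sum_abs]) (intro sum_mono, use loc[of "x - \<tau> _"] sym in auto)
  also have "\<dots> = F * num_in N (win x (R / real N)) \<tau> + K0"
    using N by (simp add: sum.distrib num_in_def sum_distrib_left)
  finally show ?thesis by (simp add: potential_def divide_right_mono)
qed

text \<open>Only the N arcs centred at grid points are inspected; their radius exceeds
  \<open>R / N\<close> by the mesh of the grid, so they control the arcs of radius
  \<open>R / N\<close> around all points.\<close>

definition "crowded A \<tau> \<longleftrightarrow> (\<exists>m<N. A < num_in N (win (2 * pi * real m / real N) ((R + 2 * pi) / real N)) \<tau>)"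

lemma crowded_meas [measurable]: "Measurable.pred (PiM {1..N} (\<lambda>_. borel)) (crowded A)"
  unfolding crowded_def by measurable

lemma h_bound_uncrowded:
  assumes "\<not> crowded A \<tau>" shows "\<bar>h \<tau> x\<bar> \<le> (F * A + K0) / sqrt (real N)"
proof -
  obtain m where m: "m < N" "win x (R / real N) \<subseteq> win (2 * pi * real m / real N) ((R + 2 * pi) / real N)"
    using win_cover[OF N R(1)] by blast
  have "num_in N (win x (R / real N)) \<tau> \<le> A"
    using num_in_mono[OF m(2), of N \<tau>] assms m(1) unfolding crowded_def by force
  then have "(F * num_in N (win x (R / real N)) \<tau> + K0) / sqrt (real N) \<le> (F * A + K0) / sqrt (real N)"
    using F by (intro divide_right_mono add_right_mono mult_left_mono) auto
  with h_bound show ?thesis by (rule order.trans)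
qed

lemma num_in_exp_integrable: "B \<in> sets borel \<Longrightarrow> integrable (law b N) (\<lambda>\<tau>. 2 powr num_in N B \<tau>)"
  using num_in_le by (intro law_integrable[where C = "2 powr real N"]) (auto intro!: powr_mono)

text \<open>Markov's inequality for 2 to the power of the count, and a union bound over N arcs. Each
  arc has measure of order 1/N, so its exponential moment is bounded independently of N.\<close>

lemma crowded_prob:
  "(\<integral>\<tau>. of_bool (crowded A \<tau>) \<partial>law b N) \<le> real N * (2 powr (- A) * exp ((R + 2 * pi) / pi))"
proof -
  interpret L: prob_space "law b N" by (rule prob_space_law)
  define W where "W = (\<lambda>m::nat. win (2 * pi * real m / real N) ((R + 2 * pi) / real N))"
  have "(\<integral>\<tau>. of_bool (crowded A \<tau>) \<partial>law b N) \<le> (\<integral>\<tau>. (\<Sum>m<N. 2 powr (- A) * 2 powr num_in N (W m) \<tau>) \<partial>law b N)"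
  proof (intro integral_mono Bochner_Integration.integrable_sum integrable_mult_right num_in_exp_integrable)
    show "integrable (law b N) (\<lambda>\<tau>. of_bool (crowded A \<tau>) :: real)"
      by (intro law_integrable[where C = 1]) (simp_all add: of_bool_def)
    fix \<tau>
    show "of_bool (crowded A \<tau>) \<le> (\<Sum>m<N. 2 powr (- A) * 2 powr num_in N (W m) \<tau>)"
    proof (cases "crowded A \<tau>")
      case True
      then obtain m where m: "m < N" "A < num_in N (W m) \<tau>" unfolding crowded_def W_def by blast
      have "1 \<le> 2 powr (- A) * 2 powr num_in N (W m) \<tau>"
        using m(2) by (simp add: powr_add[symmetric] ge_one_powr_ge_zero)
      also have "\<dots> \<le> (\<Sum>m<N. 2 powr (- A) * 2 powr num_in N (W m) \<tau>)"
        using m(1) by (intro member_le_sum) auto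
      finally show ?thesis using True by simp
    qed (auto intro!: sum_nonneg)
  qed (simp add: W_def)
  also have "\<dots> = (\<Sum>m<N. 2 powr (- A) * (\<integral>\<tau>. 2 powr num_in N (W m) \<tau> \<partial>law b N))"
    by (simp add: Bochner_Integration.integral_sum num_in_exp_integrable W_def)
  also have "\<dots> \<le> (\<Sum>m<N. 2 powr (- A) * exp ((R + 2 * pi) / pi))"
  proof (intro sum_mono mult_left_mono)
    fix m
    have "(\<integral>\<tau>. 2 powr num_in N (W m) \<tau> \<partial>law b N) \<le> exp (real N * measure circ (W m))"
      by (rule law_num_in_exp) (simp add: W_def)
    also have "\<dots> \<le> exp (real N * ((R + 2 * pi) / real N / pi))"
    proof -
      have "measure circ (W m) \<le> (R + 2 * pi) / real N / pi"
        unfolding W_def using R N by (intro measure_win) auto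
      then show ?thesis unfolding exp_le_cancel_iff by (rule mult_left_mono) simp
    qed
    also have "real N * ((R + 2 * pi) / real N / pi) = (R + 2 * pi) / pi" using N by simp
    finally show "(\<integral>\<tau>. 2 powr num_in N (W m) \<tau> \<partial>law b N) \<le> exp ((R + 2 * pi) / pi)" .
  qed simp
  finally show ?thesis by simp
qed

text \<open>Bound for the mean squared energy: the first factor is the size of the kernel, the
  second trades a fourth power for an exponential, the third is the exponential moment of the count
  in one arc.\<close>

definition "K3 = (F + K0) ^ 4 * (2 * (4 / ln 2) ^ 4) * exp (R / pi)"

text \<open>With \<open>G = sqrt N h\<close> the energy is the integral of \<open>G^2\<close>, so by
  the Cauchy-Schwarz inequality its square is at most the integral of \<open>G^4\<close>. After an
  exchange of integrals only the fourth moment of G at a fixed point remains, which the count in a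
  single arc dominates.\<close>

lemma energy_sq_mean: "integrable (law b N) (\<lambda>\<tau>. (energy \<tau>)\<^sup>2)" "(\<integral>\<tau>. (energy \<tau>)\<^sup>2 \<partial>law b N) \<le> K3"
proof -
  interpret L: prob_space "law b N" by (rule prob_space_law)
  interpret P: pair_prob_space "law b N" circ ..
  define G where "G = (\<lambda>\<tau> x. \<Sum>i\<in>{1..N}. g (x - \<tau> i))"
  have bs: "bdd_meas (\<lambda>x. g (x - a))" for a by (rule circ_lipschitz_bdd_meas[OF shift_lip])
  obtain C where C: "\<And>x. \<bar>g x\<bar> \<le> C" using g_bdd by (auto simp: bdd_meas_def)
  have GC: "\<bar>G \<tau> x\<bar> \<le> real N * C" for \<tau> x
    unfolding G_def using sum_abs[of "\<lambda>j. g (x - \<tau> j)" "{1..N}"] sum_bounded_above[of "{1..N}" "\<lambda>j. \<bar>g (x - \<tau> j)\<bar>" C] C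
    by (auto intro: order.trans)
  have [measurable]: "(\<lambda>(\<tau>, x). G \<tau> x) \<in> borel_measurable (law b N \<Otimes>\<^sub>M circ)"
  proof -
    have "(\<lambda>(\<tau>, x). G \<tau> x) \<in> borel_measurable (PiM {1..N} (\<lambda>_. borel) \<Otimes>\<^sub>M borel)" unfolding G_def by measurable
    moreover have "sets (law b N \<Otimes>\<^sub>M circ) = sets (PiM {1..N} (\<lambda>_. borel) \<Otimes>\<^sub>M borel)" by (intro sets_pair_measure_cong) simp_all
    ultimately show ?thesis using measurable_cong_sets by blast
  qed
  have bG: "bdd_meas (G \<tau>)" for \<tau> unfolding G_def by (intro bdd_meas_sum bs)
  have G4: "\<bar>G \<tau> x ^ 4\<bar> \<le> (real N * C) ^ 4" for \<tau> x
    using power_mono[OF GC abs_ge_zero, of \<tau> x 4] by (simp add: power_abs)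
  have iG4: "integrable (law b N \<Otimes>\<^sub>M circ) (\<lambda>(\<tau>, x). G \<tau> x ^ 4)"
    by (rule P.integrable_const_bound[of _ "(real N * C) ^ 4"]) (use G4 in auto)
  have en: "energy \<tau> = (\<integral>x. (G \<tau> x)\<^sup>2 \<partial>circ)" for \<tau>
    using N by (simp add: potential_def G_def power_divide)
  have sq: "(energy \<tau>)\<^sup>2 \<le> (\<integral>x. G \<tau> x ^ 4 \<partial>circ)" for \<tau>
  proof -
    define a where "a = (\<integral>x. (G \<tau> x)\<^sup>2 \<partial>circ)"
    have i: "integrable circ (\<lambda>x. (G \<tau> x)\<^sup>2)" "integrable circ (\<lambda>x. G \<tau> x ^ 4)"
      by (intro bdd_meas_integrable bdd_meas_power bG)+
    have "0 \<le> (\<integral>x. ((G \<tau> x)\<^sup>2 - a)\<^sup>2 \<partial>circ)" by simp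
    also have "\<dots> = (\<integral>x. G \<tau> x ^ 4 + a\<^sup>2 - 2 * a * (G \<tau> x)\<^sup>2 \<partial>circ)"
      by (intro Bochner_Integration.integral_cong refl) (simp add: power2_diff mult_ac flip: power_mult)
    also have "\<dots> = (\<integral>x. G \<tau> x ^ 4 \<partial>circ) + a\<^sup>2 - 2 * a * a"
      using i circ.prob_space by (simp add: a_def)
    finally show ?thesis unfolding en a_def[symmetric] by (simp add: power2_eq_square)
  qed
  have em: "(\<lambda>\<tau>. (energy \<tau>)\<^sup>2) \<in> borel_measurable (law b N)"
    unfolding energy_eq by measurable
  have iI: "integrable (law b N) (\<lambda>\<tau>. \<integral>x. G \<tau> x ^ 4 \<partial>circ)"
    using P.integrable_fst[OF iG4] by simp
  show ie: "integrable (law b N) (\<lambda>\<tau>. (energy \<tau>)\<^sup>2)"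
    using em sq by (intro Bochner_Integration.integrable_bound[OF iI]) (auto intro: order.trans[OF _ abs_ge_self])
  have "(\<integral>\<tau>. (energy \<tau>)\<^sup>2 \<partial>law b N) \<le> (\<integral>\<tau>. (\<integral>x. G \<tau> x ^ 4 \<partial>circ) \<partial>law b N)"
    by (intro integral_mono ie iI sq)
  also have "\<dots> = (\<integral>x. (\<integral>\<tau>. G \<tau> x ^ 4 \<partial>law b N) \<partial>circ)"
    using P.Fubini_integral[OF iG4] by simp
  also have "\<dots> \<le> (\<integral>x. K3 \<partial>circ)"
  proof (rule integral_mono)
    show "integrable circ (\<lambda>x. \<integral>\<tau>. G \<tau> x ^ 4 \<partial>law b N)"
      using P.integrable_snd[OF iG4] by simp
    fix x
    define n where "n = num_in N (win x (R / real N))"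
    have Gn: "G \<tau> x ^ 4 \<le> (F + K0) ^ 4 * (2 * (4 / ln 2) ^ 4) * 2 powr n \<tau>" for \<tau>
    proof -
      have n0: "0 \<le> n \<tau>" unfolding n_def by (rule num_in_nonneg)
      have "\<bar>G \<tau> x\<bar> = sqrt (real N) * \<bar>h \<tau> x\<bar>" using N by (simp add: potential_def G_def)
      also have "\<dots> \<le> sqrt (real N) * ((F * n \<tau> + K0) / sqrt (real N))"
        unfolding n_def by (intro mult_left_mono h_bound) simp
      also have "\<dots> = F * n \<tau> + K0" using N by simp
      also have "\<dots> \<le> (F + K0) * (n \<tau> + 1)" using F K0 n0 by (simp add: algebra_simps)
      finally have "\<bar>G \<tau> x\<bar> ^ 4 \<le> ((F + K0) * (n \<tau> + 1)) ^ 4" by (intro power_mono) auto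
      also have "\<dots> = (F + K0) ^ 4 * (n \<tau> + 1) ^ 4" by (rule power_mult_distrib)
      also have "\<dots> \<le> (F + K0) ^ 4 * (2 * (4 / ln 2) ^ 4 * 2 powr n \<tau>)"
        by (intro mult_left_mono succ_fourth_power_le n0) simp
      finally show ?thesis by (simp add: mult.assoc)
    qed
    have "(\<integral>\<tau>. G \<tau> x ^ 4 \<partial>law b N) \<le> (\<integral>\<tau>. (F + K0) ^ 4 * (2 * (4 / ln 2) ^ 4) * 2 powr n \<tau> \<partial>law b N)"
    proof (intro integral_mono Gn integrable_mult_right)
      have "(\<lambda>\<tau>. G \<tau> x ^ 4) \<in> borel_measurable (PiM {1..N} (\<lambda>_. borel))" unfolding G_def by measurable
      then show "integrable (law b N) (\<lambda>\<tau>. G \<tau> x ^ 4)"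
        using G4 by (intro law_integrable[where C = "(real N * C) ^ 4"]) auto
    qed (simp add: n_def num_in_exp_integrable)
    also have "\<dots> = (F + K0) ^ 4 * (2 * (4 / ln 2) ^ 4) * (\<integral>\<tau>. 2 powr n \<tau> \<partial>law b N)"
      by (rule integral_mult_right_zero)
    also have "\<dots> \<le> K3"
      unfolding K3_def
    proof (intro mult_left_mono)
      have "(\<integral>\<tau>. 2 powr n \<tau> \<partial>law b N) \<le> exp (real N * measure circ (win x (R / real N)))"
        unfolding n_def by (rule law_num_in_exp) simp
      also have "\<dots> \<le> exp (real N * (R / real N / pi))"
      proof -
        have "R / real N \<le> (R + 2 * pi) / real N" by (intro divide_right_mono) auto
        then have "R / real N < pi" using R(2) by linarith
        then have "measure circ (win x (R / real N)) \<le> R / real N / pi"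
          using R N by (intro measure_win) auto
        then show ?thesis unfolding exp_le_cancel_iff by (rule mult_left_mono) simp
      qed
      finally show "(\<integral>\<tau>. 2 powr n \<tau> \<partial>law b N) \<le> exp (R / pi)" using N by simp
    qed (use F K0 in auto)
    finally show "(\<integral>\<tau>. G \<tau> x ^ 4 \<partial>law b N) \<le> K3" .
  qed simp
  finally show "(\<integral>\<tau>. (energy \<tau>)\<^sup>2 \<partial>law b N) \<le> K3" using circ.prob_space by simp
qed

end

section \<open>Conditional characteristic functions and replicas\<close>

lemma qform_cmult: "qform b N (\<lambda>x. s * f x) = s\<^sup>2 * qform b N f"
  unfolding qform_def using toep_cmult[of b "of_real s" "\<lambda>x. of_real (f x)"]
  by (simp add: norm_mult power_mult_distrib sum_distrib_left right_diff_distrib)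

text \<open>If P fails, both quantities have modulus at most 1. Failure enters as an additive
  indicator, so that the bound can be averaged over a frozen configuration.\<close>

lemma law_gaussian_approx_cond:
  assumes h: "bdd_meas h" and mean: "(\<integral>x. h x \<partial>circ) = 0" and e: "0 < \<epsilon>" "\<epsilon> \<le> 1 / 2"
    and bd: "P \<Longrightarrow> \<forall>x. \<bar>h x\<bar> \<le> \<epsilon>"
  shows "cmod ((\<integral>x. cis (\<Sum>j\<in>{1..N}. h (x j)) \<partial>law b N) - of_real (exp (- qform b N h / 2)))
     \<le> 9 * \<epsilon> * (real N * (\<integral>x. (h x)\<^sup>2 \<partial>circ)) + 2 * of_bool (\<not> P)"
proof (cases P)
  case True
  then show ?thesis using law_gaussian_approx[OF h _ e mean, where N = N and b = b] bd by (simp add: mult.assoc)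
next
  case False
  have "cmod ((\<integral>x. cis (\<Sum>j\<in>{1..N}. h (x j)) \<partial>law b N) - of_real (exp (- qform b N h / 2)))
     \<le> cmod (\<integral>x. cis (\<Sum>j\<in>{1..N}. h (x j)) \<partial>law b N) + cmod (of_real (exp (- qform b N h / 2)))"
    by (rule norm_triangle_ineq4)
  also have "\<dots> \<le> 1 + 1"
    using qform_nonneg[OF h, where b = b and N = N] by (intro add_mono law_cis_le_1) simp
  finally have *: "cmod ((\<integral>x. cis (\<Sum>j\<in>{1..N}. h (x j)) \<partial>law b N) - of_real (exp (- qform b N h / 2))) \<le> 2" by simp
  have "0 \<le> 9 * \<epsilon> * (real N * (\<integral>x. (h x)\<^sup>2 \<partial>circ))" using e by simp
  with * False show ?thesis by simp
qed

lemma exp_neg_lipschitz: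
  fixes x y :: real
  assumes "0 \<le> x" "0 \<le> y" shows "\<bar>exp (- x) - exp (- y)\<bar> \<le> \<bar>x - y\<bar>"
proof -
  have *: "exp (- a) - exp (- b) \<le> b - a" if "0 \<le> a" "a \<le> b" for a b :: real
  proof -
    have "exp (- a) - exp (- b) = exp (- a) * (1 - exp (- (b - a)))"
      by (simp add: right_diff_distrib flip: exp_add)
    also have "\<dots> \<le> 1 * (b - a)"
    proof (intro mult_mono)
      show "1 - exp (- (b - a)) \<le> b - a" using exp_ge_add_one_self[of "- (b - a)"] by linarith
    qed (use that in auto)
    finally show ?thesis by simp
  qed
  show ?thesis
  proof (cases "x \<le> y")
    case True
    then show ?thesis using *[of x y] assms by (simp add: abs_real_def)
  next
    case False
    then show ?thesis using *[of y x] assms by (simp add: abs_real_def)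
  qed
qed

context kernel
begin

text \<open>The characteristic function at u of the statistic with \<tau> frozen and the other
  configuration drawn from \<open>law b\<close>.\<close>

definition "Phi b u \<tau> = (\<integral>\<theta>. cis (u * (\<Sum>j\<in>{1..N}. h \<tau> (\<theta> j))) \<partial>law b N)"

text \<open>Two frozen configurations act on one random configuration; the square of
  \<open>Phi\<close> turns into this object once the roles are exchanged.\<close>

definition "Psi b u \<tau> \<tau>' = (\<integral>\<theta>. cis (u * (\<Sum>j\<in>{1..N}. h \<tau> (\<theta> j) + h \<tau>' (\<theta> j))) \<partial>law b N)"

text \<open>Evenness of g. The double sum is a linear statistic of either configuration, which is
  what allows their roles to be exchanged.\<close>

lemma statistic_sym: "(\<Sum>j\<in>{1..N}. h \<tau> (\<theta> j)) = (\<Sum>j\<in>{1..N}. h \<theta> (\<tau> j))"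
proof -
  have "(\<Sum>j\<in>{1..N}. \<Sum>i\<in>{1..N}. g (\<theta> j - \<tau> i)) = (\<Sum>i\<in>{1..N}. \<Sum>j\<in>{1..N}. g (\<tau> i - \<theta> j))"
    using even[of "\<theta> _ - \<tau> _"] by (subst sum.swap) simp
  then show ?thesis by (simp add: potential_def flip: sum_divide_distrib)
qed

lemma measurable_pair_law: "measurable (law b N \<Otimes>\<^sub>M law b' N) M' = measurable (PiM {1..N} (\<lambda>_. borel) \<Otimes>\<^sub>M PiM {1..N} (\<lambda>_. borel)) M'"
  by (intro measurable_cong_sets sets_pair_measure_cong) simp_all

lemma statistic_meas [measurable]:
  "(\<lambda>(\<tau>, \<theta>). \<Sum>j\<in>{1..N}. h \<tau> (\<theta> j)) \<in> borel_measurable (PiM {1..N} (\<lambda>_. borel) \<Otimes>\<^sub>M PiM {1..N} (\<lambda>_. borel))"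
  unfolding potential_def by measurable

lemma statistic_meas' [measurable]:
  "(\<lambda>(\<tau>, \<theta>). \<Sum>j\<in>{1..N}. h \<tau> (\<theta> j)) \<in> borel_measurable (law b N \<Otimes>\<^sub>M law b' N)"
  unfolding measurable_pair_law by (rule statistic_meas)

lemma Phi_meas [measurable]: "Phi b u \<in> borel_measurable (law b' N)"
proof -
  interpret L: prob_space "law b N" by (rule prob_space_law)
  show ?thesis unfolding Phi_def by (rule L.borel_measurable_lebesgue_integral) measurable
qed

lemma Phi_le_1: "cmod (Phi b u \<tau>) \<le> 1"
  unfolding Phi_def by (rule law_cis_le_1)

lemma Psi_le_1: "cmod (Psi b u \<tau> \<tau>') \<le> 1"
  unfolding Psi_def by (rule law_cis_le_1)

lemma law_integrable_sq:
  "integrable (law b N) (\<lambda>\<tau>. qform b' N (h \<tau>))" "integrable (law b N) energy" "(\<integral>\<tau>. energy \<tau> \<partial>law b N) \<le> K2"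
  "integrable (law b N) (\<lambda>\<tau>. of_bool (crowded A \<tau>) :: real)"
proof -
  show "integrable (law b N) (\<lambda>\<tau>. qform b' N (h \<tau>))" by (rule qform_h_mean)
  show "integrable (law b N) energy" unfolding energy_eq by (rule qform_h_mean)
  show "(\<integral>\<tau>. energy \<tau> \<partial>law b N) \<le> K2" unfolding energy_eq by (rule qform_h_mean_le)
  show "integrable (law b N) (\<lambda>\<tau>. of_bool (crowded A \<tau>) :: real)"
    by (intro law_integrable[where C = 1]) (simp_all add: of_bool_def)
qed

lemma Phi_approx:
  assumes e: "0 < \<epsilon>" "\<epsilon> \<le> 1 / 2" and ub: "\<bar>u\<bar> * ((F * A + K0) / sqrt (real N)) \<le> \<epsilon>"
  shows "cmod (Phi b u \<tau> - of_real (exp (- (u\<^sup>2 / 2 * qform b N (h \<tau>))))) \<le> 9 * \<epsilon> * u\<^sup>2 * energy \<tau> + 2 * of_bool (crowded A \<tau>)"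
proof -
  have "cmod ((\<integral>x. cis (\<Sum>j\<in>{1..N}. u * h \<tau> (x j)) \<partial>law b N) - of_real (exp (- qform b N (\<lambda>x. u * h \<tau> x) / 2)))
     \<le> 9 * \<epsilon> * (real N * (\<integral>x. (u * h \<tau> x)\<^sup>2 \<partial>circ)) + 2 * of_bool (\<not> \<not> crowded A \<tau>)"
  proof (rule law_gaussian_approx_cond[OF bdd_meas_cmult[OF h_bdd] _ e])
    show "(\<integral>x. u * h \<tau> x \<partial>circ) = 0" by (simp add: h_mean)
    assume nc: "\<not> crowded A \<tau>"
    show "\<forall>x. \<bar>u * h \<tau> x\<bar> \<le> \<epsilon>"
      using mult_left_mono[OF h_bound_uncrowded[OF nc], of "\<bar>u\<bar>"] ub by (auto simp: abs_mult intro: order.trans)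
  qed
  then show ?thesis
    unfolding Phi_def by (simp add: qform_cmult power_mult_distrib sum_distrib_left mult_ac)
qed

text \<open>The supremum bound doubles for a sum of two potentials, hence 2 \<epsilon> and the
  stricter condition on \<epsilon>, and the energy of the sum is at most twice the sum of the
  energies; together 9 becomes 36.\<close>

lemma Psi_approx:
  assumes e: "0 < \<epsilon>" "\<epsilon> \<le> 1 / 4" and ub: "\<bar>u\<bar> * ((F * A + K0) / sqrt (real N)) \<le> \<epsilon>"
  shows "cmod (Psi b u \<tau> \<tau>' - of_real (exp (- (u\<^sup>2 / 2 * qform b N (\<lambda>x. h \<tau> x + h \<tau>' x)))))
     \<le> 36 * \<epsilon> * u\<^sup>2 * (energy \<tau> + energy \<tau>') + 2 * (of_bool (crowded A \<tau>) + of_bool (crowded A \<tau>'))"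
proof -
  have bs: "bdd_meas (\<lambda>x. h \<tau> x + h \<tau>' x)" by (intro bdd_meas_add h_bdd)
  have i2: "integrable circ (\<lambda>x. (h \<sigma> x)\<^sup>2)" for \<sigma> by (intro bdd_meas_integrable bdd_meas_power h_bdd)
  have "cmod ((\<integral>x. cis (\<Sum>j\<in>{1..N}. u * (h \<tau> (x j) + h \<tau>' (x j))) \<partial>law b N) - of_real (exp (- qform b N (\<lambda>x. u * (h \<tau> x + h \<tau>' x)) / 2)))
     \<le> 9 * (2 * \<epsilon>) * (real N * (\<integral>x. (u * (h \<tau> x + h \<tau>' x))\<^sup>2 \<partial>circ)) + 2 * of_bool (\<not> (\<not> crowded A \<tau> \<and> \<not> crowded A \<tau>'))"
  proof (rule law_gaussian_approx_cond[OF bdd_meas_cmult[OF bs]])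
    show "(\<integral>x. u * (h \<tau> x + h \<tau>' x) \<partial>circ) = 0"
      using bdd_meas_integrable[OF h_bdd] by (simp add: h_mean)
    assume nc: "\<not> crowded A \<tau> \<and> \<not> crowded A \<tau>'"
    show "\<forall>x. \<bar>u * (h \<tau> x + h \<tau>' x)\<bar> \<le> 2 * \<epsilon>"
    proof
      fix x
      have "\<bar>u\<bar> * \<bar>h \<tau> x + h \<tau>' x\<bar> \<le> \<bar>u\<bar> * (2 * ((F * A + K0) / sqrt (real N)))"
      proof (intro mult_left_mono)
        have "\<bar>h \<tau> x\<bar> \<le> (F * A + K0) / sqrt (real N)" "\<bar>h \<tau>' x\<bar> \<le> (F * A + K0) / sqrt (real N)"
          using h_bound_uncrowded nc by auto
        then show "\<bar>h \<tau> x + h \<tau>' x\<bar> \<le> 2 * ((F * A + K0) / sqrt (real N))"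
          using abs_triangle_ineq[of "h \<tau> x" "h \<tau>' x"] by linarith
      qed simp
      then show "\<bar>u * (h \<tau> x + h \<tau>' x)\<bar> \<le> 2 * \<epsilon>" using ub unfolding abs_mult mult.left_commute[of _ 2] by linarith
    qed
  qed (use e in auto)
  also have "\<dots> \<le> 9 * (2 * \<epsilon>) * (u\<^sup>2 * (2 * energy \<tau> + 2 * energy \<tau>')) + 2 * (of_bool (crowded A \<tau>) + of_bool (crowded A \<tau>'))"
  proof (intro add_mono mult_left_mono)
    have "(\<integral>x. (h \<tau> x + h \<tau>' x)\<^sup>2 \<partial>circ) \<le> (\<integral>x. 2 * (h \<tau> x)\<^sup>2 + 2 * (h \<tau>' x)\<^sup>2 \<partial>circ)"
    proof (rule integral_mono)
      show "integrable circ (\<lambda>x. (h \<tau> x + h \<tau>' x)\<^sup>2)"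
        by (intro bdd_meas_integrable bdd_meas_power bs)
      show "integrable circ (\<lambda>x. 2 * (h \<tau> x)\<^sup>2 + 2 * (h \<tau>' x)\<^sup>2)" using i2 by simp
      fix x
      show "(h \<tau> x + h \<tau>' x)\<^sup>2 \<le> 2 * (h \<tau> x)\<^sup>2 + 2 * (h \<tau>' x)\<^sup>2"
        using zero_le_power2[of "h \<tau> x - h \<tau>' x"] by (simp add: power2_eq_square algebra_simps)
    qed
    also have "\<dots> = 2 * (\<integral>x. (h \<tau> x)\<^sup>2 \<partial>circ) + 2 * (\<integral>x. (h \<tau>' x)\<^sup>2 \<partial>circ)" using i2 by simp
    finally have "u\<^sup>2 * (real N * (\<integral>x. (h \<tau> x + h \<tau>' x)\<^sup>2 \<partial>circ)) \<le> u\<^sup>2 * (real N * (2 * (\<integral>x. (h \<tau> x)\<^sup>2 \<partial>circ) + 2 * (\<integral>x. (h \<tau>' x)\<^sup>2 \<partial>circ)))"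
      by (intro mult_left_mono) auto
    moreover have "(\<integral>x. (u * (h \<tau> x + h \<tau>' x))\<^sup>2 \<partial>circ) = u\<^sup>2 * (\<integral>x. (h \<tau> x + h \<tau>' x)\<^sup>2 \<partial>circ)"
      by (simp only: power_mult_distrib integral_mult_right_zero)
    ultimately show "real N * (\<integral>x. (u * (h \<tau> x + h \<tau>' x))\<^sup>2 \<partial>circ) \<le> u\<^sup>2 * (2 * energy \<tau> + 2 * energy \<tau>')"
      by (simp only:) (simp add: algebra_simps)
    show "of_bool (\<not> (\<not> crowded A \<tau> \<and> \<not> crowded A \<tau>')) \<le> (of_bool (crowded A \<tau>) + of_bool (crowded A \<tau>') :: real)"
      by auto
  qed (use e in auto)
  finally show ?thesis
    unfolding Psi_def qform_cmult by (simp add: sum_distrib_left algebra_simps)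
qed

lemma exp_qform_bounds: "0 < exp (- (u\<^sup>2 / 2 * qform b N (h \<tau>)))" "exp (- (u\<^sup>2 / 2 * qform b N (h \<tau>))) \<le> 1"
  using qform_nonneg[OF h_bdd[of \<tau>], where b = b and N = N] by auto

lemma exp_qform_integrable: "integrable (law b' N) (\<lambda>\<tau>. exp (- (u\<^sup>2 / 2 * qform b N (h \<tau>))))"
  using exp_qform_bounds by (intro law_integrable[where C = 1]) (auto simp: less_imp_le)

lemma Phi_mean_approx:
  assumes e: "0 < \<epsilon>" "\<epsilon> \<le> 1 / 2" and ub: "\<bar>u\<bar> * ((F * A + K0) / sqrt (real N)) \<le> \<epsilon>"
    and p: "real N * (2 powr (- A) * exp ((R + 2 * pi) / pi)) \<le> p"
  shows "(\<integral>\<tau>. cmod (Phi b u \<tau> - of_real (exp (- (u\<^sup>2 / 2 * qform b N (h \<tau>))))) \<partial>law b' N) \<le> 9 * \<epsilon> * u\<^sup>2 * K2 + 2 * p"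
    and "integrable (law b' N) (\<lambda>\<tau>. cmod (Phi b u \<tau> - of_real (exp (- (u\<^sup>2 / 2 * qform b N (h \<tau>))))))"
proof -
  interpret L: prob_space "law b' N" by (rule prob_space_law)
  have [measurable]: "(\<lambda>\<tau>. qform b N (h \<tau>)) \<in> borel_measurable (law b' N)" by measurable
  have bound: "cmod (Phi b u \<tau> - of_real (exp (- (u\<^sup>2 / 2 * qform b N (h \<tau>))))) \<le> 2" for \<tau>
  proof -
    define X where "X = exp (- (u\<^sup>2 / 2 * qform b N (h \<tau>)))"
    have "cmod (of_real X) \<le> 1" using exp_qform_bounds[of u b \<tau>] unfolding X_def by simp
    then show ?thesis
      using norm_triangle_ineq4[of "Phi b u \<tau>" "of_real X"] Phi_le_1[of b u \<tau>] unfolding X_def by linarith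
  qed
  show i: "integrable (law b' N) (\<lambda>\<tau>. cmod (Phi b u \<tau> - of_real (exp (- (u\<^sup>2 / 2 * qform b N (h \<tau>))))))"
    using bound by (intro L.integrable_const_bound[of _ 2]) auto
  have "(\<integral>\<tau>. cmod (Phi b u \<tau> - of_real (exp (- (u\<^sup>2 / 2 * qform b N (h \<tau>))))) \<partial>law b' N)
     \<le> (\<integral>\<tau>. 9 * \<epsilon> * u\<^sup>2 * energy \<tau> + 2 * of_bool (crowded A \<tau>) \<partial>law b' N)"
    by (intro integral_mono i Phi_approx[OF e ub] Bochner_Integration.integrable_add integrable_mult_right law_integrable_sq)
  also have "\<dots> = 9 * \<epsilon> * u\<^sup>2 * (\<integral>\<tau>. energy \<tau> \<partial>law b' N) + 2 * (\<integral>\<tau>. of_bool (crowded A \<tau>) \<partial>law b' N)"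
    using law_integrable_sq(2,4) by (subst Bochner_Integration.integral_add) auto
  also have "\<dots> \<le> 9 * \<epsilon> * u\<^sup>2 * K2 + 2 * p"
    using e law_integrable_sq(3)[of b'] order.trans[OF crowded_prob p, of b'] by (intro add_mono mult_left_mono) auto
  finally show "(\<integral>\<tau>. cmod (Phi b u \<tau> - of_real (exp (- (u\<^sup>2 / 2 * qform b N (h \<tau>))))) \<partial>law b' N) \<le> 9 * \<epsilon> * u\<^sup>2 * K2 + 2 * p" .
qed

text \<open>Squaring the conditional characteristic function introduces a second copy of \<open>\<theta>\<close>; exchanging the order of
integration and the roles of the two ensembles gives the characteristic function of a linear statistic of \<open>\<tau>\<close>.\<close>

lemma replica_identity:
  "(\<integral>\<tau>. (Phi b u \<tau>)\<^sup>2 \<partial>law b' N) = (\<integral>\<theta>. (\<integral>\<theta>'. Psi b' u \<theta> \<theta>' \<partial>law b N) \<partial>law b N)"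
proof -
  interpret P: pair_prob_space "law b' N" "law b N"
    by (intro pair_prob_space.intro pair_sigma_finite.intro prob_space_imp_sigma_finite prob_space_law)
  define a where "a = (\<lambda>\<tau> \<theta>. cis (u * (\<Sum>j\<in>{1..N}. h \<tau> (\<theta> j))))"
  have am [measurable]: "(\<lambda>(\<tau>, \<theta>). a \<tau> \<theta>) \<in> borel_measurable (law b' N \<Otimes>\<^sub>M law b N)"
    unfolding a_def by measurable
  have a1: "cmod (a \<tau> \<theta>) = 1" for \<tau> \<theta> by (simp add: a_def)
  have PhiE: "Phi b u \<tau> = (\<integral>\<theta>. a \<tau> \<theta> \<partial>law b N)" for \<tau> by (simp add: Phi_def a_def)
  have aPhi: "cmod (a \<tau> \<theta> * Phi b u \<tau>) \<le> 1" for \<tau> \<theta> using Phi_le_1 by (simp add: norm_mult a1)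
  \<comment> \<open>One factor is unfolded at a time, so that each exchange of integrals involves
    only two configurations.\<close>
  have "(\<integral>\<tau>. (Phi b u \<tau>)\<^sup>2 \<partial>law b' N) = (\<integral>\<tau>. (\<integral>\<theta>. a \<tau> \<theta> * Phi b u \<tau> \<partial>law b N) \<partial>law b' N)"
    by (simp add: PhiE[symmetric] power2_eq_square)
  also have "\<dots> = (\<integral>\<theta>. (\<integral>\<tau>. a \<tau> \<theta> * Phi b u \<tau> \<partial>law b' N) \<partial>law b N)"
  proof (rule P.Fubini_integral[symmetric])
    show "integrable (law b' N \<Otimes>\<^sub>M law b N) (\<lambda>(\<tau>, \<theta>). a \<tau> \<theta> * Phi b u \<tau>)"
      by (rule P.integrable_const_bound[of _ 1]) (use aPhi in \<open>auto\<close>)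
  qed
  also have "\<dots> = (\<integral>\<theta>. (\<integral>\<theta>'. Psi b' u \<theta> \<theta>' \<partial>law b N) \<partial>law b N)"
  proof (rule Bochner_Integration.integral_cong[OF refl])
    fix \<theta> assume th: "\<theta> \<in> space (law b N)"
    have [measurable]: "(\<lambda>\<tau>. a \<tau> \<theta>) \<in> borel_measurable (law b' N)"
      using measurable_compose[OF measurable_Pair2'[OF th] am] by simp
    have "(\<integral>\<tau>. a \<tau> \<theta> * Phi b u \<tau> \<partial>law b' N) = (\<integral>\<tau>. (\<integral>\<theta>'. a \<tau> \<theta> * a \<tau> \<theta>' \<partial>law b N) \<partial>law b' N)"
      unfolding PhiE by simp
    also have "\<dots> = (\<integral>\<theta>'. (\<integral>\<tau>. a \<tau> \<theta> * a \<tau> \<theta>' \<partial>law b' N) \<partial>law b N)"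
    proof (rule P.Fubini_integral[symmetric])
      show "integrable (law b' N \<Otimes>\<^sub>M law b N) (\<lambda>(\<tau>, \<theta>'). a \<tau> \<theta> * a \<tau> \<theta>')"
        by (rule P.integrable_const_bound[of _ 1]) (auto simp: norm_mult a1)
    qed
    also have "\<dots> = (\<integral>\<theta>'. Psi b' u \<theta> \<theta>' \<partial>law b N)"
    proof -
      have "a \<tau> \<theta> * a \<tau> \<theta>' = cis (u * (\<Sum>j\<in>{1..N}. h \<theta> (\<tau> j) + h \<theta>' (\<tau> j)))" for \<tau> \<theta>'
        unfolding a_def statistic_sym[of \<tau>] by (simp add: cis_mult sum.distrib distrib_left)
      then show ?thesis by (simp add: Psi_def)
    qed
    finally show "(\<integral>\<tau>. a \<tau> \<theta> * Phi b u \<tau> \<partial>law b' N) = (\<integral>\<theta>'. Psi b' u \<theta> \<theta>' \<partial>law b N)" .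
  qed
  finally show ?thesis .
qed

text \<open>Both sides are the characteristic function of the same double sum. The replica argument
  ends with means for exchanged ensembles, and this identity carries them back.\<close>

lemma Phi_swap: "(\<integral>\<tau>. Phi b u \<tau> \<partial>law b' N) = (\<integral>\<theta>. Phi b' u \<theta> \<partial>law b N)"
proof -
  interpret P: pair_prob_space "law b' N" "law b N"
    by (intro pair_prob_space.intro pair_sigma_finite.intro prob_space_imp_sigma_finite prob_space_law)
  have "(\<integral>\<theta>. (\<integral>\<tau>. cis (u * (\<Sum>j\<in>{1..N}. h \<tau> (\<theta> j))) \<partial>law b' N) \<partial>law b N)
      = (\<integral>\<tau>. (\<integral>\<theta>. cis (u * (\<Sum>j\<in>{1..N}. h \<tau> (\<theta> j))) \<partial>law b N) \<partial>law b' N)"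
    by (rule P.Fubini_integral, rule P.integrable_const_bound[of _ 1]) auto
  moreover have "Phi b' u \<theta> = (\<integral>\<tau>. cis (u * (\<Sum>j\<in>{1..N}. h \<tau> (\<theta> j))) \<partial>law b' N)" for \<theta>
    unfolding Phi_def by (intro Bochner_Integration.integral_cong refl) (simp only: statistic_sym[of \<theta>])
  ultimately show ?thesis by (simp add: Phi_def[of b])
qed

section \<open>The cross term of the quadratic form\<close>

definition "cross_term b k \<theta> \<theta>' = 4 * mode_var b N k * (cmod (c k))\<^sup>2 / real N * Re (cnj (pow_sum N k \<theta>) * pow_sum N k \<theta>')"

lemma cross_term_meas [measurable]:
  "(\<lambda>(\<theta>', \<theta>). cross_term b k \<theta> \<theta>') \<in> borel_measurable (PiM {1..N} (\<lambda>_. borel) \<Otimes>\<^sub>M PiM {1..N} (\<lambda>_. borel))"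
proof -
  have "cross_term b k \<theta> \<theta>' = 4 * mode_var b N k * (cmod (c k))\<^sup>2 / real N *
      (Re (pow_sum N k \<theta>) * Re (pow_sum N k \<theta>') + Im (pow_sum N k \<theta>) * Im (pow_sum N k \<theta>'))" for \<theta> \<theta>'
    by (simp add: cross_term_def)
  then show ?thesis by simp
qed

lemma sum_lip: "circ_lipschitz (real N * Lip / sqrt (real N) + real N * Lip / sqrt (real N)) (\<lambda>x. h \<theta> x + h \<theta>' x)"
  unfolding circ_lipschitz_def
proof (intro allI)
  fix x y
  have "norm (h \<theta> x + h \<theta>' x - (h \<theta> y + h \<theta>' y)) \<le> norm (h \<theta> x - h \<theta> y) + norm (h \<theta>' x - h \<theta>' y)"
    by (rule order.trans[OF eq_refl norm_triangle_ineq]) (simp add: algebra_simps)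
  also have "\<dots> \<le> real N * Lip / sqrt (real N) * cmod (cis x - cis y) + real N * Lip / sqrt (real N) * cmod (cis x - cis y)"
    using h_lip by (intro add_mono) (simp_all add: circ_lipschitz_def)
  finally show "norm (h \<theta> x + h \<theta>' x - (h \<theta> y + h \<theta>' y)) \<le> (real N * Lip / sqrt (real N) + real N * Lip / sqrt (real N)) * cmod (cis x - cis y)"
    by (simp add: distrib_right)
qed

text \<open>Polarisation mode by mode: \<open>|a + a'|^2\<close> exceeds
  \<open>|a|^2 + |a'|^2\<close> by twice the real part of the product of \<open>cnj a\<close> and
  \<open>a'\<close>.\<close>

lemma cross_term_sums:
  "(\<lambda>k. cross_term b (Suc k) \<theta> \<theta>') sums
     (qform b N (\<lambda>x. h \<theta> x + h \<theta>' x) - qform b N (h \<theta>) - qform b N (h \<theta>'))"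
proof -
  have m: "(\<integral>x. h \<theta> x + h \<theta>' x \<partial>circ) = 0" using bdd_meas_integrable[OF h_bdd] by (simp add: h_mean)
  have f: "fcoef (\<lambda>x. complex_of_real (h \<theta> x + h \<theta>' x)) (int k)
      = c k * cnj (pow_sum N k \<theta>) / of_real (sqrt (real N)) + c k * cnj (pow_sum N k \<theta>') / of_real (sqrt (real N))" for k
    unfolding h_fcoef[symmetric] of_real_add by (rule fcoef_add) (simp_all add: h_bdd)
  have p: "2 * v * (cmod (z * cnj a / of_real (sqrt (real N)) + z * cnj a' / of_real (sqrt (real N))))\<^sup>2
      - 2 * v * ((cmod z)\<^sup>2 * (cmod a)\<^sup>2 / real N) - 2 * v * ((cmod z)\<^sup>2 * (cmod a')\<^sup>2 / real N)
      = 4 * v * (cmod z)\<^sup>2 / real N * Re (cnj a * a')" for z a a' v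
  proof -
    have "z * cnj a / of_real (sqrt (real N)) + z * cnj a' / of_real (sqrt (real N)) = z * (cnj (a + a')) / of_real (sqrt (real N))"
      by (simp add: algebra_simps add_divide_distrib)
    then have "(cmod (z * cnj a / of_real (sqrt (real N)) + z * cnj a' / of_real (sqrt (real N))))\<^sup>2 = (cmod z)\<^sup>2 * (cmod (a + a'))\<^sup>2 / real N"
      by (simp only: norm_mult norm_divide power_divide power_mult_distrib complex_mod_cnj norm_of_real power2_abs real_sqrt_pow2[OF of_nat_0_le_iff])
    moreover have "(cmod (a + a'))\<^sup>2 = (cmod a)\<^sup>2 + (cmod a')\<^sup>2 + 2 * Re (cnj a * a')"
      unfolding cmod_power2 by (simp add: power2_eq_square algebra_simps)
    ultimately show ?thesis by (simp only:) (simp add: algebra_simps add_divide_distrib)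
  qed
  have "(\<lambda>k. 2 * mode_var b N (Suc k) * (cmod (c (Suc k) * cnj (pow_sum N (Suc k) \<theta>) / of_real (sqrt (real N)) + c (Suc k) * cnj (pow_sum N (Suc k) \<theta>') / of_real (sqrt (real N))))\<^sup>2
      - 2 * mode_var b N (Suc k) * ((cmod (c (Suc k)))\<^sup>2 * (cmod (pow_sum N (Suc k) \<theta>))\<^sup>2 / real N)
      - 2 * mode_var b N (Suc k) * ((cmod (c (Suc k)))\<^sup>2 * (cmod (pow_sum N (Suc k) \<theta>'))\<^sup>2 / real N)) sums
     (qform b N (\<lambda>x. h \<theta> x + h \<theta>' x) - qform b N (h \<theta>) - qform b N (h \<theta>'))"
    by (intro sums_diff qform_h_sums) (use qform_sums[OF sum_lip m, where b = b and N = N] in \<open>simp only: f\<close>)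
  then show ?thesis unfolding p cross_term_def .
qed

lemma pow_sum_sq_integrable: "integrable (law b N) (\<lambda>\<tau>. (cmod (pow_sum N k \<tau>))\<^sup>2)"
  using power_mono[OF pow_sum_bound norm_ge_zero, of N k _ 2]
  by (intro law_integrable[where C = "(real N)\<^sup>2"]) auto

lemma coeff_sum_bound: "(\<Sum>k\<in>{1..M}. 2 * (cmod (c k))\<^sup>2) \<le> (\<integral>x. (g x)\<^sup>2 \<partial>circ)"
proof -
  have "(\<Sum>k\<in>{1..M}. 2 * (cmod (c k))\<^sup>2) = (\<Sum>k<M. 2 * (cmod (c (Suc k)))\<^sup>2)"
    by (rule sum.reindex_bij_witness[of _ Suc "\<lambda>k. k - 1"]) auto
  also have "\<dots> \<le> (\<integral>x. (g x)\<^sup>2 \<partial>circ)"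
    using g_parseval by (metis (no_types, lifting) sum_le_suminf sums_iff finite_lessThan zero_le_mult_iff zero_le_numeral zero_le_power2)
  finally show ?thesis .
qed

text \<open>For fixed \<theta>' the sum is a linear statistic of \<theta>, so its second moment is a
  sum over modes containing fourth powers of the coefficients of g. One square is at most
  \<open>(K1 / N)^2\<close>, the other squares sum to order 1/N by Parseval, and the weights supply
  \<open>N^2\<close>: no single mode dominates, whence the decay.\<close>

lemma cross_partial_second_moment:
  "(\<integral>\<theta>'. (\<integral>\<theta>. (\<Sum>k\<in>{1..M}. cross_term b k \<theta> \<theta>')\<^sup>2 \<partial>law b' N) \<partial>law b' N) \<le> 4 * K1\<^sup>2 * K2 / real N"
proof -
  have inner: "(\<integral>\<theta>. (\<Sum>k\<in>{1..M}. cross_term b k \<theta> \<theta>')\<^sup>2 \<partial>law b' N)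
     = (\<Sum>k\<in>{1..M}. 2 * mode_var b' N k * (2 * mode_var b N k * (cmod (c k))\<^sup>2 / real N)\<^sup>2 * (cmod (pow_sum N k \<theta>'))\<^sup>2)" for \<theta>'
  proof -
    define a where "a = (\<lambda>k. of_real (2 * mode_var b N k * (cmod (c k))\<^sup>2 / real N) * cnj (pow_sum N k \<theta>'))"
    have "cross_term b k \<theta> \<theta>' = 2 * Re (a k * pow_sum N k \<theta>)" for k \<theta>
      unfolding cross_term_def a_def by (simp add: algebra_simps)
    then have "(\<integral>\<theta>. (\<Sum>k\<in>{1..M}. cross_term b k \<theta> \<theta>')\<^sup>2 \<partial>law b' N) = (\<Sum>k\<in>{1..M}. 2 * mode_var b' N k * (cmod (a k))\<^sup>2)"
      using trig_poly_moment[where a = a and M = M and N = N and b = b'] by simp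
    also have "\<dots> = (\<Sum>k\<in>{1..M}. 2 * mode_var b' N k * (2 * mode_var b N k * (cmod (c k))\<^sup>2 / real N)\<^sup>2 * (cmod (pow_sum N k \<theta>'))\<^sup>2)"
      unfolding a_def norm_mult power_mult_distrib norm_of_real power2_abs complex_mod_cnj by (simp add: mult_ac)
    finally show ?thesis .
  qed
  have "(\<integral>\<theta>'. (\<integral>\<theta>. (\<Sum>k\<in>{1..M}. cross_term b k \<theta> \<theta>')\<^sup>2 \<partial>law b' N) \<partial>law b' N)
     = (\<Sum>k\<in>{1..M}. 2 * mode_var b' N k * (2 * mode_var b N k * (cmod (c k))\<^sup>2 / real N)\<^sup>2 * (\<integral>\<theta>'. (cmod (pow_sum N k \<theta>'))\<^sup>2 \<partial>law b' N))"
    unfolding inner by (simp add: Bochner_Integration.integral_sum pow_sum_sq_integrable)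
  also have "\<dots> \<le> (\<Sum>k\<in>{1..M}. 4 * K1\<^sup>2 * (2 * (cmod (c k))\<^sup>2))"
  proof (intro sum_mono)
    fix k assume k: "k \<in> {1..M}"
    have "2 * mode_var b' N k * (2 * mode_var b N k * (cmod (c k))\<^sup>2 / real N)\<^sup>2 * (\<integral>\<theta>'. (cmod (pow_sum N k \<theta>'))\<^sup>2 \<partial>law b' N)
       = 8 * (mode_var b' N k * mode_var b' N k) * (mode_var b N k * mode_var b N k) * ((cmod (c k))\<^sup>2 * (cmod (c k))\<^sup>2) / (real N * real N)"
      using k pow_sum_second_moment[where k = k and N = N and b = b'] by (simp add: power2_eq_square)
    also have "\<dots> \<le> 8 * (real N * real N) * (real N * real N) * ((cmod (c k))\<^sup>2 * (K1 / real N)\<^sup>2) / (real N * real N)"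
      using K1[of k] mode_var_bounds
      by (intro divide_right_mono mult_mono mult_nonneg_nonneg power_mono) auto
    also have "\<dots> = 4 * K1\<^sup>2 * (2 * (cmod (c k))\<^sup>2)" using N by (simp add: power2_eq_square)
    finally show "2 * mode_var b' N k * (2 * mode_var b N k * (cmod (c k))\<^sup>2 / real N)\<^sup>2 * (\<integral>\<theta>'. (cmod (pow_sum N k \<theta>'))\<^sup>2 \<partial>law b' N) \<le> 4 * K1\<^sup>2 * (2 * (cmod (c k))\<^sup>2)" .
  qed
  also have "\<dots> = 4 * K1\<^sup>2 * (\<Sum>k\<in>{1..M}. 2 * (cmod (c k))\<^sup>2)" by (simp add: sum_distrib_left)
  also have "\<dots> \<le> 4 * K1\<^sup>2 * (K2 / real N)"
    using order.trans[OF coeff_sum_bound, of "K2 / real N"] K2 N by (intro mult_left_mono) (auto simp: field_simps)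
  finally show ?thesis by simp
qed

text \<open>The pair carries \<theta>' in front, so that the inner of the iterated integrals runs
  over \<theta>.\<close>

definition "cross_diff b = (\<lambda>(\<theta>', \<theta>). qform b N (\<lambda>x. h \<theta> x + h \<theta>' x) - qform b N (h \<theta>) - qform b N (h \<theta>'))"

text \<open>The second moment is known for partial sums; it bounds their mean modulus through
  \<open>|D| \<le> D^2 / (2 t) + t / 2\<close>, and bounded convergence passes this on to the full
  series.\<close>

lemma cross_mean_bound:
  assumes t: "0 < t" "4 * K1\<^sup>2 * K2 / real N \<le> t\<^sup>2"
  shows "integrable (law b' N \<Otimes>\<^sub>M law b' N) (\<lambda>z. \<bar>cross_diff b z\<bar>)"
    "(\<integral>z. \<bar>cross_diff b z\<bar> \<partial>(law b' N \<Otimes>\<^sub>M law b' N)) \<le> t"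
proof -
  define D where "D = cross_diff b"
  interpret P: pair_prob_space "law b' N" "law b' N"
    by (intro pair_prob_space.intro pair_sigma_finite.intro prob_space_imp_sigma_finite prob_space_law)
  define DM where "DM = (\<lambda>M (\<theta>', \<theta>). \<Sum>k\<in>{1..M}. cross_term b k \<theta> \<theta>')"
  define C where "C = 2 * (real N)\<^sup>2 * (\<integral>x. (g x)\<^sup>2 \<partial>circ)"
  have DMm [measurable]: "DM M \<in> borel_measurable (law b' N \<Otimes>\<^sub>M law b' N)" for M
    unfolding measurable_pair_law DM_def case_prod_unfold
    by (intro borel_measurable_sum cross_term_meas[unfolded case_prod_unfold])
  have DMC: "\<bar>DM M z\<bar> \<le> C" for M z
  proof -
    obtain \<theta>' \<theta> where z: "z = (\<theta>', \<theta>)" by force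
    have "\<bar>DM M z\<bar> \<le> (\<Sum>k\<in>{1..M}. \<bar>cross_term b k \<theta> \<theta>'\<bar>)" unfolding z DM_def by simp
    also have "\<dots> \<le> (\<Sum>k\<in>{1..M}. 2 * (real N)\<^sup>2 * (2 * (cmod (c k))\<^sup>2))"
    proof (intro sum_mono)
      fix k
      have "\<bar>Re (cnj (pow_sum N k \<theta>) * pow_sum N k \<theta>')\<bar> \<le> real N * real N"
        by (rule order.trans[OF abs_Re_le_cmod]) (auto simp: norm_mult intro!: mult_mono pow_sum_bound)
      then have "4 * mode_var b N k * (cmod (c k))\<^sup>2 / real N * \<bar>Re (cnj (pow_sum N k \<theta>) * pow_sum N k \<theta>')\<bar>
         \<le> 4 * real N * (cmod (c k))\<^sup>2 / real N * (real N * real N)"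
        using mode_var_bounds by (intro mult_mono divide_right_mono mult_right_mono mult_left_mono) auto
      then show "\<bar>cross_term b k \<theta> \<theta>'\<bar> \<le> 2 * (real N)\<^sup>2 * (2 * (cmod (c k))\<^sup>2)"
        using N mode_var_bounds by (simp add: cross_term_def abs_mult power2_eq_square mult_ac)
    qed
    also have "\<dots> = 2 * (real N)\<^sup>2 * (\<Sum>k\<in>{1..M}. 2 * (cmod (c k))\<^sup>2)"
      by (rule sum_distrib_left[symmetric])
    also have "\<dots> \<le> C"
      unfolding C_def by (intro mult_left_mono coeff_sum_bound) simp
    finally show ?thesis .
  qed
  have lim: "(\<lambda>M. \<bar>DM M z\<bar>) \<longlonglongrightarrow> \<bar>D z\<bar>" for z
  proof -
    obtain \<theta>' \<theta> where z: "z = (\<theta>', \<theta>)" by force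
    have "DM M z = (\<Sum>k<M. cross_term b (Suc k) \<theta> \<theta>')" for M
      unfolding z DM_def prod.case by (rule sum.reindex_bij_witness[of _ Suc "\<lambda>k. k - 1"]) auto
    then show ?thesis using cross_term_sums[of b \<theta> \<theta>'] unfolding D_def cross_diff_def z sums_def by (simp add: tendsto_rabs)
  qed
  have iDM: "integrable (law b' N \<Otimes>\<^sub>M law b' N) (DM M)" "integrable (law b' N \<Otimes>\<^sub>M law b' N) (\<lambda>z. (DM M z)\<^sup>2)" for M
  proof -
    show "integrable (law b' N \<Otimes>\<^sub>M law b' N) (DM M)"
      using DMC by (intro P.integrable_const_bound[of _ C]) auto
    have "(DM M z)\<^sup>2 \<le> C\<^sup>2" for z using power_mono[OF DMC[of M z] abs_ge_zero, of 2] by simp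
    then show "integrable (law b' N \<Otimes>\<^sub>M law b' N) (\<lambda>z. (DM M z)\<^sup>2)"
      by (intro P.integrable_const_bound[of _ "C\<^sup>2"]) auto
  qed
  have DMt: "(\<integral>z. \<bar>DM M z\<bar> \<partial>(law b' N \<Otimes>\<^sub>M law b' N)) \<le> t" for M
  proof -
    have "(\<integral>z. (DM M z)\<^sup>2 \<partial>(law b' N \<Otimes>\<^sub>M law b' N)) = (\<integral>\<theta>'. (\<integral>\<theta>. (DM M (\<theta>', \<theta>))\<^sup>2 \<partial>law b' N) \<partial>law b' N)"
      by (rule P.integral_fst'[OF iDM(2), symmetric])
    also have "\<dots> \<le> t\<^sup>2" using cross_partial_second_moment[where b = b and M = M and b' = b'] t(2) by (simp add: DM_def)
    finally have sq: "(\<integral>z. (DM M z)\<^sup>2 \<partial>(law b' N \<Otimes>\<^sub>M law b' N)) \<le> t\<^sup>2" .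
    have "(\<integral>z. \<bar>DM M z\<bar> \<partial>(law b' N \<Otimes>\<^sub>M law b' N)) \<le> (\<integral>z. (DM M z)\<^sup>2 / (2 * t) + t / 2 \<partial>(law b' N \<Otimes>\<^sub>M law b' N))"
    proof (rule integral_mono)
      fix z
      have "0 \<le> (\<bar>DM M z\<bar> - t)\<^sup>2 / (2 * t)" using t by simp
      also have "\<dots> = (DM M z)\<^sup>2 / (2 * t) + t / 2 - \<bar>DM M z\<bar>"
        using t by (simp add: power2_diff add_divide_distrib diff_divide_distrib) (simp add: power2_eq_square)
      finally show "\<bar>DM M z\<bar> \<le> (DM M z)\<^sup>2 / (2 * t) + t / 2" by simp
    qed (use iDM in auto)
    also have "\<dots> = (\<integral>z. (DM M z)\<^sup>2 \<partial>(law b' N \<Otimes>\<^sub>M law b' N)) / (2 * t) + t / 2"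
      using iDM by (simp add: P.prob_space)
    also have "\<dots> \<le> t\<^sup>2 / (2 * t) + t / 2" using sq t by (intro add_right_mono divide_right_mono) auto
    also have "\<dots> = t" using t by (simp add: power2_eq_square)
    finally show ?thesis .
  qed
  have Dm: "(\<lambda>z. \<bar>D z\<bar>) \<in> borel_measurable (law b' N \<Otimes>\<^sub>M law b' N)"
    by (rule borel_measurable_LIMSEQ_metric[OF _ lim]) measurable
  have "(\<lambda>M. \<integral>z. \<bar>DM M z\<bar> \<partial>(law b' N \<Otimes>\<^sub>M law b' N)) \<longlonglongrightarrow> (\<integral>z. \<bar>D z\<bar> \<partial>(law b' N \<Otimes>\<^sub>M law b' N))"
    by (rule integral_dominated_convergence[where w = "\<lambda>_. C"]) (use Dm lim DMC in auto)
  then show "(\<integral>z. \<bar>cross_diff b z\<bar> \<partial>(law b' N \<Otimes>\<^sub>M law b' N)) \<le> t"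
    unfolding D_def by (rule LIMSEQ_le_const2) (use DMt in auto)
  have "\<bar>D z\<bar> \<le> C" for z
    by (rule LIMSEQ_le_const2[OF lim]) (use DMC in auto)
  then show "integrable (law b' N \<Otimes>\<^sub>M law b' N) (\<lambda>z. \<bar>cross_diff b z\<bar>)"
    using Dm unfolding D_def by (intro P.integrable_const_bound[of _ C]) auto
qed

end

section \<open>A quantitative central limit bound\<close>

lemma pair_marginals:
  fixes f :: "'a \<Rightarrow> real"
  assumes M: "prob_space M" and f: "integrable M f"
  shows "integrable (M \<Otimes>\<^sub>M M) (\<lambda>z. f (fst z))" "integrable (M \<Otimes>\<^sub>M M) (\<lambda>z. f (snd z))"
    "(\<integral>z. f (fst z) \<partial>(M \<Otimes>\<^sub>M M)) = (\<integral>x. f x \<partial>M)" "(\<integral>z. f (snd z) \<partial>(M \<Otimes>\<^sub>M M)) = (\<integral>x. f x \<partial>M)"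
proof -
  interpret prob_space M by (rule M)
  interpret P: pair_prob_space M M ..
  have fm: "f \<in> borel_measurable M" using f by simp
  show a: "integrable (M \<Otimes>\<^sub>M M) (\<lambda>z. f (fst z))"
    by (rule integrable_distr[OF measurable_fst]) (simp add: distr_pair_fst f)
  show b: "(\<integral>z. f (fst z) \<partial>(M \<Otimes>\<^sub>M M)) = (\<integral>x. f x \<partial>M)"
    using integral_distr[OF measurable_fst fm, of M] by (simp add: distr_pair_fst)
  show "integrable (M \<Otimes>\<^sub>M M) (\<lambda>z. f (snd z))"
    using P.integrable_product_swap[OF a] by (simp add: case_prod_unfold)
  show "(\<integral>z. f (snd z) \<partial>(M \<Otimes>\<^sub>M M)) = (\<integral>x. f x \<partial>M)"
    using P.integral_product_swap[OF borel_measurable_integrable[OF a]] b by (simp add: case_prod_unfold)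
qed

context kernel
begin

lemma Psi_meas: "(\<lambda>(\<theta>, \<theta>'). Psi b u \<theta> \<theta>') \<in> borel_measurable (law b1 N \<Otimes>\<^sub>M law b2 N)"
proof -
  interpret L: prob_space "law b N" by (rule prob_space_law)
  let ?P = "PiM {1..N} (\<lambda>_. borel :: real measure)"
  have "(\<lambda>(z, x). cis (u * (\<Sum>j\<in>{1..N}. h (fst z) (x j) + h (snd z) (x j)))) \<in> borel_measurable ((?P \<Otimes>\<^sub>M ?P) \<Otimes>\<^sub>M ?P)"
    unfolding potential_def by measurable
  moreover have "sets ((law b1 N \<Otimes>\<^sub>M law b2 N) \<Otimes>\<^sub>M law b N) = sets ((?P \<Otimes>\<^sub>M ?P) \<Otimes>\<^sub>M ?P)"
    by (intro sets_pair_measure_cong) simp_all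
  ultimately have "(\<lambda>(z, x). cis (u * (\<Sum>j\<in>{1..N}. h (fst z) (x j) + h (snd z) (x j)))) \<in> borel_measurable ((law b1 N \<Otimes>\<^sub>M law b2 N) \<Otimes>\<^sub>M law b N)"
    using measurable_cong_sets by blast
  from L.borel_measurable_lebesgue_integral[OF this] show ?thesis
    by (simp add: Psi_def case_prod_unfold)
qed

lemma qform_sum_meas: "(\<lambda>(\<theta>, \<theta>'). qform b N (\<lambda>x. h \<theta> x + h \<theta>' x)) \<in> borel_measurable (law b1 N \<Otimes>\<^sub>M law b2 N)"
proof -
  have "(\<lambda>z. qform b N (\<lambda>x. h (fst z) x + h (snd z) x)) \<in> borel_measurable (PiM {1..N} (\<lambda>_. borel) \<Otimes>\<^sub>M PiM {1..N} (\<lambda>_. borel))"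
    by (rule measurable_qform) (unfold potential_def, measurable)
  then show ?thesis unfolding measurable_pair_law by (simp add: case_prod_unfold)
qed

text \<open>The mean of \<open>Phi\<close> is close to that of \<open>Y = exp(-u^2 Q/2)\<close>, and
  Y concentrates once its variance is below \<open>w^2\<close>. If e1 is the mean error of
  \<open>Phi\<close> against Y, that variance collects 2 e1 from squaring, 4 e1 from exchanging the
  ensembles, the error of \<open>Psi\<close>, and the cross term; this is the condition on
  w.\<close>

lemma kernel_clt_bound:
  assumes e: "0 < \<epsilon>" "\<epsilon> \<le> 1 / 4" and ub: "\<bar>u\<bar> * ((F * A + K0) / sqrt (real N)) \<le> \<epsilon>"
    and p: "real N * (2 powr (- A) * exp ((R + 2 * pi) / pi)) \<le> p"
    and t: "0 < t" "4 * K1\<^sup>2 * K2 / real N \<le> t\<^sup>2"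
    and w: "0 < w" "6 * (9 * \<epsilon> * u\<^sup>2 * K2 + 2 * p) + (72 * \<epsilon> * u\<^sup>2 * K2 + 4 * p) + u\<^sup>2 / 2 * t \<le> w\<^sup>2"
  shows "cmod ((\<integral>\<tau>. Phi b u \<tau> \<partial>law b' N) - of_real (exp (- (u\<^sup>2 / 2 * (\<integral>\<tau>. qform b N (h \<tau>) \<partial>law b' N)))))
     \<le> (9 * \<epsilon> * u\<^sup>2 * K2 + 2 * p) + exp (u\<^sup>2 / 2 * K2) * (w * (3 + 2 * ((u\<^sup>2 / 2)\<^sup>2 * K3)))"
proof -
  interpret L: prob_space "law b N" by (rule prob_space_law)
  interpret L': prob_space "law b' N" by (rule prob_space_law)
  interpret P: pair_prob_space "law b N" "law b N" ..
  define Y where "Y = (\<lambda>b \<tau>. exp (- (u\<^sup>2 / 2 * qform b N (h \<tau>))))"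
  define e1 where "e1 = 9 * \<epsilon> * u\<^sup>2 * K2 + 2 * p"
  define W where "W = law b N \<Otimes>\<^sub>M law b N"
  have e': "\<epsilon> \<le> 1 / 2" using e by simp
  have Y01: "0 < Y d \<tau>" "Y d \<tau> \<le> 1" for d \<tau> unfolding Y_def using exp_qform_bounds by auto
  have iY: "integrable (law bb N) (Y d)" for bb d unfolding Y_def by (rule exp_qform_integrable)
  have iY2: "integrable (law bb N) (\<lambda>\<tau>. (Y d \<tau>)\<^sup>2)" for bb d
    using Y01[of d] borel_measurable_integrable[OF iY[of bb d]]
    by (intro law_integrable[where C = 1]) (auto simp: power_le_one less_imp_le)
  have iPhi: "integrable (law bb N) (Phi d u)" for bb d
    using Phi_le_1[of d u] Phi_meas[of d u bb] by (intro law_integrable[where C = 1]) auto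
  have iPhi2: "integrable (law bb N) (\<lambda>\<tau>. (Phi d u \<tau>)\<^sup>2)" for bb d
    using Phi_le_1[of d u] Phi_meas[of d u bb] by (intro law_integrable[where C = 1]) (auto simp: norm_power power_le_one)
  define m where "m = (\<integral>\<tau>. Y b \<tau> \<partial>law b' N)"
  define m' where "m' = (\<integral>\<tau>. Y b' \<tau> \<partial>law b N)"
  have phi_mean: "cmod ((\<integral>\<tau>. Phi d u \<tau> \<partial>law bb N) - of_real (\<integral>\<tau>. Y d \<tau> \<partial>law bb N)) \<le> e1" for bb d
  proof -
    have "(\<integral>\<tau>. Phi d u \<tau> \<partial>law bb N) - of_real (\<integral>\<tau>. Y d \<tau> \<partial>law bb N) = (\<integral>\<tau>. Phi d u \<tau> - of_real (Y d \<tau>) \<partial>law bb N)"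
      using iPhi[of bb d] iY[of bb d] by (simp add: Bochner_Integration.integral_diff)
    also have "cmod \<dots> \<le> (\<integral>\<tau>. cmod (Phi d u \<tau> - of_real (Y d \<tau>)) \<partial>law bb N)" by (rule integral_norm_bound)
    also have "\<dots> \<le> e1" unfolding Y_def e1_def by (rule Phi_mean_approx(1)[OF e(1) e' ub p])
    finally show ?thesis .
  qed
  have m01: "0 \<le> m" "m \<le> 1" "0 \<le> m'" "m' \<le> 1"
  proof -
    show "0 \<le> m" "0 \<le> m'" unfolding m_def m'_def using Y01 by (auto intro!: Bochner_Integration.integral_nonneg simp: less_imp_le)
    show "m \<le> 1" unfolding m_def using integral_mono[OF iY[of b' b], of "\<lambda>_. 1"] Y01 by (simp add: L'.prob_space)
    show "m' \<le> 1" unfolding m'_def using integral_mono[OF iY[of b b'], of "\<lambda>_. 1"] Y01 by (simp add: L.prob_space)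
  qed
  \<comment> \<open>Exchanging the ensembles leaves the mean of \<open>Phi\<close> unchanged, so the
    means of Y for the two assignments of roles differ by at most two approximation errors.\<close>
  have mm': "\<bar>m - m'\<bar> \<le> 2 * e1"
  proof -
    have "cmod (of_real m - of_real m') \<le> cmod ((\<integral>\<tau>. Phi b u \<tau> \<partial>law b' N) - of_real m') + cmod ((\<integral>\<tau>. Phi b u \<tau> \<partial>law b' N) - of_real m)"
      using norm_triangle_ineq4[of "(\<integral>\<tau>. Phi b u \<tau> \<partial>law b' N) - of_real m'" "(\<integral>\<tau>. Phi b u \<tau> \<partial>law b' N) - of_real m"] by simp
    also have "\<dots> \<le> e1 + e1"
      unfolding m_def m'_def using phi_mean[of b' b] phi_mean[of b b'] Phi_swap[of b' b u] by (intro add_mono) simp_all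
    finally show ?thesis by (simp flip: of_real_diff)
  qed
  have msq: "\<bar>m\<^sup>2 - m'\<^sup>2\<bar> \<le> 4 * e1"
  proof -
    have "\<bar>m\<^sup>2 - m'\<^sup>2\<bar> = \<bar>m - m'\<bar> * \<bar>m + m'\<bar>"
      by (simp add: power2_eq_square algebra_simps flip: abs_mult)
    also have "\<dots> \<le> 2 * e1 * 2" using mm' m01 by (intro mult_mono) auto
    finally show ?thesis by simp
  qed
  have A2: "cmod ((\<integral>\<tau>. (Phi b u \<tau>)\<^sup>2 \<partial>law b' N) - of_real (\<integral>\<tau>. (Y b \<tau>)\<^sup>2 \<partial>law b' N)) \<le> 2 * e1"
  proof -
    have "(\<integral>\<tau>. (Phi b u \<tau>)\<^sup>2 \<partial>law b' N) - of_real (\<integral>\<tau>. (Y b \<tau>)\<^sup>2 \<partial>law b' N) = (\<integral>\<tau>. (Phi b u \<tau>)\<^sup>2 - of_real ((Y b \<tau>)\<^sup>2) \<partial>law b' N)"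
      unfolding integral_complex_of_real[symmetric] using iPhi2[of b' b] iY2[of b' b]
      by (intro Bochner_Integration.integral_diff[symmetric]) (auto simp del: of_real_power)
    also have "cmod \<dots> \<le> (\<integral>\<tau>. cmod ((Phi b u \<tau>)\<^sup>2 - of_real ((Y b \<tau>)\<^sup>2)) \<partial>law b' N)" by (rule integral_norm_bound)
    also have "\<dots> \<le> (\<integral>\<tau>. 2 * cmod (Phi b u \<tau> - of_real (Y b \<tau>)) \<partial>law b' N)"
    proof (rule integral_mono)
      show "integrable (law b' N) (\<lambda>\<tau>. cmod ((Phi b u \<tau>)\<^sup>2 - of_real ((Y b \<tau>)\<^sup>2)))"
        using iPhi2[of b' b] iY2[of b' b] by (intro integrable_norm Bochner_Integration.integrable_diff) (auto simp del: of_real_power)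
      show "integrable (law b' N) (\<lambda>\<tau>. 2 * cmod (Phi b u \<tau> - of_real (Y b \<tau>)))"
        unfolding Y_def by (intro integrable_mult_right Phi_mean_approx(2)[OF e(1) e' ub p])
      fix \<tau>
      have "(Phi b u \<tau>)\<^sup>2 - of_real ((Y b \<tau>)\<^sup>2) = (Phi b u \<tau> + of_real (Y b \<tau>)) * (Phi b u \<tau> - of_real (Y b \<tau>))"
        by (simp add: power2_eq_square algebra_simps)
      moreover have "cmod (Phi b u \<tau> + of_real (Y b \<tau>)) \<le> 2"
        using norm_triangle_ineq[of "Phi b u \<tau>" "of_real (Y b \<tau>)"] Phi_le_1[of b u \<tau>] Y01[of b \<tau>] by simp
      ultimately show "cmod ((Phi b u \<tau>)\<^sup>2 - of_real ((Y b \<tau>)\<^sup>2)) \<le> 2 * cmod (Phi b u \<tau> - of_real (Y b \<tau>))"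
        by (simp add: norm_mult mult_right_mono)
    qed
    also have "\<dots> \<le> 2 * e1" unfolding e1_def Y_def using Phi_mean_approx(1)[OF e(1) e' ub p, of b' b] by simp
    finally show ?thesis .
  qed
  define E where "E = (\<lambda>z. exp (- (u\<^sup>2 / 2 * qform b' N (\<lambda>x. h (fst z) x + h (snd z) x))))"
  have bs: "bdd_meas (\<lambda>x. h \<tau> x + h \<tau>' x)" for \<tau> \<tau>' by (intro bdd_meas_add h_bdd)
  have E01: "0 < E z" "E z \<le> 1" for z unfolding E_def using qform_nonneg[OF bs] by auto
  have Em: "E \<in> borel_measurable W"
    unfolding E_def W_def using qform_sum_meas[of b' b b] by (simp add: case_prod_unfold)
  have iE: "integrable W E"
    unfolding W_def using E01 Em by (intro P.integrable_const_bound[of _ 1]) (auto simp: less_imp_le W_def)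
  have Pm: "(\<lambda>z. Psi b' u (fst z) (snd z)) \<in> borel_measurable W"
    unfolding W_def using Psi_meas[of b' u b b] by (simp add: case_prod_unfold)
  have iPsi: "integrable W (\<lambda>z. Psi b' u (fst z) (snd z))"
    unfolding W_def using Psi_le_1 Pm by (intro P.integrable_const_bound[of _ 1]) (auto simp: W_def)
  have A3: "(\<integral>\<tau>. (Phi b u \<tau>)\<^sup>2 \<partial>law b' N) = (\<integral>z. Psi b' u (fst z) (snd z) \<partial>W)"
    unfolding replica_identity W_def using P.integral_fst'[OF iPsi[unfolded W_def]] by simp
  note en = pair_marginals[OF prob_space_law law_integrable_sq(2)[of b], folded W_def]
  note cr = pair_marginals[OF prob_space_law law_integrable_sq(4)[of b A], folded W_def]
  have A4: "cmod ((\<integral>z. Psi b' u (fst z) (snd z) \<partial>W) - of_real (\<integral>z. E z \<partial>W)) \<le> 72 * \<epsilon> * u\<^sup>2 * K2 + 4 * p"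
  proof -
    have "(\<integral>z. Psi b' u (fst z) (snd z) \<partial>W) - of_real (\<integral>z. E z \<partial>W) = (\<integral>z. Psi b' u (fst z) (snd z) - of_real (E z) \<partial>W)"
      using iPsi iE by (simp add: Bochner_Integration.integral_diff)
    also have "cmod \<dots> \<le> (\<integral>z. cmod (Psi b' u (fst z) (snd z) - of_real (E z)) \<partial>W)" by (rule integral_norm_bound)
    also have "\<dots> \<le> (\<integral>z. 36 * \<epsilon> * u\<^sup>2 * (energy (fst z) + energy (snd z)) + 2 * (of_bool (crowded A (fst z)) + of_bool (crowded A (snd z))) \<partial>W)"
      unfolding E_def
      by (intro integral_mono Psi_approx[OF e ub] integrable_norm Bochner_Integration.integrable_diff Bochner_Integration.integrable_add
          integrable_mult_right integrable_of_real en cr iPsi iE[unfolded E_def])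
    also have "\<dots> = 36 * \<epsilon> * u\<^sup>2 * ((\<integral>z. energy (fst z) \<partial>W) + (\<integral>z. energy (snd z) \<partial>W)) + 2 * ((\<integral>z. of_bool (crowded A (fst z)) \<partial>W) + (\<integral>z. of_bool (crowded A (snd z)) \<partial>W))"
    proof -
      have *: "(\<integral>z. c * (f1 z + f2 z) + 2 * (f3 z + f4 z) \<partial>W) = c * ((\<integral>z. f1 z \<partial>W) + (\<integral>z. f2 z \<partial>W)) + 2 * ((\<integral>z. f3 z \<partial>W) + (\<integral>z. f4 z \<partial>W))"
        if "integrable W f1" "integrable W f2" "integrable W f3" "integrable W f4" for c :: real and f1 f2 f3 f4 :: "_ \<Rightarrow> real"
        using that by simp
      show ?thesis by (rule *[OF en(1,2) cr(1,2)])
    qed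
    also have "\<dots> \<le> 36 * \<epsilon> * u\<^sup>2 * (K2 + K2) + 2 * (p + p)"
      unfolding en cr using e law_integrable_sq(3)[of b] order.trans[OF crowded_prob p, of b] by (intro add_mono mult_left_mono) auto
    finally show ?thesis by (simp add: algebra_simps)
  qed
  note cross = cross_mean_bound[OF t, of b b', folded W_def]
  have iYY: "integrable W (\<lambda>z. Y b' (fst z) * Y b' (snd z))"
  proof -
    have "(\<lambda>z. Y b' (fst z) * Y b' (snd z)) \<in> borel_measurable W"
      using borel_measurable_integrable[OF pair_marginals(1)[OF prob_space_law iY[of b b']]]
        borel_measurable_integrable[OF pair_marginals(2)[OF prob_space_law iY[of b b']]]
      unfolding W_def by measurable
    then show ?thesis
      unfolding W_def using Y01[of b'] by (intro P.integrable_const_bound[of _ 1]) (auto simp: less_imp_le mult_le_one)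
  qed
  \<comment> \<open>Replacing the form of a sum by the sum of the forms costs the cross term, since
    \<open>exp(-x)\<close> has Lipschitz constant 1 on the half-line; what results is a product over
    the two independent copies.\<close>
  have A5: "\<bar>(\<integral>z. E z \<partial>W) - (\<integral>z. Y b' (fst z) * Y b' (snd z) \<partial>W)\<bar> \<le> u\<^sup>2 / 2 * t"
  proof -
    have "(\<integral>z. E z \<partial>W) - (\<integral>z. Y b' (fst z) * Y b' (snd z) \<partial>W) = (\<integral>z. E z - Y b' (fst z) * Y b' (snd z) \<partial>W)"
      using iE iYY by simp
    also have "\<bar>\<dots>\<bar> \<le> (\<integral>z. \<bar>E z - Y b' (fst z) * Y b' (snd z)\<bar> \<partial>W)" using integral_norm_bound[of W "\<lambda>z. E z - Y b' (fst z) * Y b' (snd z)"] by simp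
    also have "\<dots> \<le> (\<integral>z. u\<^sup>2 / 2 * \<bar>cross_diff b' z\<bar> \<partial>W)"
    proof (intro integral_mono integrable_mult_right cross)
      show "integrable W (\<lambda>z. \<bar>E z - Y b' (fst z) * Y b' (snd z)\<bar>)" using iE iYY by simp
      fix z
      define q1 q2 q3 where "q1 = qform b' N (\<lambda>x. h (fst z) x + h (snd z) x)" and "q2 = qform b' N (h (fst z))" and "q3 = qform b' N (h (snd z))"
      have q0: "0 \<le> q1" "0 \<le> q2" "0 \<le> q3" unfolding q1_def q2_def q3_def by (intro qform_nonneg bs h_bdd)+
      have D: "cross_diff b' z = q1 - q2 - q3"
        unfolding cross_diff_def q1_def q2_def q3_def case_prod_unfold by (simp add: add.commute)
      have "\<bar>exp (- (u\<^sup>2 / 2 * q1)) - exp (- (u\<^sup>2 / 2 * (q2 + q3)))\<bar> \<le> \<bar>u\<^sup>2 / 2 * q1 - u\<^sup>2 / 2 * (q2 + q3)\<bar>"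
        using q0 by (intro exp_neg_lipschitz mult_nonneg_nonneg) auto
      also have "\<bar>u\<^sup>2 / 2 * q1 - u\<^sup>2 / 2 * (q2 + q3)\<bar> = \<bar>u\<^sup>2 / 2 * (q1 - q2 - q3)\<bar>"
        by (simp only: right_diff_distrib distrib_left diff_diff_eq)
      also have "\<dots> = u\<^sup>2 / 2 * \<bar>cross_diff b' z\<bar>" unfolding D abs_mult by simp
      also have "exp (- (u\<^sup>2 / 2 * (q2 + q3))) = Y b' (fst z) * Y b' (snd z)"
        unfolding Y_def q2_def q3_def by (simp add: distrib_left add_divide_distrib flip: exp_add)
      finally show "\<bar>E z - Y b' (fst z) * Y b' (snd z)\<bar> \<le> u\<^sup>2 / 2 * \<bar>cross_diff b' z\<bar>"
        unfolding E_def q1_def .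
    qed
    also have "\<dots> \<le> u\<^sup>2 / 2 * t" using cross(2) by (simp add: mult_left_mono)
    finally show ?thesis .
  qed
  have A6: "(\<integral>z. Y b' (fst z) * Y b' (snd z) \<partial>W) = m'\<^sup>2"
  proof -
    have "(\<integral>z. Y b' (fst z) * Y b' (snd z) \<partial>W) = (\<integral>x. (\<integral>y. Y b' x * Y b' y \<partial>law b N) \<partial>law b N)"
      unfolding W_def using P.integral_fst'[OF iYY[unfolded W_def]] by simp
    then show ?thesis by (simp add: m'_def power2_eq_square)
  qed
  have var: "(\<integral>\<tau>. (Y b \<tau>)\<^sup>2 \<partial>law b' N) - m\<^sup>2 \<le> w\<^sup>2"
  proof -
    define a1 a2 a3 where "a1 = (\<integral>\<tau>. (Phi b u \<tau>)\<^sup>2 \<partial>law b' N)" and "a2 = (\<integral>\<tau>. (Y b \<tau>)\<^sup>2 \<partial>law b' N)" and "a3 = (\<integral>z. E z \<partial>W)"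
    have "cmod (of_real a2 - of_real a3) \<le> cmod (a1 - of_real a3) + cmod (a1 - of_real a2)"
      using norm_triangle_ineq4[of "a1 - of_real a3" "a1 - of_real a2"] by simp
    also have "\<dots> \<le> (72 * \<epsilon> * u\<^sup>2 * K2 + 4 * p) + 2 * e1"
      using A2 A4 unfolding A3[symmetric] a1_def a2_def a3_def by (intro add_mono) simp_all
    finally have "\<bar>a2 - a3\<bar> \<le> (72 * \<epsilon> * u\<^sup>2 * K2 + 4 * p) + 2 * e1" by (simp flip: of_real_diff)
    moreover have "\<bar>a3 - m'\<^sup>2\<bar> \<le> u\<^sup>2 / 2 * t" using A5 unfolding A6 a3_def .
    ultimately have "a2 - m\<^sup>2 \<le> (72 * \<epsilon> * u\<^sup>2 * K2 + 4 * p) + 2 * e1 + u\<^sup>2 / 2 * t + 4 * e1"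
      using msq by linarith
    also have "\<dots> \<le> w\<^sup>2" using w(2) unfolding e1_def by linarith
    finally show ?thesis by (simp add: a2_def)
  qed
  \<comment> \<open>The second moment required for concentration is that of Q, which is at most the
    energy.\<close>
  have conc: "\<bar>m - exp (- (\<integral>\<tau>. u\<^sup>2 / 2 * qform b N (h \<tau>) \<partial>law b' N))\<bar> \<le> exp (u\<^sup>2 / 2 * K2) * (w * (3 + 2 * ((u\<^sup>2 / 2)\<^sup>2 * K3)))"
    unfolding m_def Y_def
  proof (rule exp_concentration[OF prob_space_law])
    have q2: "(u\<^sup>2 / 2 * qform b N (h \<tau>))\<^sup>2 \<le> (u\<^sup>2 / 2)\<^sup>2 * (energy \<tau>)\<^sup>2" for \<tau>
    proof -
      have "(qform b N (h \<tau>))\<^sup>2 \<le> (energy \<tau>)\<^sup>2"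
        by (rule power_mono[OF qform_le qform_nonneg[OF h_bdd]])
      from mult_left_mono[OF this, of "(u\<^sup>2 / 2)\<^sup>2"] show ?thesis
        unfolding power_mult_distrib[of "u\<^sup>2 / 2" "qform b N (h \<tau>)"] by simp
    qed
    show qm: "(\<lambda>\<tau>. u\<^sup>2 / 2 * qform b N (h \<tau>)) \<in> borel_measurable (law b' N)" by measurable
    show "0 \<le> u\<^sup>2 / 2 * qform b N (h \<tau>)" for \<tau>
      using qform_nonneg[OF h_bdd[of \<tau>], where b = b and N = N] by simp
    have iq2: "integrable (law b' N) (\<lambda>\<tau>. (u\<^sup>2 / 2)\<^sup>2 * (energy \<tau>)\<^sup>2)"
      by (intro integrable_mult_right energy_sq_mean(1))
    show i: "integrable (law b' N) (\<lambda>\<tau>. (u\<^sup>2 / 2 * qform b N (h \<tau>))\<^sup>2)"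
    proof (rule Bochner_Integration.integrable_bound[OF iq2])
      show "(\<lambda>\<tau>. (u\<^sup>2 / 2 * qform b N (h \<tau>))\<^sup>2) \<in> borel_measurable (law b' N)" using qm by measurable
      show "AE \<tau> in law b' N. norm ((u\<^sup>2 / 2 * qform b N (h \<tau>))\<^sup>2) \<le> norm ((u\<^sup>2 / 2)\<^sup>2 * (energy \<tau>)\<^sup>2)"
        using q2 by (intro AE_I2) (simp only: real_norm_def abs_of_nonneg[OF zero_le_power2] abs_of_nonneg[OF mult_nonneg_nonneg[OF zero_le_power2 zero_le_power2]])
    qed
    show "(\<integral>\<tau>. u\<^sup>2 / 2 * qform b N (h \<tau>) \<partial>law b' N) \<le> u\<^sup>2 / 2 * K2"
      using qform_h_mean_le[of b' b] by (simp add: mult_left_mono)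
    have "(\<integral>\<tau>. (u\<^sup>2 / 2 * qform b N (h \<tau>))\<^sup>2 \<partial>law b' N) \<le> (\<integral>\<tau>. (u\<^sup>2 / 2)\<^sup>2 * (energy \<tau>)\<^sup>2 \<partial>law b' N)"
      by (rule integral_mono[OF i iq2 q2])
    also have "\<dots> = (u\<^sup>2 / 2)\<^sup>2 * (\<integral>\<tau>. (energy \<tau>)\<^sup>2 \<partial>law b' N)" by (rule integral_mult_right_zero)
    also have "\<dots> \<le> (u\<^sup>2 / 2)\<^sup>2 * K3" by (intro mult_left_mono energy_sq_mean(2)) simp
    finally show "(\<integral>\<tau>. (u\<^sup>2 / 2 * qform b N (h \<tau>))\<^sup>2 \<partial>law b' N) \<le> (u\<^sup>2 / 2)\<^sup>2 * K3" .
    show "0 < w" by (rule w)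
    show "(\<integral>\<tau>. (exp (- (u\<^sup>2 / 2 * qform b N (h \<tau>))))\<^sup>2 \<partial>law b' N) - (\<integral>\<tau>. exp (- (u\<^sup>2 / 2 * qform b N (h \<tau>))) \<partial>law b' N)\<^sup>2 \<le> w\<^sup>2"
      using var unfolding m_def Y_def .
  qed
  define s where "s = exp (- (\<integral>\<tau>. u\<^sup>2 / 2 * qform b N (h \<tau>) \<partial>law b' N))"
  define I where "I = (\<integral>\<tau>. Phi b u \<tau> \<partial>law b' N)"
  have "cmod (I - of_real s) \<le> cmod (I - of_real m) + cmod (of_real (m - s))"
    using norm_triangle_ineq[of "I - of_real m" "of_real (m - s)"] by simp
  also have "\<dots> \<le> e1 + exp (u\<^sup>2 / 2 * K2) * (w * (3 + 2 * ((u\<^sup>2 / 2)\<^sup>2 * K3)))"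
    using phi_mean[of b' b] conc unfolding norm_of_real I_def s_def m_def by (rule add_mono)
  finally show ?thesis unfolding I_def s_def e1_def integral_mult_right_zero .
qed

end

section \<open>Rescaled test functions\<close>

text \<open>Chord against arc: \<open>|cis d - 1| = 2 sin(|d|/2)\<close>, and the cubic Taylor bound
  gives sin x \<ge> x / 3 up to pi/2. The crude constant 3 enters only the Lipschitz constant of the
  periodised function.\<close>

lemma abs_le_cmod_cis_diff:
  assumes "\<bar>d\<bar> \<le> pi" shows "\<bar>d\<bar> \<le> 3 * cmod (cis d - 1)"
proof -
  define x where "x = \<bar>d\<bar> / 2"
  have x: "0 \<le> x" "x \<le> pi / 2" using assms by (auto simp: x_def)
  have im: "Im (iexp x) = sin x" by (simp flip: cis_conv_exp)
  have "\<bar>sin x - x\<bar> \<le> x ^ 3 / 6"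
    using im order.trans[OF abs_Im_le_cmod iexp_approx1[of x 2]] x(1)
    by (simp add: numeral_2_eq_2 numeral_3_eq_3 One_nat_def fact_numeral algebra_simps power2_eq_square)
  moreover have "x ^ 3 / 6 \<le> 2 / 3 * x"
  proof -
    have "x \<le> 2" using x(2) pi_less_4 by linarith
    then have "x * x \<le> 2 * 2" using x(1) by (intro mult_mono) auto
    then have "x * (x * x) \<le> x * 4" using x(1) by (intro mult_left_mono) auto
    then show ?thesis by (simp add: power3_eq_cube)
  qed
  ultimately have s: "x / 3 \<le> sin x" by linarith
  have "(cmod (cis d - 1))\<^sup>2 = 2 - 2 * cos d"
    unfolding cmod_power2 using sin_cos_squared_add[of d] by (simp add: power2_eq_square algebra_simps)
  also have "cos d = 1 - 2 * (sin x)\<^sup>2"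
    using cos_double_sin[of x] by (simp add: x_def)
  finally have "(cmod (cis d - 1))\<^sup>2 = (2 * sin x)\<^sup>2" by (simp add: power2_eq_square)
  moreover have "(2 * x / 3)\<^sup>2 \<le> (2 * sin x)\<^sup>2" using s x(1) by (intro power_mono) auto
  ultimately have "2 * x / 3 \<le> cmod (cis d - 1)" by (metis norm_ge_zero power2_le_imp_le)
  then show ?thesis by (simp add: x_def)
qed

lemma reduce_mod_2pi:
  obtains m :: int where "- pi \<le> x - 2 * pi * real_of_int m" "x - 2 * pi * real_of_int m < pi"
proof -
  define m where "m = \<lfloor>(x + pi) / (2 * pi)\<rfloor>"
  have "real_of_int m \<le> (x + pi) / (2 * pi)" "(x + pi) / (2 * pi) < real_of_int m + 1" unfolding m_def by linarith+
  then show ?thesis by (intro that[of m]) (auto simp: field_simps)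
qed

lemma floor_mod_2pi:
  assumes "- pi \<le> y" "y < pi" shows "\<lfloor>(y + 2 * pi * real_of_int m + pi) / (2 * pi)\<rfloor> = m"
  using assms by (intro floor_unique) (auto simp: field_simps)

text \<open>The data drawn from an even test function: a support radius and a Lipschitz constant.
  The latter gives decay of order 1/|t| for the Fourier transform, so that its square has an
  integrable majorant.\<close>

locale test_function =
  fixes f :: "real \<Rightarrow> real" and R Lf :: real
  assumes R: "0 < R" and supp: "\<And>x. R \<le> \<bar>x\<bar> \<Longrightarrow> f x = 0" and even: "\<And>x. f (- x) = f x"
    and lip: "\<And>x y. \<bar>f x - f y\<bar> \<le> Lf * \<bar>x - y\<bar>"
begin

lemma Lf: "0 \<le> Lf"
  using order.trans[OF abs_ge_zero lip[of 1 0]] by simp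

lemma f_cont: "continuous_on UNIV f"
proof (rule continuous_on_subset[OF _ subset_UNIV])
  have "Lf-lipschitz_on UNIV f" using lip Lf by (auto simp: lipschitz_on_def dist_real_def)
  then show "continuous_on UNIV f" by (rule lipschitz_on_continuous_on)
qed

lemma f_meas [measurable]: "f \<in> borel_measurable borel"
  by (rule borel_measurable_continuous_onI[OF f_cont])

definition "Fm = Lf * R"

lemma Fm: "0 \<le> Fm" "\<bar>f x\<bar> \<le> Fm" "\<bar>f x\<bar> \<le> Fm * indicator {- R..R} x"
proof -
  show 0: "0 \<le> Fm" using Lf R by (simp add: Fm_def)
  show 1: "\<bar>f x\<bar> \<le> Fm"
  proof (cases "\<bar>x\<bar> < R")
    case False
    then show ?thesis using supp[of x] 0 by simp
  next
    case True
    have "\<bar>f x\<bar> \<le> Lf * \<bar>x - (if 0 \<le> x then R else - R)\<bar>"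
      using lip[of x "if 0 \<le> x then R else - R"] supp[of R] supp[of "- R"] R by (auto split: if_splits)
    also have "\<dots> \<le> Lf * R" using Lf True by (intro mult_left_mono) auto
    finally show ?thesis by (simp add: Fm_def)
  qed
  show "\<bar>f x\<bar> \<le> Fm * indicator {- R..R} x"
    using 1 supp[of x] by (cases "x \<in> {- R..R}") (auto simp: indicator_def)
qed

lemma bounded_supp_integrable:
  fixes F :: "real \<Rightarrow> 'a::{second_countable_topology, banach}"
  assumes "F \<in> borel_measurable borel" "\<And>x. norm (F x) \<le> C * indicator {- R..R} x"
  shows "integrable lborel F"
proof (rule Bochner_Integration.integrable_bound[of _ "\<lambda>x. C * indicator {- R..R} x"])
  show "integrable lborel (\<lambda>x. C * indicator {- R..R} x :: real)"
    using R by (intro integrable_mult_right integrable_real_indicator) auto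
  show "AE x in lborel. norm (F x) \<le> norm (C * indicator {- R..R} x)"
    using assms(2) by (auto intro: order.trans[OF _ abs_ge_self])
qed (use assms in simp)

lemma f_integrable: "integrable lborel f" "integrable lborel (\<lambda>x. \<bar>f x\<bar>)" "integrable lborel (\<lambda>x. (f x)\<^sup>2)"
proof -
  show 1: "integrable lborel f" using Fm(3) by (intro bounded_supp_integrable[of f Fm]) auto
  show "integrable lborel (\<lambda>x. \<bar>f x\<bar>)" using 1 by simp
  have "(f x)\<^sup>2 \<le> Fm\<^sup>2 * indicator {- R..R} x" for x
  proof (cases "x \<in> {- R..R}")
    case True
    then show ?thesis using power_mono[OF Fm(2)[of x] abs_ge_zero, of 2] by simp
  next
    case False
    then show ?thesis using supp[of x] by auto
  qed
  then show "integrable lborel (\<lambda>x. (f x)\<^sup>2)" by (intro bounded_supp_integrable[of _ "Fm\<^sup>2"]) auto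
qed

section \<open>Decay and continuity of the Fourier transform\<close>

abbreviation "fh \<equiv> fourier_transform f"

lemma fourier_integrable: "integrable lborel (\<lambda>x. complex_of_real (f x) * cis (- (t * x)))"
  using Fm(3) by (intro bounded_supp_integrable[of _ Fm]) (auto simp: norm_mult)

lemma fourier_eq: "fh t = of_real (1 / sqrt (2 * pi)) * (\<integral>x. complex_of_real (f x) * cis (- (t * x)) \<partial>lborel)"
  by (simp add: fourier_transform_def cis_conv_exp)

lemma fourier_uminus: "cmod (fh (- t)) = cmod (fh t)"
proof -
  have "(\<integral>x. complex_of_real (f x) * cis (- (- t * x)) \<partial>lborel) = (\<integral>x. cnj (complex_of_real (f x) * cis (- (t * x))) \<partial>lborel)"
    by (simp add: cis_cnj)
  also have "\<dots> = cnj (\<integral>x. complex_of_real (f x) * cis (- (t * x)) \<partial>lborel)"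
    by (rule Bochner_Integration.integral_cnj)
  finally show ?thesis by (simp only: fourier_eq norm_mult complex_mod_cnj)
qed

definition "Cf = (\<integral>x. \<bar>f x\<bar> \<partial>lborel)"

lemma Cf: "0 \<le> Cf" unfolding Cf_def by simp

lemma fourier_bound: "cmod (fh t) \<le> Cf"
proof -
  have "cmod (\<integral>x. complex_of_real (f x) * cis (- (t * x)) \<partial>lborel) \<le> (\<integral>x. cmod (complex_of_real (f x) * cis (- (t * x))) \<partial>lborel)"
    by (rule integral_norm_bound)
  also have "\<dots> = Cf" by (simp add: norm_mult Cf_def)
  finally have a: "cmod (\<integral>x. complex_of_real (f x) * cis (- (t * x)) \<partial>lborel) \<le> Cf" .
  have "1 \<le> sqrt (2 * pi)" using pi_gt3 by simp
  then have "1 / sqrt (2 * pi) \<le> 1" by simp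
  then have "1 / sqrt (2 * pi) * cmod (\<integral>x. complex_of_real (f x) * cis (- (t * x)) \<partial>lborel) \<le> 1 * Cf"
    using a by (intro mult_mono) auto
  then show ?thesis unfolding fourier_eq by (simp add: norm_mult norm_divide)
qed

text \<open>Translation by \<open>s = pi / t\<close> flips the sign of the oscillating factor, so
  twice the integral is that of f minus its translate. The difference is at most
  \<open>Lf |s|\<close> and vanishes outside two intervals of length 2 R.\<close>

lemma fourier_decay: "t \<noteq> 0 \<Longrightarrow> cmod (fh t) \<le> (2 * R * Lf * pi) / \<bar>t\<bar>"
proof -
  assume t: "t \<noteq> 0"
  define s where "s = pi / t"
  define I where "I = (\<integral>x. complex_of_real (f x) * cis (- (t * x)) \<partial>lborel)"
  have i2: "integrable lborel (\<lambda>x. complex_of_real (f (x - s)) * cis (- (t * x)))"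
  proof -
    have "integrable lborel (\<lambda>x. complex_of_real (f ((- s) + 1 * x)) * cis (- (t * (- s + 1 * x))))"
      by (rule lborel_integrable_real_affine[OF fourier_integrable]) simp
    then have "integrable lborel (\<lambda>x. cis (- (t * s)) * (complex_of_real (f ((- s) + 1 * x)) * cis (- (t * (- s + 1 * x)))))"
      by (intro integrable_mult_right)
    moreover have eq: "cis (- (t * s)) * (complex_of_real (f ((- s) + 1 * x)) * cis (- (t * (- s + 1 * x)))) = complex_of_real (f (x - s)) * cis (- (t * x))" for x
    proof -
      have "cis (- (t * s)) * cis (- (t * (- s + 1 * x))) = cis (- (t * x))" by (simp add: cis_mult algebra_simps)
      then show ?thesis by (simp add: mult.left_commute)
    qed
    ultimately show ?thesis by (simp only: eq)
  qed
  have "(\<integral>x. complex_of_real (f (x - s)) * cis (- (t * x)) \<partial>lborel) = (\<integral>x. complex_of_real (f ((s + x) - s)) * cis (- (t * (s + x))) \<partial>lborel)"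
    by (rule lborel_integral_shift)
  also have "\<dots> = (\<integral>x. - (complex_of_real (f x) * cis (- (t * x))) \<partial>lborel)"
  proof (intro Bochner_Integration.integral_cong refl)
    fix x
    have "cis (- (t * (s + x))) = cis (- pi) * cis (- (t * x))" using t by (simp add: s_def cis_mult algebra_simps)
    moreover have "cis (- pi) = - 1" by (simp add: complex_eq_iff)
    ultimately show "complex_of_real (f ((s + x) - s)) * cis (- (t * (s + x))) = - (complex_of_real (f x) * cis (- (t * x)))"
      by simp
  qed
  also have "\<dots> = - I" by (simp add: I_def)
  finally have e: "2 * I = (\<integral>x. complex_of_real (f x) * cis (- (t * x)) - complex_of_real (f (x - s)) * cis (- (t * x)) \<partial>lborel)"
    using fourier_integrable i2 by (simp add: I_def)
  have ii: "integrable lborel (indicator {- R..R} :: real \<Rightarrow> real)" using R by (intro integrable_real_indicator) auto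
  have ish: "integrable lborel (\<lambda>x. indicator {- R..R} (x - s) :: real)"
    using lborel_integrable_real_affine[OF ii, of 1 "- s"] by simp
  have Is: "(\<integral>x. indicator {- R..R} (x - s) \<partial>lborel) = 2 * R"
    using lborel_integral_shift[of "\<lambda>x. indicator {- R..R} (x - s) :: real" s] R by simp
  have Ii: "(\<integral>x. indicator {- R..R} x \<partial>lborel) = 2 * R" using R by simp
  have "cmod (2 * I) \<le> (\<integral>x. cmod (complex_of_real (f x) * cis (- (t * x)) - complex_of_real (f (x - s)) * cis (- (t * x))) \<partial>lborel)"
    unfolding e by (rule integral_norm_bound)
  also have "\<dots> \<le> (\<integral>x. Lf * \<bar>s\<bar> * (indicator {- R..R} x + indicator {- R..R} (x - s)) \<partial>lborel)"
  proof (rule integral_mono)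
    show "integrable lborel (\<lambda>x. cmod (complex_of_real (f x) * cis (- (t * x)) - complex_of_real (f (x - s)) * cis (- (t * x))))"
      by (intro integrable_norm Bochner_Integration.integrable_diff fourier_integrable i2)
    show "integrable lborel (\<lambda>x. Lf * \<bar>s\<bar> * (indicator {- R..R} x + indicator {- R..R} (x - s)) :: real)"
      using ii ish by simp
    fix x
    have "cmod (complex_of_real (f x) * cis (- (t * x)) - complex_of_real (f (x - s)) * cis (- (t * x))) = \<bar>f x - f (x - s)\<bar>"
      unfolding left_diff_distrib[symmetric] norm_mult by (simp flip: of_real_diff)
    also have "\<dots> \<le> Lf * \<bar>s\<bar> * (indicator {- R..R} x + indicator {- R..R} (x - s))"
    proof (cases "x \<in> {- R..R} \<or> x - s \<in> {- R..R}")
      case True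
      have "\<bar>f x - f (x - s)\<bar> \<le> Lf * \<bar>s\<bar> * 1" using lip[of x "x - s"] by simp
      also have "\<dots> \<le> Lf * \<bar>s\<bar> * (indicator {- R..R} x + indicator {- R..R} (x - s))"
        using True Lf by (intro mult_left_mono) (auto simp: indicator_def)
      finally show ?thesis .
    next
      case False
      then have "f x = 0" "f (x - s) = 0" by (auto intro!: supp)
      then show ?thesis using Lf by simp
    qed
    finally show "cmod (complex_of_real (f x) * cis (- (t * x)) - complex_of_real (f (x - s)) * cis (- (t * x))) \<le> Lf * \<bar>s\<bar> * (indicator {- R..R} x + indicator {- R..R} (x - s))" .
  qed
  also have "\<dots> = Lf * \<bar>s\<bar> * (2 * R + 2 * R)"
    unfolding integral_mult_right_zero using ii ish Is Ii by simp
  also have "\<dots> = 2 * (2 * R * Lf * pi / \<bar>t\<bar>)" by (simp add: s_def abs_divide algebra_simps)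
  finally have "2 * cmod I \<le> 2 * (2 * R * Lf * pi / \<bar>t\<bar>)" by (simp only: norm_mult norm_numeral)
  then have I: "cmod I \<le> 2 * R * Lf * pi / \<bar>t\<bar>" by linarith
  have "1 \<le> sqrt (2 * pi)" using pi_gt3 by simp
  then have "1 / sqrt (2 * pi) \<le> 1" by simp
  then have "1 / sqrt (2 * pi) * cmod I \<le> 1 * (2 * R * Lf * pi / \<bar>t\<bar>)"
    using I by (intro mult_mono) auto
  then show ?thesis unfolding fourier_eq I_def by (simp add: norm_mult norm_divide)
qed

lemma fourier_cont: "continuous_on UNIV fh"
proof -
  have "isCont (\<lambda>t. \<integral>x. complex_of_real (f x) * cis (- (t * x)) \<partial>lborel) t" for t
  proof (rule continuous_at_sequentiallyI)
    fix u :: "nat \<Rightarrow> real" assume u: "u \<longlonglongrightarrow> t"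
    show "(\<lambda>n. \<integral>x. complex_of_real (f x) * cis (- (u n * x)) \<partial>lborel) \<longlonglongrightarrow> (\<integral>x. complex_of_real (f x) * cis (- (t * x)) \<partial>lborel)"
    proof (rule integral_dominated_convergence[where w = "\<lambda>x. \<bar>f x\<bar>"])
      show "AE x in lborel. (\<lambda>n. complex_of_real (f x) * cis (- (u n * x))) \<longlonglongrightarrow> complex_of_real (f x) * cis (- (t * x))"
        unfolding cis_conv_exp by (intro AE_I2 tendsto_intros u)
    qed (auto simp: norm_mult f_integrable)
  qed
  then have "continuous_on UNIV (\<lambda>t. of_real (1 / sqrt (2 * pi)) * (\<integral>x. complex_of_real (f x) * cis (- (t * x)) \<partial>lborel))"
    by (intro continuous_intros) (simp add: continuous_on_eq_continuous_at)
  then show ?thesis unfolding fourier_eq[abs_def] .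
qed

definition "spec t = (cmod (fh t))\<^sup>2"

lemma spec_nonneg: "0 \<le> spec t" by (simp add: spec_def)

lemma spec_even: "spec (- t) = spec t" by (simp add: spec_def fourier_uminus)

definition "Cs = 2 * (Cf\<^sup>2 + (2 * R * Lf * pi)\<^sup>2)"

lemma Cs: "0 \<le> Cs" by (simp add: Cs_def)

lemma spec_decay: "spec t \<le> Cs / (1 + t\<^sup>2)"
proof -
  have 1: "spec t \<le> Cf\<^sup>2"
    unfolding spec_def by (intro power_mono fourier_bound) simp
  have 2: "spec t * t\<^sup>2 \<le> (2 * R * Lf * pi)\<^sup>2"
  proof (cases "t = 0")
    case False
    have "spec t * t\<^sup>2 \<le> ((2 * R * Lf * pi) / \<bar>t\<bar>)\<^sup>2 * t\<^sup>2"
      unfolding spec_def by (intro mult_right_mono power_mono fourier_decay False) auto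
    also have "\<dots> = (2 * R * Lf * pi)\<^sup>2" using False by (simp add: power_divide)
    finally show ?thesis .
  qed simp
  have "spec t * (1 + t\<^sup>2) \<le> Cf\<^sup>2 + (2 * R * Lf * pi)\<^sup>2"
    using 1 2 by (simp add: distrib_left)
  also have "\<dots> \<le> Cs" by (simp add: Cs_def)
  finally show ?thesis by (simp add: pos_le_divide_eq add_pos_nonneg)
qed

lemma spec_cont: "continuous_on UNIV spec"
  unfolding spec_def[abs_def] by (intro continuous_intros fourier_cont)

end

section \<open>Convergence of the variance\<close>

lemma integrable_inverse_one_plus_square: "integrable lborel (\<lambda>t::real. 1 / (1 + t\<^sup>2))"
proof -
  have "set_integrable lborel UNIV (\<lambda>t::real. inverse (1 + t\<^sup>2))"
    using integrable_inverse_1_plus_square by simp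
  then show ?thesis by (simp add: set_integrable_def inverse_eq_divide)
qed

text \<open>The sum is the integral of the step function S that evaluates G at the right end of each
  cell of length 1/N. The right end is at least t, so S inherits the decreasing majorant, and
  dominated convergence applies on the whole half-line.\<close>

lemma riemann_sum_limit:
  fixes G :: "real \<Rightarrow> real"
  assumes cont: "continuous_on UNIV G" and G0: "\<And>t. 0 \<le> G t" and GC: "\<And>t. G t \<le> C / (1 + t\<^sup>2)"
  shows "\<And>N. 0 < N \<Longrightarrow> summable (\<lambda>k. G (real (Suc k) / real N) / real N)"
    and "(\<lambda>N. \<Sum>k. G (real (Suc k) / real N) / real N) \<longlonglongrightarrow> (\<integral>t. indicator {0<..} t * G t \<partial>lborel)"
proof -
  have C0: "0 \<le> C" using order.trans[OF G0[of 0] GC[of 0]] by simp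
  have [measurable]: "G \<in> borel_measurable borel" by (rule borel_measurable_continuous_onI[OF cont])
  define S where "S = (\<lambda>N t. indicator {0<..} t * G (real_of_int \<lceil>t * real N\<rceil> / real N))"
  have Sm [measurable]: "S N \<in> borel_measurable borel" for N
    unfolding S_def by measurable
  have SC: "S N t \<le> C * (1 / (1 + t\<^sup>2))" "0 \<le> S N t" if "0 < N" for N t
  proof -
    show "0 \<le> S N t" unfolding S_def using G0 by simp
    show "S N t \<le> C * (1 / (1 + t\<^sup>2))"
    proof (cases "0 < t")
      case True
      define s where "s = real_of_int \<lceil>t * real N\<rceil> / real N"
      have "t = t * real N / real N" using that by simp
      also have "\<dots> \<le> s" unfolding s_def by (intro divide_right_mono) auto
      finally have ts: "t \<le> s" .
      have "t\<^sup>2 \<le> s\<^sup>2" using True ts by (intro power_mono) auto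
      then have "C / (1 + s\<^sup>2) \<le> C / (1 + t\<^sup>2)"
        using C0 by (intro divide_left_mono) (auto intro!: mult_pos_pos add_pos_nonneg)
      with GC[of s] True show ?thesis by (simp add: S_def s_def)
    next
      case False
      then show ?thesis using C0 by (simp add: S_def)
    qed
  qed
  have iC: "integrable lborel (\<lambda>t::real. C * (1 / (1 + t\<^sup>2)))"
    by (intro integrable_mult_right integrable_inverse_one_plus_square)
  have iS: "integrable lborel (S N)" if "0 < N" for N
  proof (rule Bochner_Integration.integrable_bound[OF iC])
    show "AE t in lborel. norm (S N t) \<le> norm (C * (1 / (1 + t\<^sup>2)))"
    proof (intro AE_I2)
      fix t
      show "norm (S N t) \<le> norm (C * (1 / (1 + t\<^sup>2)))"
        unfolding real_norm_def abs_of_nonneg[OF SC(2)[OF that]] by (rule order.trans[OF SC(1)[OF that] abs_ge_self])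
    qed
  qed simp
  have sums: "(\<lambda>k. G (real (Suc k) / real N) / real N) sums (\<integral>t. S N t \<partial>lborel)" if N: "0 < N" for N
  proof -
    define I where "I = (\<lambda>k. {real k / real N<..real (Suc k) / real N})"
    define T where "T = (\<lambda>k t. indicator (I k) t * G (real (Suc k) / real N))"
    \<comment> \<open>The cells are open on the left and closed on the right, so every t > 0 lies in
      exactly one of them, found by the ceiling.\<close>
    have uniq: "t \<in> I k \<longleftrightarrow> 0 < t \<and> nat (\<lceil>t * real N\<rceil> - 1) = k" for t k
    proof -
      have "t \<in> I k \<longleftrightarrow> real k < t * real N \<and> t * real N \<le> real (Suc k)"
        unfolding I_def using N by (simp add: field_simps)
      also have "\<dots> \<longleftrightarrow> \<lceil>t * real N\<rceil> = int k + 1"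
        by (subst ceiling_eq_iff) auto
      also have "\<dots> \<longleftrightarrow> 0 < t \<and> nat (\<lceil>t * real N\<rceil> - 1) = k"
      proof
        assume a: "\<lceil>t * real N\<rceil> = int k + 1"
        then have "0 < t * real N" by (metis less_ceiling_iff of_int_0 of_nat_0_le_iff zle_add1_eq_le add.commute int_one_le_iff_zero_less of_nat_less_0_iff linorder_not_less zero_less_one_class.zero_le_one ceiling_le_zero add_nonneg_pos zero_less_one not_le)
        then show "0 < t \<and> nat (\<lceil>t * real N\<rceil> - 1) = k" using a N by (simp add: zero_less_mult_iff)
      next
        assume a: "0 < t \<and> nat (\<lceil>t * real N\<rceil> - 1) = k"
        then have "0 < \<lceil>t * real N\<rceil>" using N by simp
        then show "\<lceil>t * real N\<rceil> = int k + 1" using a by auto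
      qed
      finally show ?thesis .
    qed
    have Ts: "(\<lambda>k. T k t) sums S N t" for t
    proof -
      define k0 where "k0 = nat (\<lceil>t * real N\<rceil> - 1)"
      have "(\<lambda>k. T k t) sums (\<Sum>k\<in>{k0}. T k t)"
      proof (rule sums_finite)
        fix k assume "k \<notin> {k0}"
        then have "t \<notin> I k" unfolding uniq k0_def by auto
        then show "T k t = 0" by (simp add: T_def)
      qed simp
      moreover have "T k0 t = S N t"
      proof (cases "0 < t")
        case True
        then have "0 < \<lceil>t * real N\<rceil>" using N by simp
        then have "real_of_int \<lceil>t * real N\<rceil> = real (Suc k0)" unfolding k0_def by linarith
        moreover have "t \<in> I k0" using True by (simp add: uniq k0_def)
        ultimately show ?thesis using True by (simp add: T_def S_def)
      next
        case False
        then have "t \<notin> I k0" by (simp add: uniq)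
        then show ?thesis using False by (simp add: T_def S_def)
      qed
      ultimately show ?thesis by simp
    qed
    have T0: "0 \<le> T k t" for k t unfolding T_def using G0 by simp
    have iI: "integrable lborel (indicator (I k) :: real \<Rightarrow> real)" for k
      unfolding I_def using N by (intro integrable_real_indicator) (auto simp: divide_right_mono)
    have iT: "integrable lborel (T k)" for k
      unfolding T_def by (intro integrable_mult_left iI)
    have TI: "(\<integral>t. T k t \<partial>lborel) = G (real (Suc k) / real N) / real N" for k
    proof -
      have "(\<integral>t. T k t \<partial>lborel) = measure lborel (I k) * G (real (Suc k) / real N)"
        unfolding T_def by simp
      also have "measure lborel (I k) = real (Suc k) / real N - real k / real N"
        unfolding I_def using N by (simp add: divide_right_mono)
      finally show ?thesis using N by (simp add: diff_divide_distrib[symmetric])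
    qed
    have sm: "summable (\<lambda>k. \<integral>t. norm (T k t) \<partial>lborel)"
    proof (rule summableI_nonneg_bounded[where x = "\<integral>t. S N t \<partial>lborel"])
      fix n
      have "(\<Sum>k<n. \<integral>t. norm (T k t) \<partial>lborel) = (\<integral>t. (\<Sum>k<n. T k t) \<partial>lborel)"
        using T0 iT by (simp add: Bochner_Integration.integral_sum)
      also have "\<dots> \<le> (\<integral>t. S N t \<partial>lborel)"
      proof (intro integral_mono Bochner_Integration.integrable_sum iT iS N)
        fix t
        show "(\<Sum>k<n. T k t) \<le> S N t"
          using sum_le_suminf[OF sums_summable[OF Ts], of "{..<n}"] T0 sums_unique[OF Ts] by simp
      qed
      finally show "(\<Sum>k<n. \<integral>t. norm (T k t) \<partial>lborel) \<le> (\<integral>t. S N t \<partial>lborel)" .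
    qed simp
    have "AE t in lborel. summable (\<lambda>k. norm (T k t))"
      unfolding real_norm_def abs_of_nonneg[OF T0] by (intro AE_I2 sums_summable[OF Ts])
    from sums_integral[OF iT this sm] show ?thesis
      unfolding TI sums_unique[OF Ts, symmetric] .
  qed
  show "summable (\<lambda>k. G (real (Suc k) / real N) / real N)" if "0 < N" for N
    using sums[OF that] by (rule sums_summable)
  \<comment> \<open>The majorant holds for N > 0, so convergence is proved along
    \<open>Suc n\<close>.\<close>
  have "(\<lambda>n. \<integral>t. S (Suc n) t \<partial>lborel) \<longlonglongrightarrow> (\<integral>t. indicator {0<..} t * G t \<partial>lborel)"
  proof (rule integral_dominated_convergence[OF _ _ iC])
    show "AE t in lborel. (\<lambda>n. S (Suc n) t) \<longlonglongrightarrow> indicator {0<..} t * G t"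
    proof (intro AE_I2)
      fix t :: real
      have "(\<lambda>n. real_of_int \<lceil>t * real (Suc n)\<rceil> / real (Suc n)) \<longlonglongrightarrow> t"
      proof (rule tendsto_sandwich)
        show "\<forall>\<^sub>F n in sequentially. t \<le> real_of_int \<lceil>t * real (Suc n)\<rceil> / real (Suc n)"
        proof (intro always_eventually allI)
          fix n
          show "t \<le> real_of_int \<lceil>t * real (Suc n)\<rceil> / real (Suc n)"
            by (subst pos_le_divide_eq) auto
        qed
        show "\<forall>\<^sub>F n in sequentially. real_of_int \<lceil>t * real (Suc n)\<rceil> / real (Suc n) \<le> t + 1 / real (Suc n)"
        proof (intro always_eventually allI)
          fix n
          have "real_of_int \<lceil>t * real (Suc n)\<rceil> \<le> t * real (Suc n) + 1" by linarith
          then have "real_of_int \<lceil>t * real (Suc n)\<rceil> / real (Suc n) \<le> (t * real (Suc n) + 1) / real (Suc n)"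
            by (intro divide_right_mono) auto
          then show "real_of_int \<lceil>t * real (Suc n)\<rceil> / real (Suc n) \<le> t + 1 / real (Suc n)"
            by (simp add: add_divide_distrib)
        qed
        show "(\<lambda>n. t + 1 / real (Suc n)) \<longlonglongrightarrow> t"
          using tendsto_add[OF tendsto_const[of t] LIMSEQ_inverse_real_of_nat] by (simp add: inverse_eq_divide)
      qed simp
      moreover have "isCont G t" using cont by (simp add: continuous_on_eq_continuous_at)
      ultimately have "(\<lambda>n. G (real_of_int \<lceil>t * real (Suc n)\<rceil> / real (Suc n))) \<longlonglongrightarrow> G t"
        by (rule isCont_tendsto_compose[rotated])
      then show "(\<lambda>n. S (Suc n) t) \<longlonglongrightarrow> indicator {0<..} t * G t"
        unfolding S_def by (intro tendsto_mult tendsto_const)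
    qed
    show "AE t in lborel. norm (S (Suc n) t) \<le> C * (1 / (1 + t\<^sup>2))" for n
      using SC[of "Suc n"] by (intro AE_I2) (simp only: real_norm_def, subst abs_of_nonneg, auto)
  qed auto
  then have "(\<lambda>n. \<Sum>k. G (real (Suc k) / real (Suc n)) / real (Suc n)) \<longlonglongrightarrow> (\<integral>t. indicator {0<..} t * G t \<partial>lborel)"
    using sums_unique[OF sums[OF zero_less_Suc]] by simp
  then show "(\<lambda>N. \<Sum>k. G (real (Suc k) / real N) / real N) \<longlonglongrightarrow> (\<integral>t. indicator {0<..} t * G t \<partial>lborel)"
    by (rule LIMSEQ_imp_Suc)
qed

lemma integral_even_half:
  fixes G :: "real \<Rightarrow> real"
  assumes i: "integrable lborel G" and even: "\<And>t. G (- t) = G t"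
  shows "(\<integral>t. G t \<partial>lborel) = 2 * (\<integral>t. indicator {0<..} t * G t \<partial>lborel)"
proof -
  have m: "G \<in> borel_measurable borel" using i by simp
  have ip: "integrable lborel (\<lambda>t. indicator {0<..} t * G t)"
    using integrable_mult_indicator[OF _ i, of "{0<..}"] by simp
  have im: "integrable lborel (\<lambda>t. indicator {..<0} t * G t)"
    using integrable_mult_indicator[OF _ i, of "{..<0}"] by simp
  have "(\<integral>t. indicator {..<0} t * G t \<partial>lborel) = (\<integral>t. indicator {..<0} (- t) * G (- t) \<partial>lborel)"
    using lborel_integral_real_affine[of "- 1" "\<lambda>t. indicator {..<0} t * G t" 0] by simp
  also have "\<dots> = (\<integral>t. indicator {0<..} t * G t \<partial>lborel)"
    by (intro Bochner_Integration.integral_cong) (auto simp: even indicator_def)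
  finally have neg: "(\<integral>t. indicator {..<0} t * G t \<partial>lborel) = (\<integral>t. indicator {0<..} t * G t \<partial>lborel)" .
  have "(\<integral>t. G t \<partial>lborel) = (\<integral>t. indicator {0<..} t * G t + indicator {..<0} t * G t \<partial>lborel)"
    using AE_lborel_singleton[of "0::real"] m
    by (intro integral_cong_AE) (auto elim!: eventually_mono simp: indicator_def)
  then show ?thesis using ip im neg by simp
qed

section \<open>Rescaled periodic functions and their Fourier coefficients\<close>

context test_function
begin

abbreviation "fN N \<equiv> rescaled_periodic f N"

lemma fN_periodic: "circ_periodic (fN N)"
proof -
  have "\<lfloor>(x + 2 * pi + pi) / (2 * pi)\<rfloor> = \<lfloor>(x + pi) / (2 * pi)\<rfloor> + 1" for x :: real
  proof -
    have "(x + 2 * pi + pi) / (2 * pi) = (x + pi) / (2 * pi) + 1" by (simp add: field_simps)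
    then show ?thesis by simp
  qed
  then show ?thesis by (simp add: circ_periodic_def rescaled_periodic_def algebra_simps)
qed

text \<open>The definition covers a half-open interval; at y = pi the representative is -pi, and
  evenness of f extends the formula to the closed interval.\<close>

lemma fN_eq:
  assumes y: "\<bar>y\<bar> \<le> pi" and N: "R < real N * pi"
  shows "fN N (y + 2 * pi * real_of_int m) = f (real N * y)"
proof (cases "y = pi")
  case False
  then have "- pi \<le> y" "y < pi" using y by auto
  then show ?thesis unfolding rescaled_periodic_def by (simp add: floor_mod_2pi)
next
  case True
  have "fN N (y + 2 * pi * real_of_int m) = fN N (- pi + 2 * pi * real_of_int (m + 1))"
    unfolding True by (intro arg_cong[of _ _ "fN N"]) (simp add: algebra_simps)
  also have "\<dots> = f (real N * (- pi))"
    unfolding rescaled_periodic_def by (subst floor_mod_2pi) auto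
  also have "\<dots> = f (real N * y)" using True even[of "real N * pi"] by simp
  finally show ?thesis .
qed

lemma fN_even: "R < real N * pi \<Longrightarrow> fN N (- x) = fN N x"
proof -
  assume N: "R < real N * pi"
  obtain m :: int where m: "- pi \<le> x - 2 * pi * real_of_int m" "x - 2 * pi * real_of_int m < pi" by (rule reduce_mod_2pi)
  define y where "y = x - 2 * pi * real_of_int m"
  have y: "\<bar>y\<bar> \<le> pi" "\<bar>- y\<bar> \<le> pi" using m by (auto simp: y_def abs_le_iff)
  have "fN N (- x) = fN N (- y + 2 * pi * real_of_int (- m))" by (simp add: y_def)
  also have "\<dots> = f (real N * (- y))" by (rule fN_eq[OF y(2) N])
  also have "\<dots> = f (real N * y)" using even[of "real N * y"] by simp
  also have "\<dots> = fN N (y + 2 * pi * real_of_int m)" by (rule fN_eq[OF y(1) N, symmetric])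
  finally show ?thesis by (simp add: y_def)
qed

text \<open>A step that leaves the period interval crosses the seam at pi or -pi, where the rescaled
  f vanishes; the step is cut there and both parts are bounded separately.\<close>

lemma fN_lip_real:
  assumes N: "R < real N * pi" and d: "\<bar>d\<bar> \<le> pi"
  shows "\<bar>fN N (x + d) - fN N x\<bar> \<le> Lf * real N * \<bar>d\<bar>"
proof -
  obtain m :: int where m: "- pi \<le> x - 2 * pi * real_of_int m" "x - 2 * pi * real_of_int m < pi" by (rule reduce_mod_2pi)
  define y where "y = x - 2 * pi * real_of_int m"
  have y: "- pi \<le> y" "y < pi" using m by (auto simp: y_def)
  have fx: "fN N x = f (real N * y)" using fN_eq[OF _ N, of y m] y by (simp add: y_def abs_le_iff)
  have z: "f (real N * pi) = 0" "f (- (real N * pi)) = 0" using N R by (auto intro!: supp)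
  have l: "\<bar>f (real N * a) - f (real N * b)\<bar> \<le> Lf * real N * \<bar>a - b\<bar>" for a b
    using lip[of "real N * a" "real N * b"] by (simp add: abs_mult mult.assoc flip: right_diff_distrib)
  consider "\<bar>y + d\<bar> \<le> pi" | "y + d > pi" | "y + d < - pi" by linarith
  then show ?thesis
  proof cases
    case 1
    have "fN N (x + d) = f (real N * (y + d))" using fN_eq[OF 1 N, of m] by (simp add: y_def algebra_simps)
    then show ?thesis using l[of "y + d" y] unfolding fx by simp
  next
    case 2
    have "\<bar>y + d - 2 * pi\<bar> \<le> pi" using 2 y d by (auto simp: abs_le_iff)
    from fN_eq[OF this N, of "m + 1"] have e: "fN N (x + d) = f (real N * (y + d - 2 * pi))" by (simp add: y_def algebra_simps)
    have "\<bar>f (real N * (y + d - 2 * pi))\<bar> \<le> Lf * real N * (y + d - pi)"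
      using l[of "y + d - 2 * pi" "- pi"] z 2 by simp
    moreover have "\<bar>f (real N * y)\<bar> \<le> Lf * real N * (pi - y)" using l[of y pi] z y by simp
    ultimately have "\<bar>fN N (x + d) - fN N x\<bar> \<le> Lf * real N * (y + d - pi) + Lf * real N * (pi - y)"
      unfolding e fx by linarith
    also have "\<dots> = Lf * real N * d" by (simp add: algebra_simps)
    also have "\<dots> \<le> Lf * real N * \<bar>d\<bar>" using Lf by (intro mult_left_mono) auto
    finally show ?thesis .
  next
    case 3
    have "\<bar>y + d + 2 * pi\<bar> \<le> pi" using 3 y d by (auto simp: abs_le_iff)
    from fN_eq[OF this N, of "m - 1"] have e: "fN N (x + d) = f (real N * (y + d + 2 * pi))" by (simp add: y_def algebra_simps)
    have "\<bar>f (real N * (y + d + 2 * pi))\<bar> \<le> Lf * real N * (- y - d - pi)"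
      using l[of "y + d + 2 * pi" "pi"] z 3 by simp
    moreover have "\<bar>f (real N * y)\<bar> \<le> Lf * real N * (y + pi)" using l[of y "- pi"] z y by simp
    ultimately have "\<bar>fN N (x + d) - fN N x\<bar> \<le> Lf * real N * (- y - d - pi) + Lf * real N * (y + pi)"
      unfolding e fx by linarith
    also have "\<dots> = Lf * real N * (- d)" by (simp add: algebra_simps)
    also have "\<dots> \<le> Lf * real N * \<bar>d\<bar>" using Lf by (intro mult_left_mono) auto
    finally show ?thesis .
  qed
qed

lemma fN_circ_lip:
  assumes N: "R < real N * pi" shows "circ_lipschitz (3 * Lf * real N) (fN N)"
  unfolding circ_lipschitz_def
proof (intro allI)
  fix x y
  obtain m :: int where m: "- pi \<le> (x - y) - 2 * pi * real_of_int m" "(x - y) - 2 * pi * real_of_int m < pi" by (rule reduce_mod_2pi)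
  define d where "d = x - y - 2 * pi * real_of_int m"
  have d: "\<bar>d\<bar> \<le> pi" using m by (auto simp: d_def abs_le_iff)
  have x: "x = (y + d) + 2 * pi * real_of_int m" by (simp add: d_def)
  have "fN N x = fN N (y + d)" unfolding x by (rule circ_periodic_int[OF fN_periodic])
  then have "norm (fN N x - fN N y) \<le> Lf * real N * \<bar>d\<bar>" using fN_lip_real[OF N d, of y] by simp
  also have "\<dots> \<le> Lf * real N * (3 * cmod (cis d - 1))"
    using Lf by (intro mult_left_mono abs_le_cmod_cis_diff d) auto
  also have "cmod (cis d - 1) = cmod (cis x - cis y)"
  proof -
    have "cis (2 * pi * real_of_int m) = 1" by (rule cis_multiple_2pi) simp
    then have "cis x = cis y * cis d" unfolding x by (simp flip: cis_mult)
    then have "cis x - cis y = cis y * (cis d - 1)" by (simp add: algebra_simps)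
    then show ?thesis by (simp add: norm_mult)
  qed
  finally show "norm (fN N x - fN N y) \<le> 3 * Lf * real N * cmod (cis x - cis y)" by (simp add: mult_ac)
qed

text \<open>The substitution behind the mean, the mean square and the Fourier coefficients: the
  period is moved to [-pi, pi), stretched by N, and completed to the line by zeros of k.\<close>

lemma integral_circ_rescaled:
  fixes H k :: "real \<Rightarrow> 'a::{second_countable_topology, banach}"
  assumes H: "bdd_meas H" "circ_periodic H" and k [measurable]: "k \<in> borel_measurable borel"
    and eq: "\<And>x. - pi \<le> x \<Longrightarrow> x < pi \<Longrightarrow> H x = k (real N * x)" and k0: "\<And>y. R \<le> \<bar>y\<bar> \<Longrightarrow> k y = 0" and N: "R < real N * pi"
  shows "(\<integral>x. H x \<partial>circ) = (1 / (2 * pi * real N)) *\<^sub>R (\<integral>y. k y \<partial>lborel)"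
proof -
  have N0: "0 < real N" using N R by (metis less_trans mult_zero_left of_nat_0_less_iff not_gr_zero of_nat_0 less_irrefl)
  have [measurable]: "H \<in> borel_measurable borel" by (rule bdd_meas_measurable[OF H(1)])
  have "(\<integral>x. H x \<partial>circ) = (\<integral>x. H (x - pi) \<partial>circ)" by (rule integral_circ_translate[OF H, symmetric])
  also have "\<dots> = (\<integral>x. (indicator {0..<2 * pi} x / (2 * pi)) *\<^sub>R H (x - pi) \<partial>lborel)"
    by (rule integral_circ) measurable
  also have "\<dots> = (\<integral>x. (indicator {0..<2 * pi} (pi + x) / (2 * pi)) *\<^sub>R H (pi + x - pi) \<partial>lborel)"
    by (rule lborel_integral_shift)
  also have "\<dots> = (\<integral>x. (1 / (2 * pi)) *\<^sub>R k (real N * x) \<partial>lborel)"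
  proof (intro Bochner_Integration.integral_cong refl)
    fix x :: real
    show "(indicator {0..<2 * pi} (pi + x) / (2 * pi)) *\<^sub>R H (pi + x - pi) = (1 / (2 * pi)) *\<^sub>R k (real N * x)"
    proof (cases "- pi \<le> x \<and> x < pi")
      case True
      then show ?thesis using eq[of x] by (simp add: indicator_def)
    next
      case False
      then have "pi \<le> \<bar>x\<bar>" by auto
      then have "real N * pi \<le> \<bar>real N * x\<bar>" using N0 by (simp add: abs_mult)
      then have "k (real N * x) = 0" using N by (intro k0) simp
      then show ?thesis using False by (auto simp: indicator_def)
    qed
  qed
  also have "\<dots> = (1 / (2 * pi)) *\<^sub>R (\<integral>x. k (real N * x) \<partial>lborel)" by (rule integral_scaleR_right)
  also have "(\<integral>x. k (real N * x) \<partial>lborel) = (1 / real N) *\<^sub>R (\<integral>y. k y \<partial>lborel)"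
    using lborel_integral_real_affine[of "real N" k 0] N0 by simp
  finally show ?thesis by simp
qed

lemma fN_on: "- pi \<le> x \<Longrightarrow> x < pi \<Longrightarrow> fN N x = f (real N * x)"
  using floor_mod_2pi[of x 0] by (simp add: rescaled_periodic_def)

lemma fN_bdd: "R < real N * pi \<Longrightarrow> bdd_meas (fN N)"
  by (rule circ_lipschitz_bdd_meas[OF fN_circ_lip])

lemma fN_integral: "R < real N * pi \<Longrightarrow> (\<integral>x. fN N x \<partial>circ) = (\<integral>x. f x \<partial>lborel) / (2 * pi * real N)"
  using integral_circ_rescaled[where H = "fN N" and k = f and N = N] by (simp add: fN_bdd fN_periodic fN_on supp)

lemma fN_sq_integral: "R < real N * pi \<Longrightarrow> (\<integral>x. (fN N x)\<^sup>2 \<partial>circ) = (\<integral>x. (f x)\<^sup>2 \<partial>lborel) / (2 * pi * real N)"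
  using integral_circ_rescaled[where H = "\<lambda>x. (fN N x)\<^sup>2" and k = "\<lambda>x. (f x)\<^sup>2" and N = N] fN_periodic[of N]
  by (simp add: fN_bdd bdd_meas_power circ_periodic_def fN_on supp)

lemma fN_fcoef:
  assumes N: "R < real N * pi"
  shows "fcoef (\<lambda>x. complex_of_real (fN N x)) (int k) = fh (real k / real N) / of_real (sqrt (2 * pi) * real N)"
proof -
  have N0: "0 < real N" using N R by (metis less_trans mult_zero_left of_nat_0_less_iff not_gr_zero of_nat_0 less_irrefl)
  define K where "K = (\<lambda>y. complex_of_real (f y) * cis (- (real k / real N * y)))"
  define H where "H = (\<lambda>x. complex_of_real (fN N x) * cis (- (real_of_int (int k) * x)))"
  have "(\<integral>x. H x \<partial>circ) = (1 / (2 * pi * real N)) *\<^sub>R (\<integral>y. K y \<partial>lborel)"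
  proof (rule integral_circ_rescaled[OF _ _ _ _ _ N])
    show "bdd_meas H" unfolding H_def by (intro bdd_meas_mult bdd_meas_cis) (simp add: fN_bdd[OF N])
    show "circ_periodic H" using fN_periodic[of N] cis_periodic[of "int k"] unfolding circ_periodic_def H_def by metis
    show "K \<in> borel_measurable borel" unfolding K_def by measurable
    show "H x = K (real N * x)" if "- pi \<le> x" "x < pi" for x
      using fN_on[OF that, of N] N0 by (simp add: H_def K_def)
    show "K y = 0" if "R \<le> \<bar>y\<bar>" for y using supp[OF that] by (simp add: K_def)
  qed
  also have "(\<integral>y. K y \<partial>lborel) = of_real (sqrt (2 * pi)) * fh (real k / real N)"
    unfolding K_def fourier_eq by simp
  also have "(1 / (2 * pi * real N)) *\<^sub>R (of_real (sqrt (2 * pi)) * fh (real k / real N)) = fh (real k / real N) / of_real (sqrt (2 * pi) * real N)"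
  proof -
    have "of_real (2 * pi) = complex_of_real (sqrt (2 * pi)) * of_real (sqrt (2 * pi))"
      by (simp flip: of_real_mult)
    then show ?thesis using N0 by (simp add: scaleR_conv_of_real field_simps)
  qed
  finally show ?thesis by (simp add: H_def fcoef_def)
qed

definition "gN N x = fN N x - (\<integral>x. f x \<partial>lborel) / (2 * pi * real N)"

lemma gN_fcoef:
  assumes N: "R < real N * pi"
  shows "fcoef (\<lambda>x. complex_of_real (gN N x)) (int k) = (if k = 0 then 0 else fh (real k / real N) / of_real (sqrt (2 * pi) * real N))"
proof -
  define c where "c = (\<integral>x. f x \<partial>lborel) / (2 * pi * real N)"
  have "fcoef (\<lambda>x. complex_of_real (gN N x)) (int k) = fcoef (\<lambda>x. complex_of_real (fN N x) + of_real (- c)) (int k)"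
    by (simp add: gN_def c_def)
  also have "\<dots> = fcoef (\<lambda>x. complex_of_real (fN N x)) (int k) + (if k = 0 then of_real (- c) else 0)"
    using fN_bdd[OF N] by (subst fcoef_add) (simp_all add: fcoef_const)
  finally have *: "fcoef (\<lambda>x. complex_of_real (gN N x)) (int k) = fcoef (\<lambda>x. complex_of_real (fN N x)) (int k) + (if k = 0 then of_real (- c) else 0)" .
  show ?thesis
  proof (cases "k = 0")
    case True
    have "fcoef (\<lambda>x. complex_of_real (fN N x)) 0 = of_real c"
      unfolding c_def fN_integral[OF N, symmetric] by (simp add: fcoef_def)
    then show ?thesis using True * by simp
  next
    case False
    then show ?thesis using * fN_fcoef[OF N, of k] by simp
  qed
qed

text \<open>\<open>Fm\<close> bounds f, K0 comes from the subtracted mean, the integral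
  \<open>Cf\<close> of |f| bounds all Fourier coefficients, and K2 is a mean square, which does not
  grow when the mean is subtracted. Only the Lipschitz constant grows with N.\<close>

lemma kernel_gN:
  assumes N: "(R + 2 * pi) / real N < pi" "0 < N"
  shows "kernel N (gN N) (3 * Lf * real N) Fm R (\<bar>\<integral>x. f x \<partial>lborel\<bar> / (2 * pi)) Cf ((\<integral>x. (f x)\<^sup>2 \<partial>lborel) / (2 * pi))"
proof -
  have "R + 2 * pi < real N * pi" using N by (simp add: divide_less_eq mult.commute)
  then have N': "R < real N * pi" using pi_gt_zero by linarith
  define c where "c = (\<integral>x. f x \<partial>lborel) / (2 * pi * real N)"
  have g: "gN N x = fN N x - c" for x by (simp add: gN_def c_def)
  show ?thesis
  proof
    show "0 < N" by (rule N)
    show "circ_lipschitz (3 * Lf * real N) (gN N)"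
      using fN_circ_lip[OF N'] by (simp add: circ_lipschitz_def g)
    show "gN N (- x) = gN N x" for x by (simp add: g fN_even[OF N'])
    show "(\<integral>x. gN N x \<partial>circ) = 0"
      unfolding g using bdd_meas_integrable[OF fN_bdd[OF N']] fN_integral[OF N'] circ.prob_space by (simp add: c_def)
    show "0 \<le> Fm" by (rule Fm)
    show "0 \<le> \<bar>\<integral>x. f x \<partial>lborel\<bar> / (2 * pi)" by simp
    show "0 \<le> R" using R by simp
    show "(R + 2 * pi) / real N < pi" by (rule N)
    show "\<bar>gN N t\<bar> \<le> Fm * indicator (win 0 (R / real N)) t + \<bar>\<integral>x. f x \<partial>lborel\<bar> / (2 * pi) / real N" for t
    proof -
      have "\<bar>fN N t\<bar> \<le> Fm * indicator (win 0 (R / real N)) t"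
      proof (cases "t \<in> win 0 (R / real N)")
        case True
        then show ?thesis using Fm(2) by (simp add: rescaled_periodic_def)
      next
        case False
        define m where "m = \<lfloor>(t + pi) / (2 * pi)\<rfloor>"
        have "R / real N < \<bar>t - 0 - 2 * pi * real_of_int m\<bar>" using False unfolding win_iff by (meson linorder_not_less)
        then have "R < \<bar>real N * (t - 2 * pi * real_of_int m)\<bar>"
          using N(2) by (simp add: abs_mult divide_less_eq mult.commute)
        then have "fN N t = 0" unfolding rescaled_periodic_def m_def[symmetric] by (intro supp) simp
        then show ?thesis using Fm(1) by simp
      qed
      moreover have "\<bar>c\<bar> = \<bar>\<integral>x. f x \<partial>lborel\<bar> / (2 * pi) / real N" by (simp add: c_def abs_divide abs_mult)
      ultimately show ?thesis using abs_triangle_ineq4[of "fN N t" c] unfolding g by linarith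
    qed
    show "cmod (fcoef (\<lambda>x. complex_of_real (gN N x)) (int k)) \<le> Cf / real N" for k
    proof (cases "k = 0")
      case True
      then show ?thesis using Cf gN_fcoef[OF N', of 0] by simp
    next
      case False
      have "1 \<le> sqrt (2 * pi)" using pi_gt3 by simp
      then have "cmod (fh (real k / real N)) / (sqrt (2 * pi) * real N) \<le> Cf / (1 * real N)"
        using fourier_bound[of "real k / real N"] N(2) Cf by (intro frac_le mult_right_mono) auto
      then show ?thesis using False by (simp add: gN_fcoef[OF N'] norm_divide norm_mult)
    qed
    show "real N * (\<integral>x. (gN N x)\<^sup>2 \<partial>circ) \<le> (\<integral>x. (f x)\<^sup>2 \<partial>lborel) / (2 * pi)"
    proof -
      have b: "integrable circ (fN N)" "integrable circ (\<lambda>x. (fN N x)\<^sup>2)"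
        by (intro bdd_meas_integrable bdd_meas_power fN_bdd[OF N'])+
      have "(\<integral>x. (gN N x)\<^sup>2 \<partial>circ) = (\<integral>x. (fN N x)\<^sup>2 - 2 * c * fN N x + c\<^sup>2 \<partial>circ)"
        unfolding g by (intro Bochner_Integration.integral_cong refl) (simp add: power2_diff)
      also have "\<dots> = (\<integral>x. (fN N x)\<^sup>2 \<partial>circ) - 2 * c * (\<integral>x. fN N x \<partial>circ) + c\<^sup>2"
        using b circ.prob_space by simp
      also have "\<dots> \<le> (\<integral>x. (fN N x)\<^sup>2 \<partial>circ)"
        unfolding fN_integral[OF N'] c_def[symmetric] by (simp add: power2_eq_square)
      also have "\<dots> = (\<integral>x. (f x)\<^sup>2 \<partial>lborel) / (2 * pi * real N)" by (rule fN_sq_integral[OF N'])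
      finally have "real N * (\<integral>x. (gN N x)\<^sup>2 \<partial>circ) \<le> real N * ((\<integral>x. (f x)\<^sup>2 \<partial>lborel) / (2 * pi * real N))"
        by (intro mult_left_mono) auto
      then show ?thesis using N(2) by simp
    qed
  qed
qed

end

section \<open>Evenly spaced points\<close>

definition even_points :: "nat \<Rightarrow> nat \<Rightarrow> real" where
  "even_points N i = 2 * pi * real i / real N"

text \<open>A geometric sum of roots of unity. Only frequencies divisible by N survive; this
  aliasing is why the limit variance is a sum over integers instead of an integral.\<close>

lemma pow_sum_even_points:
  assumes N: "0 < N" shows "pow_sum N k (even_points N) = (if N dvd k then of_nat N else 0)"
proof -
  define z where "z = cis (2 * pi * (real k / real N))"
  have zi: "cis (real k * even_points N i) = z ^ i" for i
    by (simp add: z_def even_points_def Complex.DeMoivre mult_ac)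
  have s: "pow_sum N k (even_points N) = (\<Sum>i\<in>{1..N}. z ^ i)"
    unfolding pow_sum_def zi ..
  have zN: "z ^ N = 1"
  proof -
    have "z ^ N = cis (2 * pi * real_of_int (int k))" using N by (simp add: z_def Complex.DeMoivre)
    also have "\<dots> = 1" by (rule cis_multiple_2pi) simp
    finally show ?thesis .
  qed
  show ?thesis
  proof (cases "N dvd k")
    case True
    then obtain q where q: "k = N * q" by (auto elim: dvdE)
    have "z = cis (2 * pi * real_of_int (int q))" unfolding z_def q using N by simp
    also have "\<dots> = 1" by (rule cis_multiple_2pi) simp
    finally have "z = 1" .
    then show ?thesis unfolding s using True by simp
  next
    case False
    have z1: "z \<noteq> 1"
    proof
      assume "z = 1"
      then obtain n :: int where "2 * pi * (real k / real N) = of_int (2 * n) * pi"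
        unfolding z_def cis_conv_exp exp_eq_1 by auto
      then have "(2 * pi) * (real k / real N) = (2 * pi) * real_of_int n" by simp
      then have "real k / real N = real_of_int n" by (subst (asm) mult_left_cancel) auto
      then have "real_of_int (int k) = real_of_int (n * int N)" using N by (simp add: field_simps)
      then have "int k = n * int N" by (simp only: of_int_eq_iff)
      then have "int N dvd int k" by simp
      then show False using False by simp
    qed
    have "(z - 1) * (\<Sum>i\<in>{1..N}. z ^ i) = (z - 1) * (z * (\<Sum>i<N. z ^ i))"
    proof -
      have "(\<Sum>i\<in>{1..N}. z ^ i) = (\<Sum>i<N. z ^ Suc i)"
        by (rule sum.reindex_bij_witness[of _ Suc "\<lambda>i. i - 1"]) auto
      then show ?thesis by (simp add: sum_distrib_left)
    qed
    also have "\<dots> = z * (z ^ N - 1)" by (simp add: power_diff_1_eq)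
    also have "\<dots> = 0" by (simp add: zN)
    finally show ?thesis unfolding s using z1 False by simp
  qed
qed

text \<open>The deterministic counterpart of the crowding estimate: after unwrapping, the points in
  the arc correspond to distinct integers in an interval of length \<open>r / pi\<close>.\<close>

lemma num_in_even_points:
  assumes N: "0 < N" and r: "0 \<le> r"
  shows "num_in N (win y (r / real N)) (even_points N) \<le> r / pi + 1"
proof -
  define J where "J = {j\<in>{1..N}. even_points N j \<in> win y (r / real N)}"
  define a where "a = real N * y / (2 * pi)"
  have fin: "finite J" by (simp add: J_def)
  have n: "num_in N (win y (r / real N)) (even_points N) = real (card J)"
    unfolding num_in_def J_def indicator_def by (simp add: sum.If_cases Int_def)
  have "\<forall>j\<in>J. \<exists>m::int. \<bar>even_points N j - y - 2 * pi * real_of_int m\<bar> \<le> r / real N"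
    unfolding J_def win_iff by auto
  then obtain m where m: "\<And>j. j \<in> J \<Longrightarrow> \<bar>even_points N j - y - 2 * pi * real_of_int (m j)\<bar> \<le> r / real N"
    by metis
  \<comment> \<open>The label of the point on the unwrapped grid of mesh 2 pi / N; it is injective
    because labels in 1, ..., N that agree modulo N are equal.\<close>
  define \<phi> where "\<phi> = (\<lambda>j. int j - int N * m j)"
  have inj: "inj_on \<phi> J"
  proof (rule inj_onI)
    fix i j assume ij: "i \<in> J" "j \<in> J" "\<phi> i = \<phi> j"
    then have d: "int i - int j = int N * (m i - m j)" by (simp add: \<phi>_def algebra_simps)
    have "1 \<le> i" "i \<le> N" "1 \<le> j" "j \<le> N" using ij by (auto simp: J_def)
    then have "\<bar>int i - int j\<bar> < int N" by auto
    then have "int N * \<bar>m i - m j\<bar> < int N * 1" unfolding d by (simp add: abs_mult)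
    then have "m i - m j = 0" using N by (simp add: mult_less_cancel_left)
    then show "i = j" using d by simp
  qed
  have bd: "\<bar>real_of_int (\<phi> j) - a\<bar> \<le> r / (2 * pi)" if "j \<in> J" for j
  proof -
    have "real_of_int (\<phi> j) - a = (real N / (2 * pi)) * (even_points N j - y - 2 * pi * real_of_int (m j))"
      using N by (simp add: \<phi>_def a_def even_points_def field_simps)
    then have "\<bar>real_of_int (\<phi> j) - a\<bar> = (real N / (2 * pi)) * \<bar>even_points N j - y - 2 * pi * real_of_int (m j)\<bar>"
      by (simp add: abs_mult)
    also have "\<dots> \<le> (real N / (2 * pi)) * (r / real N)" by (intro mult_left_mono m that) simp
    finally show ?thesis using N by simp
  qed
  have "\<phi> ` J \<subseteq> {\<lceil>a - r / (2 * pi)\<rceil>..\<lfloor>a + r / (2 * pi)\<rfloor>}"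
  proof
    fix k assume "k \<in> \<phi> ` J"
    then obtain j where "j \<in> J" "k = \<phi> j" by auto
    then have "a - r / (2 * pi) \<le> real_of_int k" "real_of_int k \<le> a + r / (2 * pi)"
      using bd[of j] by (auto simp: abs_le_iff)
    then show "k \<in> {\<lceil>a - r / (2 * pi)\<rceil>..\<lfloor>a + r / (2 * pi)\<rfloor>}" by (simp add: ceiling_le_iff le_floor_iff)
  qed
  then have "card (\<phi> ` J) \<le> card {\<lceil>a - r / (2 * pi)\<rceil>..\<lfloor>a + r / (2 * pi)\<rfloor>}" by (intro card_mono) auto
  then have "card J \<le> nat (\<lfloor>a + r / (2 * pi)\<rfloor> - \<lceil>a - r / (2 * pi)\<rceil> + 1)"
    using card_image[OF inj] by simp
  then have "real (card J) \<le> real (nat (\<lfloor>a + r / (2 * pi)\<rfloor> - \<lceil>a - r / (2 * pi)\<rceil> + 1))" by simp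
  also have "\<dots> \<le> r / pi + 1"
  proof -
    have "real_of_int \<lfloor>a + r / (2 * pi)\<rfloor> \<le> a + r / (2 * pi)" "a - r / (2 * pi) \<le> real_of_int \<lceil>a - r / (2 * pi)\<rceil>" by linarith+
    moreover have "r / pi = r / (2 * pi) + r / (2 * pi)" by simp
    ultimately have "real_of_int (\<lfloor>a + r / (2 * pi)\<rfloor> - \<lceil>a - r / (2 * pi)\<rceil> + 1) \<le> r / pi + 1"
      unfolding of_int_add of_int_diff of_int_1 by linarith
    moreover have "0 \<le> r / pi + 1" using r by simp
    ultimately show ?thesis by (simp add: of_nat_nat)
  qed
  finally show ?thesis unfolding n .
qed

section \<open>The mean of the quadratic form and its limit\<close>

context test_function
begin

text \<open>The profile of \<open>mode_var\<close> at t = k / N, in units of N.\<close>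

definition "mode_weight b t = (if b then min \<bar>t\<bar> 1 else (1::real))"

text \<open>One weight per ensemble: two CUEs give min(|t|, 1)^2, a CUE with independent points
  gives min(|t|, 1).\<close>

definition "spec2 b b' t = spec t * mode_weight b t * mode_weight b' t"

lemma mode_weight_bounds: "0 \<le> mode_weight b t" "mode_weight b t \<le> 1"
  by (auto simp: mode_weight_def)

lemma spec2_nonneg: "0 \<le> spec2 b b' t"
  unfolding spec2_def by (intro mult_nonneg_nonneg spec_nonneg mode_weight_bounds)

lemma spec2_decay: "spec2 b b' t \<le> Cs / (1 + t\<^sup>2)"
proof -
  have "spec2 b b' t \<le> spec t * 1 * 1"
    unfolding spec2_def using spec_nonneg mode_weight_bounds by (intro mult_mono mult_nonneg_nonneg) auto
  then show ?thesis using spec_decay[of t] by simp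
qed

lemma spec2_cont: "continuous_on UNIV (spec2 b b')"
proof -
  have "continuous_on UNIV (mode_weight b)" for b
    unfolding mode_weight_def[abs_def] by (cases b) (auto intro!: continuous_intros)
  then show ?thesis unfolding spec2_def[abs_def] by (intro continuous_intros spec_cont)
qed

lemma spec2_integrable: "integrable lborel (spec2 b b')"
proof (rule Bochner_Integration.integrable_bound)
  show "integrable lborel (\<lambda>t. Cs * (1 / (1 + t\<^sup>2)))"
    by (intro integrable_mult_right integrable_inverse_one_plus_square)
  show "spec2 b b' \<in> borel_measurable lborel"
    using borel_measurable_continuous_onI[OF spec2_cont] by simp
  show "AE t in lborel. norm (spec2 b b' t) \<le> norm (Cs * (1 / (1 + t\<^sup>2)))"
  proof (intro AE_I2)
    fix t
    have "spec2 b b' t \<le> Cs * (1 / (1 + t\<^sup>2))" using spec2_decay by simp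
    then show "norm (spec2 b b' t) \<le> norm (Cs * (1 / (1 + t\<^sup>2)))"
      unfolding real_norm_def abs_of_nonneg[OF spec2_nonneg] by (rule order.trans[OF _ abs_ge_self])
  qed
qed

lemma spec2_even: "spec2 b b' (- t) = spec2 b b' t"
  by (simp add: spec2_def spec_even mode_weight_def)

lemma mode_var_weight: "0 < N \<Longrightarrow> mode_var b N k = real N * mode_weight b (real k / real N)"
  by (auto simp: mode_var_def mode_weight_def min_def field_simps)

lemma coeff_sq:
  assumes "R < real N * pi" "0 < k"
  shows "(cmod (fcoef (\<lambda>x. complex_of_real (gN N x)) (int k)))\<^sup>2 = spec (real k / real N) / (2 * pi * (real N)\<^sup>2)"
  using assms by (simp add: gN_fcoef norm_divide norm_mult power_divide power_mult_distrib spec_def)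

lemma large_N: "(R + 2 * pi) / real N < pi \<Longrightarrow> 0 < N \<Longrightarrow> R < real N * pi"
proof -
  assume N: "(R + 2 * pi) / real N < pi" "0 < N"
  then have "R + 2 * pi < real N * pi" by (simp add: divide_less_eq mult.commute)
  then show ?thesis using pi_gt_zero by linarith
qed

lemma eventually_large_N: "\<forall>\<^sub>F N in sequentially. (R + 2 * pi) / real N < pi \<and> 0 < N \<and> 2 \<le> N"
proof -
  have "(\<lambda>N. (R + 2 * pi) / real N) \<longlonglongrightarrow> 0"
    by (rule lim_const_over_n)
  then have "\<forall>\<^sub>F N in sequentially. (R + 2 * pi) / real N < pi"
    by (rule order_tendstoD) simp
  then show ?thesis using eventually_ge_at_top[of 2] by eventually_elim auto
qed

text \<open>For each admissible N the mean is exactly a Riemann sum of mesh 1/N; the factor 1/pi is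
  2, for frequencies of either sign, over the 2 pi of the squared Fourier coefficients.\<close>

lemma variance_sum:
  assumes big: "(R + 2 * pi) / real N < pi" "0 < N"
  shows "(\<integral>\<tau>. qform b N (potential N (gN N) \<tau>) \<partial>law b' N) = (\<Sum>k. spec2 b b' (real (Suc k) / real N) / real N) / pi"
proof -
  interpret kernel N "gN N" "3 * Lf * real N" Fm R "\<bar>\<integral>x. f x \<partial>lborel\<bar> / (2 * pi)" Cf "(\<integral>x. (f x)\<^sup>2 \<partial>lborel) / (2 * pi)"
    by (rule kernel_gN[OF big])
  have eq: "2 * mode_var b N (Suc k) * mode_var b' N (Suc k) * (cmod (fcoef (\<lambda>x. complex_of_real (gN N x)) (int (Suc k))))\<^sup>2 / real N
     = spec2 b b' (real (Suc k) / real N) / real N / pi" for k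
    unfolding coeff_sq[OF large_N[OF big] zero_less_Suc] mode_var_weight[OF big(2)]
    using big(2) by (simp add: spec2_def power2_eq_square mult_ac)
  have "summable (\<lambda>k. spec2 b b' (real (Suc k) / real N) / real N)"
    by (rule riemann_sum_limit(1)[OF spec2_cont spec2_nonneg spec2_decay big(2)])
  then have "(\<Sum>k. spec2 b b' (real (Suc k) / real N) / real N / pi) = (\<Sum>k. spec2 b b' (real (Suc k) / real N) / real N) / pi"
    by (rule suminf_divide)
  then show ?thesis using sums_unique[OF qform_h_mean(2)[where b = b and b' = b']] unfolding eq by simp
qed

lemma variance_limit:
  "(\<lambda>N. \<integral>\<tau>. qform b N (potential N (gN N) \<tau>) \<partial>law b' N) \<longlonglongrightarrow> 1 / (2 * pi) * (\<integral>t. spec2 b b' t \<partial>lborel)"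
proof -
  have "(\<lambda>N. (\<Sum>k. spec2 b b' (real (Suc k) / real N) / real N) / pi) \<longlonglongrightarrow> (\<integral>t. indicator {0<..} t * spec2 b b' t \<partial>lborel) / pi"
    by (intro tendsto_divide tendsto_const riemann_sum_limit(2)[OF spec2_cont spec2_nonneg spec2_decay]) simp
  also have "(\<integral>t. indicator {0<..} t * spec2 b b' t \<partial>lborel) / pi = 1 / (2 * pi) * (\<integral>t. spec2 b b' t \<partial>lborel)"
    unfolding integral_even_half[OF spec2_integrable spec2_even] by simp
  finally show ?thesis
    by (rule Lim_transform_eventually) (use eventually_large_N in \<open>eventually_elim, simp add: variance_sum\<close>)
qed

text \<open>Aliasing leaves the frequencies k = N l, where \<open>mode_var\<close> equals N for
  either flag, so the limit variance is attained exactly for every admissible N.\<close>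

lemma qform_even_points:
  assumes big: "(R + 2 * pi) / real N < pi" "0 < N"
  shows "qform b N (potential N (gN N) (even_points N)) = limit_variance Evenly_Spaced f"
proof -
  interpret kernel N "gN N" "3 * Lf * real N" Fm R "\<bar>\<integral>x. f x \<partial>lborel\<bar> / (2 * pi)" Cf "(\<integral>x. (f x)\<^sup>2 \<partial>lborel) / (2 * pi)"
    by (rule kernel_gN[OF big])
  define F where "F = (\<lambda>k. if N dvd Suc k then spec (real (Suc k) / real N) / pi else 0)"
  \<comment> \<open>Modes are indexed from 0, so the frequency \<open>N (l + 1)\<close> sits at
    index \<open>N (l + 1) - 1\<close>.\<close>
  define s where "s = (\<lambda>l. N * Suc l - 1)"
  have Ss: "Suc (s l) = N * Suc l" for l using big(2) by (simp add: s_def)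
  have "2 * mode_var b N (Suc k) * ((cmod (fcoef (\<lambda>x. complex_of_real (gN N x)) (int (Suc k))))\<^sup>2 * (cmod (pow_sum N (Suc k) (even_points N)))\<^sup>2 / real N) = F k" for k
  proof (cases "N dvd Suc k")
    case True
    then have "N \<le> Suc k" by (simp add: dvd_imp_le)
    then have "mode_var b N (Suc k) = real N" by (simp add: mode_var_def)
    then show ?thesis
      unfolding coeff_sq[OF large_N[OF big] zero_less_Suc] pow_sum_even_points[OF big(2)] F_def
      using True big(2) by (simp add: power2_eq_square)
  next
    case False
    then show ?thesis unfolding pow_sum_even_points[OF big(2)] F_def by simp
  qed
  then have Fs: "F sums qform b N (potential N (gN N) (even_points N))"
    using qform_h_sums[of b "even_points N"] by simp
  have "(\<lambda>l. F (s l)) sums qform b N (potential N (gN N) (even_points N)) \<longleftrightarrow> F sums qform b N (potential N (gN N) (even_points N))"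
  proof (rule sums_mono_reindex)
    show "strict_mono s"
      by (rule strict_monoI_Suc) (use big(2) in \<open>simp add: s_def\<close>)
    fix k assume k: "k \<notin> range s"
    show "F k = 0"
    proof (rule ccontr)
      assume "F k \<noteq> 0"
      then have "N dvd Suc k" by (auto simp: F_def split: if_splits)
      then obtain q where q: "Suc k = N * q" by (auto elim: dvdE)
      then obtain l where "q = Suc l" by (cases q) auto
      then have "k = s l" using q by (simp add: s_def)
      then show False using k by auto
    qed
  qed
  moreover have "F (s l) = spec (real (Suc l)) / pi" for l
  proof -
    have "real (N * Suc l) / real N = real (Suc l)" using big(2) by (simp only: of_nat_mult) simp
    then show ?thesis unfolding F_def Ss by simp
  qed
  ultimately have half: "(\<lambda>l. spec (real (Suc l)) / pi) sums qform b N (potential N (gN N) (even_points N))"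
    using Fs by simp
  define V where "V = qform b N (potential N (gN N) (even_points N))"
  have "(\<lambda>l. pi * (spec (real (Suc l)) / pi)) sums (pi * V)"
    using sums_mult[OF half, of pi] by (simp add: V_def)
  then have hs: "((\<lambda>l. spec (real (Suc l))) has_sum (pi * V)) UNIV"
    by (intro sums_nonneg_imp_has_sum) (simp_all add: spec_nonneg)
  have p: "((\<lambda>l::int. spec (real_of_int l)) has_sum (pi * V)) (range (\<lambda>l::nat. int (Suc l)))"
    using hs by (subst has_sum_reindex) (auto simp: inj_on_def o_def)
  have n: "((\<lambda>l::int. spec (real_of_int l)) has_sum (pi * V)) (range (\<lambda>l::nat. - int (Suc l)))"
  proof -
    have "spec (real_of_int (- int (Suc l))) = spec (real (Suc l))" for l
      using spec_even[of "real (Suc l)"] by simp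
    then show ?thesis using hs by (subst has_sum_reindex) (auto simp: inj_on_def o_def)
  qed
  have U: "range (\<lambda>l::nat. int (Suc l)) \<union> range (\<lambda>l::nat. - int (Suc l)) = {l::int. l \<noteq> 0}"
  proof (intro equalityI subsetI)
    fix l :: int assume "l \<in> {l. l \<noteq> 0}"
    then consider "l > 0" | "l < 0" by fastforce
    then show "l \<in> range (\<lambda>l::nat. int (Suc l)) \<union> range (\<lambda>l::nat. - int (Suc l))"
    proof cases
      case 1
      then have "l = int (Suc (nat (l - 1)))" by simp
      then show ?thesis by blast
    next
      case 2
      then have "l = - int (Suc (nat (- l - 1)))" by simp
      then show ?thesis by blast
    qed
  qed auto
  have "((\<lambda>l::int. spec (real_of_int l)) has_sum (pi * V + pi * V)) {l. l \<noteq> 0}"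
    unfolding U[symmetric] by (rule has_sum_Un_disjoint[OF p n]) auto
  then have "(\<Sum>\<^sub>\<infinity>l\<in>{l::int. l \<noteq> 0}. spec (real_of_int l)) = pi * V + pi * V" by (rule infsumI)
  then show ?thesis by (simp add: V_def spec_def)
qed

end

section \<open>Limits of the characteristic functions\<close>

context test_function
begin

abbreviation "K0f \<equiv> \<bar>\<integral>x. f x \<partial>lborel\<bar> / (2 * pi)"
abbreviation "K2f \<equiv> (\<integral>x. (f x)\<^sup>2 \<partial>lborel) / (2 * pi)"

text \<open>The threshold \<open>A = N^(1/4)\<close> meets two opposing requirements:
  \<open>A / sqrt N\<close> must vanish for the potential to be small, and \<open>N 2^(-A)\<close>
  must vanish for crowding to be rare. The bound t on the cross term is of order
  \<open>N^(-1/2)\<close>.\<close>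

lemma Phi_mean_limit:
  "(\<lambda>N. \<integral>\<tau>. kernel.Phi N (gN N) b u \<tau> \<partial>law b' N) \<longlonglongrightarrow>
     of_real (exp (- (u\<^sup>2 / 2 * (1 / (2 * pi) * (\<integral>t. spec2 b b' t \<partial>lborel)))))"
proof -
  \<comment> \<open>The added 1 here and in the next constant keeps \<epsilon> and t positive in
    degenerate cases such as u = 0 or f = 0.\<close>
  define C where "C = \<bar>u\<bar> * (Fm + K0f) + 1"
  define C2 where "C2 = 4 * Cf\<^sup>2 * K2f + 1"
  define E where "E = exp ((R + 2 * pi) / pi)"
  define K3f where "K3f = (Fm + K0f) ^ 4 * (2 * (4 / ln 2) ^ 4) * exp (R / pi)"
  define \<epsilon> where "\<epsilon> = (\<lambda>N::nat. C * real N powr (- 1 / 4))"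
  define A where "A = (\<lambda>N::nat. real N powr (1 / 4))"
  define p where "p = (\<lambda>N. real N * (2 powr (- A N) * E))"
  define t where "t = (\<lambda>N::nat. C2 / sqrt (real N))"
  define Q where "Q = (\<lambda>N. 6 * (9 * \<epsilon> N * u\<^sup>2 * K2f + 2 * p N) + (72 * \<epsilon> N * u\<^sup>2 * K2f + 4 * p N) + u\<^sup>2 / 2 * t N)"
  \<comment> \<open>The extra 1/N makes w strictly positive.\<close>
  define w where "w = (\<lambda>N. sqrt (Q N + 1 / real N))"
  define D where "D = (\<lambda>N. (9 * \<epsilon> N * u\<^sup>2 * K2f + 2 * p N) + exp (u\<^sup>2 / 2 * K2f) * (w N * (3 + 2 * ((u\<^sup>2 / 2)\<^sup>2 * K3f))))"
  define V where "V = (\<lambda>N. \<integral>\<tau>. qform b N (potential N (gN N) \<tau>) \<partial>law b' N)"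
  have K0: "0 \<le> K0f" and K2: "0 \<le> K2f" by simp_all
  have C: "1 \<le> C" "1 \<le> C2" unfolding C_def C2_def using Fm(1) K0 K2 by simp_all
  have \<epsilon>0: "\<epsilon> \<longlonglongrightarrow> 0" unfolding \<epsilon>_def by (intro tendsto_mult_right_zero) real_asymp
  have p0: "p \<longlonglongrightarrow> 0"
  proof -
    have "(\<lambda>N::nat. real N * 2 powr (- (real N powr (1 / 4))) * E) \<longlonglongrightarrow> 0"
      by (intro tendsto_mult_left_zero) real_asymp
    then show ?thesis by (simp add: p_def A_def mult.assoc)
  qed
  have t0: "t \<longlonglongrightarrow> 0"
  proof -
    have "(\<lambda>N::nat. C2 * (1 / sqrt (real N))) \<longlonglongrightarrow> 0" by (intro tendsto_mult_right_zero) real_asymp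
    then show ?thesis by (simp add: t_def)
  qed
  have "Q \<longlonglongrightarrow> 6 * (9 * 0 * u\<^sup>2 * K2f + 2 * 0) + (72 * 0 * u\<^sup>2 * K2f + 4 * 0) + u\<^sup>2 / 2 * 0"
    unfolding Q_def by (intro tendsto_intros \<epsilon>0 p0 t0)
  then have Q0: "Q \<longlonglongrightarrow> 0" by simp
  have "w \<longlonglongrightarrow> sqrt (0 + 0)" unfolding w_def by (intro tendsto_intros Q0 lim_const_over_n)
  then have w0: "w \<longlonglongrightarrow> 0" by simp
  have "D \<longlonglongrightarrow> (9 * 0 * u\<^sup>2 * K2f + 2 * 0) + exp (u\<^sup>2 / 2 * K2f) * (0 * (3 + 2 * ((u\<^sup>2 / 2)\<^sup>2 * K3f)))"
    unfolding D_def by (intro tendsto_intros \<epsilon>0 p0 w0)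
  then have D0: "D \<longlonglongrightarrow> 0" by simp
  have "\<forall>\<^sub>F N in sequentially. \<epsilon> N < 1 / 4" by (rule order_tendstoD(2)[OF \<epsilon>0]) simp
  then have "\<forall>\<^sub>F N in sequentially. norm ((\<integral>\<tau>. kernel.Phi N (gN N) b u \<tau> \<partial>law b' N) - of_real (exp (- (u\<^sup>2 / 2 * V N)))) \<le> D N"
    using eventually_large_N
  proof eventually_elim
    case (elim N)
    then have big: "(R + 2 * pi) / real N < pi" "0 < N" and N2: "2 \<le> N" by auto
    interpret K: kernel N "gN N" "3 * Lf * real N" Fm R K0f Cf K2f by (rule kernel_gN[OF big])
    have N0: "0 < real N" "1 \<le> real N" using big(2) by auto
    have A1: "1 \<le> A N" unfolding A_def using N0 by (intro ge_one_powr_ge_zero) auto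
    have As: "A N / sqrt (real N) = real N powr (- 1 / 4)"
      unfolding A_def using N0 by (simp add: powr_half_sqrt[symmetric] flip: powr_diff)
    have e1: "0 < \<epsilon> N" "\<epsilon> N \<le> 1 / 4" using C(1) N0 elim by (simp_all add: \<epsilon>_def)
    have e2: "\<bar>u\<bar> * ((Fm * A N + K0f) / sqrt (real N)) \<le> \<epsilon> N"
    proof -
      have "K0f \<le> K0f * A N" using A1 K0 by (metis mult_left_mono mult.right_neutral)
      then have "Fm * A N + K0f \<le> (Fm + K0f) * A N" by (simp add: distrib_right)
      then have "\<bar>u\<bar> * ((Fm * A N + K0f) / sqrt (real N)) \<le> \<bar>u\<bar> * (((Fm + K0f) * A N) / sqrt (real N))"
        by (intro mult_left_mono divide_right_mono) auto
      also have "\<dots> = (\<bar>u\<bar> * (Fm + K0f)) * (A N / sqrt (real N))" by (simp only: times_divide_eq_right mult.assoc)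
      also have "\<dots> \<le> C * real N powr (- 1 / 4)" unfolding As C_def by (intro mult_right_mono) auto
      finally show ?thesis by (simp add: \<epsilon>_def)
    qed
    have t1: "0 < t N" using C(2) N0 by (simp add: t_def)
    have t2: "4 * Cf\<^sup>2 * K2f / real N \<le> (t N)\<^sup>2"
    proof -
      have "(t N)\<^sup>2 = C2\<^sup>2 / real N"
        unfolding t_def using N0 by (simp add: power_divide)
      moreover have "4 * Cf\<^sup>2 * K2f \<le> C2\<^sup>2"
      proof -
        have "C2 * 1 \<le> C2 * C2" using C(2) by (intro mult_left_mono) auto
        moreover have "4 * Cf\<^sup>2 * K2f \<le> C2" unfolding C2_def by linarith
        ultimately show ?thesis unfolding power2_eq_square[of C2] by linarith
      qed
      ultimately show ?thesis using N0 by (simp only: divide_right_mono)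
    qed
    have p1: "0 \<le> p N" by (simp add: p_def E_def)
    have Q1: "0 \<le> Q N" unfolding Q_def using e1 K2 p1 t1 by (intro add_nonneg_nonneg mult_nonneg_nonneg) auto
    have w1: "0 < w N" "Q N \<le> (w N)\<^sup>2" using Q1 N0 by (auto simp: w_def intro!: add_nonneg_pos)
    have K3: "K.K3 = K3f" unfolding K.K3_def K3f_def ..
    show ?case
      using K.kernel_clt_bound[OF e1 e2 _ t1 t2 w1(1) w1(2)[unfolded Q_def], where b = b and b' = b']
      unfolding D_def V_def K3 p_def E_def by simp
  qed
  then have "(\<lambda>N. (\<integral>\<tau>. kernel.Phi N (gN N) b u \<tau> \<partial>law b' N) - of_real (exp (- (u\<^sup>2 / 2 * V N)))) \<longlonglongrightarrow> 0"
    by (rule Lim_null_comparison[OF _ D0])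
  moreover have "(\<lambda>N. complex_of_real (exp (- (u\<^sup>2 / 2 * V N)))) \<longlonglongrightarrow> of_real (exp (- (u\<^sup>2 / 2 * (1 / (2 * pi) * (\<integral>t. spec2 b b' t \<partial>lborel)))))"
    unfolding V_def by (intro tendsto_intros variance_limit)
  ultimately show ?thesis using tendsto_add by fastforce
qed

text \<open>Evenly spaced points are uncrowded at a fixed threshold, so \<epsilon> is of order
  \<open>N^(-1/2)\<close>. Energy and variance both equal the limit variance, and \<tau> is not
  averaged.\<close>

lemma Phi_even_points_limit:
  "(\<lambda>N. kernel.Phi N (gN N) b u (even_points N)) \<longlonglongrightarrow> of_real (exp (- (u\<^sup>2 / 2 * limit_variance Evenly_Spaced f)))"
proof -
  define A where "A = (R + 2 * pi) / pi + 1"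
  define C where "C = \<bar>u\<bar> * (Fm * A + K0f) + 1"
  define \<epsilon> where "\<epsilon> = (\<lambda>N::nat. C / sqrt (real N))"
  define v where "v = limit_variance Evenly_Spaced f"
  have K0: "0 \<le> K0f" by simp
  have A: "0 \<le> A" unfolding A_def using R by simp
  have C: "1 \<le> C" unfolding C_def using Fm(1) A by simp
  have \<epsilon>0: "\<epsilon> \<longlonglongrightarrow> 0"
  proof -
    have "(\<lambda>N::nat. C * (1 / sqrt (real N))) \<longlonglongrightarrow> 0" by (intro tendsto_mult_right_zero) real_asymp
    then show ?thesis by (simp add: \<epsilon>_def)
  qed
  have "(\<lambda>N. 9 * \<epsilon> N * u\<^sup>2 * v) \<longlonglongrightarrow> 9 * 0 * u\<^sup>2 * v" by (intro tendsto_intros \<epsilon>0)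
  then have D0: "(\<lambda>N. 9 * \<epsilon> N * u\<^sup>2 * v) \<longlonglongrightarrow> 0" by simp
  have "\<forall>\<^sub>F N in sequentially. \<epsilon> N < 1 / 2" by (rule order_tendstoD(2)[OF \<epsilon>0]) simp
  then have "\<forall>\<^sub>F N in sequentially. norm (kernel.Phi N (gN N) b u (even_points N) - of_real (exp (- (u\<^sup>2 / 2 * v)))) \<le> 9 * \<epsilon> N * u\<^sup>2 * v"
    using eventually_large_N
  proof eventually_elim
    case (elim N)
    then have big: "(R + 2 * pi) / real N < pi" "0 < N" by auto
    interpret K: kernel N "gN N" "3 * Lf * real N" Fm R K0f Cf K2f by (rule kernel_gN[OF big])
    have N0: "0 < real N" using big(2) by auto
    have e1: "0 < \<epsilon> N" "\<epsilon> N \<le> 1 / 2" using C N0 elim by (simp_all add: \<epsilon>_def)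
    have e2: "\<bar>u\<bar> * ((Fm * A + K0f) / sqrt (real N)) \<le> \<epsilon> N"
      unfolding \<epsilon>_def C_def times_divide_eq_right by (intro divide_right_mono) auto
    have "\<not> K.crowded A (even_points N)"
      unfolding K.crowded_def A_def not_ex not_less de_Morgan_conj
      using num_in_even_points[OF big(2), of "R + 2 * pi"] R by (auto simp: not_less)
    moreover have "K.energy (even_points N) = v"
      unfolding K.energy_eq v_def by (rule qform_even_points[OF big])
    moreover have "qform b N (potential N (gN N) (even_points N)) = v"
      unfolding v_def by (rule qform_even_points[OF big])
    ultimately show ?case
      using K.Phi_approx[OF e1 e2, of b "even_points N"] by simp
  qed
  then have "(\<lambda>N. kernel.Phi N (gN N) b u (even_points N) - of_real (exp (- (u\<^sup>2 / 2 * v)))) \<longlonglongrightarrow> 0"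
    by (rule Lim_null_comparison[OF _ D0])
  then show ?thesis unfolding v_def by (rule LIM_zero_cancel)
qed

lemma limit_variance_spec2:
  "limit_variance Independent_CUE f = 1 / (2 * pi) * (\<integral>t. spec2 True True t \<partial>lborel)"
  "limit_variance IID_Uniform f = 1 / (2 * pi) * (\<integral>t. spec2 True False t \<partial>lborel)"
  by (simp_all add: spec2_def mode_weight_def spec_def power2_eq_square mult.assoc)

lemma limit_variance_nonneg: "0 \<le> limit_variance e f"
  by (cases e) (auto intro!: infsum_nonneg divide_nonneg_nonneg)

end

section \<open>Convergence in distribution\<close>

text \<open>The law is that of \<open>sqrt v\<close> times a standard Gaussian, which for v = 0 is
  the point mass, so one formula serves both branches of the definition.\<close>

lemma char_centered_gaussian:
  assumes v: "0 \<le> v"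
  shows "real_distribution (centered_gaussian v)"
    and "char (centered_gaussian v) u = of_real (exp (- (u\<^sup>2 / 2 * v)))"
proof -
  interpret N: real_distribution std_normal_distribution by (rule real_dist_normal_dist)
  have "centered_gaussian v = distr std_normal_distribution borel (\<lambda>x. sqrt v * x)"
  proof (cases "v = 0")
    case True
    have "distr std_normal_distribution borel (\<lambda>x. 0) = return borel (0::real)"
      by (rule measure_eqI) (simp_all add: emeasure_distr indicator_def N.emeasure_space_1[simplified])
    with True show ?thesis by (simp add: centered_gaussian_def)
  next
    case False
    then have s: "0 < sqrt v" using v by simp
    have "distributed std_normal_distribution lborel (\<lambda>x. x) (\<lambda>x. ennreal (normal_density 0 1 x))"
      unfolding distributed_def by (simp add: distr_id2)
    then have "distributed std_normal_distribution lborel (\<lambda>x. 0 + sqrt v * x)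
        (\<lambda>x. ennreal (normal_density (0 + sqrt v * 0) (\<bar>sqrt v\<bar> * 1) x))"
      by (rule N.normal_density_affine) (use s in auto)
    then have "distributed std_normal_distribution lborel (\<lambda>x. sqrt v * x) (\<lambda>x. ennreal (normal_density 0 (sqrt v) x))"
      using s by simp
    then have "distr std_normal_distribution lborel (\<lambda>x. sqrt v * x) = density lborel (\<lambda>x. ennreal (normal_density 0 (sqrt v) x))"
      by (rule distributed_distr_eq_density)
    moreover have "distr std_normal_distribution lborel (\<lambda>x. sqrt v * x) = distr std_normal_distribution borel (\<lambda>x. sqrt v * x)"
      by (rule distr_cong) auto
    ultimately show ?thesis using False by (simp add: centered_gaussian_def)
  qed
  note eq = this
  show "real_distribution (centered_gaussian v)" unfolding eq by (rule N.real_distribution_distr) simp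
  have "char (centered_gaussian v) u = char std_normal_distribution (u * sqrt v)"
    unfolding eq char_def by (subst integral_distr) (simp_all add: mult.assoc)
  then show "char (centered_gaussian v) u = of_real (exp (- (u\<^sup>2 / 2 * v)))"
    unfolding char_std_normal_distribution using v by (simp add: power_mult_distrib)
qed

text \<open>Levy's continuity theorem with the finitely many exceptional indices filled by the limit
  law.\<close>

lemma weak_conv_m_eventually_char:
  assumes ev: "\<forall>\<^sub>F n in sequentially. real_distribution (\<mu> n)" and \<nu>: "real_distribution \<nu>"
    and char: "\<And>u. (\<lambda>n. char (\<mu> n) u) \<longlonglongrightarrow> char \<nu> u"
  shows "weak_conv_m \<mu> \<nu>"
proof -
  define \<mu>' where "\<mu>' = (\<lambda>n. if real_distribution (\<mu> n) then \<mu> n else \<nu>)"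
  have eq: "\<forall>\<^sub>F n in sequentially. \<mu>' n = \<mu> n" using ev by eventually_elim (simp add: \<mu>'_def)
  have "weak_conv_m \<mu>' \<nu>"
  proof (rule levy_continuity)
    show "real_distribution (\<mu>' n)" for n using \<nu> by (simp add: \<mu>'_def)
    show "(\<lambda>n. char (\<mu>' n) u) \<longlonglongrightarrow> char \<nu> u" for u
      by (rule Lim_transform_eventually[OF char]) (use eq in \<open>eventually_elim, simp\<close>)
  qed (rule \<nu>)
  then show ?thesis
    unfolding weak_conv_m_def weak_conv_def
  proof (intro allI impI)
    fix x assume a: "\<forall>x. isCont (cdf \<nu>) x \<longrightarrow> (\<lambda>n. cdf (\<mu>' n) x) \<longlonglongrightarrow> cdf \<nu> x" "isCont (cdf \<nu>) x"
    then have "(\<lambda>n. cdf (\<mu>' n) x) \<longlonglongrightarrow> cdf \<nu> x" by blast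
    then show "(\<lambda>n. cdf (\<mu> n) x) \<longlonglongrightarrow> cdf \<nu> x"
      by (rule Lim_transform_eventually) (use eq in \<open>eventually_elim, simp\<close>)
  qed
qed

text \<open>The derivative is bounded on a compact interval around the support, and retracting the
  line onto that interval does not change the values of f, which extends the Lipschitz bound to all
  arguments.\<close>

lemma Cc_infty_test_function:
  assumes f: "f \<in> Cc_infty" and even: "\<And>x. f (- x) = f x"
  obtains R Lf where "test_function f R Lf"
proof -
  have d: "(deriv ^^ n) f differentiable (at x)" for n x using f by (simp add: Cc_infty_def)
  have "bounded (closure {x. f x \<noteq> 0})" using f by (auto simp: Cc_infty_def compact_imp_bounded)
  then have "bounded {x. f x \<noteq> 0}" using bounded_subset closure_subset by blast
  then obtain r where r: "0 < r" "\<And>x. f x \<noteq> 0 \<Longrightarrow> \<bar>x\<bar> \<le> r" by (auto simp: bounded_pos)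
  \<comment> \<open>The slack of 1 makes f vanish at the end points R and -R themselves.\<close>
  define R where "R = r + 1"
  have R: "0 < R" using r by (simp add: R_def)
  have supp: "f x = 0" if "R \<le> \<bar>x\<bar>" for x using r(2)[of x] that by (force simp: R_def)
  have D: "(f has_real_derivative deriv f x) (at x)" for x
    using d[of 0 x] by (simp add: DERIV_deriv_iff_real_differentiable)
  have "isCont (deriv f) x" for x
    using d[of "Suc 0" x] by (simp add: differentiable_imp_continuous_within)
  then have "compact (deriv f ` {- R..R})"
    by (intro compact_continuous_image continuous_at_imp_continuous_on) auto
  then obtain L where L: "\<And>x. x \<in> {- R..R} \<Longrightarrow> \<bar>deriv f x\<bar> \<le> L"
    using compact_imp_bounded[of "deriv f ` {- R..R}"] unfolding bounded_iff real_norm_def by blast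
  have L0: "0 \<le> L" using L[of 0] R by (auto intro: order.trans[OF abs_ge_zero])
  have l: "\<bar>f x - f y\<bar> \<le> L * \<bar>x - y\<bar>" if "x \<in> {- R..R}" "y \<in> {- R..R}" for x y
    using field_differentiable_bound[of "{- R..R}" f "deriv f" L x y] L that
      has_field_derivative_at_within[OF D] by auto
  define clip where "clip = (\<lambda>x. max (- R) (min R x))"
  have fc: "f x = f (clip x)" for x
    using supp[of x] supp[of "clip x"] R by (cases "\<bar>x\<bar> < R") (auto simp: clip_def max_def min_def)
  have "test_function f R L"
  proof
    fix x y
    have "\<bar>f x - f y\<bar> = \<bar>f (clip x) - f (clip y)\<bar>" using fc by simp
    also have "\<dots> \<le> L * \<bar>clip x - clip y\<bar>" using R by (intro l) (auto simp: clip_def)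
    also have "\<dots> \<le> L * \<bar>x - y\<bar>" using L0 by (intro mult_left_mono) (auto simp: clip_def)
    finally show "\<bar>f x - f y\<bar> \<le> L * \<bar>x - y\<bar>" .
  qed (auto simp: R supp even)
  then show ?thesis by (rule that)
qed

section \<open>Laws of the configurations and of the statistic\<close>

lemma distr_tuple_cue:
  assumes "cue_configuration M N \<theta>"
  shows "tuple N \<theta> \<in> measurable M (PiM {1..N} (\<lambda>_. borel))"
    and "distr M (PiM {1..N} (\<lambda>_. borel)) (tuple N \<theta>) = law True N"
proof -
  have d: "distributed M (PiM {1..N} (\<lambda>_. lborel)) (tuple N \<theta>) (\<lambda>x. ennreal (cue_density N x))"
    using assms by (simp add: cue_configuration_def)
  have s: "sets (PiM {1..N} (\<lambda>_. lborel)) = sets (PiM {1..N} (\<lambda>_. borel :: real measure))"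
    by (rule sets_PiM_cong) simp_all
  show "tuple N \<theta> \<in> measurable M (PiM {1..N} (\<lambda>_. borel))"
    using distributed_measurable[OF d] unfolding measurable_cong_sets[OF refl s] .
  have "distr M (PiM {1..N} (\<lambda>_. borel)) (tuple N \<theta>) = distr M (PiM {1..N} (\<lambda>_. lborel)) (tuple N \<theta>)"
    by (rule distr_cong) (simp_all add: s)
  then show "distr M (PiM {1..N} (\<lambda>_. borel)) (tuple N \<theta>) = law True N"
    using distributed_distr_eq_density[OF d] by (simp add: law_def)
qed

lemma distr_tuple_iid:
  assumes M: "prob_space M" and N: "0 < N" and ind: "prob_space.indep_vars M (\<lambda>_. borel) \<tau> {1..N}"
    and unif: "\<And>i. i \<in> {1..N} \<Longrightarrow> distr M lborel (\<tau> i) = uniform_measure lborel {0..<2 * pi}"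
  shows "distr M (PiM {1..N} (\<lambda>_. borel)) (tuple N \<tau>) = law False N"
proof -
  interpret prob_space M by (rule M)
  have rv: "\<tau> i \<in> borel_measurable M" if "i \<in> {1..N}" for i
    using ind that unfolding indep_vars_def2 by auto
  have "distr M (PiM {1..N} (\<lambda>_. borel)) (\<lambda>\<omega>. \<lambda>i\<in>{1..N}. \<tau> i \<omega>) = PiM {1..N} (\<lambda>i. distr M borel (\<tau> i))"
    using ind by (subst (asm) indep_vars_iff_distr_eq_PiM') (use N rv in auto)
  also have "\<dots> = PiM {1..N} (\<lambda>_. circ)"
  proof (rule PiM_cong)
    fix i assume "i \<in> {1..N}"
    moreover have "distr M borel (\<tau> i) = distr M lborel (\<tau> i)" by (rule distr_cong) simp_all
    ultimately show "distr M borel (\<tau> i) = circ" using unif by (simp add: circ_def)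
  qed simp
  finally show ?thesis by (simp add: law_def tuple_def[abs_def])
qed

lemma distr_tuple_pair:
  assumes M: "prob_space M" and cue: "cue_configuration M N \<theta>" and N: "0 < N"
    and ens: "e \<noteq> Evenly_Spaced" "comes_from e M N \<theta> \<tau>"
  shows "(\<lambda>\<omega>. (tuple N \<tau> \<omega>, tuple N \<theta> \<omega>)) \<in> measurable M (PiM {1..N} (\<lambda>_. borel) \<Otimes>\<^sub>M PiM {1..N} (\<lambda>_. borel))"
    and "distr M (PiM {1..N} (\<lambda>_. borel) \<Otimes>\<^sub>M PiM {1..N} (\<lambda>_. borel)) (\<lambda>\<omega>. (tuple N \<tau> \<omega>, tuple N \<theta> \<omega>))
       = law (e = Independent_CUE) N \<Otimes>\<^sub>M law True N"
proof -
  interpret prob_space M by (rule M)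
  have ind: "indep_var (PiM {1..N} (\<lambda>_. borel)) (tuple N \<tau>) (PiM {1..N} (\<lambda>_. borel)) (tuple N \<theta>)"
    using ens by (cases e) (auto simp: independent_tuples_def)
  then have m: "tuple N \<tau> \<in> measurable M (PiM {1..N} (\<lambda>_. borel))" "tuple N \<theta> \<in> measurable M (PiM {1..N} (\<lambda>_. borel))"
    by (auto dest: indep_var_rv1 indep_var_rv2)
  then show "(\<lambda>\<omega>. (tuple N \<tau> \<omega>, tuple N \<theta> \<omega>)) \<in> measurable M (PiM {1..N} (\<lambda>_. borel) \<Otimes>\<^sub>M PiM {1..N} (\<lambda>_. borel))"
    by (rule measurable_Pair)
  have "distr M (PiM {1..N} (\<lambda>_. borel)) (tuple N \<tau>) = law (e = Independent_CUE) N"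
  proof (cases e)
    case Independent_CUE
    then show ?thesis using ens distr_tuple_cue by auto
  next
    case IID_Uniform
    then show ?thesis using ens distr_tuple_iid[OF M N] by auto
  qed (use ens in simp)
  then show "distr M (PiM {1..N} (\<lambda>_. borel) \<Otimes>\<^sub>M PiM {1..N} (\<lambda>_. borel)) (\<lambda>\<omega>. (tuple N \<tau> \<omega>, tuple N \<theta> \<omega>))
       = law (e = Independent_CUE) N \<Otimes>\<^sub>M law True N"
    using ind distr_tuple_cue(2)[OF cue] by (subst (asm) indep_var_distribution_eq) simp
qed

context kernel
begin

lemma statistic_bound: "\<exists>C. \<forall>\<tau> \<theta>. \<bar>\<Sum>j\<in>{1..N}. h \<tau> (\<theta> j)\<bar> \<le> C"
proof -
  obtain C where C: "\<And>x. \<bar>g x\<bar> \<le> C" using g_bdd by (auto simp: bdd_meas_def)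
  have "\<bar>h \<tau> x\<bar> \<le> real N * C / sqrt (real N)" for \<tau> x
  proof -
    have "\<bar>\<Sum>i\<in>{1..N}. g (x - \<tau> i)\<bar> \<le> (\<Sum>i\<in>{1..N}. C)"
      by (rule order.trans[OF sum_abs sum_mono]) (rule C)
    then show ?thesis by (simp add: potential_def divide_right_mono)
  qed
  then have "\<bar>\<Sum>j\<in>{1..N}. h \<tau> (\<theta> j)\<bar> \<le> (\<Sum>j\<in>{1..N}. real N * C / sqrt (real N))" for \<tau> \<theta>
    by (intro order.trans[OF sum_abs sum_mono])
  then show ?thesis by blast
qed

definition "statistic = (\<lambda>(\<tau>, \<theta>). \<Sum>j\<in>{1..N}. h \<tau> (\<theta> j))"

lemma statistic_pair:
  assumes M: "prob_space M"
    and m: "X \<in> measurable M (PiM {1..N} (\<lambda>_. borel) \<Otimes>\<^sub>M PiM {1..N} (\<lambda>_. borel))"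
    and d: "distr M (PiM {1..N} (\<lambda>_. borel) \<Otimes>\<^sub>M PiM {1..N} (\<lambda>_. borel)) X = law b' N \<Otimes>\<^sub>M law b N"
  shows "(\<lambda>\<omega>. statistic (X \<omega>)) \<in> borel_measurable M"
    and "(\<integral>\<omega>. statistic (X \<omega>) \<partial>M) = 0"
    and "(\<integral>\<omega>. cis (u * statistic (X \<omega>)) \<partial>M) = (\<integral>\<tau>. Phi b u \<tau> \<partial>law b' N)"
proof -
  interpret L: prob_space "law b N" by (rule prob_space_law)
  interpret L': prob_space "law b' N" by (rule prob_space_law)
  interpret P: pair_prob_space "law b' N" "law b N" ..
  obtain C where C: "\<And>\<tau> \<theta>. \<bar>\<Sum>j\<in>{1..N}. h \<tau> (\<theta> j)\<bar> \<le> C" using statistic_bound by blast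
  have sm [measurable]: "statistic \<in> borel_measurable (PiM {1..N} (\<lambda>_. borel) \<Otimes>\<^sub>M PiM {1..N} (\<lambda>_. borel))"
    unfolding statistic_def by (rule statistic_meas)
  have sm' [measurable]: "statistic \<in> borel_measurable (law b' N \<Otimes>\<^sub>M law b N)"
    unfolding measurable_pair_law by (rule sm)
  show "(\<lambda>\<omega>. statistic (X \<omega>)) \<in> borel_measurable M"
    using measurable_compose[OF m sm] .
  have "integrable (law b' N \<Otimes>\<^sub>M law b N) statistic"
    by (rule P.P.integrable_const_bound[of _ C]) (auto simp: statistic_def C)
  from P.integral_fst'[OF this]
  have "(\<integral>z. statistic z \<partial>(law b' N \<Otimes>\<^sub>M law b N)) = (\<integral>\<tau>. (\<integral>\<theta>. statistic (\<tau>, \<theta>) \<partial>law b N) \<partial>law b' N)" by simp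
  also have "\<dots> = 0" unfolding statistic_def case_prod_conv law_moments(1)[OF h_bdd h_mean] by simp
  finally show "(\<integral>\<omega>. statistic (X \<omega>) \<partial>M) = 0"
    unfolding integral_distr[OF m sm, symmetric] d .
  have "integrable (law b' N \<Otimes>\<^sub>M law b N) (\<lambda>z. cis (u * statistic z))"
    by (rule P.P.integrable_const_bound[of _ 1]) (simp, measurable)
  from P.integral_fst'[OF this]
  have "(\<integral>z. cis (u * statistic z) \<partial>(law b' N \<Otimes>\<^sub>M law b N)) = (\<integral>\<tau>. (\<integral>\<theta>. cis (u * statistic (\<tau>, \<theta>)) \<partial>law b N) \<partial>law b' N)" by simp
  then have "(\<integral>z. cis (u * statistic z) \<partial>(law b' N \<Otimes>\<^sub>M law b N)) = (\<integral>\<tau>. Phi b u \<tau> \<partial>law b' N)"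
    unfolding statistic_def case_prod_conv Phi_def .
  moreover have "(\<lambda>z. cis (u * statistic z)) \<in> borel_measurable (PiM {1..N} (\<lambda>_. borel) \<Otimes>\<^sub>M PiM {1..N} (\<lambda>_. borel))"
    by measurable
  ultimately show "(\<integral>\<omega>. cis (u * statistic (X \<omega>)) \<partial>M) = (\<integral>\<tau>. Phi b u \<tau> \<partial>law b' N)"
    using integral_distr[OF m, of "\<lambda>z. cis (u * statistic z)"] unfolding d by simp
qed

lemma statistic_deterministic:
  assumes m: "Y \<in> measurable M (PiM {1..N} (\<lambda>_. borel))"
    and d: "distr M (PiM {1..N} (\<lambda>_. borel)) Y = law b N"
  shows "(\<lambda>\<omega>. statistic (\<tau>, Y \<omega>)) \<in> borel_measurable M"
    and "(\<integral>\<omega>. statistic (\<tau>, Y \<omega>) \<partial>M) = 0"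
    and "(\<integral>\<omega>. cis (u * statistic (\<tau>, Y \<omega>)) \<partial>M) = Phi b u \<tau>"
proof -
  have hm [measurable]: "h \<tau> \<in> borel_measurable borel" by (rule bdd_meas_measurable[OF h_bdd])
  have sm [measurable]: "(\<lambda>\<theta>. statistic (\<tau>, \<theta>)) \<in> borel_measurable (PiM {1..N} (\<lambda>_. borel))"
    unfolding statistic_def case_prod_conv by measurable
  show "(\<lambda>\<omega>. statistic (\<tau>, Y \<omega>)) \<in> borel_measurable M"
    using measurable_compose[OF m sm] .
  show "(\<integral>\<omega>. statistic (\<tau>, Y \<omega>) \<partial>M) = 0"
    unfolding integral_distr[OF m sm, symmetric] d
    unfolding statistic_def case_prod_conv by (rule law_moments(1)[OF h_bdd h_mean])
  have "(\<lambda>\<theta>. cis (u * statistic (\<tau>, \<theta>))) \<in> borel_measurable (PiM {1..N} (\<lambda>_. borel))" by measurable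
  then show "(\<integral>\<omega>. cis (u * statistic (\<tau>, Y \<omega>)) \<partial>M) = Phi b u \<tau>"
    using integral_distr[OF m, of "\<lambda>\<theta>. cis (u * statistic (\<tau>, \<theta>))"] unfolding d
    by (simp add: Phi_def statistic_def)
qed

end

text \<open>Subtracting the mean of the periodised function from each of the \<open>N^2\<close>
  terms produces the constant. Agreement of \<tau>' with \<tau> is asked on the indices 1, ..., N,
  which fits a restricted tuple as well as a deterministic sequence.\<close>

lemma (in test_function) B_stat_decomposition:
  assumes big: "(R + 2 * pi) / real N < pi" "0 < N"
    and \<tau>': "\<And>i. i \<in> {1..N} \<Longrightarrow> \<tau>' i = \<tau> i \<omega>"
  shows "B_stat f N \<tau> \<theta> \<omega> = real N / (2 * pi) * (\<integral>x. f x \<partial>lborel)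
    + sqrt (real N) * kernel.statistic N (gN N) (\<tau>', tuple N \<theta> \<omega>)"
proof -
  interpret K: kernel N "gN N" "3 * Lf * real N" Fm R K0f Cf K2f by (rule kernel_gN[OF big])
  define c0 where "c0 = (\<integral>x. f x \<partial>lborel) / (2 * pi * real N)"
  have N0: "0 < real N" using big by simp
  have "K.statistic (\<tau>', tuple N \<theta> \<omega>) = (\<Sum>j\<in>{1..N}. \<Sum>i\<in>{1..N}. gN N (\<theta> j \<omega> - \<tau> i \<omega>)) / sqrt (real N)"
    unfolding K.statistic_def case_prod_conv potential_def sum_divide_distrib[symmetric]
    by (intro arg_cong2[of _ _ _ _ "(/)"] sum.cong) (auto simp: tuple_def \<tau>')
  then have "sqrt (real N) * K.statistic (\<tau>', tuple N \<theta> \<omega>) = (\<Sum>j\<in>{1..N}. \<Sum>i\<in>{1..N}. gN N (\<theta> j \<omega> - \<tau> i \<omega>))"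
    using N0 by simp
  also have "\<dots> = (\<Sum>j\<in>{1..N}. \<Sum>i\<in>{1..N}. fN N (\<tau> i \<omega> - \<theta> j \<omega>) - c0)"
  proof (intro sum.cong refl)
    fix i j
    have "fN N (- (\<tau> i \<omega> - \<theta> j \<omega>)) = fN N (\<tau> i \<omega> - \<theta> j \<omega>)" by (rule fN_even[OF large_N[OF big]])
    then show "gN N (\<theta> j \<omega> - \<tau> i \<omega>) = fN N (\<tau> i \<omega> - \<theta> j \<omega>) - c0" by (simp add: gN_def c0_def)
  qed
  also have "\<dots> = (\<Sum>j\<in>{1..N}. \<Sum>i\<in>{1..N}. fN N (\<tau> i \<omega> - \<theta> j \<omega>)) - real N * (real N * c0)"
    by (simp add: sum_subtractf)
  also have "(\<Sum>j\<in>{1..N}. \<Sum>i\<in>{1..N}. fN N (\<tau> i \<omega> - \<theta> j \<omega>)) = B_stat f N \<tau> \<theta> \<omega>"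
    unfolding B_stat_def by (rule sum.swap)
  also have "real N * (real N * c0) = real N / (2 * pi) * (\<integral>x. f x \<partial>lborel)"
    using N0 by (simp add: c0_def)
  finally show ?thesis by simp
qed

text \<open>Everything is required eventually, since the estimates concern large N. Once the
  expectation is known to be the constant part, the normalised deviation is S itself, and its
  characteristic function is given.\<close>

lemma clt_from_char:
  fixes M :: "nat \<Rightarrow> 'a measure"
  assumes v: "0 \<le> v"
    and ev: "\<forall>\<^sub>F N in sequentially. prob_space (M N) \<and> S N \<in> borel_measurable (M N) \<and> integrable (M N) (S N)
       \<and> (\<integral>\<omega>. S N \<omega> \<partial>M N) = 0 \<and> (\<forall>\<omega>\<in>space (M N). B N \<omega> = a N + sqrt (real N) * S N \<omega>)
       \<and> (\<forall>u. (\<integral>\<omega>. cis (u * S N \<omega>) \<partial>M N) = \<phi> N u)"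
    and lim: "\<And>u. (\<lambda>N. \<phi> N u) \<longlonglongrightarrow> of_real (exp (- (u\<^sup>2 / 2 * v)))"
  defines "EB \<equiv> \<lambda>N. prob_space.expectation (M N) (B N)"
  shows "\<forall>\<^sub>F N in sequentially. EB N = a N"
    and "weak_conv_m (\<lambda>N. distr (M N) borel (\<lambda>\<omega>. (B N \<omega> - EB N) * real N powr (- 1 / 2))) (centered_gaussian v)"
proof -
  define \<mu> where "\<mu> = (\<lambda>N. distr (M N) borel (\<lambda>\<omega>. (B N \<omega> - EB N) * real N powr (- 1 / 2)))"
  have EB: "\<forall>\<^sub>F N in sequentially. EB N = a N"
    using ev
  proof eventually_elim
    case (elim N)
    interpret prob_space "M N" using elim by simp
    have "EB N = (\<integral>\<omega>. a N + sqrt (real N) * S N \<omega> \<partial>M N)"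
      unfolding EB_def using elim by (intro Bochner_Integration.integral_cong) auto
    then show ?case using elim prob_space by simp
  qed
  then show "\<forall>\<^sub>F N in sequentially. EB N = a N" .
  have \<mu>: "\<forall>\<^sub>F N in sequentially. real_distribution (\<mu> N) \<and> (\<forall>u. char (\<mu> N) u = \<phi> N u)"
    using ev EB eventually_gt_at_top[of 0]
  proof eventually_elim
    case (elim N)
    then interpret prob_space "M N" by simp
    have [measurable]: "S N \<in> borel_measurable (M N)" using elim by simp
    have "(B N \<omega> - EB N) * real N powr (- 1 / 2) = S N \<omega>" if "\<omega> \<in> space (M N)" for \<omega>
    proof -
      have "sqrt (real N) * real N powr (- 1 / 2) = 1"
        using elim by (simp add: powr_half_sqrt[symmetric] flip: powr_add)
      then show ?thesis using elim that by (simp add: mult.assoc mult.left_commute)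
    qed
    then have \<mu>S: "\<mu> N = distr (M N) borel (S N)" unfolding \<mu>_def by (intro distr_cong) auto
    have "char (\<mu> N) u = \<phi> N u" for u
      unfolding \<mu>S char_def using elim by (subst integral_distr) (simp_all add: cis_conv_exp)
    moreover have "real_distribution (\<mu> N)" unfolding \<mu>S by (rule real_distribution_distr) simp
    ultimately show ?case by simp
  qed
  have "weak_conv_m \<mu> (centered_gaussian v)"
  proof (rule weak_conv_m_eventually_char)
    show "\<forall>\<^sub>F N in sequentially. real_distribution (\<mu> N)" using \<mu> by eventually_elim simp
    show "real_distribution (centered_gaussian v)" by (rule char_centered_gaussian(1)[OF v])
    show "(\<lambda>N. char (\<mu> N) u) \<longlonglongrightarrow> char (centered_gaussian v) u" for u
      unfolding char_centered_gaussian(2)[OF v]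
      by (rule Lim_transform_eventually[OF lim]) (use \<mu> in \<open>eventually_elim, simp\<close>)
  qed
  then show "weak_conv_m (\<lambda>N. distr (M N) borel (\<lambda>\<omega>. (B N \<omega> - EB N) * real N powr (- 1 / 2))) (centered_gaussian v)"
    by (simp add: \<mu>_def)
qed

theorem theorem4p2:
  fixes f :: "real \<Rightarrow> real"
    and M :: "nat \<Rightarrow> 'a measure"
    and \<theta> \<tau> :: "nat \<Rightarrow> nat \<Rightarrow> 'a \<Rightarrow> real"
    and e :: ensemble
  assumes "f \<in> Cc_infty"
    and "\<And>x. f (- x) = f x"
    and "\<And>N. N \<ge> 2 \<Longrightarrow> prob_space (M N)"
    and "\<And>N. N \<ge> 2 \<Longrightarrow> cue_configuration (M N) N (\<theta> N)"
    and "\<And>N. N \<ge> 2 \<Longrightarrow> comes_from e (M N) N (\<theta> N) (\<tau> N)"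
  defines "B \<equiv> \<lambda>N. B_stat f N (\<tau> N) (\<theta> N)"
  defines "EB \<equiv> \<lambda>N. prob_space.expectation (M N) (B N)"
  shows "(\<forall>\<^sub>F N in sequentially. EB N = real N / (2 * pi) * (\<integral>x. f x \<partial>lborel)) \<and>
         weak_conv_m (\<lambda>N. distr (M N) borel (\<lambda>\<omega>. (B N \<omega> - EB N) * real N powr (- 1 / 2)))
           (centered_gaussian (limit_variance e f))"
proof -
  obtain R Lf where "test_function f R Lf" using Cc_infty_test_function[OF assms(1,2)] .
  then interpret test_function f R Lf .
  \<comment> \<open>In the evenly spaced case \<tau>' is the same for all sample points, so it can
    serve as a frozen configuration.\<close>
  define \<tau>' where "\<tau>' = (\<lambda>N. if e = Evenly_Spaced then \<lambda>_. even_points N else tuple N (\<tau> N))"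
  define S where "S = (\<lambda>N \<omega>. kernel.statistic N (gN N) (\<tau>' N \<omega>, tuple N (\<theta> N) \<omega>))"
  define \<phi> where "\<phi> = (\<lambda>N u. if e = Evenly_Spaced then kernel.Phi N (gN N) True u (even_points N)
      else \<integral>\<tau>. kernel.Phi N (gN N) True u \<tau> \<partial>law (e = Independent_CUE) N)"
  have lim: "(\<lambda>N. \<phi> N u) \<longlonglongrightarrow> of_real (exp (- (u\<^sup>2 / 2 * limit_variance e f)))" for u
  proof (cases e)
    case Independent_CUE
    then show ?thesis
      unfolding \<phi>_def using Phi_mean_limit[where b = True and b' = True and u = u] by (simp only: ensemble.distinct if_False limit_variance_spec2 simp_thms)
  next
    case IID_Uniform
    then show ?thesis
      unfolding \<phi>_def using Phi_mean_limit[where b = True and b' = False and u = u] by (simp only: ensemble.distinct if_False limit_variance_spec2 simp_thms)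
  next
    case Evenly_Spaced
    then show ?thesis
      unfolding \<phi>_def using Phi_even_points_limit[where b = True and u = u] by (simp only: if_True simp_thms)
  qed
  have "\<forall>\<^sub>F N in sequentially. prob_space (M N) \<and> S N \<in> borel_measurable (M N) \<and> integrable (M N) (S N)
       \<and> (\<integral>\<omega>. S N \<omega> \<partial>M N) = 0
       \<and> (\<forall>\<omega>\<in>space (M N). B N \<omega> = real N / (2 * pi) * (\<integral>x. f x \<partial>lborel) + sqrt (real N) * S N \<omega>)
       \<and> (\<forall>u. (\<integral>\<omega>. cis (u * S N \<omega>) \<partial>M N) = \<phi> N u)"
    using eventually_large_N
  proof eventually_elim
    case (elim N)
    then have big: "(R + 2 * pi) / real N < pi" "0 < N" and N: "2 \<le> N" by auto
    interpret K: kernel N "gN N" "3 * Lf * real N" Fm R K0f Cf K2f by (rule kernel_gN[OF big])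
    interpret prob_space "M N" by (rule assms(3)[OF N])
    note cue = assms(4)[OF N] and ens = assms(5)[OF N]
    have B: "B N \<omega> = real N / (2 * pi) * (\<integral>x. f x \<partial>lborel) + sqrt (real N) * S N \<omega>" if \<omega>: "\<omega> \<in> space (M N)" for \<omega>
      unfolding B_def S_def
    proof (rule B_stat_decomposition[OF big])
      fix i assume "i \<in> {1..N}"
      then show "\<tau>' N \<omega> i = \<tau> N i \<omega>"
        using ens \<omega> by (auto simp: \<tau>'_def even_points_def tuple_def)
    qed
    obtain C where C: "\<And>\<tau> \<theta>. \<bar>\<Sum>j\<in>{1..N}. potential N (gN N) \<tau> (\<theta> j)\<bar> \<le> C" using K.statistic_bound by blast
    have S: "S N \<in> borel_measurable (M N) \<and> (\<integral>\<omega>. S N \<omega> \<partial>M N) = 0 \<and> (\<forall>u. (\<integral>\<omega>. cis (u * S N \<omega>) \<partial>M N) = \<phi> N u)"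
    proof (cases "e = Evenly_Spaced")
      case True
      then have "S N = (\<lambda>\<omega>. K.statistic (even_points N, tuple N (\<theta> N) \<omega>))" by (simp add: S_def \<tau>'_def)
      then show ?thesis
        using K.statistic_deterministic[OF distr_tuple_cue[OF cue]] True by (simp add: \<phi>_def)
    next
      case False
      then have "S N = (\<lambda>\<omega>. K.statistic (tuple N (\<tau> N) \<omega>, tuple N (\<theta> N) \<omega>))" by (simp add: S_def \<tau>'_def)
      then show ?thesis
        using K.statistic_pair[OF prob_space_axioms distr_tuple_pair[OF prob_space_axioms cue big(2) False ens]] False
        by (simp add: \<phi>_def)
    qed
    moreover have "integrable (M N) (S N)"
      by (rule integrable_const_bound[of _ C]) (use S C in \<open>auto simp: S_def K.statistic_def\<close>)
    ultimately show ?case using B prob_space_axioms by blast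
  qed
  from clt_from_char[OF limit_variance_nonneg this lim] show ?thesis
    unfolding EB_def by blast
qed

end
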